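(* Let $N,n,k$ be positive integers, let $y_1,\dots,y_\ell\in\mathbb A^1$ be distinct points and $d_1,\dots,d_\ell$ positive integers with $\sum_id_i=N$, and let $\mathbf y=\sum_id_iy_i$ be regarded as a point of $\mathbb A^N$ (with $y_i$ repeated $d_i$ times). For any $\phi\in\Gamma(\mathbb A^N,\mathcal V^{n,k}_N)_0$, its restriction $\phi_{\mathbf y}\in\Gamma(\tilde\pi^{-1}(\mathbf y),\mathcal O(k))$ to the fibre over $\mathbf y$ belongs to the subspace of modified conformal blocks, i.e. $\phi_{\mathbf y}$ is $\mathfrak g^0_{\vec y}$-invariant.
   Context: The Beilinson-Drinfeld Grassmannian $\mathrm{Gr}_{GL_n,\mathbb A^N}$ is the ind-scheme over $\mathbb A^N$ whose points over $\vec x=(x_1,\dots,x_N)$ are rank $n$ locally free subsheaves $\mathcal E\subset j_*\mathcal O^{\oplus n}_{\mathbb A^1\setminus\{x_1,\dots,x_N\}}$ that agree with $\mathcal O^{\oplus n}$ away from the $x_i$. Its connected component $\mathrm{Gr}^{\mathbf 1}_{GL_n,\mathbb A^N}$ is the one whose fibre over a point with distinct coordinates is $\prod_{i=1}^N\mathrm{Gr}^{(1)}_{GL_n}$, where $\mathrm{Gr}^{(m)}_{GL_n}$ is the component of the affine Grassmannian of lattices $\Lambda\subset\mathbb C(\!(z)\!)^{\oplus n}$ with $\dim(\mathbb C[\![z]\!]^{\oplus n}/z^M\Lambda)=m+Mn$ for $M\gg0$. Let $\tilde\pi:\mathrm{Gr}^{\mathbf 1}_{GL_n,\mathbb A^N}\to\mathbb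 A^N$ be the structure map, $\mathcal O(1)$ the determinant line bundle (whose fibre at $\mathcal E\subset\mathcal O^{\oplus n}$ is $\det(\mathcal O^{\oplus n}/\mathcal E)$), $\mathcal O(k)=\mathcal O(1)^{\otimes k}$, and $\mathcal V^{n,k}_N=\tilde\pi_*\mathcal O(k)$. The group $\mathbb C^\times_q$ acts by scaling $\mathbb A^1$ with weight $-1$ (so coordinate functions on $\mathbb A^N$ have weight $1$) and $\mathcal O(k)$ is equivariant; $\Gamma(\mathbb A^N,\mathcal V^{n,k}_N)_0$ denotes the $\mathbb C^\times_q$-eigenspace of smallest weight. The fibre $\tilde\pi^{-1}(\mathbf y)$ is $\prod_{i=1}^\ell\mathrm{Gr}^{(d_i)}_{GL_n}$ and $\mathcal O(k)$ restricts to the external product of the $\mathcal O(k)$. It is known that $\Gamma(\tilde\pi^{-1}(\mathbf y),\mathcal O(k))$ is the dual of $\bigotimes_{i=1}^\ell M_i$, with $M_i=L_{k\varpi_{n-r_i}}(\widehat{\mathfrak{sl}}(n)_k)\otimes\mathrm{Fock}_{-kd_i}(\widehat{\mathfrak{gl}}(1)_{kn})$, $r_i=d_i-\lfloor d_i/n\rfloor n$, a module over the level $k$ central extension of $\mathfrak{gl}_n(\!(z-y_i)\!)$ (the action being induced from the natural action on the affine Grassmannian). $\mathfrak g^0_{\vec y}$ is the Lie algebra of $f\in\mathfrak{gl}_n\otimes\mathbb C[z,\frac1{z-y_1},\dots,\frac1{z-y_\ell}]$ with $f(\infty)=0$. It acts on $\bigotimes_iM_i$ through Laurent expansion at each $y_i$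 (the central cocycles cancel by the residue theorem), hence on the dual. The space of modified conformal blocks is $\big(\bigotimes_iM_i^*\big)^{\mathfrak g^0_{\vec y}}=\Gamma(\tilde\pi^{-1}(\mathbf y),\mathcal O(k))^{\mathfrak g^0_{\vec y}}$, the subspace annihilated by $\mathfrak g^0_{\vec y}$. *)

theory Defs
  imports
    "HOL-Library.Poly_Mapping"
    "HOL-Library.FuncSet"
    "HOL-Computational_Algebra.Formal_Laurent_Series"
    "Jordan_Normal_Form.Determinant"
    "HOL-Analysis.Cartesian_Space"
begin

no_notation Matrix.vec_index (infixl "$" 100)
no_notation Matrix.index_mat (infixl "$$" 100)

text \<open>
  The Grassmannian is treated through its functor of points on commutative complex algebras
  (nilpotents matter, since the Grassmannian of GL_n is not reduced). To quantify over algebras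
  inside HOL, they are presented as quotients of one polynomial ring in countably many variables:
  every finitely generated algebra is of the form \<open>base / I\<close>, and every algebra homomorphism
  \<open>base / I \<rightarrow> base / J\<close> is induced by an algebra endomorphism \<open>h\<close> of \<open>base\<close> with \<open>h ` I \<subseteq> J\<close>.
  All objects over \<open>base / I\<close> are represented by lifts to \<open>base\<close> and only matter modulo \<open>I\<close>.
  Ideals of the coefficient ring are passed around so that the same definitions serve for \<open>base / I\<close>
  and for the complex numbers (with ideal \<open>{0}\<close>).
\<close>

type_synonym base = "(nat \<Rightarrow>\<^sub>0 nat) \<Rightarrow>\<^sub>0 complex"

definition cst :: "complex \<Rightarrow> base" where
  "cst c = Poly_Mapping.single 0 c"

definition is_ideal :: "'a::comm_ring_1 set \<Rightarrow> bool" where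
  "is_ideal I \<longleftrightarrow> 0 \<in> I \<and> (\<forall>a\<in>I. \<forall>b\<in>I. a + b \<in> I) \<and> (\<forall>a. \<forall>b\<in>I. a * b \<in> I)"

text \<open>Homomorphisms of complex algebras out of \<open>base\<close>, where \<open>\<kappa>\<close> is the structure map of the target.\<close>

definition alg_hom :: "(complex \<Rightarrow> 'b::comm_ring_1) \<Rightarrow> (base \<Rightarrow> 'b) \<Rightarrow> bool" where
  "alg_hom \<kappa> h \<longleftrightarrow> (\<forall>a b. h (a + b) = h a + h b) \<and> (\<forall>a b. h (a * b) = h a * h b) \<and>
     (\<forall>c. h (cst c) = \<kappa> c)"

definition fls_map :: "('a::zero \<Rightarrow> 'b::zero) \<Rightarrow> 'a fls \<Rightarrow> 'b fls" where
  "fls_map h F = Abs_fls (\<lambda>j. h (fls_nth F j))"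

definition vmap :: "('a::zero \<Rightarrow> 'b::zero) \<Rightarrow> 'a fls ^ 'n \<Rightarrow> 'b fls ^ 'n" where
  "vmap h v = (\<chi> i. fls_map h (v $ i))"

definition mmap :: "('a::zero \<Rightarrow> 'b::zero) \<Rightarrow> 'a fls ^ 'n ^ 'n \<Rightarrow> 'b fls ^ 'n ^ 'n" where
  "mmap h f = (\<chi> i j. fls_map h (f $ i $ j))"

text \<open>The vectors of Laurent series which are zero modulo \<open>I\<close>.\<close>

definition van :: "'a::comm_ring_1 set \<Rightarrow> ('a fls ^ 'n) set" where
  "van I = {v. \<forall>i j. fls_nth (v $ i) j \<in> I}"


section \<open>Functions on the punctured line\<close>

text \<open>
  A rational function of the coordinate \<open>z\<close> with poles along a divisor \<open>x 0 + ... + x (N - 1)\<close>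
  is identified with its Laurent expansion at infinity, i.e. with a Laurent series in \<open>1/z\<close>:
  the series variable is \<open>1/z\<close>, and \<open>z\<close> is \<open>fls_X_inv\<close>. This embeds \<open>R[z, 1/(z - x i)]\<close> into
  \<open>R((1/z))\<close> for every \<open>R = base / I\<close>, because the equation of the divisor is monic.
\<close>

definition divisor_eq :: "nat \<Rightarrow> (nat \<Rightarrow> 'a::comm_ring_1) \<Rightarrow> 'a fls" where
  "divisor_eq N x = (\<Prod>i<N. fls_X_inv - fls_const (x i))"

definition polyfuns :: "'a::comm_ring_1 set \<Rightarrow> 'a fls set" where
  "polyfuns I = {F. \<forall>j>0. fls_nth F j \<in> I}"

definition ratfuns :: "'a::comm_ring_1 set \<Rightarrow> nat \<Rightarrow> (nat \<Rightarrow> 'a) \<Rightarrow> 'a fls set" where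
  "ratfuns I N x = {F. \<exists>m. divisor_eq N x ^ m * F \<in> polyfuns I}"

definition poly_vecs :: "'a::comm_ring_1 set \<Rightarrow> ('a fls ^ 'n) set" where
  "poly_vecs I = {v. \<forall>i. v $ i \<in> polyfuns I}"

definition rat_vecs :: "'a::comm_ring_1 set \<Rightarrow> nat \<Rightarrow> (nat \<Rightarrow> 'a) \<Rightarrow> ('a fls ^ 'n) set" where
  "rat_vecs I N x = {v. \<forall>i. v $ i \<in> ratfuns I N x}"

text \<open>
  \<open>expands I N x c F L\<close>: the series \<open>L\<close> in the local coordinate \<open>t = z - c\<close> is the Laurent expansion
  at \<open>c\<close> of the rational function \<open>F\<close>. Writing \<open>F = p / (\<Prod>i. z - x i) ^ m\<close>, the expansion is obtained
  by substituting \<open>z = t + c\<close> in \<open>p\<close> and in the denominator. It is only used when each \<open>c - x i\<close> is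
  modulo \<open>I\<close> a complex constant, so that \<open>\<Prod>i. t + c - x i\<close> is a unit of \<open>R((t))\<close>.
\<close>

definition expands ::
    "'a::comm_ring_1 set \<Rightarrow> nat \<Rightarrow> (nat \<Rightarrow> 'a) \<Rightarrow> 'a \<Rightarrow> 'a fls \<Rightarrow> 'a fls \<Rightarrow> bool" where
  "expands I N x c F L \<longleftrightarrow> (\<exists>m p.
     (\<forall>j. fls_nth (divisor_eq N x ^ m * F - poly (map_poly fls_const p) fls_X_inv) j \<in> I) \<and>
     (\<forall>j. fls_nth ((\<Prod>i<N. fls_X + fls_const (c - x i)) ^ m * L
             - poly (map_poly fls_const p) (fls_X + fls_const c)) j \<in> I))"

definition vexpands ::
    "'a::comm_ring_1 set \<Rightarrow> nat \<Rightarrow> (nat \<Rightarrow> 'a) \<Rightarrow> 'a \<Rightarrow> 'a fls ^ 'n \<Rightarrow> 'a fls ^ 'n \<Rightarrow> bool" where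
  "vexpands I N x c v L \<longleftrightarrow> (\<forall>i. expands I N x c (v $ i) (L $ i))"

text \<open>In the local coordinate: \<open>R[[t]]^n\<close>, and its complement \<open>t^-1 R[t^-1]^n\<close> in \<open>R((t))^n\<close>.\<close>

definition pow_vecs :: "'a::comm_ring_1 set \<Rightarrow> ('a fls ^ 'n) set" where
  "pow_vecs I = {v. \<forall>i. \<forall>j<0. fls_nth (v $ i) j \<in> I}"

definition polar_vecs :: "'a::comm_ring_1 set \<Rightarrow> ('a fls ^ 'n) set" where
  "polar_vecs I = {v. \<forall>i. \<forall>j\<ge>0. fls_nth (v $ i) j \<in> I}"


section \<open>The Beilinson-Drinfeld Grassmannian\<close>

text \<open>\<open>us\<close> is a basis of the module \<open>A / B\<close> over the coefficient ring modulo \<open>I\<close>.\<close>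

definition frame ::
    "'a::comm_ring_1 set \<Rightarrow> ('a fls ^ 'n) set \<Rightarrow> ('a fls ^ 'n) set \<Rightarrow> ('a fls ^ 'n) list \<Rightarrow> bool" where
  "frame I A B us \<longleftrightarrow> B \<subseteq> A \<and> set us \<subseteq> A \<and>
     (\<forall>v\<in>A. \<exists>c. v - (\<Sum>a<length us. fls_const (c a) *s (us ! a)) \<in> B) \<and>
     (\<forall>c. (\<Sum>a<length us. fls_const (c a) *s (us ! a)) \<in> B \<longrightarrow> (\<forall>a<length us. c a \<in> I))"

definition submod :: "'a::comm_ring_1 set \<Rightarrow> ('a fls ^ 'n) set \<Rightarrow> bool" where
  "submod I E \<longleftrightarrow> van I \<subseteq> E \<and> (\<forall>u\<in>E. \<forall>v\<in>E. u + v \<in> E) \<and>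
     (\<forall>F\<in>polyfuns I. \<forall>v\<in>E. F *s v \<in> E)"

text \<open>
  \<open>E\<close> is locally free over \<open>R[z]\<close>, of rank the cardinality of \<open>'n\<close>: there are finitely many functions
  \<open>g\<close> generating the unit ideal such that the localization of \<open>E\<close> at each \<open>g\<close> is free of that rank.
\<close>

definition locally_free :: "'a::comm_ring_1 set \<Rightarrow> ('a fls ^ 'n) set \<Rightarrow> bool" where
  "locally_free I E \<longleftrightarrow> (\<exists>G. finite G \<and> G \<subseteq> polyfuns I \<and>
     (\<exists>q. (\<forall>g\<in>G. q g \<in> polyfuns I) \<and> (\<forall>j. fls_nth ((\<Sum>g\<in>G. q g * g) - 1) j \<in> I)) \<and>
     (\<forall>g\<in>G. \<exists>b :: 'n \<Rightarrow> 'a fls ^ 'n. range b \<subseteq> E \<and>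
        (\<forall>v\<in>E. \<exists>m c. (\<forall>i. c i \<in> polyfuns I) \<and> g ^ m *s v - (\<Sum>i\<in>UNIV. c i *s b i) \<in> van I) \<and>
        (\<forall>c. (\<forall>i. c i \<in> polyfuns I) \<and> (\<Sum>i\<in>UNIV. c i *s b i) \<in> van I \<longrightarrow>
           (\<exists>m. \<forall>i j. fls_nth (g ^ m * c i) j \<in> I))))"

text \<open>The points over \<open>x\<close>: locally free subsheaves of \<open>j\<^sub>*O^n\<close> which agree with \<open>O^n\<close> off the divisor.\<close>

definition bd_points :: "base set \<Rightarrow> nat \<Rightarrow> (nat \<Rightarrow> base) \<Rightarrow> (base fls ^ 'n) set set" where
  "bd_points I N x = {E. submod I E \<and> locally_free I E \<and> E \<subseteq> rat_vecs I N x \<and>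
     (\<forall>v\<in>rat_vecs I N x. \<exists>m. divisor_eq N x ^ m *s v \<in> E)}"

text \<open>
  The lattice in \<open>\<complex>((t))^n\<close>, \<open>t = z - c\<close>, generated by the expansions at \<open>c\<close> of a subsheaf \<open>E\<close>; and the
  component of the affine Grassmannian to which a lattice belongs.
\<close>

definition local_lattice ::
    "nat \<Rightarrow> (nat \<Rightarrow> complex) \<Rightarrow> complex \<Rightarrow> (complex fls ^ 'n) set \<Rightarrow> (complex fls ^ 'n) set" where
  "local_lattice N x c E =
     module.span (\<lambda>a v. fps_to_fls a *s v) {L. \<exists>v\<in>E. vexpands {0} N x c v L}"

definition has_degree :: "(complex fls ^ 'n) set \<Rightarrow> nat \<Rightarrow> bool" where
  "has_degree \<Lambda> m \<longleftrightarrow> (\<exists>M0. \<forall>M\<ge>M0. \<exists>us. length us = m + M * CARD('n) \<and>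
     frame {0} (pow_vecs {0}) ((\<lambda>v. fls_X ^ M *s v) ` \<Lambda>) us)"

text \<open>
  The part of the Grassmannian whose fibre over a point of \<open>\<A>^N\<close> is the product, over the distinct
  coordinates \<open>c\<close>, of the components of degree equal to the multiplicity of \<open>c\<close>; in particular all
  degrees are \<open>1\<close> over a point with distinct coordinates. This is a condition on complex points: an
  \<open>R\<close>-point belongs to this part if its specializations at all \<open>\<theta> : R \<rightarrow> \<complex>\<close> do, with no condition on
  nilpotents. So it is the formal completion of the full Grassmannian along a closed subset; it is
  flat over \<open>\<A>^N\<close>, and its fibres are the full (non-reduced) products of components.
\<close>

definition gr1_points :: "base set \<Rightarrow> nat \<Rightarrow> (nat \<Rightarrow> base) \<Rightarrow> (base fls ^ 'n) set set" where
  "gr1_points I N x = {E \<in> bd_points I N x.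
     \<forall>\<theta> :: base \<Rightarrow> complex. alg_hom id \<theta> \<and> \<theta> ` I \<subseteq> {0} \<longrightarrow>
       (\<forall>c. has_degree (local_lattice N (\<theta> \<circ> x) c (vmap \<theta> ` E)) (card {i. i < N \<and> \<theta> (x i) = c}))}"


section \<open>The determinant line bundle and its sections\<close>

text \<open>
  The fibre of \<open>O(1)\<close> at \<open>E\<close> is the relative determinant \<open>det(O^n/E) = det(\<Omega>/E) \<otimes> det(\<Omega>/O^n)^-1\<close>
  for any \<open>\<Omega>\<close> containing \<open>O^n\<close> and \<open>E\<close>; if \<open>E \<subseteq> O^n\<close> one may take \<open>\<Omega> = O^n\<close>. Where the quotients are
  free, bases \<open>u\<close> of \<open>\<Omega>/O^n\<close> and \<open>v\<close> of \<open>\<Omega>/E\<close> give a generator \<open>\<And>v / \<And>u\<close>. A section of \<open>O(k)\<close> is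
  recorded by its coordinate with respect to the \<open>k\<close>-th power of this generator. Such framed points
  exist Zariski-locally on the base of any point, so they determine the section.
\<close>

record 'n framed_point =
  alg :: "base set"
  pts :: "nat \<Rightarrow> base"
  lat :: "(base fls ^ 'n) set"
  big :: "(base fls ^ 'n) set"
  frO :: "(base fls ^ 'n) list"
  frE :: "(base fls ^ 'n) list"

definition Gr1 :: "nat \<Rightarrow> 'n::finite framed_point set" where
  "Gr1 N = {p. is_ideal (alg p) \<and> lat p \<in> gr1_points (alg p) N (pts p) \<and>
     submod (alg p) (big p) \<and> big p \<subseteq> rat_vecs (alg p) N (pts p) \<and>
     frame (alg p) (big p) (poly_vecs (alg p)) (frO p) \<and>
     frame (alg p) (big p) (lat p) (frE p)}"

definition base_change ::
    "(base \<Rightarrow> base) \<Rightarrow> base set \<Rightarrow> (base fls ^ 'n) set \<Rightarrow> (base fls ^ 'n) set" where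
  "base_change h J E = module.span (\<lambda>a v. fls_const a *s v) (vmap h ` E \<union> van J)"

definition is_pullback ::
    "nat \<Rightarrow> (base \<Rightarrow> base) \<Rightarrow> 'n::finite framed_point \<Rightarrow> 'n framed_point \<Rightarrow> bool" where
  "is_pullback N h p p' \<longleftrightarrow> alg_hom cst h \<and> h ` alg p \<subseteq> alg p' \<and>
     (\<forall>i<N. pts p' i - h (pts p i) \<in> alg p') \<and>
     lat p' = base_change h (alg p') (lat p) \<and> big p' = base_change h (alg p') (big p) \<and>
     list_all2 (\<lambda>u' u. u' - vmap h u \<in> poly_vecs (alg p')) (frO p') (frO p) \<and>
     list_all2 (\<lambda>v' v. v' - vmap h v \<in> lat p') (frE p') (frE p)"

definition changes_frame ::
    "(base fls ^ 'n) set \<Rightarrow> (nat \<Rightarrow> nat \<Rightarrow> base) \<Rightarrow> (base fls ^ 'n) list \<Rightarrow> (base fls ^ 'n) list \<Rightarrow> bool"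
  where
  "changes_frame B G us us' \<longleftrightarrow> length us' = length us \<and>
     (\<forall>a<length us. us' ! a - (\<Sum>b<length us. fls_const (G a b) *s (us ! b)) \<in> B)"

definition frame_det :: "nat \<Rightarrow> (nat \<Rightarrow> nat \<Rightarrow> base) \<Rightarrow> base" where
  "frame_det r G = Determinant.det (Matrix.mat r r (\<lambda>(a, b). G a b))"

text \<open>
  Sections of \<open>O(k)\<close> over \<open>X\<close>, either the whole of \<open>Gr1 N\<close> or a fibre of it: functions of framed points
  (up to functions vanishing modulo \<open>alg p\<close>), compatible with base change, with changes of the bases
  \<open>u\<close> and \<open>v\<close>, and with enlarging \<open>\<Omega>\<close> by elements \<open>q\<close> added to both bases. As \<open>\<A>^N\<close> is affine,
  \<open>sections N k (Gr1 N)\<close> is also the space of global sections of the pushforward of \<open>O(k)\<close> to \<open>\<A>^N\<close>.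
\<close>

definition sections ::
    "nat \<Rightarrow> nat \<Rightarrow> 'n::finite framed_point set \<Rightarrow> ('n framed_point \<Rightarrow> base) set" where
  "sections N k X = {s.
     (\<forall>p\<in>X. \<forall>p'\<in>X. \<forall>h. is_pullback N h p p' \<longrightarrow> s p' - h (s p) \<in> alg p') \<and>
     (\<forall>p\<in>X. \<forall>p'\<in>X. \<forall>G H.
        alg p' = alg p \<and> pts p' = pts p \<and> lat p' = lat p \<and> big p' = big p \<and>
        changes_frame (poly_vecs (alg p)) H (frO p) (frO p') \<and>
        changes_frame (lat p) G (frE p) (frE p') \<longrightarrow>
        s p' * frame_det (length (frE p)) G ^ k - s p * frame_det (length (frO p)) H ^ k \<in> alg p) \<and>
     (\<forall>p\<in>X. \<forall>p'\<in>X. \<forall>q.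
        alg p' = alg p \<and> pts p' = pts p \<and> lat p' = lat p \<and> big p \<subseteq> big p' \<and>
        frO p' = frO p @ q \<and> frE p' = frE p @ q \<longrightarrow> s p' - s p \<in> alg p)}"

definition zero_section :: "'n::finite framed_point set \<Rightarrow> ('n framed_point \<Rightarrow> base) \<Rightarrow> bool" where
  "zero_section X s \<longleftrightarrow> (\<forall>p\<in>X. s p \<in> alg p)"


section \<open>Weights\<close>

text \<open>
  The scaling by \<open>\<lambda>\<close> sends \<open>x i\<close> to \<open>\<lambda> x i\<close> and a function \<open>F(z)\<close> to \<open>F(z/\<lambda>)\<close>; on Laurent series in \<open>1/z\<close>
  it multiplies the coefficient of \<open>z^-j\<close> by \<open>\<lambda>^j\<close>. With the convention below, the coordinate
  functions \<open>x i\<close> have weight \<open>1\<close>.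
\<close>

definition scale_vec :: "complex \<Rightarrow> base fls ^ 'n \<Rightarrow> base fls ^ 'n" where
  "scale_vec lam v = (\<chi> i. Abs_fls (\<lambda>j. cst (lam powi j) * fls_nth (v $ i) j))"

definition scale_point :: "complex \<Rightarrow> 'n::finite framed_point \<Rightarrow> 'n framed_point" where
  "scale_point lam p = \<lparr>alg = alg p, pts = (\<lambda>i. cst lam * pts p i),
     lat = scale_vec lam ` lat p, big = scale_vec lam ` big p,
     frO = map (scale_vec lam) (frO p), frE = map (scale_vec lam) (frE p)\<rparr>"

definition weight_space :: "nat \<Rightarrow> nat \<Rightarrow> int \<Rightarrow> ('n::finite framed_point \<Rightarrow> base) set" where
  "weight_space N k w = {s \<in> sections N k (Gr1 N).
     \<forall>lam p. lam \<noteq> 0 \<and> p \<in> Gr1 N \<longrightarrow> s (scale_point lam p) - cst (lam powi w) * s p \<in> alg p}"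

definition is_smallest_weight :: "'n::finite itself \<Rightarrow> nat \<Rightarrow> nat \<Rightarrow> int \<Rightarrow> bool" where
  "is_smallest_weight T N k w \<longleftrightarrow>
     (\<exists>s \<in> weight_space N k w. \<not> zero_section (Gr1 N :: 'n framed_point set) s) \<and>
     (\<forall>w'<w. \<forall>s \<in> weight_space N k w'. zero_section (Gr1 N :: 'n framed_point set) s)"

definition lowest_weight_sections :: "nat \<Rightarrow> nat \<Rightarrow> ('n::finite framed_point \<Rightarrow> base) set" where
  "lowest_weight_sections N k =
     {s. \<exists>w. is_smallest_weight TYPE('n) N k w \<and> s \<in> weight_space N k w}"


section \<open>Modified conformal blocks\<close>

definition fibre :: "nat \<Rightarrow> (nat \<Rightarrow> complex) \<Rightarrow> 'n::finite framed_point set" where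
  "fibre N b = {p \<in> Gr1 N. \<forall>i<N. pts p i - cst (b i) \<in> alg p}"

text \<open>Matrices of rational functions with poles at the \<open>y i\<close> only, vanishing at infinity.\<close>

definition g0 :: "nat \<Rightarrow> (nat \<Rightarrow> complex) \<Rightarrow> (complex fls ^ 'n ^ 'n) set" where
  "g0 l y = {f. \<forall>a b. f $ a $ b \<in> ratfuns {0} l y \<and> (\<forall>j\<le>0. fls_nth (f $ a $ b) j = 0)}"

text \<open>The action of the infinitesimal group element \<open>1 + \<epsilon> f\<close>.\<close>

definition inf_act :: "base \<Rightarrow> complex fls ^ 'n ^ 'n \<Rightarrow> base fls ^ 'n \<Rightarrow> base fls ^ 'n" where
  "inf_act e f v = v + fls_const e *s (mmap cst f *v v)"

text \<open>
  Let \<open>f i\<close> be the Laurent expansion of \<open>f\<close> at \<open>y i\<close>, and \<open>g = 1 + \<epsilon> f\<close>, \<open>g i = 1 + \<epsilon> f i\<close> with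
  \<open>\<epsilon>^2 = 0\<close>. The element \<open>g\<close> maps \<open>E \<subseteq> \<Omega>\<close> to \<open>g E \<subseteq> g \<Omega>\<close>, and a basis of \<open>\<Omega>/E\<close> to one of
  \<open>g \<Omega> / g E\<close>. To get an action on \<open>O(1)\<close> one must also pass from a basis of \<open>\<Omega>/O^n\<close>, hence of
  \<open>g \<Omega> / g O^n\<close>, to a basis of \<open>g \<Omega> / O^n\<close>. At each \<open>y i\<close> this uses the standard (normally ordered)
  lift of \<open>gl_n((t))\<close> to its central extension: \<open>R((t))^n\<close> modulo \<open>g i R[[t]]^n\<close> and modulo \<open>R[[t]]^n\<close>
  are both identified with the principal parts \<open>t^-1 R[t^-1]^n\<close>. So the image of \<open>u\<close> is the class
  modulo \<open>O^n\<close> whose principal part \<open>w\<close> at each \<open>y i\<close> represents \<open>g i u\<close> modulo \<open>g i R[[t]]^n\<close>.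
\<close>

definition moves_polar_part ::
    "base set \<Rightarrow> nat \<Rightarrow> (nat \<Rightarrow> base) \<Rightarrow> nat \<Rightarrow> (nat \<Rightarrow> complex) \<Rightarrow> base \<Rightarrow> complex fls ^ 'n ^ 'n \<Rightarrow>
     base fls ^ 'n \<Rightarrow> base fls ^ 'n \<Rightarrow> bool" where
  "moves_polar_part I N x l y e f u u' \<longleftrightarrow> (\<forall>i<l. \<exists>L L' fi w q.
     vexpands I N x (cst (y i)) u L \<and> vexpands I N x (cst (y i)) u' L' \<and>
     (\<forall>a b. expands {0} l y (y i) (f $ a $ b) (fi $ a $ b)) \<and>
     w \<in> polar_vecs I \<and> L' - w \<in> pow_vecs I \<and>
     q \<in> pow_vecs I \<and> w - inf_act e fi (L + q) \<in> van I)"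

definition is_moved ::
    "nat \<Rightarrow> nat \<Rightarrow> (nat \<Rightarrow> complex) \<Rightarrow> base \<Rightarrow> complex fls ^ 'n ^ 'n \<Rightarrow>
     'n::finite framed_point \<Rightarrow> 'n framed_point \<Rightarrow> bool" where
  "is_moved N l y e f p p' \<longleftrightarrow> alg p' = alg p \<and> pts p' = pts p \<and>
     lat p' = {v'. \<exists>v\<in>lat p. v' - inf_act e f v \<in> van (alg p)} \<and>
     big p' = {v'. \<exists>v\<in>big p. v' - inf_act e f v \<in> van (alg p)} \<and>
     list_all2 (moves_polar_part (alg p) N (pts p) l y e f) (frO p) (frO p') \<and>
     list_all2 (\<lambda>v v'. v' - inf_act e f v \<in> lat p') (frE p) (frE p')"

text \<open>
  \<open>t\<close> is the derivative of the section \<open>s\<close> along \<open>f\<close>, i.e. its image under \<open>f\<close> up to the sign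
  conventions for dual representations.
\<close>

definition has_lie_derivative ::
    "nat \<Rightarrow> nat \<Rightarrow> (nat \<Rightarrow> complex) \<Rightarrow> 'n::finite framed_point set \<Rightarrow> complex fls ^ 'n ^ 'n \<Rightarrow>
     ('n framed_point \<Rightarrow> base) \<Rightarrow> ('n framed_point \<Rightarrow> base) \<Rightarrow> bool" where
  "has_lie_derivative N l y X f s t \<longleftrightarrow> (\<forall>e. \<forall>p\<in>X. \<forall>p'\<in>X.
     e * e \<in> alg p \<and> is_moved N l y e f p p' \<longrightarrow> s p' - (s p + e * t p) \<in> alg p)"

definition modified_conformal_blocks ::
    "nat \<Rightarrow> nat \<Rightarrow> nat \<Rightarrow> (nat \<Rightarrow> complex) \<Rightarrow> (nat \<Rightarrow> complex) \<Rightarrow>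
     ('n::finite framed_point \<Rightarrow> base) set" where
  "modified_conformal_blocks N k l y b = {s \<in> sections N k (fibre N b).
     \<forall>f \<in> g0 l y. has_lie_derivative N l y (fibre N b) f s (\<lambda>_. 0)}"

end

theory Submission
 imports Defs
begin

text \<open>
 Over the family of all configurations \<open>x\<close>, the rational matrices with entries \<open>z^a / (\<Prod>j<N. z - x j)^m\<close>,
 \<open>a < m N\<close>, act on sections and lower the weight by \<open>m N - a\<close>. The derivative of a section of smallest weight
 thus is a section of smaller weight, that is, zero. At a given configuration these matrices span the Lie algebra
 of rational matrices vanishing at infinity, whence the invariance.

 Two points need care. The derivative is computed on framed points with \<open>\<Omega> = O(M)^n\<close>, and transported to other
 framed points by determinants of comparison matrices; that the result does not depend on the choices is seen
 after localizations that make all quotients free. And the lift of the action to the determinant line that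
 is normally ordered at infinity differs from the one that is normally ordered at the points \<open>y i\<close> by
 off-diagonal operators, which do not change determinants to first order.
\<close>

text \<open>The obstacle is base change. Free quotients of a framed point survive every base change
  when \<Omega> = O(M)^n, but for a general \<Omega> the quotient O(M)^n / \<Omega> need not be
  projective, and tensoring can destroy independence. Passing to dual numbers is such a base change,
  so derivatives are first taken at points with \<Omega> = O(M)^n. The way back to other framed
  points is flatness. The module E stays inside the rational vectors modulo every ideal, so the
  relations in a finite presentation of O(M)^n / E split. A large M supplies as many free summands
  as there are relations, and O(M)^n / E becomes free. Independence of choices is checked after
  localizing at the entries of an injective matrix. These localizations need not cover the spectrum;
  they detect zero because the entries have no common annihilator, and this remains true one row
  after another. Scaling is applied to framed points of the whole family only, whereas invariance is
  wanted at one constant configuration. The bridge is that a matrix vanishing at infinity has a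
  numerator of degree less than m N over the m-th power of the divisor equation.\<close>

lemmas smult_assoc = vector_smult_assoc and smult_diff = vector_ssub_ldistrib
 and smult_add = vector_add_ldistrib and add_smult = vector_sadd_rdistrib
 and diff_smult = vector_sub_rdistrib and mv_diff = matrix_vector_mult_diff_distrib
 and mv_add = matrix_vector_right_distrib and add_mv = matrix_vector_mult_add_rdistrib
 and diff_mv = matrix_vector_mult_diff_rdistrib

abbreviation csmult :: "'a::comm_ring_1 => 'a fls ^ 'n => 'a fls ^ 'n" (infixl "*c" 70) where
 "c *c v \<equiv> fls_const c *s v"

section \<open>Ideals and congruences\<close>

lemma ideal_zero: "is_ideal I ==> 0 : I"
 by(simp add: is_ideal_def)

lemma ideal_add: "is_ideal I ==> a : I ==> b : I ==> a + b : I"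
 by(simp add: is_ideal_def)

lemma ideal_mult: "is_ideal I ==> b : I ==> a * b : I"
 by(simp add: is_ideal_def)

lemma ideal_mult2: "is_ideal I ==> b : I ==> b * a : I"
 by(metis ideal_mult mult.commute)

lemma ideal_uminus: "is_ideal I ==> a : I ==> - a : I"
 using ideal_mult[of I a "-1"] by simp

lemma ideal_diff: "is_ideal I ==> a : I ==> b : I ==> a - b : I"
 using ideal_add[of I a "-b"] ideal_uminus[of I b] by simp

lemma ideal_sum: "is_ideal I ==> (!!x. x : A ==> f x : I) ==> sum f A : I"
 by(induction A rule: infinite_finite_induct) (auto intro: ideal_zero ideal_add)

lemma ideal_cong: "is_ideal I ==> a - b : I ==> a : I \<longleftrightarrow> b : I"
 by(metis add_diff_cancel_left' diff_add_cancel ideal_add ideal_diff)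

lemma ideal_eq_zeroI: "is_ideal I ==> b : I ==> a - b : I ==> a : I"
 using ideal_cong by blast

lemma cong_sym: "is_ideal I ==> a - b : I ==> b - a : I"
 using ideal_uminus[of I "a - b"] by simp

lemma cong_trans: "is_ideal I ==> a - b : I ==> b - c : I ==> a - c : I"
 using ideal_add[of I "a - b" "b - c"] by simp

lemma cong_mult: "is_ideal I ==> a - a' : I ==> b - b' : I ==> a * b - a' * b' : I"
proof -
 assume I: "is_ideal I" and "a - a' : I" "b - b' : I"
 hence "a * (b - b') + b' * (a - a') : I"
  by(intro ideal_add ideal_mult)
 thus ?thesis by(simp add: algebra_simps)
qed

lemma cong_power: "is_ideal I ==> a - a' : I ==> a ^ k - a' ^ k : I"
 by(induction k) (auto simp: ideal_zero intro: cong_mult)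

lemma cong_sum: "is_ideal I ==> (!!x. x : A ==> f x - g x : I) ==> sum f A - sum g A : I"
 by(metis (mono_tags, lifting) ideal_sum sum_subtractf sum.cong)

lemma cong_prod: "is_ideal I ==> (!!x. x : A ==> f x - g x : I) ==> prod f A - prod g A : I"
 by(induction A rule: infinite_finite_induct) (auto simp: ideal_zero intro: cong_mult)

lemma is_ideal_zero: "is_ideal {0 :: 'a :: comm_ring_1}"
 by(simp add: is_ideal_def)

section \<open>Laurent series modulo an ideal\<close>

text \<open>The kernel of the reduction of Laurent series modulo \<open>I\<close>. Congruence of
  series modulo \<open>I\<close> is membership of their difference.\<close>

definition cof :: "'a::comm_ring_1 set => 'a fls set" where
 "cof I = {F. ALL j. fls_nth F j : I}"

lemma fls_times_nth_bounds:
 fixes f g :: "'a::comm_ring_1 fls"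
 assumes "!!j. j < a ==> fls_nth f j = 0" "!!j. j < b ==> fls_nth g j = 0"
 shows "fls_nth (f * g) n = (\<Sum>i=a..n-b. fls_nth f i * fls_nth g (n - i))"
proof -
 let ?h = "%i. fls_nth f i * fls_nth g (n - i)"
 let ?S = "{min a (fls_subdegree f)..max (n-b) (n - fls_subdegree g)}"
 have "fls_nth (f * g) n = sum ?h {fls_subdegree f..n - fls_subdegree g}"
  by(simp add: fls_times_nth(2))
 also have "\<dots> = sum ?h ?S"
  by(rule sum.mono_neutral_left) auto
 also have "\<dots> = sum ?h {a..n-b}"
  using assms by(intro sum.mono_neutral_right) (auto simp: not_le)
 finally show ?thesis .
qed

lemma cof_ideal: "is_ideal I ==> is_ideal (cof I)"
 unfolding is_ideal_def[of "cof I"]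
proof(intro conjI ballI allI)
 assume I: "is_ideal I"
 show "0 : cof I" using I by(auto simp: cof_def ideal_zero)
 show "a + b : cof I" if "a : cof I" "b : cof I" for a b
  using that I by(auto simp: cof_def ideal_add)
 show "a * b : cof I" if "b : cof I" for a b
  using that I by(auto simp: cof_def fls_times_nth(2) intro!: ideal_sum ideal_mult)
qed

lemma cof_const: "is_ideal I ==> fls_const c : cof I \<longleftrightarrow> c : I"
 by(auto simp: cof_def ideal_zero split: if_splits)

lemma van_iff: "v : van I \<longleftrightarrow> (ALL i. v $ i : cof I)"
 by(simp add: van_def cof_def)

lemma van_zero: "is_ideal I ==> 0 : van I"
 by(simp add: van_iff cof_ideal ideal_zero)

lemma van_add: "is_ideal I ==> u : van I ==> v : van I ==> u + v : van I"
 by(simp add: van_iff cof_ideal ideal_add)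

lemma van_diff: "is_ideal I ==> u : van I ==> v : van I ==> u - v : van I"
 by(simp add: van_iff cof_ideal ideal_diff)

lemma van_uminus: "is_ideal I ==> u : van I ==> - u : van I"
 by(simp add: van_iff cof_ideal ideal_uminus)

lemma van_smult: "is_ideal I ==> v : van I ==> F *s v : van I"
 by(simp add: van_iff cof_ideal ideal_mult)

lemma van_smult_left: "is_ideal I ==> F : cof I ==> F *s v : van I"
 by(simp add: van_iff cof_ideal ideal_mult2)

lemma van_sum: "is_ideal I ==> (!!x. x : A ==> f x : van I) ==> sum f A : van I"
 by(induction A rule: infinite_finite_induct) (auto intro: van_zero van_add)

lemma van_sym: "is_ideal I ==> u - v : van I ==> v - u : van I"
 using van_uminus[of I "u - v"] by simp

lemma van_trans: "is_ideal I ==> u - v : van I ==> v - w : van I ==> u - w : van I"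
 using van_add[of I "u - v" "v - w"] by simp

lemma van_mono: "I \<subseteq> J ==> van I \<subseteq> van J"
 by(auto simp: van_def)

lemma van_mv: "is_ideal I ==> v : van I ==> F *v v : van I"
 by(auto simp: van_iff matrix_vector_mult_def cof_ideal intro!: ideal_sum ideal_mult)

lemma van_mv_left: "is_ideal I ==> (!!i j. F $ i $ j : cof I) ==> F *v v : van I"
 by(auto simp: van_iff matrix_vector_mult_def cof_ideal intro!: ideal_sum ideal_mult2)

lemma smult_mv: "F *v (c *s v) = c *s (F *v (v :: 'a::comm_ring_1 ^ 'n))"
 by(simp add: vec_eq_iff matrix_vector_mult_def sum_distrib_left algebra_simps)

section \<open>Coefficientwise maps\<close>

lemma fls_nth_Abs:
 assumes "!!j. j < a ==> f j = 0"
 shows "fls_nth (Abs_fls f) j = f j"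
proof -
 have "\<forall>\<^sub>\<infinity>n. f (- int n) = 0"
  unfolding MOST_nat
  by(rule exI[of _ "nat (- a)"]) (auto intro!: assms)
 thus ?thesis by(simp add: Abs_fls_inverse)
qed

lemma fls_map_nth: "h 0 = 0 ==> fls_nth (fls_map h F) j = h (fls_nth F j)"
 unfolding fls_map_def by(rule fls_nth_Abs[of "fls_subdegree F"]) simp

text \<open>Unital ring maps without a condition on complex constants, so that \<open>cst\<close>,
  evaluations of polynomials, scalings and the coefficientwise extensions \<open>fls_map h\<close>
  are instances too.\<close>

locale ring_map =
 fixes h :: "'a::comm_ring_1 => 'b::comm_ring_1"
 assumes add: "h (a + b) = h a + h b" and mult: "h (a * b) = h a * h b" and one: "h 1 = 1"
begin

lemma zero: "h 0 = 0"
 using add[of 0 0] by simp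

lemma uminus: "h (- a) = - h a"
 using add[of a "- a"] zero by(simp add: eq_neg_iff_add_eq_0 add.commute)

lemma diff: "h (a - b) = h a - h b"
 using add[of a "- b"] uminus by simp

lemma sum: "h (sum f A) = (\<Sum>x\<in>A. h (f x))"
 by(induction A rule: infinite_finite_induct) (auto simp: zero add)

lemma prod: "h (prod f A) = (\<Prod>x\<in>A. h (f x))"
 by(induction A rule: infinite_finite_induct) (auto simp: one mult)

lemma power: "h (a ^ k) = h a ^ k"
 by(induction k) (auto simp: one mult)

lemma map_nth: "fls_nth (fls_map h F) j = h (fls_nth F j)"
 by(rule fls_map_nth[of h, OF zero])

lemma ring_map_fls: "ring_map (fls_map h)"
proof
 show "fls_map h (F + G) = fls_map h F + fls_map h G" for F G
  by(rule fls_eqI) (simp add: map_nth add)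
 show "fls_map h 1 = 1"
  by(rule fls_eqI) (simp add: map_nth one zero)
 show "fls_map h (F * G) = fls_map h F * fls_map h G" for F G
 proof(rule fls_eqI)
  fix n
  have "fls_nth (fls_map h F * fls_map h G) n =
    (\<Sum>i=fls_subdegree F..n-fls_subdegree G. fls_nth (fls_map h F) i * fls_nth (fls_map h G) (n-i))"
   by(rule fls_times_nth_bounds) (auto simp: map_nth zero)
  thus "fls_nth (fls_map h (F * G)) n = fls_nth (fls_map h F * fls_map h G) n"
   by(simp add: map_nth fls_times_nth(2) sum mult)
 qed
qed

lemma map_const: "fls_map h (fls_const c) = fls_const (h c)"
 by(rule fls_eqI) (simp add: map_nth zero)

lemma map_X_inv: "fls_map h fls_X_inv = fls_X_inv"
 by(rule fls_eqI) (simp add: map_nth zero one)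

lemma map_X: "fls_map h fls_X = fls_X"
 by(rule fls_eqI) (simp add: map_nth zero one)

lemma map_divisor: "fls_map h (divisor_eq N x) = divisor_eq N (h o x)"
proof -
 interpret F: ring_map "fls_map h" by(rule ring_map_fls)
 show ?thesis by(simp add: divisor_eq_def F.prod F.diff map_const map_X_inv)
qed

lemma map_cof: "h ` I \<subseteq> J ==> F : cof I ==> fls_map h F : cof J"
 by(auto simp: cof_def map_nth)

lemma vmap_nth: "vmap h v $ i = fls_map h (v $ i)"
 by(simp add: vmap_def)

lemma vmap_add: "vmap h (u + v) = vmap h u + vmap h v"
 by(simp add: vec_eq_iff vmap_nth ring_map.add[OF ring_map_fls])

lemma vmap_diff: "vmap h (u - v) = vmap h u - vmap h v"
 by(simp add: vec_eq_iff vmap_nth ring_map.diff[OF ring_map_fls])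

lemma vmap_zero: "vmap h 0 = 0"
 by(simp add: vec_eq_iff vmap_nth ring_map.zero[OF ring_map_fls])

lemma vmap_smult: "vmap h (F *s v) = fls_map h F *s vmap h v"
 by(simp add: vec_eq_iff vmap_nth ring_map.mult[OF ring_map_fls])

lemma vmap_sum: "vmap h (sum f A) = (\<Sum>x\<in>A. vmap h (f x))"
 by(induction A rule: infinite_finite_induct) (auto simp: vmap_zero vmap_add)

lemma vmap_mv: "vmap h (F *v v) = mmap h F *v vmap h v"
 by(simp add: vec_eq_iff vmap_nth matrix_vector_mult_def mmap_def
   ring_map.sum[OF ring_map_fls] ring_map.mult[OF ring_map_fls])

lemma vmap_van: "h ` I \<subseteq> J ==> v : van I ==> vmap h v : van J"
 by(auto simp: van_def vmap_nth map_nth)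

end

lemma ring_map_cst: "ring_map cst"
 by unfold_locales (simp_all add: cst_def single_add mult_single flip: single_one)

lemma cst_simps: "cst 0 = 0" "cst 1 = 1" "cst (a + b) = cst a + cst b" "cst (a * b) = cst a * cst b"
 "cst (- a) = - cst a" "cst (a - b) = cst a - cst b"
 using ring_map.zero[OF ring_map_cst] ring_map.one[OF ring_map_cst] ring_map.add[OF ring_map_cst]
  ring_map.mult[OF ring_map_cst] ring_map.uminus[OF ring_map_cst] ring_map.diff[OF ring_map_cst]
 by auto

lemma alg_hom_ring_map: "alg_hom cst h ==> ring_map h"
 by unfold_locales (auto simp: alg_hom_def simp flip: cst_simps(2))

lemma alg_hom_id_ring_map: "alg_hom id h ==> ring_map h"
 using cst_simps(2) by unfold_locales (auto simp: alg_hom_def, metis id_apply)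

section \<open>Homomorphisms out of the polynomial ring\<close>

definition Var :: "nat => base" where
 "Var i = Poly_Mapping.single (Poly_Mapping.single i 1) 1"

lemma base_induct [case_names cst var add mult]:
 assumes "!!c. P (cst c)" "!!i. P (Var i)" "!!a b. P a ==> P b ==> P (a + b)"
  "!!a b. P a ==> P b ==> P (a * b)"
 shows "P (a :: base)"
proof -
 have pw: "P (Var i ^ k)" for i k
  by(induction k) (auto simp: assms simp flip: cst_simps(2))
 have vpow: "Var i ^ k = Poly_Mapping.single (Poly_Mapping.single i k) 1" for i k
  by(induction k) (auto simp: Var_def mult_single simp flip: single_add)
 have mono: "P (Poly_Mapping.single m 1)" for m
 proof(induction m rule: update_induct)
  case const
  show ?case using assms(1)[of 1] by(simp add: cst_def)
 next
  case (update f a b)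
  have "Poly_Mapping.update a b f = f + Poly_Mapping.single a b"
   using update(1) by(intro poly_mapping_eqI) (auto simp: lookup_update lookup_add lookup_single when_def in_keys_iff)
  hence "Poly_Mapping.single (Poly_Mapping.update a b f) (1::complex) =
    Poly_Mapping.single f 1 * Poly_Mapping.single (Poly_Mapping.single a b) 1"
   by(simp add: mult_single)
  thus ?case using update assms(4) pw vpow by metis
 qed
 show ?thesis
 proof(induction a rule: update_induct)
  case const
  show ?case using assms(1)[of 0] by(simp add: cst_simps)
 next
  case (update f a b)
  have "Poly_Mapping.update a b f = f + cst b * Poly_Mapping.single a 1"
   using update(1) by(intro poly_mapping_eqI)
    (auto simp: cst_def mult_single lookup_update lookup_add lookup_single when_def in_keys_iff)
  thus ?case using update assms mono by metis
 qed
qed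

definition mono_ev :: "(nat => 'b::comm_ring_1) => (nat \<Rightarrow>\<^sub>0 nat) => 'b" where
 "mono_ev v m = (\<Prod>i\<in>Poly_Mapping.keys m. v i ^ Poly_Mapping.lookup m i)"

text \<open>The homomorphism given by the universal property of the polynomial ring:
  \<open>kap\<close> on constants, \<open>v\<close> on variables.\<close>

definition ev :: "(complex => 'b) => (nat => 'b::comm_ring_1) => base => 'b" where
 "ev kap v a = (\<Sum>m\<in>Poly_Mapping.keys a. kap (Poly_Mapping.lookup a m) * mono_ev v m)"

lemma mono_ev_superset:
 "finite S ==> Poly_Mapping.keys m \<subseteq> S ==> mono_ev v m = (\<Prod>i\<in>S. v i ^ Poly_Mapping.lookup m i)"
 unfolding mono_ev_def by(rule prod.mono_neutral_left) (auto simp: in_keys_iff)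

lemma mono_ev_add: "mono_ev v (m + m') = mono_ev v m * mono_ev v m'"
proof -
 let ?S = "Poly_Mapping.keys m \<union> Poly_Mapping.keys m'"
 have "mono_ev v (m + m') = (\<Prod>i\<in>?S. v i ^ Poly_Mapping.lookup (m + m') i)"
  by(rule mono_ev_superset) (auto simp: keys_add)
 also have "\<dots> = (\<Prod>i\<in>?S. v i ^ Poly_Mapping.lookup m i) * (\<Prod>i\<in>?S. v i ^ Poly_Mapping.lookup m' i)"
  by(simp add: lookup_add power_add prod.distrib)
 also have "\<dots> = mono_ev v m * mono_ev v m'"
  by(subst (1 2) mono_ev_superset[of ?S]) auto
 finally show ?thesis .
qed

lemma ev_superset:
 "ring_map kap ==> finite S ==> Poly_Mapping.keys a \<subseteq> S ==>
  ev kap v a = (\<Sum>m\<in>S. kap (Poly_Mapping.lookup a m) * mono_ev v m)"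
 unfolding ev_def by(rule sum.mono_neutral_left) (auto simp: in_keys_iff ring_map.zero)

lemma ev_single: "ring_map kap ==> ev kap v (Poly_Mapping.single m c) = kap c * mono_ev v m"
 by(subst ev_superset[of _ "{m}"]) (auto simp: keys_single)

lemma ev_add: "ring_map kap ==> ev kap v (a + b) = ev kap v a + ev kap v b"
 by(subst (1 2 3) ev_superset[of _ "Poly_Mapping.keys a \<union> Poly_Mapping.keys b"])
  (auto simp: keys_add lookup_add ring_map.add sum.distrib algebra_simps in_keys_iff)

lemma ev_mult:
 assumes "ring_map kap" shows "ev kap v (a * b) = ev kap v a * ev kap v b"
proof -
 have single: "ev kap v (Poly_Mapping.single m c * b) = ev kap v (Poly_Mapping.single m c) * ev kap v b" for m c b
 proof(induction b rule: update_induct)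
  case const
  show ?case by(simp add: ev_def)
 next
  case (update f a b)
  have upd: "Poly_Mapping.update a b f = f + Poly_Mapping.single a b"
   using update(1) by(intro poly_mapping_eqI)
    (auto simp: lookup_update lookup_add lookup_single when_def in_keys_iff)
  show ?case using update
   by(simp add: upd distrib_left ev_add[OF assms] ev_single[OF assms] mult_single mono_ev_add
    ring_map.mult[OF assms] algebra_simps)
 qed
 show ?thesis
 proof(induction a rule: update_induct)
  case const
  show ?case by(simp add: ev_def)
 next
  case (update f c d)
  have upd: "Poly_Mapping.update c d f = f + Poly_Mapping.single c d"
   using update(1) by(intro poly_mapping_eqI)
    (auto simp: lookup_update lookup_add lookup_single when_def in_keys_iff)
  show ?case using update by(simp add: upd distrib_right ev_add[OF assms] single)
 qed
qed

lemma ev_cst: "ring_map kap ==> ev kap v (cst c) = kap c"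
 by(simp add: cst_def ev_single mono_ev_def)

lemma ev_Var: "ring_map kap ==> ev kap v (Var i) = v i"
 by(simp add: Var_def ev_single mono_ev_def keys_single ring_map.one)

lemma ring_map_ev: "ring_map kap ==> ring_map (ev kap v)"
 using ev_cst[of kap v 1] by unfold_locales (auto simp: ev_add ev_mult cst_simps ring_map.one)

lemma hom_ext:
 assumes "ring_map g" "ring_map h" "!!c. g (cst c) = h (cst c)" "!!i. g (Var i) = h (Var i)"
 shows "g a = h a"
 by(induction a rule: base_induct) (auto simp: assms ring_map.add ring_map.mult)

lemma ring_map_comp: "ring_map g ==> ring_map h ==> ring_map (%a. g (h a))"
 by(auto simp: ring_map_def)

lemma ring_map_const_poly: "ring_map (%c :: 'a :: comm_ring_1. [:c:])"
 by unfold_locales (auto simp: one_pCons)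

lemma ring_map_map_poly: "ring_map h ==> ring_map (map_poly h)"
 by unfold_locales (auto intro!: poly_eqI simp: coeff_map_poly coeff_mult ring_map.zero ring_map.add
  ring_map.sum ring_map.mult ring_map.one)

lemma ring_map_poly: "ring_map (%p. poly p e)"
 by unfold_locales auto

text \<open>\<open>base\<close> is a polynomial ring in one variable over an isomorphic copy of itself.\<close>

definition shift :: "base => base" where
 "shift = ev cst (%i. Var (Suc i))"

definition unshift :: "base => base poly" where
 "unshift = ev (%c. [:cst c:]) (%i. if i = 0 then [:0, 1:] else [:Var (i - 1):])"

lemma ring_map_cst_poly: "ring_map (%c. [:cst c:])"
 by(rule ring_map_comp[OF ring_map_const_poly ring_map_cst])

lemma ring_map_shift: "ring_map shift"
 unfolding shift_def by(rule ring_map_ev[OF ring_map_cst])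

lemma shift_cst: "shift (cst c) = cst c"
 unfolding shift_def by(rule ev_cst[OF ring_map_cst])

lemma shift_Var: "shift (Var i) = Var (Suc i)"
 unfolding shift_def by(rule ev_Var[OF ring_map_cst])

lemma alg_hom_shift: "alg_hom cst shift"
 by(simp add: alg_hom_def ring_map.add[OF ring_map_shift] ring_map.mult[OF ring_map_shift] shift_cst)

lemma ring_map_unshift: "ring_map unshift"
 unfolding unshift_def by(rule ring_map_ev[OF ring_map_cst_poly])

lemma unshift_cst: "unshift (cst c) = [:cst c:]"
 unfolding unshift_def by(rule ev_cst[OF ring_map_cst_poly])

lemma unshift_Var: "unshift (Var i) = (if i = 0 then [:0, 1:] else [:Var (i - 1):])"
 unfolding unshift_def by(rule ev_Var[OF ring_map_cst_poly])

lemma unshift_shift: "unshift (shift a) = [:a:]"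
 by(rule hom_ext[OF ring_map_comp[OF ring_map_unshift ring_map_shift] ring_map_const_poly])
  (simp_all add: shift_cst unshift_cst shift_Var unshift_Var)

text \<open>A left inverse of \<open>unshift\<close>. It allows induction on polynomials in
  \<open>Var 0\<close> for elements of \<open>base\<close>, as for the denominators in
  \<open>loc_ideal\<close>.\<close>

definition reshift :: "base poly => base" where
 "reshift p = poly (map_poly shift p) (Var 0)"

lemma reshift_unshift: "reshift (unshift a) = a"
 unfolding reshift_def
proof(rule hom_ext[where h = "%a. a"])
 show "ring_map (%a. poly (map_poly shift (unshift a)) (Var 0))"
  by(intro ring_map_comp[OF ring_map_poly] ring_map_comp[OF ring_map_map_poly] ring_map_shift ring_map_unshift)
 show "ring_map (%a. a)" by unfold_locales auto
 show "poly (map_poly shift (unshift (cst c))) (Var 0) = cst c" for c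
  by(simp add: unshift_cst map_poly_pCons ring_map.zero[OF ring_map_shift] shift_cst)
 show "poly (map_poly shift (unshift (Var i))) (Var 0) = Var i" for i
  by(simp add: unshift_Var map_poly_pCons ring_map.zero[OF ring_map_shift] ring_map.one[OF ring_map_shift])
   (simp add: shift_def ev_Var[OF ring_map_cst])
qed

text \<open>The extension of \<open>h\<close> to \<open>base\<close>, seen as \<open>base[Var 0]\<close>, with value \<open>e\<close> on the new variable.\<close>

definition ext_hom :: "(base => base) => base => base => base" where
 "ext_hom h e a = poly (map_poly h (unshift a)) e"

lemma ext_hom:
 assumes "alg_hom cst h"
 shows "alg_hom cst (ext_hom h e)" "ext_hom h e (shift a) = h a" "ext_hom h e (Var 0) = e"
proof -
 have h: "ring_map h" by(rule alg_hom_ring_map[OF assms])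
 have r: "ring_map (ext_hom h e)"
  unfolding ext_hom_def
  by(intro ring_map_comp[OF ring_map_poly] ring_map_comp[OF ring_map_map_poly] h ring_map_unshift)
 have "ext_hom h e (cst c) = cst c" for c
  using assms by(simp add: ext_hom_def unshift_cst map_poly_pCons ring_map.zero[OF h] alg_hom_def)
 thus "alg_hom cst (ext_hom h e)"
  using r by(simp add: alg_hom_def ring_map_def)
 show "ext_hom h e (shift a) = h a"
  by(simp add: ext_hom_def unshift_shift map_poly_pCons ring_map.zero[OF h])
 show "ext_hom h e (Var 0) = e"
  by(simp add: ext_hom_def unshift_Var map_poly_pCons ring_map.zero[OF h] ring_map.one[OF h])
qed

text \<open>Its quotient is the ring of dual numbers over \<open>base / I\<close>, with
  \<open>Var 0\<close> as the element of square zero. Coefficients from degree 2 on are therefore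
  unconstrained.\<close>

definition dual_ideal :: "base set => base set" where
 "dual_ideal I = {a. coeff (unshift a) 0 : I \<and> coeff (unshift a) 1 : I}"

lemma dual_ideal:
 assumes "is_ideal I"
 shows "is_ideal (dual_ideal I)" "shift ` I \<subseteq> dual_ideal I" "Var 0 * Var 0 : dual_ideal I"
  "shift a + Var 0 * shift b : dual_ideal I \<longleftrightarrow> a : I \<and> b : I"
  "EX a b. c - (shift a + Var 0 * shift b) : dual_ideal I"
proof -
 note u = ring_map.add[OF ring_map_unshift] ring_map.mult[OF ring_map_unshift]
  ring_map.diff[OF ring_map_unshift] ring_map.zero[OF ring_map_unshift]
 show "is_ideal (dual_ideal I)"
  using assms unfolding is_ideal_def[of "dual_ideal I"]
  by(auto simp: dual_ideal_def u coeff_mult ideal_zero intro!: ideal_add ideal_mult)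
 show "shift ` I \<subseteq> dual_ideal I"
  using assms by(auto simp: dual_ideal_def unshift_shift ideal_zero)
 show "Var 0 * Var 0 : dual_ideal I"
  using assms by(auto simp: dual_ideal_def unshift_Var u ideal_zero)
 show *: "shift a + Var 0 * shift b : dual_ideal I \<longleftrightarrow> a : I \<and> b : I" for a b
  using assms by(auto simp: dual_ideal_def unshift_Var unshift_shift u ideal_zero)
 show "EX a b. c - (shift a + Var 0 * shift b) : dual_ideal I"
  by(rule exI[of _ "coeff (unshift c) 0"], rule exI[of _ "coeff (unshift c) 1"])
   (use assms in \<open>auto simp: dual_ideal_def unshift_Var unshift_shift u ideal_zero\<close>)
qed

text \<open>The universal property of dual numbers: any element of square zero may be the image of
  \<open>Var 0\<close>. It reduces derivatives along all \<open>e\<close> to the one along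
  \<open>Var 0\<close>.\<close>

lemma ext_hom_dual:
 assumes "alg_hom cst h" "is_ideal I" "is_ideal J" "h ` I \<subseteq> J" "e * e : J"
 shows "ext_hom h e ` dual_ideal I \<subseteq> J"
proof
 have h: "ring_map h" by(rule alg_hom_ring_map[OF assms(1)])
 fix b assume "b : ext_hom h e ` dual_ideal I"
 then obtain a where a: "a : dual_ideal I" "b = poly (map_poly h (unshift a)) e"
  by(auto simp: ext_hom_def)
 define p where "p = map_poly h (unshift a)"
 have 0: "coeff p 0 : J" "coeff p 1 : J"
  using a assms(4) by(auto simp: p_def dual_ideal_def coeff_map_poly ring_map.zero[OF h])
 obtain c q where p: "p = pCons c q" by(cases p)
 obtain d q' where q: "q = pCons d q'" by(cases q)
 have "b = c + (e * d + (e * e) * poly q' e)"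
  using a(2) unfolding p_def[symmetric] p q by(simp add: algebra_simps)
 moreover have "c : J" "d : J" using 0 by(simp_all add: p q)
 ultimately show "b : J"
  using assms(3,5) by(auto intro!: ideal_add ideal_mult ideal_mult2[of J "e*e"])
qed

text \<open>\<open>h\<close> makes \<open>base / J\<close> a localization of \<open>base / I\<close>.\<close>

definition is_loc :: "base set => (base => base) => base set => bool" where
 "is_loc I h J \<longleftrightarrow> is_ideal I \<and> is_ideal J \<and> alg_hom cst h \<and> h ` I \<subseteq> J \<and>
  (ALL c. EX a d w. w * h d - 1 : J \<and> h d * c - h a : J) \<and>
  (ALL a. h a : J --> (EX d w. w * h d - 1 : J \<and> d * a : I))"

lemma is_loc_id: "is_ideal I ==> is_loc I (%a. a) I"
 unfolding is_loc_def alg_hom_def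
proof(intro conjI allI impI)
 assume I: "is_ideal I"
 show "EX a d w. w * d - 1 : I \<and> d * c - a : I" for c
  using I by(intro exI[of _ c] exI[of _ 1]) (simp add: ideal_zero)
 show "EX d w. w * d - 1 : I \<and> d * a : I" if "a : I" for a
  using I that by(intro exI[of _ 1]) (simp add: ideal_zero)
qed auto

text \<open>A denominator \<open>d\<close> of the second localization need not come from the bottom
  ring, but it is a fraction \<open>h a1 / h d1\<close>. If \<open>d\<close> becomes a unit, then so
  does its numerator \<open>a1\<close>, which serves as a denominator from the bottom ring.\<close>

lemma is_loc_comp:
 assumes "is_loc I h J" "is_loc J g K"
 shows "is_loc I (%a. g (h a)) K"
proof -
 have hom: "alg_hom cst h" "alg_hom cst g" and id: "is_ideal I" "is_ideal J" "is_ideal K"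
  and sub: "h ` I \<subseteq> J" "g ` J \<subseteq> K"
  using assms by(auto simp: is_loc_def)
 interpret h: ring_map h by(rule alg_hom_ring_map[OF hom(1)])
 interpret g: ring_map g by(rule alg_hom_ring_map[OF hom(2)])
 have gJ: "g a - g b : K" if "a - b : J" for a b
  using sub(2) that by(auto simp flip: g.diff)
 have 1: "EX a d w. w * g (h d) - 1 : K \<and> g (h d) * c - g (h a) : K" for c
 proof -
  obtain a d w where *: "w * g d - 1 : K" "g d * c - g a : K"
   using assms(2) unfolding is_loc_def by blast
  obtain a1 d1 w1 where 1: "w1 * h d1 - 1 : J" "h d1 * d - h a1 : J"
   using assms(1) unfolding is_loc_def by blast
  obtain a2 d2 w2 where 2: "w2 * h d2 - 1 : J" "h d2 * a - h a2 : J"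
   using assms(1) unfolding is_loc_def by blast
  have 3: "g w1 * g (h d1) - 1 : K" "g w2 * g (h d2) - 1 : K"
   using gJ[OF 1(1)] gJ[OF 2(1)] by(simp_all add: g.mult g.one)
  have 4: "g (h d1) * g d - g (h a1) : K" "g (h d2) * g a - g (h a2) : K"
   using gJ[OF 1(2)] gJ[OF 2(2)] by(simp_all add: g.mult)
  have u: "(g w1 * w * g w2) * g (h (a1 * d2)) - 1 : K"
  proof -
   have "(g w1 * w * g w2) * g (h (a1 * d2)) - 1 =
     (g w1 * w * g w2 * g (h d2)) * (g (h a1) - g (h d1) * g d) +
     ((g w1 * g (h d1)) * (w * g d) * (g w2 * g (h d2)) - 1 * 1 * 1)"
    by(simp add: g.mult h.mult algebra_simps)
   also have "\<dots> : K"
    by(intro ideal_add ideal_mult id cong_sym[OF id(3) 4(1)] cong_mult 3 *)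
   finally show ?thesis .
  qed
  have "g (h (a1 * d2)) * c - g (h (d1 * a2)) =
    g (h d2) * c * (g (h a1) - g (h d1) * g d) + g (h d1) * g (h d2) * (g d * c - g a) +
    g (h d1) * (g (h d2) * g a - g (h a2))"
   by(simp add: g.mult h.mult algebra_simps)
  also have "\<dots> : K"
   by(intro ideal_add ideal_mult id 4 * cong_sym[OF id(3) 4(1)])
  finally show ?thesis using u by blast
 qed
 have 2: "EX d w. w * g (h d) - 1 : K \<and> d * a : I" if ga: "g (h a) : K" for a
 proof -
  obtain d w where *: "w * g d - 1 : K" "d * h a : J"
   using assms(2) ga unfolding is_loc_def by blast
  obtain a1 d1 w1 where 1: "w1 * h d1 - 1 : J" "h d1 * d - h a1 : J"
   using assms(1) unfolding is_loc_def by blast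
  have "h (a1 * a) : J"
  proof -
   have "h (a1 * a) = h d1 * (d * h a) - h a * (h d1 * d - h a1)"
    by(simp add: h.mult algebra_simps)
   thus ?thesis using * 1 by(auto intro!: ideal_diff ideal_mult id)
  qed
  then obtain d2 w2 where 2: "w2 * h d2 - 1 : J" "d2 * (a1 * a) : I"
   using assms(1) unfolding is_loc_def by blast
  have 3: "g w1 * g (h d1) - 1 : K" "g w2 * g (h d2) - 1 : K"
   using gJ[OF 1(1)] gJ[OF 2(1)] by(simp_all add: g.mult g.one)
  have 4: "g (h d1) * g d - g (h a1) : K"
   using gJ[OF 1(2)] by(simp add: g.mult)
  have "(g w1 * w * g w2) * g (h (d2 * a1)) - 1 =
     (g w1 * w * g w2 * g (h d2)) * (g (h a1) - g (h d1) * g d) +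
     ((g w1 * g (h d1)) * (w * g d) * (g w2 * g (h d2)) - 1 * 1 * 1)"
   by(simp add: g.mult h.mult algebra_simps)
  also have "\<dots> : K"
   by(intro ideal_add ideal_mult id cong_sym[OF id(3) 4(1)] cong_mult 3 *)
  finally show ?thesis using 2(2) by(metis mult.assoc)
 qed
 have "alg_hom cst (%a. g (h a))"
  using hom by(simp add: alg_hom_def)
 moreover have "(%a. g (h a)) ` I \<subseteq> K" using sub by auto
 ultimately show ?thesis unfolding is_loc_def using id 1 2 by auto
qed

text \<open>The quotient is \<open>base / I\<close> with \<open>m\<close> inverted, presented as
  (base / I)[T] / (m T - 1) with \<open>Var 0\<close> as T.\<close>

definition loc_ideal :: "base set => base => base set" where
 "loc_ideal I m = {a. EX q. ALL i. coeff (unshift a - [:-1, m:] * q) i : I}"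

lemma loc_ideal:
 assumes I: "is_ideal I"
 shows "is_loc I shift (loc_ideal I m)" "Var 0 * shift m - 1 : loc_ideal I m"
  "shift a : loc_ideal I m ==> EX k. m ^ k * a : I"
proof -
 note u = ring_map.add[OF ring_map_unshift] ring_map.mult[OF ring_map_unshift]
  ring_map.diff[OF ring_map_unshift] ring_map.zero[OF ring_map_unshift] ring_map.one[OF ring_map_unshift]
 interpret s: ring_map shift by(rule ring_map_shift)
 let ?J = "loc_ideal I m"
 have J: "is_ideal ?J"
  unfolding is_ideal_def
 proof(intro conjI ballI allI)
  show "0 : ?J" using I by(auto simp: loc_ideal_def u ideal_zero intro!: exI[of _ 0])
  show "a + b : ?J" if "a : ?J" "b : ?J" for a b
  proof -
   obtain q r where q: "ALL i. coeff (unshift a - [:-1, m:] * q) i : I"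
    and r: "ALL i. coeff (unshift b - [:-1, m:] * r) i : I"
    using \<open>a : ?J\<close> \<open>b : ?J\<close> unfolding loc_ideal_def by blast
   have "coeff (unshift (a + b) - [:-1, m:] * (q + r)) i : I" for i
   proof -
    have "unshift (a + b) - [:-1, m:] * (q + r) =
      (unshift a - [:-1, m:] * q) + (unshift b - [:-1, m:] * r)"
     by(simp add: u algebra_simps smult_add_right)
    thus ?thesis using q r ideal_add[OF I] by(metis coeff_add)
   qed
   thus ?thesis unfolding loc_ideal_def by blast
  qed
  show "a * b : ?J" if "b : ?J" for a b
  proof -
   obtain q where q: "ALL i. coeff (unshift b - [:-1, m:] * q) i : I"
    using \<open>b : ?J\<close> unfolding loc_ideal_def by blast
   have e: "unshift (a * b) - [:-1, m:] * (unshift a * q) = unshift a * (unshift b - [:-1, m:] * q)"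
    by(simp only: u right_diff_distrib mult.left_commute)
   hence "coeff (unshift (a * b) - [:-1, m:] * (unshift a * q)) i : I" for i
    unfolding e coeff_mult by(intro ideal_sum I ideal_mult) (use q in blast)
   thus ?thesis unfolding loc_ideal_def by blast
  qed
 qed
 show m: "Var 0 * shift m - 1 : ?J"
 proof -
  have "unshift (Var 0 * shift m - 1) - [:-1, m:] * 1 = 0"
   by(simp add: u unshift_Var unshift_shift one_pCons)
  thus ?thesis unfolding loc_ideal_def mem_Collect_eq
   by(intro exI[of _ 1] allI) (simp only: coeff_0 ideal_zero[OF I])
 qed
 show k: "EX k. m ^ k * a : I" if aJ: "shift a : ?J" for a
 proof -
  obtain q where q': "ALL i. coeff ([:a:] - [:-1, m:] * q) i : I"
   using aJ unfolding loc_ideal_def mem_Collect_eq unshift_shift by blast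
  have q: "coeff ([:a:] - [:-1, m:] * q) i : I" for i using q' by blast
  \<comment> \<open>Comparing coefficients in a = (m T - 1) q gives q_i = - m^i a modulo
    \<open>I\<close>. As \<open>q\<close> is a polynomial, m^i a vanishes for i beyond its
    degree.\<close>
  have c: "coeff q i + m ^ i * a : I" for i
  proof(induction i)
   case 0
   thus ?case using q[of 0] by(simp add: add.commute)
  next
   case (Suc i)
   have "coeff q (Suc i) - m * coeff q i : I"
    using q[of "Suc i"] by(simp add: coeff_pCons)
   hence "(coeff q (Suc i) - m * coeff q i) + m * (coeff q i + m ^ i * a) : I"
    by(intro ideal_add[OF I] ideal_mult[OF I] Suc)
   thus ?case by(simp add: algebra_simps)
  qed
  show ?thesis using c[of "Suc (degree q)"] by(auto simp: coeff_eq_0 intro!: exI[of _ "Suc (degree q)"])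
 qed
 have mk: "(Var 0 ^ k) * shift (m ^ k) - 1 : ?J" for k
  using cong_power[OF J m, of k] by(simp add: power_mult_distrib s.power)
 have sub: "shift ` I \<subseteq> ?J"
  using I by(auto simp: loc_ideal_def unshift_shift ideal_zero coeff_pCons split: nat.splits intro!: exI[of _ 0])
 have den: "EX a d w. w * shift d - 1 : ?J \<and> shift d * c - shift a : ?J" for c
 proof -
  \<comment> \<open>Each power of \<open>Var 0\<close> is cleared by one factor \<open>m\<close>, by
    induction on the polynomial in \<open>Var 0\<close>.\<close>
  have "EX k a. shift (m ^ k) * reshift p - shift a : ?J" for p
  proof(induction p)
   case 0
   thus ?case using J
    by(auto simp: reshift_def ideal_zero s.zero intro!: exI[of _ 0])
  next
   case (pCons c p)
   obtain k a where ka: "shift (m ^ k) * reshift p - shift a : ?J" using pCons by blast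
   have "shift (m ^ Suc k) * reshift (pCons c p) - shift (m ^ Suc k * c + a) =
     (shift m * Var 0) * (shift (m ^ k) * reshift p - shift a) + shift a * (Var 0 * shift m - 1)"
    using pCons(1) by(simp add: reshift_def map_poly_pCons s.zero s.mult s.add algebra_simps)
   also have "\<dots> : ?J" using ka m J by(intro ideal_add ideal_mult)
   finally show ?case by blast
  qed
  from this[of "unshift c"] obtain k a where "shift (m ^ k) * c - shift a : ?J"
   by(auto simp: reshift_unshift)
  thus ?thesis using mk by blast
 qed
 show "is_loc I shift ?J"
  unfolding is_loc_def using I J alg_hom_shift sub den k mk by blast
qed

section \<open>Submodules and frames\<close>

text \<open>Preimages of submodules over the quotient by \<open>I\<close>: containing
  \<open>van I\<close> makes membership depend on classes modulo \<open>I\<close> only.\<close>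

definition csub :: "'a::comm_ring_1 set => ('a fls ^ 'n) set => bool" where
 "csub I B \<longleftrightarrow> is_ideal I \<and> van I \<subseteq> B \<and> (ALL u:B. ALL v:B. u + v : B) \<and>
   (ALL c. ALL v:B. c *c v : B)"

lemma csub_van: "csub I B ==> v : van I ==> v : B"
 by(auto simp: csub_def)

lemma csub_add: "csub I B ==> u : B ==> v : B ==> u + v : B"
 by(auto simp: csub_def)

lemma csub_smult: "csub I B ==> v : B ==> c *c v : B"
 by(auto simp: csub_def)

lemma csub_zero: "csub I B ==> 0 : B"
 using van_zero by(auto simp: csub_def)

lemma fls_const_minus: "fls_const (- c) = - fls_const c"
 by(rule fls_eqI) simp

lemma csub_uminus: "csub I B ==> v : B ==> - v : B"
 using csub_smult[of I B v "-1"] by(simp add: fls_const_minus vector_sneg_minus1[symmetric])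

lemma csub_diff: "csub I B ==> u : B ==> v : B ==> u - v : B"
 using csub_add[of I B u "- v"] csub_uminus[of I B v] by simp

lemma csub_sum: "csub I B ==> (!!x. x : A ==> f x : B) ==> sum f A : B"
 by(induction A rule: infinite_finite_induct) (auto intro: csub_zero csub_add)

lemma csub_cong: "csub I B ==> u - v : B ==> u : B \<longleftrightarrow> v : B"
 by(metis add_diff_cancel_left' diff_add_cancel csub_add csub_diff)

lemma csub_sym: "csub I B ==> u - v : B ==> v - u : B"
 using csub_uminus[of I B "u - v"] by simp

lemma csub_trans: "csub I B ==> u - v : B ==> v - w : B ==> u - w : B"
 using csub_add[of I B "u - v" "v - w"] by simp

lemma csub_self_van: "is_ideal I ==> csub I (van I)"
 by(auto simp: csub_def intro: van_add van_smult)

lemma polyfuns_const: "is_ideal I ==> fls_const c : polyfuns I"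
 by(auto simp: polyfuns_def ideal_zero)

lemma polyfuns_one: "is_ideal I ==> 1 : polyfuns I"
 by(auto simp: polyfuns_def ideal_zero)

lemma polyfuns_X_inv: "is_ideal I ==> fls_X_inv : polyfuns I"
 by(auto simp: polyfuns_def ideal_zero)

lemma polyfuns_cof: "F : cof I ==> F : polyfuns I"
 by(auto simp: polyfuns_def cof_def)

lemma polyfuns_add: "is_ideal I ==> F : polyfuns I ==> G : polyfuns I ==> F + G : polyfuns I"
 by(auto simp: polyfuns_def ideal_add)

lemma polyfuns_zero: "is_ideal I ==> 0 : polyfuns I"
 by(auto simp: polyfuns_def ideal_zero)

lemma polyfuns_diff: "is_ideal I ==> F : polyfuns I ==> G : polyfuns I ==> F - G : polyfuns I"
 by(auto simp: polyfuns_def ideal_diff)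

lemma polyfuns_mult:
 assumes "is_ideal I" "F : polyfuns I" "G : polyfuns I" shows "F * G : polyfuns I"
 unfolding polyfuns_def
proof(intro CollectI allI impI)
 fix j :: int assume j: "j > 0"
 show "fls_nth (F * G) j : I"
  unfolding fls_times_nth(2)
 proof(rule ideal_sum[OF assms(1)])
  fix i show "fls_nth F i * fls_nth G (j - i) : I"
   using assms j by(cases "i > 0") (auto simp: polyfuns_def intro: ideal_mult ideal_mult2)
 qed
qed

lemma polyfuns_sum: "is_ideal I ==> (!!x. x : A ==> f x : polyfuns I) ==> sum f A : polyfuns I"
 by(induction A rule: infinite_finite_induct) (auto intro: polyfuns_zero polyfuns_add)

lemma polyfuns_prod: "is_ideal I ==> (!!x. x : A ==> f x : polyfuns I) ==> prod f A : polyfuns I"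
 by(induction A rule: infinite_finite_induct) (auto intro: polyfuns_one polyfuns_mult)

lemma polyfuns_power: "is_ideal I ==> F : polyfuns I ==> F ^ k : polyfuns I"
 by(induction k) (auto intro: polyfuns_one polyfuns_mult)

lemma polyfuns_divisor: "is_ideal I ==> divisor_eq N x : polyfuns I"
 unfolding divisor_eq_def by(intro polyfuns_prod polyfuns_diff polyfuns_X_inv polyfuns_const)

lemma polyfuns_cong: "is_ideal I ==> F - G : cof I ==> F : polyfuns I \<longleftrightarrow> G : polyfuns I"
 by(metis add_diff_cancel_left' diff_add_cancel polyfuns_cof polyfuns_add polyfuns_diff)

lemma X_inv_power_nth: "fls_nth (fls_X_inv ^ k :: 'a::comm_ring_1 fls) j = (if j = - int k then 1 else 0)"
 by(induction k arbitrary: j) (auto simp: fls_X_inv_times_conv_shift)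

text \<open>A Laurent series in 1/z has finitely many terms with nonnegative powers of z, so modulo
  \<open>I\<close> it is a polynomial in z. Closure under z and constants thus suffices for a
  submodule (\<open>submodI\<close>).\<close>

lemma polyfuns_expand:
 fixes F :: "'a::comm_ring_1 fls"
 assumes "is_ideal I" "F : polyfuns I" "!!j. j < - int K ==> fls_nth F j : I"
 shows "F - (\<Sum>k\<le>K. fls_const (fls_nth F (- int k)) * fls_X_inv ^ k) : cof I"
 unfolding cof_def
proof(intro CollectI allI)
 fix j
 have nthsum: "fls_nth (sum f A) j = (\<Sum>x\<in>A. fls_nth (f x) j)" for f :: "nat => 'a fls" and A
  by(induction A rule: infinite_finite_induct) auto
 have "fls_nth (\<Sum>k\<le>K. fls_const (fls_nth F (- int k)) * fls_X_inv ^ k) j =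
   (\<Sum>k\<le>K. if j = - int k then fls_nth F j else 0)"
  unfolding nthsum by(rule sum.cong) (auto simp: X_inv_power_nth)
 also have "\<dots> = (\<Sum>k\<le>K. if k = nat (- j) \<and> j \<le> 0 then fls_nth F j else 0)"
  by(rule sum.cong) auto
 also have "\<dots> = (if j \<le> 0 \<and> - int K \<le> j then fls_nth F j else 0)"
  by(cases "j \<le> 0") (auto simp: sum.delta)
 finally show "fls_nth (F - (\<Sum>k\<le>K. fls_const (fls_nth F (- int k)) * fls_X_inv ^ k)) j : I"
  using assms by(auto simp: polyfuns_def ideal_zero not_le)
qed

lemma submod_csub: "is_ideal I ==> submod I E ==> csub I E"
 by(auto simp: submod_def csub_def polyfuns_const)

lemma submod_smult: "submod I E ==> F : polyfuns I ==> v : E ==> F *s v : E"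
 by(auto simp: submod_def)

lemma smult_sum_left: "sum f A *s v = (\<Sum>x\<in>A. f x *s (v :: 'a::comm_ring_1 ^ 'n))"
 by(induction A rule: infinite_finite_induct) (auto simp: add_smult)

lemma smult_sum_right: "c *s sum f A = (\<Sum>x\<in>A. c *s (f x :: 'a::comm_ring_1 ^ 'n))"
 by(induction A rule: infinite_finite_induct) (auto simp: smult_add)

lemma submodI:
 assumes "csub I E" "!!v. v : E ==> fls_X_inv *s v : E"
 shows "submod I E"
 unfolding submod_def
proof(intro conjI ballI)
 have I: "is_ideal I" using assms(1) by(simp add: csub_def)
 show "van I \<subseteq> E" "!!u v. u : E ==> v : E ==> u + v : E"
  using assms by(auto simp: csub_def)
 fix F v assume F: "F : polyfuns I" and v: "v : E"
 have pow: "fls_X_inv ^ k *s v : E" for k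
  by(induction k) (use v assms(2) in \<open>auto simp: smult_assoc[symmetric]\<close>)
 define K where "K = nat (- fls_subdegree F)"
 define G where "G = (\<Sum>k\<le>K. fls_const (fls_nth F (- int k)) * fls_X_inv ^ k)"
 have "F - G : cof I"
  unfolding G_def
 proof(rule polyfuns_expand[OF I F])
  fix j assume "j < - int K"
  hence "j < fls_subdegree F" by(auto simp: K_def split: if_splits)
  thus "fls_nth F j : I" using I by(simp add: ideal_zero)
 qed
 hence "(F - G) *s v : E"
  using assms(1) I by(auto intro: csub_van van_smult_left)
 moreover have "G *s v = (\<Sum>k\<le>K. (fls_nth F (- int k)) *c (fls_X_inv ^ k *s v))"
  by(simp add: G_def smult_sum_left smult_assoc)
 hence "G *s v : E"
  using pow assms(1) by(auto intro!: csub_sum csub_smult)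
 ultimately have "(F - G) *s v + G *s v : E" using assms(1) csub_add by blast
 thus "F *s v : E" by(simp add: add_smult[symmetric])
qed

lemma polyvecs_submod: "is_ideal I ==> submod I (poly_vecs I)"
 unfolding submod_def poly_vecs_def
 by(auto simp: van_iff intro: polyfuns_cof polyfuns_add polyfuns_mult)

subsection \<open>Linear combinations\<close>

definition lcomb :: "(nat => 'a::comm_ring_1) => ('a fls ^ 'n) list => 'a fls ^ 'n" where
 "lcomb c us = (\<Sum>a<length us. c a *c (us ! a))"

lemma frame_iff:
 "frame I A B us \<longleftrightarrow> B \<subseteq> A \<and> set us \<subseteq> A \<and> (ALL v:A. EX c. v - lcomb c us : B) \<and>
  (ALL c. lcomb c us : B --> (ALL a<length us. c a : I))"
 by(simp add: frame_def lcomb_def)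

lemma lcomb_in: "csub I B ==> (!!a. a < length us ==> us ! a : B) ==> lcomb c us : B"
 unfolding lcomb_def by(intro csub_sum csub_smult) auto

lemma fls_const_add: "fls_const (a + b) = fls_const a + fls_const b"
 by(rule fls_eqI) simp

lemma fls_const_diff: "fls_const (a - b) = fls_const a - fls_const (b :: 'a :: comm_ring_1)"
 by(rule fls_eqI) simp

lemma lcomb_add: "lcomb (%a. c a + d a) us = lcomb c us + lcomb d us"
 by(simp add: lcomb_def fls_const_add add_smult sum.distrib)

lemma lcomb_diff: "lcomb (%a. c a - d a) us = lcomb c us - lcomb d us"
 by(simp add: lcomb_def fls_const_diff diff_smult sum_subtractf)

lemma lcomb_smult: "lcomb (%a. k * c a) us = k *c lcomb c us"
 by(simp add: lcomb_def smult_sum_right smult_assoc)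

lemma lcomb_zero: "lcomb (%a. 0) us = 0"
 by(simp add: lcomb_def)

lemma lcomb_sum: "lcomb (%a. \<Sum>i\<in>S. f i a) us = (\<Sum>i\<in>S. lcomb (f i) us)"
 by(induction S rule: infinite_finite_induct) (auto simp: lcomb_add lcomb_zero)

lemma lcomb_uminus: "lcomb (%a. - c a) us = - lcomb c us"
 using lcomb_diff[of "%_. 0" c us] by(simp add: lcomb_zero)

lemma lcomb_cong: "(!!a. a < length us ==> c a = d a) ==> lcomb c us = lcomb d us"
 by(simp add: lcomb_def)

lemma lcomb_van: "is_ideal I ==> (!!a. a < length us ==> c a : I) ==> lcomb c us : van I"
 unfolding lcomb_def by(intro van_sum van_smult_left) (auto simp: cof_const)

lemma lcomb_append: "lcomb c (us @ ws) = lcomb c us + lcomb (%a. c (length us + a)) ws"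
proof -
 have "lcomb c (us @ ws) = (\<Sum>a<length us. c a *c ((us @ ws) ! a)) +
   (\<Sum>a=length us..<length us + length ws. c a *c ((us @ ws) ! a))"
  unfolding lcomb_def length_append
  by(simp add: lessThan_atLeast0 sum.atLeastLessThan_concat)
 also have "(\<Sum>a=length us..<length us + length ws. c a *c ((us @ ws) ! a)) =
   lcomb (%a. c (length us + a)) ws"
  unfolding lcomb_def
  by(rule sum.reindex_bij_witness[of _ "%a. length us + a" "%a. a - length us"]) (auto simp: nth_append)
 finally show ?thesis by(simp add: lcomb_def nth_append)
qed

lemma lcomb_append_eq:
 "(!!a. a < length us ==> e a = c a) ==> (!!a. a < length ws ==> e (length us + a) = d a) ==>
  lcomb e (us @ ws) = lcomb c us + lcomb d ws"
 unfolding lcomb_append by(intro arg_cong2[of _ _ _ _ "(+)"] lcomb_cong)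

lemma lcomb_delta: "a < length us ==> lcomb (%b. if b = a then 1 else 0) us = us ! a"
proof -
 assume "a < length us"
 hence "lcomb (%b. if b = a then 1 else 0) us = (\<Sum>b<length us. if b = a then us ! b else 0)"
  unfolding lcomb_def by(intro sum.cong) auto
 thus ?thesis using \<open>a < length us\<close> by simp
qed

lemma lcomb_map:
 assumes "!!u v. f (u + v) = f u + f v" "!!c v. f (c *c v) = g c *c f v"
 shows "f (lcomb c us) = lcomb (%a. g (c a)) (map f us)"
proof -
 have "f 0 = 0" using assms(1)[of 0 0] by simp
 hence "f (sum F A) = (\<Sum>x\<in>A. f (F x))" for F and A :: "nat set"
  by(induction A rule: infinite_finite_induct) (auto simp: assms(1))
 thus ?thesis by(simp add: lcomb_def assms(2))
qed

lemma lcomb_lcomb: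
 assumes B: "csub I B" and "!!a. a < length us ==> us ! a - lcomb (A a) ws : B"
 shows "lcomb c us - lcomb (%b. \<Sum>a<length us. c a * A a b) ws : B"
proof -
 have "lcomb (%b. \<Sum>a<length us. c a * A a b) ws = (\<Sum>a<length us. c a *c lcomb (A a) ws)"
  by(simp add: lcomb_sum lcomb_smult)
 hence "lcomb c us - lcomb (%b. \<Sum>a<length us. c a * A a b) ws =
   (\<Sum>a<length us. c a *c (us ! a - lcomb (A a) ws))"
  by(simp add: lcomb_def[of c us] sum_subtractf smult_diff)
 thus ?thesis using assms by(auto intro!: csub_sum csub_smult)
qed

lemma frame_indep: "frame I A B us ==> lcomb c us : B ==> a < length us ==> c a : I"
 by(auto simp: frame_iff)

lemma frame_uniq:
 "frame I A B us ==> csub I B ==> lcomb c us - lcomb d us : B ==> a < length us ==> c a - d a : I"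
 using frame_indep[of I A B us "%a. c a - d a" a] by(simp add: lcomb_diff)

lemma frame_coords: "frame I A B us ==> v : A ==> EX c. v - lcomb c us : B"
 by(auto simp: frame_iff)

lemma frame_matrix:
 assumes "frame I A B us" "set ws \<subseteq> A"
 shows "EX G. ALL a<length ws. ws ! a - lcomb (G a) us : B"
proof -
 have "ALL a. EX c. a < length ws --> ws ! a - lcomb c us : B"
  using frame_coords[OF assms(1)] assms(2) by(meson nth_mem subsetD)
 thus ?thesis by metis
qed

text \<open>The basis of the smaller quotient comes first, which is the order in which
  \<open>sections\<close> enlarges a frame.\<close>

lemma frame_concat:
 assumes f1: "frame I A B qs" and f2: "frame I B C us" and A: "csub I A" and B: "csub I B" and C: "csub I C"
 shows "frame I A C (us @ qs)"
 unfolding frame_iff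
proof(intro conjI ballI allI impI)
 show "C \<subseteq> A" "set (us @ qs) \<subseteq> A" using f1 f2 by(auto simp: frame_iff)
 fix v assume "v : A"
 then obtain c where c: "v - lcomb c qs : B" using f1 by(auto simp: frame_iff)
 then obtain d where d: "v - lcomb c qs - lcomb d us : C" using f2 by(auto simp: frame_iff)
 define e where "e a = (if a < length us then d a else c (a - length us))" for a
 have "lcomb e (us @ qs) = lcomb d us + lcomb c qs"
  by(rule lcomb_append_eq) (auto simp: e_def)
 thus "EX c. v - lcomb c (us @ qs) : C" using d by(intro exI[of _ e]) (simp add: algebra_simps)
next
 fix c a assume c: "lcomb c (us @ qs) : C" and a: "a < length (us @ qs)"
 have "lcomb c us : B" using B f2 by(intro lcomb_in) (auto simp: frame_iff)
 moreover have "lcomb c (us @ qs) : B" using c f2 by(auto simp: frame_iff)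
 ultimately have "lcomb (%a. c (length us + a)) qs : B"
  unfolding lcomb_append using B by(metis add_diff_cancel_left' csub_diff)
 hence q: "ALL a<length qs. c (length us + a) : I" using f1 by(auto simp: frame_iff)
 hence "lcomb (%a. c (length us + a)) qs : van I"
  using A by(intro lcomb_van) (auto simp: csub_def)
 hence "lcomb (%a. c (length us + a)) qs : C" using C csub_van by blast
 hence "lcomb c us : C" using c C unfolding lcomb_append by(metis add_diff_cancel_right' csub_diff)
 hence "ALL a<length us. c a : I" using f2 by(auto simp: frame_iff)
 thus "c a : I" using q a by(cases "a < length us") (auto dest!: spec[of _ "a - length us"])
qed

subsection \<open>Transport of frames\<close>

text \<open>For \<open>g = 1 + \<epsilon> f\<close> this is the image of \<open>A\<close> under \<open>g\<close>.\<close>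

definition mvset :: "base set => (base fls ^ 'n => base fls ^ 'n) => (base fls ^ 'n) set => (base fls ^ 'n) set" where
 "mvset I g A = {v'. EX v:A. v' - g v : van I}"

text \<open>The last clause makes \<open>g\<close> well defined and injective modulo
  \<open>I\<close>, which is what is required to transport frames to images
  (\<open>frame_mvset\<close>).\<close>

definition linmap :: "base set => (base fls ^ 'n => base fls ^ 'n) => bool" where
 "linmap I g \<longleftrightarrow> is_ideal I \<and> (ALL u v. g (u + v) = g u + g v) \<and> (ALL c v. g (c *c v) = c *c g v) \<and>
   (ALL v. g v : van I \<longleftrightarrow> v : van I)"

lemma linmap_diff: "linmap I g ==> g (u - v) = g u - g v"
 unfolding linmap_def by(metis add_diff_cancel_right' diff_add_cancel)

lemma linmap_lcomb: "linmap I g ==> g (lcomb c us) = lcomb c (map g us)"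
 by(subst lcomb_map[where g = "%c. c"]) (auto simp: linmap_def)

lemma mvset_csub: "linmap I g ==> csub I A ==> csub I (mvset I g A)"
 unfolding csub_def
proof(intro conjI ballI allI)
 assume g: "linmap I g" and A: "is_ideal I \<and> van I \<subseteq> A \<and> (ALL u:A. ALL v:A. u + v : A) \<and> (ALL c. ALL v:A. c *c v : A)"
 hence A': "csub I A" by(simp add: csub_def)
 have I: "is_ideal I" using A by simp
 show "is_ideal I" by(rule I)
 have "g 0 = 0" using linmap_diff[OF g, of 0 0] by simp
 thus "van I \<subseteq> mvset I g A" using csub_zero[OF A'] by(auto simp: mvset_def intro!: bexI[of _ 0])
 show "u + v : mvset I g A" if u: "u : mvset I g A" and v: "v : mvset I g A" for u v
 proof -
  obtain a b where "a : A" "u - g a : van I" "b : A" "v - g b : van I"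
   using u v by(auto simp: mvset_def)
  moreover hence "u + v - g (a + b) : van I"
   using van_add[OF I, of "u - g a" "v - g b"] g by(simp add: linmap_def algebra_simps)
  ultimately show ?thesis using A by(auto simp: mvset_def)
 qed
 show "c *c v : mvset I g A" if v: "v : mvset I g A" for c v
 proof -
  obtain b where b: "b : A" "v - g b : van I"
   using v by(auto simp: mvset_def)
  hence "c *c v - g (c *c b) : van I"
   using van_smult[OF I b(2), of "fls_const c"] g by(simp add: linmap_def smult_diff)
  thus ?thesis using A b by(auto simp: mvset_def)
 qed
qed

lemma mvset_in: "linmap I g ==> csub I A ==> g v : mvset I g A \<longleftrightarrow> v : A"
proof
 assume g: "linmap I g" and A: "csub I A"
 show "g v : mvset I g A" if "v : A"
  using that van_zero[of I] A by(auto simp: mvset_def csub_def intro!: bexI[of _ v])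
 assume "g v : mvset I g A"
 then obtain w where w: "w : A" "g v - g w : van I" by(auto simp: mvset_def)
 hence "v - w : van I" using g by(simp add: linmap_def linmap_diff[OF g, symmetric])
 thus "v : A" using csub_van[OF A] csub_cong[OF A] w by blast
qed

lemma frame_mvset:
 assumes g: "linmap I g" and A: "csub I A" and B: "csub I B" and f: "frame I A B us"
 shows "frame I (mvset I g A) (mvset I g B) (map g us)"
 unfolding frame_iff
proof(intro conjI ballI allI impI)
 have I: "is_ideal I" using A by(simp add: csub_def)
 show "mvset I g B \<subseteq> mvset I g A" using f by(auto simp: mvset_def frame_iff)
 show "set (map g us) \<subseteq> mvset I g A" using f mvset_in[OF g A] by(auto simp: frame_iff)
 fix v assume "v : mvset I g A"
 then obtain w where w: "w : A" "v - g w : van I" by(auto simp: mvset_def)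
 then obtain c where c: "w - lcomb c us : B" using f by(auto simp: frame_iff)
 hence "g (w - lcomb c us) : mvset I g B" using mvset_in[OF g B] by blast
 hence "g w - lcomb c (map g us) : mvset I g B"
  by(simp add: linmap_diff[OF g] linmap_lcomb[OF g])
 thus "EX c. v - lcomb c (map g us) : mvset I g B"
  using csub_trans[OF mvset_csub[OF g B]] csub_van[OF mvset_csub[OF g B]] w(2) by blast
next
 fix c a assume "lcomb c (map g us) : mvset I g B" "a < length (map g us)"
 thus "c a : I"
  using frame_indep[OF f] by(simp add: linmap_lcomb[OF g, symmetric] mvset_in[OF g B])
qed

subsection \<open>Rational vectors with bounded poles\<close>

text \<open>The part vanishing at infinity, a complement of the polynomials in z.\<close>

definition fpart :: "'a::comm_ring_1 fls => 'a fls" where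
 "fpart F = Abs_fls (%j. if j > 0 then fls_nth F j else 0)"

lemma fpart_nth: "fls_nth (fpart F) j = (if j > 0 then fls_nth F j else 0)"
 unfolding fpart_def by(rule fls_nth_Abs[of 0]) simp

text \<open>The expansion of 1 / (z - x) at infinity.\<close>

definition geom :: "'a::comm_ring_1 => 'a fls" where
 "geom x = Abs_fls (%j. if j \<ge> 1 then x ^ nat (j - 1) else 0)"

lemma geom_nth: "fls_nth (geom x) j = (if j \<ge> 1 then x ^ nat (j - 1) else 0)"
 unfolding geom_def by(rule fls_nth_Abs[of 1]) simp

lemma geom_mult: "(fls_X_inv - fls_const x) * geom x = 1"
proof(rule fls_eqI)
 fix j
 show "fls_nth ((fls_X_inv - fls_const x) * geom x) j = fls_nth 1 j"
 proof(cases "j \<ge> 1")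
  case True
  hence "nat j = Suc (nat (j - 1))" by simp
  thus ?thesis using True
   by(simp add: left_diff_distrib fls_X_inv_times_conv_shift geom_nth)
 next
  case False
  thus ?thesis by(auto simp: left_diff_distrib fls_X_inv_times_conv_shift geom_nth)
 qed
qed

definition dinv :: "nat => (nat => 'a::comm_ring_1) => 'a fls" where
 "dinv N x = (\<Prod>i<N. geom (x i))"

lemma dinv_mult: "divisor_eq N x * dinv N x = 1"
 by(simp add: divisor_eq_def dinv_def prod.distrib[symmetric] geom_mult)

lemma dinv_pow: "divisor_eq N x ^ k * dinv N x ^ k = 1"
 by(simp add: power_mult_distrib[symmetric] dinv_mult)

lemma dinv_pow2: "divisor_eq N x ^ k * (dinv N x ^ k * F) = F" "dinv N x ^ k * (divisor_eq N x ^ k * F) = F"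
 using dinv_pow[of N x k] by(metis mult.assoc mult.commute mult_1)+

lemma nth_prod_low:
 fixes f g :: "'a::comm_ring_1 fls"
 assumes "!!j. j < a ==> fls_nth f j = 0" "!!j. j < b ==> fls_nth g j = 0" "n < a + b"
 shows "fls_nth (f * g) n = 0"
 using assms by(subst fls_times_nth_bounds[of a f b g]) auto

lemma dinv_nth_low: "j < int N ==> fls_nth (dinv N x) j = 0"
proof(induction N arbitrary: j)
 case 0
 thus ?case by(simp add: dinv_def)
next
 case (Suc N)
 have "dinv (Suc N) x = dinv N x * geom (x N)" by(simp add: dinv_def)
 thus ?case
  using Suc nth_prod_low[of "int N" "dinv N x" 1 "geom (x N)" j] by(simp add: geom_nth)
qed

lemma divisor_nth_low: "j < - int N ==> fls_nth (divisor_eq N x) j = 0"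
proof(induction N arbitrary: j)
 case 0
 thus ?case by(simp add: divisor_eq_def)
next
 case (Suc N)
 have "divisor_eq (Suc N) x = divisor_eq N x * (fls_X_inv - fls_const (x N))" by(simp add: divisor_eq_def)
 thus ?case
  using Suc nth_prod_low[of "- int N" "divisor_eq N x" "-1" "fls_X_inv - fls_const (x N)" j] by simp
qed

lemma divisor_cong:
 assumes "is_ideal I" "!!i. i < N ==> x i - x' i : I"
 shows "divisor_eq N x - divisor_eq N x' : cof I"
 unfolding divisor_eq_def
proof(rule cong_prod[OF cof_ideal[OF assms(1)]])
 fix i assume "i : {..<N}"
 hence "fls_const (x i - x' i) : cof I" using assms by(simp add: cof_const)
 thus "fls_X_inv - fls_const (x i) - (fls_X_inv - fls_const (x' i)) : cof I"
  using ideal_uminus[OF cof_ideal[OF assms(1)]] by(fastforce simp: fls_const_diff)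
qed

lemma dinv_cong:
 assumes "is_ideal I" "!!i. i < N ==> x i - x' i : I"
 shows "dinv N x - dinv N x' : cof I"
proof -
 have "dinv N x - dinv N x' = (dinv N x * dinv N x') * (divisor_eq N x' - divisor_eq N x)"
 proof -
  have "dinv N x * (divisor_eq N x' * dinv N x') - dinv N x' * (divisor_eq N x * dinv N x) =
    (dinv N x * dinv N x') * (divisor_eq N x' - divisor_eq N x)"
   by(simp add: algebra_simps)
  thus ?thesis by(simp add: dinv_mult)
 qed
 also have "\<dots> : cof I"
  using divisor_cong[of I N x' x] assms cong_sym[OF assms(1)]
  by(intro ideal_mult cof_ideal) auto
 finally show ?thesis .
qed

text \<open>The module O(M D)^n of vectors with poles of order at most \<open>M\<close> along the
  divisor D.\<close>

definition Om :: "'a::comm_ring_1 set => nat => (nat => 'a) => nat => ('a fls ^ 'n) set" where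
 "Om I N x M = {v. divisor_eq N x ^ M *s v : poly_vecs I}"

lemma Om_0: "Om I N x 0 = poly_vecs I"
 by(simp add: Om_def)

lemma Om_submod:
 assumes "is_ideal I" shows "submod I (Om I N x M)"
proof -
 have P: "submod I (poly_vecs I)" by(rule polyvecs_submod[OF assms])
 show ?thesis unfolding submod_def Om_def
 proof(intro conjI ballI subsetI CollectI)
  show "divisor_eq N x ^ M *s v : poly_vecs I" if "v : van I" for v
   by(rule csub_van[OF submod_csub[OF assms P] van_smult[OF assms that]])
  show "divisor_eq N x ^ M *s (u + v) : poly_vecs I" if "u : {v. divisor_eq N x ^ M *s v : poly_vecs I}" "v : {v. divisor_eq N x ^ M *s v : poly_vecs I}" for u v
   using that P by(auto simp: submod_def smult_add)
  show "divisor_eq N x ^ M *s (F *s v) : poly_vecs I" if "F : polyfuns I" "v : {v. divisor_eq N x ^ M *s v : poly_vecs I}" for F v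
   using that P submod_smult[OF P, of F "divisor_eq N x ^ M *s v"]
   by(simp add: smult_assoc mult.commute)
 qed
qed

lemma Om_csub: "is_ideal I ==> csub I (Om I N x M)"
 by(simp add: Om_submod submod_csub)

lemma polyvecs_csub: "is_ideal I ==> csub I (poly_vecs I)"
 by(simp add: polyvecs_submod submod_csub)

lemma Om_mono:
 assumes "is_ideal I" "M \<le> M'" shows "Om I N x M \<subseteq> Om I N x M'"
proof
 fix v assume "v : Om I N x M"
 hence "divisor_eq N x ^ (M' - M) *s (divisor_eq N x ^ M *s v) : poly_vecs I"
  using submod_smult[OF polyvecs_submod[OF assms(1)] polyfuns_power[OF assms(1) polyfuns_divisor[OF assms(1)]]]
  by(auto simp: Om_def)
 thus "v : Om I N x M'"
  using assms(2) by(simp add: Om_def smult_assoc power_add[symmetric])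
qed

lemma Om_monoD: "is_ideal I ==> v : Om I N x M ==> M \<le> M' ==> v : Om I N x M'"
 using Om_mono by blast

lemma Om_dinv: "dinv N x ^ M *s w : Om I N x M \<longleftrightarrow> w : poly_vecs I"
 by(simp add: Om_def smult_assoc dinv_pow)

lemma Om_cong:
 assumes "is_ideal I" "!!i. i < N ==> x i - x' i : I"
 shows "Om I N x M = (Om I N x' M :: ('a::comm_ring_1 fls ^ 'n) set)"
proof -
 have "Om I N x M \<subseteq> (Om I N x' M :: ('a::comm_ring_1 fls ^ 'n) set)" if "!!i. i < N ==> x i - x' i : I" for x x'
 proof
  fix v :: "'a fls ^ 'n" assume v: "v : Om I N x M"
  have "divisor_eq N x' ^ M - divisor_eq N x ^ M : cof I"
   using that cong_sym[OF assms(1)] by(intro cong_power cof_ideal divisor_cong assms(1)) auto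
  hence "divisor_eq N x' ^ M *s v - divisor_eq N x ^ M *s v : poly_vecs I"
   using van_smult_left[OF assms(1)] csub_van[OF polyvecs_csub[OF assms(1)]]
   by(metis diff_smult)
  thus "v : Om I N x' M"
   using v csub_cong[OF polyvecs_csub[OF assms(1)]] by(auto simp: Om_def)
 qed
 from this[of x x'] this[of x' x] show ?thesis using assms cong_sym[OF assms(1)] by blast
qed

lemma rat_vecs_Om: "is_ideal I ==> v : rat_vecs I N x \<longleftrightarrow> (EX M. v : Om I N x M)"
proof
 assume I: "is_ideal I"
 assume "v : rat_vecs I N x"
 hence "ALL i. EX m. divisor_eq N x ^ m * v $ i : polyfuns I"
  by(simp add: rat_vecs_def ratfuns_def)
 then obtain m where m: "!!i. divisor_eq N x ^ m i * v $ i : polyfuns I" by metis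
 define M where "M = Max (range m)"
 have "divisor_eq N x ^ M * v $ i : polyfuns I" for i
 proof -
  have "m i \<le> M" unfolding M_def by simp
  hence "divisor_eq N x ^ M * v $ i = divisor_eq N x ^ (M - m i) * (divisor_eq N x ^ m i * v $ i)"
   by(simp add: mult.assoc[symmetric] power_add[symmetric])
  thus ?thesis using polyfuns_mult[OF I polyfuns_power[OF I polyfuns_divisor[OF I]] m] by metis
 qed
 thus "EX M. v : Om I N x M" by(auto simp: Om_def poly_vecs_def)
next
 assume "EX M. v : Om I N x M"
 thus "v : rat_vecs I N x" by(auto simp: Om_def poly_vecs_def rat_vecs_def ratfuns_def)
qed

lemma rat_vecs_submod: "is_ideal I ==> submod I (rat_vecs I N x)"
 unfolding submod_def
proof(intro conjI ballI subsetI)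
 assume I: "is_ideal I"
 show "v : rat_vecs I N x" if "v : van I" for v
  using csub_van[OF Om_csub[OF I] that] rat_vecs_Om[OF I, of v] by blast
 show "u + v : rat_vecs I N x" if uv: "u : rat_vecs I N x" "v : rat_vecs I N x" for u v
 proof -
  obtain M M' where "u : Om I N x M" "v : Om I N x M'"
   using uv rat_vecs_Om[OF I, of u] rat_vecs_Om[OF I, of v] by blast
  hence "u : Om I N x (max M M')" "v : Om I N x (max M M')"
   using Om_monoD[OF I] by fastforce+
  thus ?thesis using csub_add[OF Om_csub[OF I]] rat_vecs_Om[OF I, of "u + v"] by blast
 qed
 show "F *s v : rat_vecs I N x" if "F : polyfuns I" "v : rat_vecs I N x" for F v
  using that submod_smult[OF Om_submod[OF I] that(1), of v] rat_vecs_Om[OF I, of v] rat_vecs_Om[OF I, of "F *s v"] by blast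
qed

lemma rat_vecs_list:
 assumes I: "is_ideal I" and "set us \<subseteq> rat_vecs I N x"
 shows "EX M0. \<forall>M\<ge>M0. set us \<subseteq> Om I N x M"
 using assms(2)
proof(induction us)
 case Nil
 thus ?case by simp
next
 case (Cons u us)
 then obtain M0 M1 where "\<forall>M\<ge>M0. set us \<subseteq> Om I N x M" "u : Om I N x M1"
  using rat_vecs_Om[OF I, of u] by auto
 thus ?case
  using Om_monoD[OF I, of u] by(intro exI[of _ "max M0 M1"]) auto
qed

text \<open>The pole order is bounded because \<open>A\<close> is generated modulo polynomial
  vectors by the finitely many rational vectors \<open>us\<close>.\<close>

lemma frame_bounded:
 assumes I: "is_ideal I" and f: "frame I A (poly_vecs I) us" and A: "A \<subseteq> rat_vecs I N x"
 shows "EX M0. \<forall>M\<ge>M0. A \<subseteq> Om I N x M"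
proof -
 obtain M0 where M0: "\<forall>M\<ge>M0. set us \<subseteq> Om I N x M"
  using rat_vecs_list[OF I, of us N x] f A by(auto simp: frame_iff)
 have "v : Om I N x M" if M: "M \<ge> M0" and v: "v : A" for v M
 proof -
  obtain c where c: "v - lcomb c us : poly_vecs I" using f v by(auto simp: frame_iff)
  hence "v - lcomb c us : Om I N x M"
   using Om_monoD[OF I, of "v - lcomb c us" N x 0 M] by(simp add: Om_0)
  moreover have "lcomb c us : Om I N x M"
   using M0 M by(intro lcomb_in[OF Om_csub[OF I]]) (meson nth_mem subsetD)
  ultimately show ?thesis using csub_cong[OF Om_csub[OF I]] by blast
 qed
 thus ?thesis by blast
qed

lemma sum_nth_distinct: "distinct L ==> (\<Sum>t<length L. f (L ! t)) = sum f (set L)"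
 by(rule sum.reindex_bij_betw) (auto intro: bij_betw_nth)

lemma fls_nth_sum: "fls_nth (sum f A) j = (\<Sum>x\<in>A. fls_nth (f x) j)"
 by(induction A rule: infinite_finite_induct) auto

text \<open>The vectors z^a D^-(M+1) e_i with a < N form a basis. This is division with remainder by
  the divisor equation D, which is monic of degree N over any coefficient ring.\<close>

lemma frame_Om_step:
 fixes x :: "nat => 'a::comm_ring_1"
 assumes I: "is_ideal I"
 shows "EX qs. frame I (Om I N x (Suc M) :: ('a fls ^ 'n) set) (Om I N x M) qs \<and> length qs = N * CARD('n)"
proof -
 obtain js :: "'n list" where js_set: "set js = UNIV" and js_d: "distinct js"
  using finite_distinct_list[OF finite_class.finite_UNIV] by blast
 define L where "L = List.product [0..<N] js"
 have L: "distinct L" "set L = {0..<N} \<times> UNIV" "length L = N * CARD('n)"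
  using js_set js_d distinct_card[OF js_d] by(auto simp: L_def distinct_product)
 let ?D = "divisor_eq N x" and ?d = "dinv N x"
 define q :: "nat \<times> 'n => 'a fls ^ 'n" where "q = (%(a, i). (?d ^ Suc M * fls_X_inv ^ a) *s axis i (1 :: 'a fls))"
 define qs where "qs = map q L"
 define S where "S c i = (\<Sum>a<N. fls_const (c (a, i)) * fls_X_inv ^ a)" for c :: "nat \<times> 'n => 'a" and i
 have comb: "lcomb (%t. c (L ! t)) qs = ?d ^ Suc M *s (\<chi> i. S c i)" for c
 proof -
  have "lcomb (%t. c (L ! t)) qs = (\<Sum>t<length L. (%p. c p *c q p) (L ! t))"
   by(simp add: lcomb_def qs_def)
  also have "\<dots> = (\<Sum>p\<in>{0..<N} \<times> UNIV. c p *c q p)"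
   unfolding L(2)[symmetric] by(rule sum_nth_distinct[OF L(1)])
  also have "\<dots> = (\<Sum>a<N. \<Sum>i\<in>UNIV. c (a, i) *c q (a, i))"
   by(simp add: sum.cartesian_product lessThan_atLeast0)
  also have "\<dots> = ?d ^ Suc M *s (\<chi> i. S c i)"
  proof(rule vec_eq_iff[THEN iffD2], rule allI)
   fix k
   have "(\<Sum>a<N. \<Sum>i\<in>UNIV. c (a, i) *c q (a, i)) $ k =
     (\<Sum>a<N. \<Sum>i\<in>UNIV. if i = k then fls_const (c (a, k)) * (?d ^ Suc M * fls_X_inv ^ a) else 0)"
   proof -
    have "(if k = i then F else 0) = (if i = k then F else (0 :: 'a fls))" for i F by auto
    thus ?thesis
     by(simp add: q_def axis_def if_distrib[where f = "%z. _ * z"] cong: if_cong)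
   qed
   also have "\<dots> = ?d ^ Suc M * S c k"
    by(simp add: S_def sum_distrib_left algebra_simps)
   finally show "(\<Sum>a<N. \<Sum>i\<in>UNIV. c (a, i) *c q (a, i)) $ k = (?d ^ Suc M *s (\<chi> i. S c i)) $ k"
    by simp
  qed
  finally show ?thesis .
 qed
 have comb': "?D ^ M *s lcomb (%t. c (L ! t)) qs = (\<chi> i. ?d * S c i)" for c
 proof -
  have "?D ^ M * ?d ^ Suc M = ?d"
   using dinv_pow[of N x M] by(simp add: power_Suc2 mult.assoc[symmetric] del: power_Suc)
  thus ?thesis
   unfolding comb[of c] smult_assoc by(simp only:) (simp add: vec_eq_iff)
 qed
 have S_poly: "S c i : polyfuns I" for c i
  unfolding S_def by(intro polyfuns_sum polyfuns_mult polyfuns_const polyfuns_power polyfuns_X_inv I)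
 have S_nth: "fls_nth (S c i) j = (if - int N < j \<and> j \<le> 0 then c (nat (- j), i) else 0)" for c i j
 proof -
  have "fls_nth (S c i) j = (\<Sum>a<N. if a = nat (- j) \<and> j \<le> 0 then c (nat (- j), i) else 0)"
   unfolding S_def fls_nth_sum by(rule sum.cong) (auto simp: X_inv_power_nth)
  thus ?thesis by(cases "j \<le> 0") (auto simp: sum.delta)
 qed
 have "frame I (Om I N x (Suc M)) (Om I N x M) qs"
  unfolding frame_iff
 proof(intro conjI ballI allI impI)
  show "Om I N x M \<subseteq> (Om I N x (Suc M) :: ('a fls ^ 'n) set)" by(rule Om_mono[OF I]) simp
  show "set qs \<subseteq> Om I N x (Suc M)"
  proof -
   have "fls_X_inv ^ a *s axis i 1 : poly_vecs I" for a and i :: 'n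
    using I by(auto simp: poly_vecs_def axis_def intro!: polyfuns_mult polyfuns_power polyfuns_X_inv polyfuns_one polyfuns_zero)
   thus ?thesis
    by(auto simp: qs_def q_def smult_assoc[symmetric] Om_dinv simp del: power_Suc)
  qed
  fix v :: "'a fls ^ 'n" assume v: "v : Om I N x (Suc M)"
  define P where "P i = ?D ^ Suc M * v $ i" for i
  have P: "P i : polyfuns I" for i using v by(simp add: Om_def poly_vecs_def P_def)
  \<comment> \<open>Division with remainder: the polynomial part of P / D is the quotient, and D
    times the part vanishing at infinity is the remainder, of degree less than
    \<open>N\<close>.\<close>
  define Q where "Q i = ?d * P i - fpart (?d * P i)" for i
  have Q: "Q i : polyfuns I" for i
   using I by(auto simp: Q_def polyfuns_def fpart_nth ideal_zero)
  define R where "R i = ?D * fpart (?d * P i)" for i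
  have PQR: "P i = ?D * Q i + R i" for i
   using dinv_pow2(1)[of N x 1 "P i"] by(simp add: Q_def R_def right_diff_distrib)
  hence R: "R i : polyfuns I" for i
   using polyfuns_diff[OF I P polyfuns_mult[OF I polyfuns_divisor[OF I] Q], of i N x i] by simp
  have R_low: "fls_nth (R i) j = 0" if "j \<le> - int N" for i j
   unfolding R_def using that
   by(intro nth_prod_low[of "- int N" _ 1]) (auto simp: divisor_nth_low fpart_nth)
  define c where "c = (%(a, i). fls_nth (R i) (- int a))"
  have RS: "R i - S c i : cof I" for i
   using R[of i] R_low[of _ i] I by(auto simp: cof_def S_nth c_def polyfuns_def ideal_zero)
  have "v - lcomb (%t. c (L ! t)) qs : Om I N x M"
  proof -
   have "?D ^ M *s (v - lcomb (%t. c (L ! t)) qs) = (\<chi> i. Q i + ?d * (R i - S c i))"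
    unfolding smult_diff comb'
   proof(rule vec_eq_iff[THEN iffD2], rule allI)
    fix i
    have "?D ^ M * v $ i = ?d * P i"
     using dinv_pow2(2)[of N x 1 "?D ^ M * v $ i"] by(simp add: P_def mult.assoc)
    moreover have "?d * P i = Q i + ?d * R i"
     unfolding PQR distrib_left using dinv_pow2(2)[of N x 1 "Q i"] by simp
    ultimately show "(?D ^ M *s v - (\<chi> i. ?d * S c i)) $ i = (\<chi> i. Q i + ?d * (R i - S c i)) $ i"
     by(simp add: right_diff_distrib)
   qed
   thus ?thesis
    using polyfuns_add[OF I Q polyfuns_cof[OF ideal_mult[OF cof_ideal[OF I] RS]]]
    unfolding Om_def poly_vecs_def by(simp del: vector_smult_component)
  qed
  thus "EX c. v - lcomb c qs : Om I N x M" by blast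
 next
  fix c t assume lc: "lcomb c qs : Om I N x M" and t: "t < length qs"
  define c' where "c' p = c (SOME t. t < length L \<and> L ! t = p)" for p
  have c': "c t = c' (L ! t)" if "t < length L" for t
  proof -
   have "(SOME t'. t' < length L \<and> L ! t' = L ! t) = t"
    using that L(1) by(intro some_equality) (auto simp: nth_eq_iff_index_eq)
   thus ?thesis by(simp add: c'_def)
  qed
  have "lcomb c qs = lcomb (%t. c' (L ! t)) qs"
  proof(rule lcomb_cong)
   fix t assume "t < length qs"
   thus "c t = c' (L ! t)" using c'[of t] by(simp add: qs_def)
  qed
  hence "?D ^ M *s lcomb (%t. c' (L ! t)) qs : poly_vecs I"
   using lc by(simp only: Om_def mem_Collect_eq)
  hence 1: "?d * S c' i : polyfuns I" for i
   unfolding comb' poly_vecs_def by simp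
  \<comment> \<open>As \<open>S\<close> has degree less than \<open>N\<close>, the series S / D
    vanishes at infinity. Being polynomial modulo \<open>I\<close> as well, it is zero modulo
    \<open>I\<close>.\<close>
  have "fls_nth (?d * S c' i) j = 0" if "j \<le> 0" for i j
   using that by(intro nth_prod_low[where a = "int N" and b = "1 - int N"]) (simp_all add: dinv_nth_low S_nth)
  hence "?d * S c' i : cof I" for i
  proof -
   have "fls_nth (?d * S c' i) j : I" for j
    using 1[of i] ideal_zero[OF I] \<open>!!j i. j \<le> 0 ==> fls_nth (?d * S c' i) j = 0\<close>
    by(cases "j \<le> 0") (auto simp: polyfuns_def)
   thus ?thesis by(simp add: cof_def)
  qed
  hence 2: "S c' i : cof I" for i
   using ideal_mult[OF cof_ideal[OF I], of "?d * S c' i" ?D] by(simp add: mult.assoc[symmetric] dinv_mult)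
  obtain a i where ai: "L ! t = (a, i)" by(cases "L ! t")
  have "L ! t : set L" using t by(simp add: qs_def)
  hence "a < N" by(simp add: L(2) ai)
  have "fls_nth (S c' i) (- int a) : I" using 2 by(simp add: cof_def)
  thus "c t : I" using ai \<open>a < N\<close> t c'[of t] by(simp add: S_nth qs_def)
 qed
 thus ?thesis using L(3) by(intro exI[of _ qs]) (simp add: qs_def)
qed

lemma frame_Om:
 fixes x :: "nat => 'a::comm_ring_1"
 assumes I: "is_ideal I"
 shows "EX qs. frame I (Om I N x (M + d) :: ('a fls ^ 'n) set) (Om I N x M) qs \<and> length qs = d * (N * CARD('n))"
proof(induction d)
 case 0
 show ?case by(intro exI[of _ "[]"]) (auto simp: frame_iff lcomb_def)
next
 case (Suc d)
 then obtain qs where qs: "frame I (Om I N x (M + d) :: ('a fls ^ 'n) set) (Om I N x M) qs" "length qs = d * (N * CARD('n))"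
  by blast
 obtain ps where ps: "frame I (Om I N x (Suc (M + d)) :: ('a fls ^ 'n) set) (Om I N x (M + d)) ps" "length ps = N * CARD('n)"
  using frame_Om_step[OF I] by blast
 have "frame I (Om I N x (M + Suc d) :: ('a fls ^ 'n) set) (Om I N x M) (qs @ ps)"
  using frame_concat[OF ps(1) qs(1) Om_csub[OF I] Om_csub[OF I] Om_csub[OF I]] by simp
 thus ?case using ps qs by(intro exI[of _ "qs @ ps"]) simp
qed

section \<open>Base change\<close>

lemma module_const: "Modules.module (%a v :: 'a::comm_ring_1 fls ^ 'n. a *c v)"
 by unfold_locales (simp_all add: smult_add fls_const_add add_smult smult_assoc)

lemma alg_homD: "alg_hom cst h ==> h (cst c) = cst c"
 by(simp add: alg_hom_def)

lemma base_change_iff: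
 assumes "is_ideal J"
 shows "v : base_change h J E \<longleftrightarrow>
  (EX us c. set us \<subseteq> E \<and> v - lcomb c (map (vmap h) us) : van J)"
proof -
 interpret m: Modules.module "%a v :: base fls ^ 'a. a *c v" by(rule module_const)
 let ?S = "{v. EX us c. set us \<subseteq> E \<and> v - lcomb c (map (vmap h) us) : van J}"
 have bc: "base_change h J E = m.span (vmap h ` E \<union> van J)" by(simp add: base_change_def)
 have sub: "m.subspace ?S"
 proof(rule m.subspaceI)
  show "0 : ?S" using van_zero[OF assms] by(auto simp: lcomb_def intro!: exI[of _ "[]"])
  fix u v assume "u : ?S" "v : ?S"
  then obtain us c ws d where 1: "set us \<subseteq> E" "u - lcomb c (map (vmap h) us) : van J"
   "set ws \<subseteq> E" "v - lcomb d (map (vmap h) ws) : van J" by blast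
  define e where "e a = (if a < length us then c a else d (a - length us))" for a
  have "lcomb e (map (vmap h) (us @ ws)) = lcomb c (map (vmap h) us) + lcomb d (map (vmap h) ws)"
   unfolding map_append by(rule lcomb_append_eq) (auto simp: e_def)
  hence "u + v - lcomb e (map (vmap h) (us @ ws)) : van J"
   using van_add[OF assms 1(2,4)] by(simp add: algebra_simps)
  thus "u + v : ?S" using 1 by(intro CollectI exI[of _ "us @ ws"] exI[of _ e]) auto
 next
  fix k v assume "v : ?S"
  then obtain us c where 1: "set us \<subseteq> E" "v - lcomb c (map (vmap h) us) : van J" by blast
  hence "k *c v - lcomb (%a. k * c a) (map (vmap h) us) : van J"
   using van_smult[OF assms 1(2), of "fls_const k"] by(simp add: lcomb_smult smult_diff)
  thus "k *c v : ?S" using 1 by blast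
 qed
 have "vmap h ` E \<union> van J \<subseteq> ?S"
 proof
  fix v assume "v : vmap h ` E \<union> van J"
  thus "v : ?S"
  proof
   assume "v : vmap h ` E"
   then obtain u where u: "u : E" "v = vmap h u" by blast
   have "lcomb (%_. 1) (map (vmap h) [u]) = v" by(simp add: lcomb_def u)
   thus ?thesis using u van_zero[OF assms]
    by(intro CollectI exI[of _ "[u]"] exI[of _ "%_. 1"]) simp
  next
   assume "v : van J"
   thus ?thesis by(intro CollectI exI[of _ "[]"]) (simp add: lcomb_def)
  qed
 qed
 hence 1: "base_change h J E \<subseteq> ?S" unfolding bc by(rule m.span_minimal[OF _ sub])
 have 2: "v : base_change h J E" if "set us \<subseteq> E" "v - lcomb c (map (vmap h) us) : van J" for us c v
 proof -
  have "map (vmap h) us ! a : vmap h ` E" if "a < length us" for a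
   using \<open>set us \<subseteq> E\<close> that by(auto dest!: nth_mem)
  hence "lcomb c (map (vmap h) us) : m.span (vmap h ` E \<union> van J)"
   unfolding lcomb_def by(intro m.span_sum m.span_scale m.span_base UnI1) auto
  moreover have "v - lcomb c (map (vmap h) us) : m.span (vmap h ` E \<union> van J)"
   using that(2) by(intro m.span_base) auto
  ultimately have "(v - lcomb c (map (vmap h) us)) + lcomb c (map (vmap h) us) : m.span (vmap h ` E \<union> van J)"
   by(rule m.span_add[rotated])
  thus ?thesis unfolding bc by simp
 qed
 show ?thesis using 1 2 by blast
qed

lemma base_change_csub: "is_ideal J ==> csub J (base_change h J E)"
proof -
 assume J: "is_ideal J"
 interpret m: Modules.module "%a v :: base fls ^ 'a. a *c v" by(rule module_const)
 show ?thesis using J unfolding csub_def base_change_def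
  by(auto intro: m.span_add m.span_scale m.span_base)
qed

lemma base_change_mem: "is_ideal J ==> u : E ==> vmap h u : base_change h J E"
proof -
 assume u: "u : E"
 interpret m: Modules.module "%a v :: base fls ^ 'a. a *c v" by(rule module_const)
 show ?thesis using u unfolding base_change_def by(auto intro: m.span_base)
qed

lemma base_change_least:
 assumes "csub J B" "!!u. u : E ==> vmap h u : B"
 shows "base_change h J E \<subseteq> B"
proof
 fix v assume "v : base_change h J E"
 moreover have J: "is_ideal J" using assms(1) by(simp add: csub_def)
 ultimately obtain us c where u: "set us \<subseteq> E" "v - lcomb c (map (vmap h) us) : van J"
  using base_change_iff by blast
 have "lcomb c (map (vmap h) us) : B"
  using u assms by(intro lcomb_in[OF assms(1)]) (auto dest!: nth_mem)
 thus "v : B" using csub_cong[OF assms(1)] csub_van[OF assms(1) u(2)] by blast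
qed

lemma base_change_mono: "is_ideal J ==> E \<subseteq> E' ==> base_change h J E \<subseteq> base_change h J E'"
 by(rule base_change_least[OF base_change_csub]) (auto intro: base_change_mem)

lemma base_change_submod:
 assumes J: "is_ideal J" and h: "ring_map h" and E: "is_ideal I" "submod I E"
 shows "submod J (base_change h J E)"
proof(rule submodI[OF base_change_csub[OF J]])
 fix v assume "v : base_change h J E"
 then obtain us c where u: "set us \<subseteq> E" "v - lcomb c (map (vmap h) us) : van J"
  using base_change_iff[OF J] by blast
 have mp: "map (vmap h) (map ((*s) fls_X_inv) us) = map ((*s) fls_X_inv) (map (vmap h) us)"
  by(simp add: ring_map.vmap_smult[OF h] ring_map.map_X_inv[OF h])
 have e: "lcomb c (map (vmap h) (map ((*s) fls_X_inv) us)) = fls_X_inv *s lcomb c (map (vmap h) us)"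
  unfolding mp by(subst lcomb_map[where g = "%c. c"])
   (auto simp: smult_add smult_assoc mult.commute)
 have "fls_X_inv *s v - lcomb c (map (vmap h) (map ((*s) fls_X_inv) us)) : van J"
  unfolding e using van_smult[OF J u(2), of fls_X_inv] by(simp add: smult_diff)
 moreover have "set (map ((*s) fls_X_inv) us) \<subseteq> E"
  using u(1) submod_smult[OF E(2) polyfuns_X_inv[OF E(1)]] by auto
 ultimately show "fls_X_inv *s v : base_change h J E"
  using base_change_iff[OF J] by blast
qed

lemma axis_decomp: "(v :: 'a::comm_ring_1 ^ 'n) = (\<Sum>i\<in>UNIV. v $ i *s axis i 1)"
 by(rule basis_expansion[symmetric])

lemma vmap_axis: "ring_map h ==> vmap h (axis i 1) = axis i 1"
 by(auto simp: vec_eq_iff ring_map.vmap_nth axis_def ring_map.one[OF ring_map.ring_map_fls]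
   ring_map.zero[OF ring_map.ring_map_fls])

lemma map_dinv: "ring_map h ==> fls_map h (dinv N x) = dinv N (h o x)"
proof -
 assume h: "ring_map h"
 have g: "fls_map h (geom c) = geom (h c)" for c
  by(rule fls_eqI) (simp add: ring_map.map_nth[OF h] geom_nth ring_map.power[OF h] ring_map.zero[OF h])
 show ?thesis by(simp add: dinv_def ring_map.prod[OF ring_map.ring_map_fls[OF h]] g)
qed

lemma vmap_poly_vecs: "ring_map h ==> h ` I \<subseteq> J ==> v : poly_vecs I ==> vmap h v : poly_vecs J"
 by(auto simp: poly_vecs_def polyfuns_def ring_map.vmap_nth ring_map.map_nth)

lemma vmap_Om: "ring_map h ==> h ` I \<subseteq> J ==> v : Om I N x M ==> vmap h v : Om J N (h o x) M"
 unfolding Om_def mem_Collect_eq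
 by(drule vmap_poly_vecs[of h I J, rotated -1])
  (simp_all add: ring_map.vmap_smult ring_map.map_divisor ring_map.power[OF ring_map.ring_map_fls])

lemma base_change_poly_vecs:
 assumes J: "is_ideal J" and I: "is_ideal I" and h: "ring_map h" "h ` I \<subseteq> J"
 shows "base_change h J (poly_vecs I) = (poly_vecs J :: (base fls ^ 'n) set)"
proof
 show "base_change h J (poly_vecs I) \<subseteq> (poly_vecs J :: (base fls ^ 'n) set)"
  by(rule base_change_least[OF polyvecs_csub[OF J]]) (rule vmap_poly_vecs[OF h])
 show "(poly_vecs J :: (base fls ^ 'n) set) \<subseteq> base_change h J (poly_vecs I)"
 proof
  fix v :: "base fls ^ 'n" assume v: "v : poly_vecs J"
  have S: "submod J (base_change h J (poly_vecs I) :: (base fls ^ 'n) set)"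
   by(rule base_change_submod[OF J h(1) I polyvecs_submod[OF I]])
  have "axis i 1 : (poly_vecs I :: (base fls ^ 'n) set)" for i
   by(auto simp: poly_vecs_def axis_def polyfuns_one[OF I] polyfuns_zero[OF I])
  hence "axis i 1 : (base_change h J (poly_vecs I) :: (base fls ^ 'n) set)" for i
   using base_change_mem[OF J, of "axis i 1" "poly_vecs I" h] by(simp add: vmap_axis[OF h(1)])
  hence "(\<Sum>i\<in>UNIV. v $ i *s axis i 1) : base_change h J (poly_vecs I)"
   using v by(intro csub_sum[OF base_change_csub[OF J]] submod_smult[OF S]) (auto simp: poly_vecs_def)
  thus "v : base_change h J (poly_vecs I)" using axis_decomp[of v] by simp
 qed
qed

lemma base_change_Om:
 assumes J: "is_ideal J" and I: "is_ideal I" and h: "ring_map h" "h ` I \<subseteq> J"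
  and x: "!!i. i < N ==> x' i - h (x i) : J"
 shows "base_change h J (Om I N x M) = (Om J N x' M :: (base fls ^ 'n) set)"
proof -
 have x': "Om J N x' M = (Om J N (h o x) M :: (base fls ^ 'n) set)"
  using x by(intro Om_cong[OF J]) auto
 have "base_change h J (Om I N x M) = (Om J N (h o x) M :: (base fls ^ 'n) set)"
 proof
  show "base_change h J (Om I N x M) \<subseteq> (Om J N (h o x) M :: (base fls ^ 'n) set)"
   by(rule base_change_least[OF Om_csub[OF J]]) (rule vmap_Om[OF h])
  show "(Om J N (h o x) M :: (base fls ^ 'n) set) \<subseteq> base_change h J (Om I N x M)"
  proof
   fix v :: "base fls ^ 'n" assume "v : Om J N (h o x) M"
   hence "divisor_eq N (h o x) ^ M *s v : base_change h J (poly_vecs I)"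
    unfolding base_change_poly_vecs[OF J I h] by(simp add: Om_def)
   then obtain us c where u: "set us \<subseteq> poly_vecs I"
    "divisor_eq N (h o x) ^ M *s v - lcomb c (map (vmap h) us) : van J"
    using base_change_iff[OF J] by blast
   let ?us = "map ((*s) (dinv N x ^ M)) us"
   have mp: "map (vmap h) ?us = map ((*s) (dinv N (h o x) ^ M)) (map (vmap h) us)"
    by(simp add: ring_map.vmap_smult[OF h(1)] map_dinv[OF h(1)] ring_map.power[OF ring_map.ring_map_fls[OF h(1)]])
   have e: "lcomb c (map (vmap h) ?us) = dinv N (h o x) ^ M *s lcomb c (map (vmap h) us)"
    unfolding mp by(subst lcomb_map[where g = "%c. c"])
     (auto simp: smult_add smult_assoc mult.commute)
   have "v - lcomb c (map (vmap h) ?us) : van J"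
    unfolding e using van_smult[OF J u(2), of "dinv N (h o x) ^ M"]
    by(simp add: smult_diff smult_assoc mult.commute dinv_pow)
   moreover have "set ?us \<subseteq> Om I N x M" using u(1) Om_dinv[of N x M] by auto
   ultimately show "v : base_change h J (Om I N x M)" using base_change_iff[OF J] by blast
  qed
 qed
 thus ?thesis using x' by simp
qed

lemma vmap_vmap: "ring_map h ==> ring_map k ==> vmap k (vmap h v) = vmap (%a. k (h a)) v"
 using ring_map_comp[of k h]
 by(auto simp: vec_eq_iff ring_map.vmap_nth fls_eq_iff ring_map.map_nth)

lemma base_change_comp:
 assumes "is_ideal J" "is_ideal K" "ring_map h" "ring_map k" "k ` J \<subseteq> K"
 shows "base_change k K (base_change h J E) = base_change (%a. k (h a)) K E"
proof
 show "base_change (%a. k (h a)) K E \<subseteq> base_change k K (base_change h J E)"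
  using assms by(intro base_change_least[OF base_change_csub])
   (auto simp flip: vmap_vmap intro!: base_change_mem)
 show "base_change k K (base_change h J E) \<subseteq> base_change (%a. k (h a)) K E"
 proof(rule base_change_least[OF base_change_csub[OF assms(2)]])
  fix u assume "u : base_change h J E"
  then obtain us c where u: "set us \<subseteq> E" "u - lcomb c (map (vmap h) us) : van J"
   using base_change_iff[OF assms(1)] by blast
  have "vmap k (u - lcomb c (map (vmap h) us)) : van K"
   by(rule ring_map.vmap_van[OF assms(4,5) u(2)])
  moreover have "vmap k (lcomb c (map (vmap h) us)) = lcomb (%a. k (c a)) (map (vmap (%a. k (h a))) us)"
   using assms(3,4) by(subst lcomb_map[where g = k])
    (auto simp: ring_map.vmap_add ring_map.vmap_smult ring_map.map_const vmap_vmap cong: map_cong)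
  ultimately have "vmap k u - lcomb (%a. k (c a)) (map (vmap (%a. k (h a))) us) : van K"
   by(simp add: ring_map.vmap_diff[OF assms(4)])
  thus "vmap k u : base_change (%a. k (h a)) K E"
   using u(1) base_change_iff[OF assms(2)] by blast
 qed
qed

lemma base_change_mvset:
 assumes J: "is_ideal J" and K: "is_ideal K" and k: "ring_map k" "k ` J \<subseteq> K"
  and g: "linmap J g" and g': "linmap K g'"
  and gg: "!!v. v : E ==> vmap k (g v) - g' (vmap k v) : van K"
 shows "base_change k K (mvset J g E) = mvset K g' (base_change k K E)"
proof
 note cs = mvset_csub[OF g' base_change_csub[OF K]]
 show "base_change k K (mvset J g E) \<subseteq> mvset K g' (base_change k K E)"
 proof(rule base_change_least[OF cs])
  fix u assume "u : mvset J g E"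
  then obtain v where v: "v : E" "u - g v : van J" by(auto simp: mvset_def)
  have "vmap k u - vmap k (g v) : van K"
   using ring_map.vmap_van[OF k v(2)] by(simp add: ring_map.vmap_diff[OF k(1)])
  hence "vmap k u - g' (vmap k v) : van K" using van_trans[OF K _ gg[OF v(1)]] by blast
  thus "vmap k u : mvset K g' (base_change k K E)"
   using base_change_mem[OF K v(1)] by(auto simp: mvset_def)
 qed
 show "mvset K g' (base_change k K E) \<subseteq> base_change k K (mvset J g E)"
 proof
  fix u assume "u : mvset K g' (base_change k K E)"
  then obtain v where v: "v : base_change k K E" "u - g' v : van K" by(auto simp: mvset_def)
  obtain us c where us: "set us \<subseteq> E" "v - lcomb c (map (vmap k) us) : van K"
   using base_change_iff[OF K] v(1) by blast
  have "g' v - lcomb c (map g' (map (vmap k) us)) : van K"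
   unfolding linmap_lcomb[OF g', symmetric] linmap_diff[OF g', symmetric]
   using us(2) g' by(simp add: linmap_def)
  moreover have "lcomb c (map g' (map (vmap k) us)) - lcomb c (map (vmap k) (map g us)) : van K"
   unfolding lcomb_def using us(1)
   by(auto simp flip: smult_diff sum_subtractf intro!: van_sum[OF K] van_smult[OF K] van_sym[OF K] gg)
  ultimately have "u - lcomb c (map (vmap k) (map g us)) : van K"
   using van_trans[OF K] v(2) by blast
  moreover have "set (map g us) \<subseteq> mvset J g E"
   using us(1) van_zero[OF J] by(auto simp: mvset_def intro!: bexI)
  ultimately show "u : base_change k K (mvset J g E)"
   using base_change_iff[OF K] by blast
 qed
qed

text \<open>At a complex point the coefficients introduced by base change become complex numbers,
  and these lift through \<open>cst\<close> to coefficients for \<open>E\<close> itself. Hence the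
  degree condition in \<open>gr1_points\<close> is inherited by base changes.\<close>

lemma vmap_base_change:
 assumes J: "is_ideal J" and h: "alg_hom cst h" and E: "csub I E"
  and t: "alg_hom id tht" "tht ` J \<subseteq> {0}"
 shows "vmap tht ` base_change h J E = vmap (%a. tht (h a)) ` E"
proof
 have rh: "ring_map h" and rt: "ring_map tht"
  using alg_hom_ring_map[OF h] alg_hom_id_ring_map[OF t(1)] by auto
 have rc: "ring_map (%a. tht (h a))" by(rule ring_map_comp[OF rt rh])
 have vv: "vmap tht (vmap h v) = vmap (%a. tht (h a)) v" for v :: "base fls ^ 'a"
  using rh rt rc by(auto simp: vec_eq_iff ring_map.vmap_nth fls_eq_iff ring_map.map_nth)
 show "vmap (%a. tht (h a)) ` E \<subseteq> vmap tht ` base_change h J E"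
  using base_change_mem[OF J] by(force simp flip: vv)
 show "vmap tht ` base_change h J E \<subseteq> vmap (%a. tht (h a)) ` E"
 proof
  fix w assume "w : vmap tht ` base_change h J E"
  then obtain v where v: "v : base_change h J E" "w = vmap tht v" by blast
  obtain us c where us: "set us \<subseteq> E" "v - lcomb c (map (vmap h) us) : van J"
   using base_change_iff[OF J] v(1) by blast
  have "vmap tht (v - lcomb c (map (vmap h) us)) : van {0}"
   by(rule ring_map.vmap_van[OF rt t(2) us(2)])
  hence "w = vmap tht (lcomb c (map (vmap h) us))"
   by(simp add: ring_map.vmap_diff[OF rt] v(2) van_def vec_eq_iff fls_eq_iff)
  also have "\<dots> = lcomb (%a. tht (c a)) (map (vmap (%a. tht (h a))) us)"
   by(subst lcomb_map[where g = tht])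
    (auto simp: ring_map.vmap_add[OF rt] ring_map.vmap_smult[OF rt] ring_map.map_const[OF rt] vv cong: map_cong)
  also have "\<dots> = vmap (%a. tht (h a)) (lcomb (%a. cst (tht (c a))) us)"
   using h t(1) by(subst lcomb_map[where g = "%a. tht (h a)"])
    (auto simp: ring_map.vmap_add[OF rc] ring_map.vmap_smult[OF rc] ring_map.map_const[OF rc] alg_hom_def)
  finally show "w : vmap (%a. tht (h a)) ` E"
   using lcomb_in[OF E, of us] us(1) by(metis imageI nth_mem subsetD)
 qed
qed

section \<open>Local freeness\<close>

lemma uniform_exponent:
 assumes "!!i :: 'n :: finite. EX m :: nat. P m i" "!!m m' i. P m i ==> m \<le> m' ==> P m' i"
 shows "EX m. ALL i. P m i"
proof -
 obtain f where f: "!!i. P (f i) i" using assms(1) by metis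
 have "P (Max (range f)) i" for i by(rule assms(2)[OF f[of i]]) simp
 thus ?thesis by blast
qed

definition loc_basis :: "'a::comm_ring_1 set => ('a fls ^ 'n) set => 'a fls => ('n => 'a fls ^ 'n) => bool" where
 "loc_basis I E g b \<longleftrightarrow> range b \<subseteq> E \<and>
    (ALL v:E. EX m c. (ALL i. c i : polyfuns I) \<and> g ^ m *s v - (\<Sum>i\<in>UNIV. c i *s b i) : van I) \<and>
    (ALL c. (ALL i. c i : polyfuns I) \<and> (\<Sum>i\<in>UNIV. c i *s b i) : van I -->
      (EX m. ALL i j. fls_nth (g ^ m * c i) j : I))"

lemma locally_free_iff:
 "locally_free I (E :: ('a::comm_ring_1 fls ^ 'n) set) \<longleftrightarrow> (EX G. finite G \<and> G \<subseteq> polyfuns I \<and>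
   (EX q. (ALL g:G. q g : polyfuns I) \<and> (\<Sum>g\<in>G. q g * g) - 1 : cof I) \<and> (ALL g:G. EX b. loc_basis I E g b))"
 unfolding locally_free_def loc_basis_def cof_def by simp

text \<open>A right inverse \<open>C\<close> of the matrix with rows \<open>b j\<close>, up to the
  factor \<open>s\<close>. It recovers the coefficients of a combination of the \<open>b j\<close>.
  Being an identity of matrices, it survives base change, unlike the independence clause of
  \<open>loc_basis\<close>.\<close>

definition recov :: "'a::comm_ring_1 set => ('n::finite => 'a fls ^ 'n) => 'a fls => ('n => 'n => 'a fls) => bool" where
 "recov I b s C \<longleftrightarrow> (ALL j l. s * (if j = l then 1 else 0) - (\<Sum>i\<in>UNIV. b j $ i * C i l) : cof I)"

lemma recov_coeff:
 assumes J: "is_ideal J" and r: "recov J b s C" and v: "(\<Sum>j\<in>UNIV. c j *s b j) : van J"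
 shows "s * c l : cof J"
proof -
 have "(\<Sum>j\<in>UNIV. c j * (s * (if j = l then 1 else 0) - (\<Sum>i\<in>UNIV. b j $ i * C i l))) : cof J"
  using r by(intro ideal_sum[OF cof_ideal[OF J]] ideal_mult[OF cof_ideal[OF J]]) (simp add: recov_def)
 also have "(\<Sum>j\<in>UNIV. c j * (s * (if j = l then 1 else 0) - (\<Sum>i\<in>UNIV. b j $ i * C i l))) =
   (\<Sum>j\<in>UNIV. if j = l then s * c l else 0) - (\<Sum>j\<in>UNIV. \<Sum>i\<in>UNIV. c j * b j $ i * C i l)"
  unfolding sum_subtractf[symmetric]
  by(rule sum.cong) (auto simp: algebra_simps sum_distrib_left)
 also have "(\<Sum>j\<in>UNIV. \<Sum>i\<in>UNIV. c j * b j $ i * C i l) = (\<Sum>i\<in>UNIV. (\<Sum>j\<in>UNIV. c j *s b j) $ i * C i l)"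
  by(subst sum.swap) (simp add: sum_distrib_right)
 finally have "s * c l - (\<Sum>i\<in>UNIV. (\<Sum>j\<in>UNIV. c j *s b j) $ i * C i l) : cof J" by simp
 moreover have "(\<Sum>i\<in>UNIV. (\<Sum>j\<in>UNIV. c j *s b j) $ i * C i l) : cof J"
  using v by(intro ideal_sum[OF cof_ideal[OF J]] ideal_mult2[OF cof_ideal[OF J]]) (simp add: van_iff)
 ultimately show ?thesis using ideal_eq_zeroI[OF cof_ideal[OF J]] by blast
qed

text \<open>Some power of the divisor equation D times each unit vector lies in \<open>E\<close>, so
  after multiplication by a power of \<open>g\<close> it is a combination of the basis
  \<open>b\<close>. Expanding the \<open>b j\<close> in unit vectors and substituting gives a
  relation among the \<open>b j\<close>, and independence turns it into the matrix identity.\<close>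

lemma loc_basis_recov:
 fixes E :: "(base fls ^ 'n) set"
 assumes I: "is_ideal I" and E: "submod I E" "E \<subseteq> rat_vecs I N x"
  and dv: "!!v. v : rat_vecs I N x ==> EX m. divisor_eq N x ^ m *s v : E"
  and b: "loc_basis I E g b" and g: "g : polyfuns I"
 shows "EX a K C. recov I b (g ^ a * divisor_eq N x ^ K) C"
proof -
 let ?D = "divisor_eq N x"
 have D: "?D ^ k : polyfuns I" for k by(intro polyfuns_power polyfuns_divisor I)
 have gk: "g ^ k : polyfuns I" for k by(intro polyfuns_power g I)
 have bE: "b i : E" for i using b by(auto simp: loc_basis_def)
 have ax: "axis i 1 : rat_vecs I N x" for i
  using rat_vecs_Om[OF I, of "axis i 1" N x]
  by(auto simp: Om_0 poly_vecs_def axis_def polyfuns_one[OF I] polyfuns_zero[OF I] intro!: exI[of _ 0])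
 have "EX K. ALL i. ?D ^ K *s axis i 1 : E"
 proof(rule uniform_exponent)
  show "EX m. ?D ^ m *s axis i 1 : E" for i using dv[OF ax] by blast
  fix m m' :: nat and i assume "?D ^ m *s axis i 1 : E" "m \<le> m'"
  hence "?D ^ (m' - m) *s (?D ^ m *s axis i 1) : E" using submod_smult[OF E(1) D] by blast
  thus "?D ^ m' *s axis i 1 : E"
   using \<open>m \<le> m'\<close> by(simp add: smult_assoc power_add[symmetric])
 qed
 then obtain K where K: "!!i. ?D ^ K *s axis i 1 : E" by blast
 have "EX m. ALL i. EX c. (ALL l. c l : polyfuns I) \<and> g ^ m *s (?D ^ K *s axis i 1) - (\<Sum>l\<in>UNIV. c l *s b l) : van I"
 proof(rule uniform_exponent)
  show "EX m c. (ALL l. c l : polyfuns I) \<and> g ^ m *s (?D ^ K *s axis i 1) - (\<Sum>l\<in>UNIV. c l *s b l) : van I" for i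
   using b K[of i] unfolding loc_basis_def by blast
  fix m m' :: nat and i
  assume "EX c. (ALL l. c l : polyfuns I) \<and> g ^ m *s (?D ^ K *s axis i 1) - (\<Sum>l\<in>UNIV. c l *s b l) : van I" and m: "m \<le> m'"
  then obtain c where c: "!!l. c l : polyfuns I" "g ^ m *s (?D ^ K *s axis i 1) - (\<Sum>l\<in>UNIV. c l *s b l) : van I"
   by blast
  have "g ^ (m' - m) *s (g ^ m *s (?D ^ K *s axis i 1) - (\<Sum>l\<in>UNIV. c l *s b l)) : van I"
   by(rule van_smult[OF I c(2)])
  also have "g ^ (m' - m) *s (g ^ m *s (?D ^ K *s axis i 1) - (\<Sum>l\<in>UNIV. c l *s b l)) =
    g ^ m' *s (?D ^ K *s axis i 1) - (\<Sum>l\<in>UNIV. (g ^ (m' - m) * c l) *s b l)"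
   using m unfolding smult_diff smult_sum_right smult_assoc
   by(simp add: mult.assoc[symmetric] power_add[symmetric])
  finally show "EX c. (ALL l. c l : polyfuns I) \<and> g ^ m' *s (?D ^ K *s axis i 1) - (\<Sum>l\<in>UNIV. c l *s b l) : van I"
   using polyfuns_mult[OF I gk c(1)] by(intro exI[of _ "%l. g ^ (m' - m) * c l"]) auto
 qed
 then obtain m where m: "ALL i. EX c. (ALL l. c l : polyfuns I) \<and> g ^ m *s (?D ^ K *s axis i 1) - (\<Sum>l\<in>UNIV. c l *s b l) : van I"
  by(elim exE)
 from choice[OF m] obtain C where C': "ALL i. (ALL l. C i l : polyfuns I) \<and> g ^ m *s (?D ^ K *s axis i 1) - (\<Sum>l\<in>UNIV. C i l *s b l) : van I"
  by(elim exE)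
 have C: "C i l : polyfuns I" "g ^ m *s (?D ^ K *s axis i 1) - (\<Sum>l\<in>UNIV. C i l *s b l) : van I" for i l
  using C' by blast+
 have "EX K'. ALL j. b j : Om I N x K'"
 proof(rule uniform_exponent)
  show "EX m. b j : Om I N x m" for j
   using bE[of j] E(2) rat_vecs_Om[OF I, of "b j"] by blast
  show "b j : Om I N x m'" if "b j : Om I N x m" "m \<le> m'" for m m' j
   by(rule Om_monoD[OF I that])
 qed
 then obtain K' where K': "!!j i. ?D ^ K' * b j $ i : polyfuns I"
  by(auto simp: Om_def poly_vecs_def)
 \<comment> \<open>The coefficients of the relation that results from the substitution. The factor
   \<open>?D ^ K'\<close> clears the poles of the \<open>b j\<close>, since the independence clause
   speaks of polynomial coefficients.\<close>
 define c where "c j l = ?D ^ K' * (g ^ m * ?D ^ K * (if j = l then 1 else 0)) - (\<Sum>i\<in>UNIV. (?D ^ K' * b j $ i) * C i l)" for j l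
 have c: "c j l : polyfuns I" for j l
 proof -
  have "(if j = l then 1 else 0) : polyfuns I" using polyfuns_one[OF I] polyfuns_zero[OF I] by simp
  thus ?thesis unfolding c_def
   by(intro polyfuns_diff[OF I] polyfuns_sum[OF I] polyfuns_mult[OF I _ C(1)] K'
    polyfuns_mult[OF I D] polyfuns_mult[OF I gk]) (intro polyfuns_mult[OF I] gk D)
 qed
 have "(\<Sum>l\<in>UNIV. c j l *s b l) : van I" for j
 proof -
  have "(\<Sum>l\<in>UNIV. c j l *s b l) = ?D ^ K' *s ((g ^ m * ?D ^ K) *s b j) -
    (\<Sum>l\<in>UNIV. \<Sum>i\<in>UNIV. ((?D ^ K' * b j $ i) * C i l) *s b l)"
  proof -
   have "(\<Sum>l\<in>UNIV. (?D ^ K' * (g ^ m * ?D ^ K * (if j = l then 1 else 0))) *s b l) =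
     (\<Sum>l\<in>UNIV. if l = j then (?D ^ K' * (g ^ m * ?D ^ K)) *s b j else 0)"
    by(rule sum.cong) auto
   also have "\<dots> = ?D ^ K' *s ((g ^ m * ?D ^ K) *s b j)" by(simp add: smult_assoc)
   finally show ?thesis
    by(simp only: c_def diff_smult sum_subtractf smult_sum_left)
  qed
  also have "(\<Sum>l\<in>UNIV. \<Sum>i\<in>UNIV. ((?D ^ K' * b j $ i) * C i l) *s b l) =
    (\<Sum>i\<in>UNIV. (?D ^ K' * b j $ i) *s (\<Sum>l\<in>UNIV. C i l *s b l))"
   by(subst sum.swap) (simp only: smult_sum_right smult_assoc)
  also have "(g ^ m * ?D ^ K) *s b j = (\<Sum>i\<in>UNIV. (b j $ i) *s (g ^ m *s (?D ^ K *s axis i 1)))"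
  proof -
   have "(g ^ m * ?D ^ K) *s b j = (g ^ m * ?D ^ K) *s (\<Sum>i\<in>UNIV. b j $ i *s axis i 1)"
    using axis_decomp[of "b j"] by simp
   thus ?thesis by(simp only: smult_sum_right smult_assoc mult_ac)
  qed
  also have "?D ^ K' *s (\<Sum>i\<in>UNIV. (b j $ i) *s (g ^ m *s (?D ^ K *s axis i 1))) -
    (\<Sum>i\<in>UNIV. (?D ^ K' * b j $ i) *s (\<Sum>l\<in>UNIV. C i l *s b l)) =
    (\<Sum>i\<in>UNIV. (?D ^ K' * b j $ i) *s (g ^ m *s (?D ^ K *s axis i 1) - (\<Sum>l\<in>UNIV. C i l *s b l)))"
   unfolding smult_diff sum_subtractf
   by(simp only: smult_sum_right[of "?D ^ K'"] smult_assoc mult.assoc)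
  also have "\<dots> : van I" by(intro van_sum[OF I] van_smult[OF I] C)
  finally show ?thesis .
 qed
 hence "EX m. ALL l. g ^ m * c j l : cof I" for j
  using b c unfolding loc_basis_def cof_def by simp
 hence "EX m. ALL j. ALL l. g ^ m * c j l : cof I"
 proof(rule uniform_exponent)
  fix m m' :: nat and j assume "ALL l. g ^ m * c j l : cof I" "m \<le> m'"
  hence "g ^ (m' - m) * (g ^ m * c j l) : cof I" for l using ideal_mult[OF cof_ideal[OF I]] by blast
  thus "ALL l. g ^ m' * c j l : cof I"
   using \<open>m \<le> m'\<close> by(simp add: mult.assoc[symmetric] power_add[symmetric])
 qed
 then obtain m' where m': "!!j l. g ^ m' * c j l : cof I" by blast
 have "recov I b (g ^ (m' + m) * ?D ^ (K' + K)) (%i l. g ^ m' * ?D ^ K' * C i l)"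
  unfolding recov_def
 proof(intro allI)
  fix j l
  have "g ^ (m' + m) * ?D ^ (K' + K) * (if j = l then 1 else 0) - (\<Sum>i\<in>UNIV. b j $ i * (g ^ m' * ?D ^ K' * C i l)) =
   g ^ m' * c j l"
   by(simp add: c_def right_diff_distrib sum_distrib_left power_add algebra_simps)
  thus "g ^ (m' + m) * ?D ^ (K' + K) * (if j = l then 1 else 0) - (\<Sum>i\<in>UNIV. b j $ i * (g ^ m' * ?D ^ K' * C i l)) : cof I"
   using m' by simp
 qed
 thus ?thesis by blast
qed

text \<open>Binomial theorem: in the power \<open>k + m\<close> of a sum, every term contains the
  \<open>k\<close>-th power of the first summand or the \<open>m\<close>-th power of the other. Here
  \<open>Q\<close> is an ideal of the ring of polynomial functions.\<close>

lemma comaximal_powers: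
 assumes I: "is_ideal I" and G: "finite G" "G \<subseteq> polyfuns I" "!!g. g : G ==> q g : polyfuns I"
  and Q: "!!a b. a : Q ==> b : Q ==> a + b : Q" "!!a b. a : polyfuns I ==> b : Q ==> a * b : Q" "0 : Q"
  and pw: "!!g. g : G ==> EX m. g ^ m : Q"
 shows "EX m. (\<Sum>g\<in>G. q g * g) ^ m : Q"
 using G pw
proof(induction G rule: finite_induct)
 case empty
 thus ?case using Q(3) by(intro exI[of _ 1]) simp
next
 case (insert g G)
 let ?s = "\<Sum>g\<in>G. q g * g"
 have qg: "q x : polyfuns I" "x : polyfuns I" "EX m. x ^ m : Q" if "x : insert g G" for x
  using insert.prems(1) insert.prems(2)[OF that] insert.prems(3)[OF that] that by blast+
 obtain m where m: "?s ^ m : Q" using insert.IH[OF _ qg(1) qg(3)] qg(2) by blast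
 obtain k where "g ^ k : Q" using qg(3)[of g] by blast
 hence k: "(q g * g) ^ k : Q"
  unfolding power_mult_distrib using qg(1)[of g] by(intro Q(2) polyfuns_power[OF I]) simp_all
 have gp: "q g * g : polyfuns I" "?s : polyfuns I"
  using qg(1,2) by(auto intro!: polyfuns_mult[OF I] polyfuns_sum[OF I])
 have cp: "of_nat j : polyfuns I" for j
  by(induction j) (auto intro!: polyfuns_add[OF I] polyfuns_one[OF I] polyfuns_zero[OF I])
 have "(q g * g + ?s) ^ (k + m) = (\<Sum>j\<le>k+m. of_nat ((k+m) choose j) * (q g * g) ^ j * ?s ^ (k + m - j))"
  by(simp add: binomial_ring)
 also have "\<dots> : Q"
 proof -
  have t: "of_nat ((k+m) choose j) * (q g * g) ^ j * ?s ^ (k + m - j) : Q" if "j \<le> k + m" for j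
  proof(cases "k \<le> j")
   case True
   have "of_nat ((k+m) choose j) * (q g * g) ^ j * ?s ^ (k + m - j) =
     (of_nat ((k+m) choose j) * (q g * g) ^ (j - k) * ?s ^ (k + m - j)) * (q g * g) ^ k"
    using power_add[of "q g * g" "j - k" k] True by(simp add: mult_ac)
   thus ?thesis using k gp cp
    by(auto intro!: Q(2) polyfuns_mult[OF I] polyfuns_power[OF I])
  next
   case False
   have "?s ^ (k + m - j) = ?s ^ (k - j) * ?s ^ m" using False by(simp flip: power_add)
   hence "of_nat ((k+m) choose j) * (q g * g) ^ j * ?s ^ (k + m - j) =
     (of_nat ((k+m) choose j) * (q g * g) ^ j * ?s ^ (k - j)) * ?s ^ m"
    by(simp add: mult.assoc)
   thus ?thesis using m gp cp
    by(auto intro!: Q(2) polyfuns_mult[OF I] polyfuns_power[OF I])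
  qed
  have "sum f A : Q" if "!!j. j : A ==> f j : Q" for A :: "nat set" and f
   using that by(induction A rule: infinite_finite_induct) (auto intro: Q)
  from this[of "{..k+m}", OF t] show ?thesis by simp
 qed
 finally show ?case using insert.hyps by(intro exI[of _ "k + m"]) simp
qed

lemma cof_mono: "I \<subseteq> J ==> cof I \<subseteq> cof J"
 by(auto simp: cof_def)

text \<open>Flatness of \<open>E\<close> over the coefficient ring: \<open>E \<inter> van A = A E\<close>.\<close>

lemma bd_points_flat:
 fixes E :: "(base fls ^ 'n) set"
 assumes I: "is_ideal I" and E: "E : bd_points I N x" and A: "is_ideal A" "I \<subseteq> A"
  and e: "e : E" "e : van A"
 shows "EX us c. set us \<subseteq> E \<and> (ALL a<length us. c a : A) \<and> e - lcomb c us : van I"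
proof -
 have Es: "submod I E" "E \<subseteq> rat_vecs I N x" "locally_free I E"
  "!!v. v : rat_vecs I N x ==> EX m. divisor_eq N x ^ m *s v : E"
  using E by(auto simp: bd_points_def)
 define P where "P v \<longleftrightarrow> (EX us c. set us \<subseteq> E \<and> (ALL a<length us. c a : A) \<and> v - lcomb c us : van I)" for v
 have P_add: "P (u + v)" if Pu: "P u" and Pv: "P v" for u v
 proof -
  obtain us c ws d where 1: "set us \<subseteq> E" "ALL a<length us. c a : A" "u - lcomb c us : van I"
   "set ws \<subseteq> E" "ALL a<length ws. d a : A" "v - lcomb d ws : van I" using Pu Pv unfolding P_def by blast
  define e where "e a = (if a < length us then c a else d (a - length us))" for a
  have "lcomb e (us @ ws) = lcomb c us + lcomb d ws"
   by(rule lcomb_append_eq) (auto simp: e_def)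
  hence "u + v - lcomb e (us @ ws) : van I" using van_add[OF I 1(3,6)] by(simp add: algebra_simps)
  thus ?thesis using 1 unfolding P_def
   by(intro exI[of _ "us @ ws"] exI[of _ e]) (auto simp: e_def)
 qed
 have P_van: "P v" if "v : van I" for v
  using that unfolding P_def by(intro exI[of _ "[]"]) (simp add: lcomb_def)
 have P_smult: "P (F *s v)" if F: "F : polyfuns I" and Pv: "P v" for F v
 proof -
  obtain us c where 1: "set us \<subseteq> E" "ALL a<length us. c a : A" "v - lcomb c us : van I"
   using Pv unfolding P_def by blast
  have "lcomb c (map ((*s) F) us) = F *s lcomb c us"
   by(subst lcomb_map[where g = "%c. c"]) (auto simp: smult_add smult_assoc mult.commute)
  hence "F *s v - lcomb c (map ((*s) F) us) : van I"
   using van_smult[OF I 1(3), of F] by(simp add: smult_diff)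
  thus ?thesis using 1 submod_smult[OF Es(1) F] unfolding P_def
   by(intro exI[of _ "map ((*s) F) us"] exI[of _ c]) auto
 qed
 have P_sum: "P (sum f S)" if "!!x. x : S ==> P (f x)" for f and S :: "'s set"
  using that by(induction S rule: infinite_finite_induct) (auto intro: P_add P_van van_zero[OF I])
 have P_coef: "P (c *s v)" if c: "c : polyfuns I" "c : cof A" and v: "v : E" for c v
 proof -
  define K where "K = nat (- fls_subdegree c)"
  have low: "fls_nth c j : I" if "j < - int K" for j
  proof -
   have "j < fls_subdegree c" using that by(auto simp: K_def split: if_splits)
   thus ?thesis using I by(simp add: ideal_zero)
  qed
  define s where "s = (\<Sum>k\<le>K. fls_const (fls_nth c (- int k)) * fls_X_inv ^ k)"
  have 1: "P ((c - s) *s v)"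
   unfolding s_def by(rule P_van[OF van_smult_left[OF I polyfuns_expand[OF I c(1) low]]])
  have "P (a *c w)" if "a : A" "w : E" for a w
   unfolding P_def using that van_zero[OF I]
   by(intro exI[of _ "[w]"] exI[of _ "%_. a"]) (auto simp: lcomb_def)
  moreover have "s *s v = (\<Sum>k\<le>K. (fls_nth c (- int k)) *c (fls_X_inv ^ k *s v))"
   by(simp add: s_def smult_sum_left smult_assoc)
  ultimately have "P (s *s v)"
   using c(2) submod_smult[OF Es(1) polyfuns_power[OF I polyfuns_X_inv[OF I]] v]
   by(auto simp: cof_def intro!: P_sum)
  from P_add[OF 1 this] show ?thesis by(simp add: add_smult[symmetric])
 qed
 obtain G q where G: "finite G" "G \<subseteq> polyfuns I" "ALL g:G. q g : polyfuns I"
  "(\<Sum>g\<in>G. q g * g) - 1 : cof I" "ALL g:G. EX b. loc_basis I E g b"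
  using Es(3) unfolding locally_free_iff by blast
 \<comment> \<open>Locally \<open>e\<close> is a combination of a basis. Modulo \<open>A\<close> the
   vector vanishes, so \<open>recov\<close> puts its coefficients into \<open>cof A\<close> after
   multiplication by a power of \<open>g\<close>. The power of the divisor equation cancels, since
   that series is invertible.\<close>
 have pw: "EX m. g ^ m : {\<gamma> : polyfuns I. P (\<gamma> *s e)}" if g: "g : G" for g
 proof -
  have gp: "g : polyfuns I" using G(2) g by blast
  obtain b where b: "loc_basis I E g b" using G(5) g by blast
  obtain a K C where C: "recov I b (g ^ a * divisor_eq N x ^ K) C"
   using loc_basis_recov[OF I Es(1,2,4) b gp] by blast
  hence C': "recov A b (g ^ a * divisor_eq N x ^ K) C"
   using cof_mono[OF A(2)] unfolding recov_def by blast
  obtain m c where c: "ALL i. c i : polyfuns I" "g ^ m *s e - (\<Sum>i\<in>UNIV. c i *s b i) : van I"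
   using b e(1) unfolding loc_basis_def by blast
  have "(\<Sum>i\<in>UNIV. c i *s b i) : van A"
   using csub_cong[OF csub_self_van[OF A(1)]] van_smult[OF A(1) e(2)] c(2) van_mono[OF A(2)] by blast
  hence "g ^ a * divisor_eq N x ^ K * c l : cof A" for l
   by(rule recov_coeff[OF A(1) C'])
  hence "dinv N x ^ K * (g ^ a * divisor_eq N x ^ K * c l) : cof A" for l
   using ideal_mult[OF cof_ideal[OF A(1)]] by blast
  moreover have "dinv N x ^ K * (g ^ a * divisor_eq N x ^ K * c l) = g ^ a * c l" for l
  proof -
   have "g ^ a * divisor_eq N x ^ K * c l = divisor_eq N x ^ K * (g ^ a * c l)" by(simp only: mult_ac)
   thus ?thesis by(simp only: dinv_pow2)
  qed
  ultimately have ca: "g ^ a * c l : cof A" for l by metis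
  have "g ^ a *s (g ^ m *s e) - (\<Sum>i\<in>UNIV. (g ^ a * c i) *s b i) : van I"
   using van_smult[OF I c(2), of "g ^ a"] by(simp add: smult_diff smult_sum_right smult_assoc)
  moreover have "P (\<Sum>i\<in>UNIV. (g ^ a * c i) *s b i)"
   using b c(1) gp by(intro P_sum P_coef ca polyfuns_mult[OF I] polyfuns_power[OF I]) (auto simp: loc_basis_def)
  ultimately have "P ((g ^ a *s (g ^ m *s e) - (\<Sum>i\<in>UNIV. (g ^ a * c i) *s b i)) + (\<Sum>i\<in>UNIV. (g ^ a * c i) *s b i))"
   using P_add P_van by blast
  hence "P (g ^ (a + m) *s e)" by(simp add: smult_assoc power_add)
  thus ?thesis using polyfuns_power[OF I gp] by blast
 qed
 have "EX m. (\<Sum>g\<in>G. q g * g) ^ m : {\<gamma> : polyfuns I. P (\<gamma> *s e)}"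
 proof(rule comaximal_powers[OF I G(1,2)])
  show "q g : polyfuns I" if "g : G" for g using G(3) that by blast
  show "a + b : {\<gamma> : polyfuns I. P (\<gamma> *s e)}" if "a : {\<gamma> : polyfuns I. P (\<gamma> *s e)}" "b : {\<gamma> : polyfuns I. P (\<gamma> *s e)}" for a b
   using that P_add by(auto simp: add_smult intro: polyfuns_add[OF I])
  show "a * b : {\<gamma> : polyfuns I. P (\<gamma> *s e)}" if "a : polyfuns I" "b : {\<gamma> : polyfuns I. P (\<gamma> *s e)}" for a b
   using that P_smult[of a "b *s e"] by(auto simp: smult_assoc intro: polyfuns_mult[OF I])
  show "0 : {\<gamma> : polyfuns I. P (\<gamma> *s e)}"
   using P_van[OF van_zero[OF I]] polyfuns_zero[OF I] by simp
 qed (rule pw)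
 then obtain m where m: "P ((\<Sum>g\<in>G. q g * g) ^ m *s e)" by blast
 have "(\<Sum>g\<in>G. q g * g) ^ m - 1 ^ m : cof I"
  by(rule cong_power[OF cof_ideal[OF I] G(4)])
 hence "(1 - (\<Sum>g\<in>G. q g * g) ^ m) *s e : van I"
  using cong_sym[OF cof_ideal[OF I]] by(intro van_smult_left[OF I]) auto
 from P_add[OF P_van[OF this] m] have "P e"
  by(simp add: add_smult[symmetric])
 thus ?thesis by(simp add: P_def)
qed

no_notation fps_nth (infixl "$" 75)

section \<open>Base change of points\<close>

lemma base_change_rat:
 assumes I: "is_ideal I" and J: "is_ideal J" and h: "ring_map h" "h ` I \<subseteq> J"
 shows "base_change h J (rat_vecs I N x) = (rat_vecs J N (h o x) :: (base fls ^ 'n) set)"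
proof
 show "base_change h J (rat_vecs I N x) \<subseteq> (rat_vecs J N (h o x) :: (base fls ^ 'n) set)"
 proof(rule base_change_least[OF submod_csub[OF J rat_vecs_submod[OF J]]])
  fix v :: "base fls ^ 'n" assume "v : rat_vecs I N x"
  then obtain M where "v : Om I N x M" using rat_vecs_Om[OF I, of v] by blast
  from vmap_Om[OF h this] show "vmap h v : rat_vecs J N (h o x)"
   using rat_vecs_Om[OF J, of "vmap h v"] by blast
 qed
 show "(rat_vecs J N (h o x) :: (base fls ^ 'n) set) \<subseteq> base_change h J (rat_vecs I N x)"
 proof
  fix v :: "base fls ^ 'n" assume "v : rat_vecs J N (h o x)"
  then obtain M where "v : Om J N (h o x) M" using rat_vecs_Om[OF J, of v] by blast
  hence "v : base_change h J (Om I N x M)"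
   using base_change_Om[OF J I h, of N "h o x" x M] ideal_zero[OF J] by auto
  moreover have "Om I N x M \<subseteq> (rat_vecs I N x :: (base fls ^ 'n) set)"
   using rat_vecs_Om[OF I] by blast
  ultimately show "v : base_change h J (rat_vecs I N x)" using base_change_mono[OF J] by blast
 qed
qed

lemma rat_vecs_cong:
 assumes "is_ideal I" "!!i. i < N ==> x i - x' i : I"
 shows "rat_vecs I N x = (rat_vecs I N x' :: ('a::comm_ring_1 fls ^ 'n) set)"
proof -
 have "(v : rat_vecs I N x) = (v : rat_vecs I N x')" for v :: "'a fls ^ 'n"
  unfolding rat_vecs_Om[OF assms(1)] using Om_cong[of I N x x'] assms by blast
 thus ?thesis by blast
qed

lemma bd_points_cong:
 assumes "is_ideal I" "!!i. i < N ==> x i - x' i : I"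
 shows "bd_points I N x = (bd_points I N x' :: (base fls ^ 'n) set set)"
proof -
 have "divisor_eq N x ^ m *s v : E \<longleftrightarrow> divisor_eq N x' ^ m *s v : E" if "submod I E" for m v and E :: "(base fls ^ 'n) set"
 proof -
  have "divisor_eq N x ^ m - divisor_eq N x' ^ m : cof I"
   by(intro cong_power cof_ideal divisor_cong assms)
  hence "divisor_eq N x ^ m *s v - divisor_eq N x' ^ m *s v : van I"
   using van_smult_left[OF assms(1)] by(simp add: diff_smult[symmetric])
  thus ?thesis using csub_van[OF submod_csub[OF assms(1) that]] csub_cong[OF submod_csub[OF assms(1) that]] by blast
 qed
 hence "E : bd_points I N x \<longleftrightarrow> E : bd_points I N x'" for E :: "(base fls ^ 'n) set"
  unfolding bd_points_def using rat_vecs_cong[of I N x x'] assms by(cases "submod I E") auto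
 thus ?thesis by blast
qed

lemma gr1_points_cong:
 assumes "is_ideal I" "!!i. i < N ==> x i - x' i : I"
 shows "gr1_points I N x = (gr1_points I N x' :: (base fls ^ 'n) set set)"
proof -
 have "gr1_points I N x \<subseteq> (gr1_points I N x' :: (base fls ^ 'n) set set)"
  if x: "!!i. i < N ==> x i - x' i : I" for x x'
 proof
  fix E :: "(base fls ^ 'n) set" assume E: "E : gr1_points I N x"
  have "has_degree (local_lattice N (tht o x') c (vmap tht ` E)) (card {i. i < N \<and> tht (x' i) = c})"
   if t: "alg_hom id tht" "tht ` I \<subseteq> {0}" for tht c
  proof -
   have eq: "tht (x i) = tht (x' i)" if "i < N" for i
    using x[OF that] t ring_map.diff[OF alg_hom_id_ring_map[OF t(1)], of "x i" "x' i"] by auto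
   have "divisor_eq N (tht o x) = divisor_eq N (tht o x')"
    unfolding divisor_eq_def by(rule prod.cong) (auto simp: eq)
   moreover have "(\<Prod>i<N. fls_X + fls_const (c - (tht o x) i)) = (\<Prod>i<N. fls_X + fls_const (c - (tht o x') i))" for c
    by(rule prod.cong) (auto simp: eq)
   ultimately have "local_lattice N (tht o x) c (vmap tht ` E) = local_lattice N (tht o x') c (vmap tht ` E)"
    unfolding local_lattice_def vexpands_def expands_def by simp
   moreover have "{i. i < N \<and> tht (x i) = c} = {i. i < N \<and> tht (x' i) = c}" using eq by auto
   moreover have "has_degree (local_lattice N (tht o x) c (vmap tht ` E)) (card {i. i < N \<and> tht (x i) = c})"
    using E t unfolding gr1_points_def by blast
   ultimately show ?thesis by metis
  qed
  thus "E : gr1_points I N x'"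
   using E bd_points_cong[OF assms(1), of N x x'] x unfolding gr1_points_def by auto
 qed
 from this[of x x'] this[of x' x] show ?thesis using assms cong_sym[OF assms(1)] by blast
qed

text \<open>One exponent serves a whole \<open>Om\<close>, because it is generated by finitely many
  vectors. In this uniform form the condition passes to base changes.\<close>

lemma bd_points_absorb:
 fixes E :: "(base fls ^ 'n) set"
 assumes I: "is_ideal I" and E: "E : bd_points I N x"
 shows "EX K. ALL M. ALL v:Om I N x M. divisor_eq N x ^ (K + M) *s v : E"
proof -
 have Es: "submod I E" "!!v. v : rat_vecs I N x ==> EX m. divisor_eq N x ^ m *s v : E"
  using E by(auto simp: bd_points_def)
 have ax: "axis i 1 : rat_vecs I N x" for i
  using rat_vecs_Om[OF I, of "axis i 1" N x]
  by(auto simp: Om_0 poly_vecs_def axis_def polyfuns_one[OF I] polyfuns_zero[OF I] intro!: exI[of _ 0])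
 have "EX K. ALL i. divisor_eq N x ^ K *s axis i 1 : E"
 proof(rule uniform_exponent)
  show "EX m. divisor_eq N x ^ m *s axis i 1 : E" for i using Es(2)[OF ax] by blast
  fix m m' :: nat and i assume "divisor_eq N x ^ m *s axis i 1 : E" "m \<le> m'"
  hence "divisor_eq N x ^ (m' - m) *s (divisor_eq N x ^ m *s axis i 1) : E"
   using submod_smult[OF Es(1) polyfuns_power[OF I polyfuns_divisor[OF I]]] by blast
  thus "divisor_eq N x ^ m' *s axis i 1 : E"
   using \<open>m \<le> m'\<close> by(simp add: smult_assoc power_add[symmetric])
 qed
 then obtain K where K: "!!i. divisor_eq N x ^ K *s axis i 1 : E" by blast
 have "divisor_eq N x ^ (K + M) *s v : E" if v: "v : Om I N x M" for M v
 proof -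
  let ?w = "divisor_eq N x ^ M *s v"
  have w: "?w $ i : polyfuns I" for i using v by(simp add: Om_def poly_vecs_def)
  have "divisor_eq N x ^ (K + M) *s v = divisor_eq N x ^ K *s ?w"
   by(simp only: smult_assoc power_add)
  also have "\<dots> = divisor_eq N x ^ K *s (\<Sum>i\<in>UNIV. ?w $ i *s axis i 1)"
   using axis_decomp[of ?w] by(rule arg_cong)
  also have "\<dots> = (\<Sum>i\<in>UNIV. ?w $ i *s (divisor_eq N x ^ K *s axis i 1))"
   by(simp only: smult_sum_right smult_assoc mult.commute)
  also have "\<dots> : E"
   by(intro csub_sum[OF submod_csub[OF I Es(1)]] submod_smult[OF Es(1) w] K)
  finally show ?thesis .
 qed
 thus ?thesis by blast
qed

text \<open>Generation passes to linear combinations of images. Independence is not linear in this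
  sense and is instead read off from the identity \<open>recov\<close>, to which \<open>h\<close> is
  applied.\<close>

lemma loc_basis_base_change:
 fixes E :: "(base fls ^ 'n) set"
 assumes I: "is_ideal I" and J: "is_ideal J" and h: "ring_map h" "h ` I \<subseteq> J"
  and E: "submod I E" "E \<subseteq> rat_vecs I N x" "!!v. v : rat_vecs I N x ==> EX m. divisor_eq N x ^ m *s v : E"
  and g: "g : polyfuns I" and b: "loc_basis I E g b"
 shows "loc_basis J (base_change h J E) (fls_map h g) (%i. vmap h (b i))"
proof -
 interpret h: ring_map h by(rule h(1))
 interpret H: ring_map "fls_map h" by(rule h.ring_map_fls)
 let ?g = "fls_map h g" and ?b = "%i. vmap h (b i)"
 have gJ: "?g : polyfuns J" using g h(2) by(auto simp: polyfuns_def h.map_nth)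
 have bE: "b i : E" for i using b by(auto simp: loc_basis_def)
 define Q where "Q v \<longleftrightarrow> (EX m c. (ALL i. c i : polyfuns J) \<and> ?g ^ m *s v - (\<Sum>i\<in>UNIV. c i *s ?b i) : van J)" for v
 have up: "EX c. (ALL i. c i : polyfuns J) \<and> ?g ^ (d + m) *s v - (\<Sum>i\<in>UNIV. c i *s ?b i) : van J"
  if c: "ALL i. c i : polyfuns J" "?g ^ m *s v - (\<Sum>i\<in>UNIV. c i *s ?b i) : van J" for m c d v
 proof -
  have "?g ^ d *s (?g ^ m *s v - (\<Sum>i\<in>UNIV. c i *s ?b i)) : van J" by(rule van_smult[OF J c(2)])
  hence "?g ^ (d + m) *s v - (\<Sum>i\<in>UNIV. (?g ^ d * c i) *s ?b i) : van J"
   by(simp add: smult_diff smult_sum_right smult_assoc power_add)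
  thus ?thesis
   using polyfuns_mult[OF J polyfuns_power[OF J gJ]] c(1) by(intro exI[of _ "%i. ?g ^ d * c i"]) blast
 qed
 have cs: "csub J {v. Q v}"
  unfolding csub_def
 proof(intro conjI ballI allI J)
  show "van J \<subseteq> {v. Q v}"
   using van_smult[OF J] polyfuns_zero[OF J] by(auto simp: Q_def intro!: exI[of _ 0] exI[of _ "%_. 0"])
  fix u v assume "u : {v. Q v}" "v : {v. Q v}"
  then obtain m c m' c' where 1: "ALL i. c i : polyfuns J" "?g ^ m *s u - (\<Sum>i\<in>UNIV. c i *s ?b i) : van J"
   "ALL i. c' i : polyfuns J" "?g ^ m' *s v - (\<Sum>i\<in>UNIV. c' i *s ?b i) : van J" unfolding Q_def by blast
  obtain d where d: "ALL i. d i : polyfuns J" "?g ^ (m' + m) *s u - (\<Sum>i\<in>UNIV. d i *s ?b i) : van J"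
   using up[OF 1(1,2)] by blast
  obtain d' where d': "ALL i. d' i : polyfuns J" "?g ^ (m + m') *s v - (\<Sum>i\<in>UNIV. d' i *s ?b i) : van J"
   using up[OF 1(3,4)] by blast
  have "?g ^ (m + m') *s (u + v) - (\<Sum>i\<in>UNIV. (d i + d' i) *s ?b i) : van J"
   using van_add[OF J d(2) d'(2)]
   by(simp add: smult_add add_smult sum.distrib algebra_simps)
  moreover have "ALL i. d i + d' i : polyfuns J" using d(1) d'(1) polyfuns_add[OF J] by blast
  ultimately show "u + v : {v. Q v}" unfolding Q_def mem_Collect_eq by(intro exI conjI)
 next
  fix k v assume "v : {v. Q v}"
  then obtain m c where 1: "ALL i. c i : polyfuns J" "?g ^ m *s v - (\<Sum>i\<in>UNIV. c i *s ?b i) : van J"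
   unfolding Q_def by blast
  have "k *c (?g ^ m *s v - (\<Sum>i\<in>UNIV. c i *s ?b i)) : van J" by(rule van_smult[OF J 1(2)])
  hence "?g ^ m *s (k *c v) - (\<Sum>i\<in>UNIV. (fls_const k * c i) *s ?b i) : van J"
   by(simp add: smult_diff smult_sum_right smult_assoc mult.commute)
  moreover have "ALL i. fls_const k * c i : polyfuns J" using 1(1) polyfuns_mult[OF J polyfuns_const[OF J]] by blast
  ultimately show "k *c v : {v. Q v}" unfolding Q_def mem_Collect_eq by(intro exI conjI)
 qed
 have "Q (vmap h u)" if "u : E" for u
 proof -
  obtain m c where c: "ALL i. c i : polyfuns I" "g ^ m *s u - (\<Sum>i\<in>UNIV. c i *s b i) : van I"
   using b \<open>u : E\<close> unfolding loc_basis_def by blast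
  have "vmap h (g ^ m *s u - (\<Sum>i\<in>UNIV. c i *s b i)) : van J" by(rule h.vmap_van[OF h(2) c(2)])
  hence "?g ^ m *s vmap h u - (\<Sum>i\<in>UNIV. fls_map h (c i) *s ?b i) : van J"
   by(simp add: h.vmap_diff h.vmap_sum h.vmap_smult H.power)
  moreover have "fls_map h (c i) : polyfuns J" for i
   using c(1) h(2) by(force simp: polyfuns_def h.map_nth)
  ultimately show ?thesis unfolding Q_def by(intro exI[of _ m] exI[of _ "%i. fls_map h (c i)"]) blast
 qed
 hence gen: "Q v" if "v : base_change h J E" for v
  using base_change_least[OF cs, of E h] that by blast
 obtain a K C where "recov I b (g ^ a * divisor_eq N x ^ K) C"
  using loc_basis_recov[OF I E b g] by blast
 hence C: "recov J ?b (?g ^ a * divisor_eq N (h o x) ^ K) (%i l. fls_map h (C i l))"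
  unfolding recov_def
 proof(intro allI)
  fix j l assume "ALL j l. g ^ a * divisor_eq N x ^ K * (if j = l then 1 else 0) - (\<Sum>i\<in>UNIV. b j $ i * C i l) : cof I"
  hence "fls_map h (g ^ a * divisor_eq N x ^ K * (if j = l then 1 else 0) - (\<Sum>i\<in>UNIV. b j $ i * C i l)) : cof J"
   by(intro h.map_cof[OF h(2)]) blast
  moreover have "fls_map h (if j = l then 1 else 0) = (if j = l then 1 else 0)" by(simp add: H.one H.zero)
  ultimately show "?g ^ a * divisor_eq N (h o x) ^ K * (if j = l then 1 else 0) - (\<Sum>i\<in>UNIV. ?b j $ i * fls_map h (C i l)) : cof J"
   by(simp only: H.diff H.mult H.power H.sum h.map_divisor h.vmap_nth)
 qed
 have ind: "EX m. ALL i j. fls_nth (?g ^ m * c i) j : J" if "(\<Sum>i\<in>UNIV. c i *s ?b i) : van J" for c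
 proof -
  have "?g ^ a * c l : cof J" for l
  proof -
   have "dinv N (h o x) ^ K * (?g ^ a * divisor_eq N (h o x) ^ K * c l) : cof J"
    using recov_coeff[OF J C that] ideal_mult[OF cof_ideal[OF J]] by blast
   moreover have "?g ^ a * divisor_eq N (h o x) ^ K * c l = divisor_eq N (h o x) ^ K * (?g ^ a * c l)"
    by(simp only: mult_ac)
   ultimately show ?thesis by(simp only: dinv_pow2)
  qed
  thus ?thesis unfolding cof_def by blast
 qed
 show ?thesis unfolding loc_basis_def
 proof(intro conjI ballI allI impI)
  show "range ?b \<subseteq> base_change h J E" using base_change_mem[OF J bE] by blast
  show "EX m c. (ALL i. c i : polyfuns J) \<and> ?g ^ m *s v - (\<Sum>i\<in>UNIV. c i *s ?b i) : van J"
   if "v : base_change h J E" for v using gen[OF that] by(simp only: Q_def)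
  show "EX m. ALL i j. fls_nth (?g ^ m * c i) j : J"
   if "(ALL i. c i : polyfuns J) \<and> (\<Sum>i\<in>UNIV. c i *s ?b i) : van J" for c
   using ind that by blast
 qed
qed

lemma locally_free_base_change:
 fixes E :: "(base fls ^ 'n) set"
 assumes I: "is_ideal I" and J: "is_ideal J" and h: "ring_map h" "h ` I \<subseteq> J"
  and E: "E : bd_points I N x"
 shows "locally_free J (base_change h J E)"
proof -
 interpret h: ring_map h by(rule h(1))
 interpret H: ring_map "fls_map h" by(rule h.ring_map_fls)
 have Es: "submod I E" "E \<subseteq> rat_vecs I N x" "locally_free I E"
  "!!v. v : rat_vecs I N x ==> EX m. divisor_eq N x ^ m *s v : E"
  using E by(auto simp: bd_points_def)
 obtain G q where G: "finite G" "G \<subseteq> polyfuns I" "ALL g:G. q g : polyfuns I"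
  "(\<Sum>g\<in>G. q g * g) - 1 : cof I" "ALL g:G. EX b. loc_basis I E g b"
  using Es(3) unfolding locally_free_iff by blast
 have pol: "fls_map h F : polyfuns J" if "F : polyfuns I" for F
  using that h(2) by(force simp: polyfuns_def h.map_nth)
 \<comment> \<open>The map may identify several members of \<open>G\<close>, so their cofactors are
   added up.\<close>
 define q' where "q' g' = (\<Sum>g\<in>{g:G. fls_map h g = g'}. fls_map h (q g))" for g'
 have "(\<Sum>g'\<in>fls_map h ` G. q' g' * g') = (\<Sum>g'\<in>fls_map h ` G. \<Sum>g\<in>{g:G. fls_map h g = g'}. fls_map h (q g * g))"
  unfolding q'_def sum_distrib_right by(intro sum.cong) (auto simp: H.mult)
 also have "\<dots> = (\<Sum>g\<in>G. fls_map h (q g * g))" by(rule sum.image_gen[OF G(1), symmetric])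
 also have "\<dots> - 1 = fls_map h ((\<Sum>g\<in>G. q g * g) - 1)" by(simp add: H.diff H.sum H.one)
 also have "\<dots> : cof J" by(rule h.map_cof[OF h(2) G(4)])
 finally have 1: "(\<Sum>g'\<in>fls_map h ` G. q' g' * g') - 1 : cof J" .
 have 2: "q' g' : polyfuns J" for g'
  unfolding q'_def using G(3) by(intro polyfuns_sum[OF J] pol) auto
 have 3: "EX b. loc_basis J (base_change h J E) g' b" if "g' : fls_map h ` G" for g'
  using that loc_basis_base_change[OF I J h Es(1,2,4)] G(2,5) by blast
 show ?thesis unfolding locally_free_iff
  using G(1,2) 1 2 3 pol by(intro exI[of _ "fls_map h ` G"]) blast
qed

lemma bd_points_base_change:
 fixes E :: "(base fls ^ 'n) set"
 assumes I: "is_ideal I" and J: "is_ideal J" and h: "ring_map h" "h ` I \<subseteq> J"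
  and E: "E : bd_points I N x"
 shows "base_change h J E : bd_points J N (h o x)"
proof -
 have Es: "submod I E" "E \<subseteq> rat_vecs I N x" using E by(auto simp: bd_points_def)
 have S: "submod J (base_change h J E)" by(rule base_change_submod[OF J h(1) I Es(1)])
 have "base_change h J E \<subseteq> rat_vecs J N (h o x)"
  using base_change_mono[OF J Es(2)] base_change_rat[OF I J h] by blast
 moreover have "EX m. divisor_eq N (h o x) ^ m *s v : base_change h J E" if v: "v : rat_vecs J N (h o x)" for v
 proof -
  obtain M where "v : Om J N (h o x) M" using v rat_vecs_Om[OF J, of v] by blast
  hence "v : base_change h J (Om I N x M)"
   using base_change_Om[OF J I h, of N "h o x" x M] ideal_zero[OF J] by auto
  moreover obtain K where K: "!!u. u : Om I N x M ==> divisor_eq N x ^ (K + M) *s u : E"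
   using bd_points_absorb[OF I E] by blast
  have "csub J {v. divisor_eq N (h o x) ^ (K + M) *s v : base_change h J E}"
   using J base_change_csub[OF J, of h E] van_smult[OF J]
   by(auto simp: csub_def smult_add smult_assoc mult.commute)
    (metis mult.commute smult_assoc)
  moreover have "vmap h u : {v. divisor_eq N (h o x) ^ (K + M) *s v : base_change h J E}" if "u : Om I N x M" for u
   using base_change_mem[OF J K[OF that], of h]
   by(simp add: ring_map.vmap_smult[OF h(1)] ring_map.power[OF ring_map.ring_map_fls[OF h(1)]] ring_map.map_divisor[OF h(1)])
  ultimately show ?thesis using base_change_least by blast
 qed
 ultimately show ?thesis
  using S locally_free_base_change[OF I J h E] by(simp add: bd_points_def)
qed

lemma gr1_points_base_change:
 fixes E :: "(base fls ^ 'n) set"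
 assumes I: "is_ideal I" and J: "is_ideal J" and h: "alg_hom cst h" "h ` I \<subseteq> J"
  and E: "E : gr1_points I N x" and x': "!!i. i < N ==> x' i - h (x i) : J"
 shows "base_change h J E : gr1_points J N x'"
proof -
 have rh: "ring_map h" by(rule alg_hom_ring_map[OF h(1)])
 have Es: "submod I E" "E : bd_points I N x" using E by(auto simp: gr1_points_def bd_points_def)
 have "has_degree (local_lattice N (tht o (h o x)) c (vmap tht ` base_change h J E)) (card {i. i < N \<and> tht ((h o x) i) = c})"
  if t: "alg_hom id tht" "tht ` J \<subseteq> {0}" for tht c
 proof -
  let ?tht = "%a. tht (h a)"
  have "alg_hom id ?tht" "?tht ` I \<subseteq> {0}" using t h by(auto simp: alg_hom_def)
  hence "has_degree (local_lattice N (?tht o x) c (vmap ?tht ` E)) (card {i. i < N \<and> ?tht (x i) = c})"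
   using E unfolding gr1_points_def by blast
  thus ?thesis
   unfolding vmap_base_change[OF J h(1) submod_csub[OF I Es(1)] t] by(simp add: comp_def)
 qed
 hence "base_change h J E : gr1_points J N (h o x)"
  using bd_points_base_change[OF I J rh h(2) Es(2)] unfolding gr1_points_def by auto
 thus ?thesis using gr1_points_cong[OF J, of N "h o x" x'] x' cong_sym[OF J] by auto
qed

section \<open>Base change of frames\<close>

lemma frame_base_change_gen:
 assumes J: "is_ideal J" and h: "ring_map h" and f: "frame I A B us" and v: "v : base_change h J A"
 shows "EX c. v - lcomb c (map (vmap h) us) : base_change h J B"
proof -
 note cB = base_change_csub[OF J, of h B]
 have cs: "csub J {v. EX c. v - lcomb c (map (vmap h) us) : base_change h J B}"
  unfolding csub_def
 proof(intro conjI ballI allI J)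
  show "van J \<subseteq> {v. EX c. v - lcomb c (map (vmap h) us) : base_change h J B}"
   using csub_van[OF cB] by(auto simp: lcomb_zero intro!: exI[of _ "%_. 0"])
  fix u v assume "u : {v. EX c. v - lcomb c (map (vmap h) us) : base_change h J B}"
   "v : {v. EX c. v - lcomb c (map (vmap h) us) : base_change h J B}"
  then obtain c d where "u - lcomb c (map (vmap h) us) : base_change h J B"
   "v - lcomb d (map (vmap h) us) : base_change h J B" by blast
  from csub_add[OF cB this]
  have "u + v - lcomb (%a. c a + d a) (map (vmap h) us) : base_change h J B"
   by(simp add: lcomb_add algebra_simps)
  thus "u + v : {v. EX c. v - lcomb c (map (vmap h) us) : base_change h J B}" by blast
 next
  fix k v assume "v : {v. EX c. v - lcomb c (map (vmap h) us) : base_change h J B}"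
  then obtain c where "v - lcomb c (map (vmap h) us) : base_change h J B" by blast
  from csub_smult[OF cB this, of k]
  have "k *c v - lcomb (%a. k * c a) (map (vmap h) us) : base_change h J B"
   by(simp add: lcomb_smult smult_diff)
  thus "k *c v : {v. EX c. v - lcomb c (map (vmap h) us) : base_change h J B}" by blast
 qed
 have "vmap h u : {v. EX c. v - lcomb c (map (vmap h) us) : base_change h J B}" if u: "u : A" for u
 proof -
  obtain c where "u - lcomb c us : B" using frame_coords[OF f u] by blast
  hence "vmap h (u - lcomb c us) : base_change h J B" by(rule base_change_mem[OF J])
  moreover have "vmap h (lcomb c us) = lcomb (%a. h (c a)) (map (vmap h) us)"
   by(rule lcomb_map) (simp_all add: ring_map.vmap_add[OF h] ring_map.vmap_smult[OF h] ring_map.map_const[OF h])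
  ultimately show ?thesis by(auto simp: ring_map.vmap_diff[OF h])
 qed
 from base_change_least[OF cs this] v show ?thesis by blast
qed

lemma vmap_lcomb: "ring_map h ==> vmap h (lcomb c us) = lcomb (%a. h (c a)) (map (vmap h) us)"
 by(rule lcomb_map) (simp_all add: ring_map.vmap_add ring_map.vmap_smult ring_map.map_const)

section \<open>Monomial bases that stay independent after every base change\<close>

definition fin_list :: "'n::finite list" where
 "fin_list = (SOME js. distinct js \<and> set js = UNIV)"

lemma fin_list: "distinct (fin_list :: 'n::finite list)" "set (fin_list :: 'n::finite list) = UNIV"
proof -
 have "EX js. distinct js \<and> set js = (UNIV :: 'n set)"
  using finite_distinct_list[OF finite_class.finite_UNIV] by blast
 from someI_ex[OF this] show "distinct (fin_list :: 'n::finite list)" "set (fin_list :: 'n::finite list) = UNIV"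
  by(auto simp: fin_list_def)
qed

definition mon_list :: "nat => ('a::comm_ring_1 fls ^ 'n) list" where
 "mon_list K = map (%(k, i). fls_X_inv ^ k *s axis i 1) (List.product [0..<K] fin_list)"

lemma mon_list_coeff:
 fixes ms :: "('a::comm_ring_1 fls ^ 'n) list"
 assumes ms: "ms = mon_list K" and "t < length ms"
 shows "EX k i. ALL c. fls_nth ((lcomb c ms) $ i) (- int k) = c t"
proof -
 let ?L = "List.product [0..<K] (fin_list :: 'n list)"
 have L: "distinct ?L" by(simp add: distinct_product fin_list)
 have t: "t < length ?L" using assms(2) by(simp add: ms mon_list_def)
 obtain k i where ki: "?L ! t = (k, i)" by(cases "?L ! t")
 define q :: "nat \<times> 'n => 'a fls ^ 'n" where "q = (%(k, i). fls_X_inv ^ k *s axis i 1)"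
 have ms': "ms = map q ?L" by(simp add: ms mon_list_def q_def)
 have vs: "(\<Sum>a\<in>S. f a) $ i = (\<Sum>a\<in>S. f a $ i)" for S :: "nat set" and f :: "nat => 'a fls ^ 'n"
  by(induction S rule: infinite_finite_induct) auto
 have "fls_nth ((lcomb c ms) $ i) (- int k) = c t" for c
 proof -
  have "fls_nth ((lcomb c ms) $ i) (- int k) =
   (\<Sum>s<length ?L. c s * fls_nth (q (?L ! s) $ i) (- int k))"
   by(simp add: lcomb_def ms' vs fls_nth_sum)
  also have "\<dots> = (\<Sum>s<length ?L. if s = t then c t else 0)"
  proof(rule sum.cong[OF refl])
   fix s assume s: "s : {..<length ?L}"
   obtain k' i' where ki': "?L ! s = (k', i')" by(cases "?L ! s")
   have "(k, i) = (k', i') \<longleftrightarrow> s = t"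
    using nth_eq_iff_index_eq[OF L, of s t] s t ki ki' by auto
   thus "c s * fls_nth (q (?L ! s) $ i) (- int k) = (if s = t then c t else 0)"
    by(auto simp: ki' q_def axis_def X_inv_power_nth)
  qed
  also have "\<dots> = c t" using t by simp
  finally show ?thesis .
 qed
 thus ?thesis by blast
qed

lemma mon_list_indep:
 fixes ms :: "('a::comm_ring_1 fls ^ 'n) list"
 assumes ms: "ms = mon_list K" and J: "is_ideal J" and c: "lcomb c ms : van J"
  and t: "t < length ms"
 shows "c t : J"
proof -
 obtain k i where ki: "ALL c. fls_nth ((lcomb c ms) $ i) (- int k) = c t"
  using mon_list_coeff[OF ms t] by blast
 have "fls_nth ((lcomb c ms) $ i) (- int k) : J"
  using c by(simp add: van_def)
 thus ?thesis using ki by metis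
qed

lemma lcomb_span_csub:
 assumes I: "is_ideal I" shows "csub I {v. EX c. v - lcomb c us : van I}"
 unfolding csub_def
proof(intro conjI ballI allI I)
 show "van I \<subseteq> {v. EX c. v - lcomb c us : van I}"
  by(auto simp: lcomb_zero intro!: exI[of _ "%_. 0"])
 fix u v assume "u : {v. EX c. v - lcomb c us : van I}" "v : {v. EX c. v - lcomb c us : van I}"
 then obtain c d where "u - lcomb c us : van I" "v - lcomb d us : van I" by blast
 from van_add[OF I this] have "u + v - lcomb (%a. c a + d a) us : van I"
  by(simp add: lcomb_add algebra_simps)
 thus "u + v : {v. EX c. v - lcomb c us : van I}" by blast
next
 fix k v assume "v : {v. EX c. v - lcomb c us : van I}"
 then obtain c where "v - lcomb c us : van I" by blast
 from van_smult[OF I this, of "fls_const k"]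
 have "k *c v - lcomb (%a. k * c a) us : van I"
  by(simp add: lcomb_smult smult_diff)
 thus "k *c v : {v. EX c. v - lcomb c us : van I}" by blast
qed

lemma mon_list_span:
 fixes v :: "'a::comm_ring_1 fls ^ 'n"
 assumes I: "is_ideal I" and v: "v : poly_vecs I"
 shows "EX K0. \<forall>K\<ge>K0. EX c. v - lcomb c (mon_list K) : van I"
proof -
 have "EX m. ALL i. ALL j< - int m. fls_nth (v $ i) j = 0"
 proof(rule uniform_exponent)
  show "EX m. ALL j< - int m. fls_nth (v $ i) j = 0" for i
   by(rule exI[of _ "nat (- fls_subdegree (v $ i))"]) auto
 qed auto
 then obtain K0 where K0: "!!i j. j < - int K0 ==> fls_nth (v $ i) j = 0" by blast
 have "EX c. v - lcomb c (mon_list K) : van I" if K: "K \<ge> Suc K0" for K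
 proof -
  let ?S = "{v. EX c. v - lcomb c (mon_list K :: ('a fls ^ 'n) list) : van I}"
  note cs = lcomb_span_csub[OF I, of "mon_list K :: ('a fls ^ 'n) list"]
  have mem: "fls_X_inv ^ k *s axis i 1 : ?S" if "k < K" for k i
  proof -
   have "fls_X_inv ^ k *s axis i 1 : set (mon_list K :: ('a fls ^ 'n) list)"
    using that by(force simp: mon_list_def fin_list)
   then obtain t where t: "t < length (mon_list K :: ('a fls ^ 'n) list)" "(mon_list K :: ('a fls ^ 'n) list) ! t = fls_X_inv ^ k *s axis i 1"
    by(metis in_set_conv_nth)
   thus ?thesis using lcomb_delta[OF t(1)] van_zero[OF I] by(auto intro!: exI[of _ "%b. if b = t then 1 else 0"])
  qed
  define w where "w i = (\<Sum>k\<le>K0. fls_const (fls_nth (v $ i) (- int k)) * fls_X_inv ^ k)" for i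
  have "w i *s axis i 1 : ?S" for i
  proof -
   have "w i *s axis i 1 = (\<Sum>k\<le>K0. (fls_nth (v $ i) (- int k)) *c (fls_X_inv ^ k *s axis i 1))"
    by(simp only: w_def smult_sum_left smult_assoc)
   also have "\<dots> : ?S" using K by(intro csub_sum[OF cs] csub_smult[OF cs] mem) auto
   finally show ?thesis .
  qed
  moreover have "(v $ i - w i) *s axis i 1 : van I" for i
   unfolding w_def using v K0 ideal_zero[OF I]
   by(intro van_smult_left[OF I] polyfuns_expand[OF I]) (auto simp: poly_vecs_def)
  ultimately have "(v $ i - w i) *s axis i 1 + w i *s axis i 1 : ?S" for i
   using csub_add[OF cs csub_van[OF cs]] by blast
  hence "v $ i *s axis i 1 : ?S" for i by(simp add: add_smult[symmetric])
  hence "(\<Sum>i\<in>UNIV. v $ i *s axis i 1) : ?S" by(intro csub_sum[OF cs])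
  thus ?thesis using axis_decomp[of v] by simp
 qed
 thus ?thesis by blast
qed

lemma vmap_mon_list: "ring_map h ==> map (vmap h) (mon_list K) = mon_list K"
 by(auto simp: mon_list_def ring_map.vmap_smult vmap_axis ring_map.power[OF ring_map.ring_map_fls] ring_map.map_X_inv)

text \<open>The module \<open>Om I N x M\<close> is an increasing union of free modules on vectors
  z^k D^-M e_i, and a finite family lies in one of them. Images of such bases stay independent after
  every \<open>h\<close>, since z^k e_i remain monomials.\<close>

lemma Om_basis:
 fixes vs :: "(base fls ^ 'n) list"
 assumes I: "is_ideal I" and vs: "set vs \<subseteq> Om I N x M"
 shows "EX ps. set ps \<subseteq> Om I N x M \<and> (ALL v:set vs. EX c. v - lcomb c ps : van I) \<and>
  (ALL (h :: base => base) J c. ring_map h --> is_ideal J --> lcomb c (map (vmap h) ps) : van J --> (ALL a<length ps. c a : J))"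
proof -
 let ?D = "divisor_eq N x" and ?d = "dinv N x"
 have "EX K0. \<forall>K\<ge>K0. ALL v:set vs. EX c. ?D ^ M *s v - lcomb c (mon_list K) : van I"
  using vs
 proof(induction vs)
  case Nil
  show ?case by simp
 next
  case (Cons v vs)
  then obtain K0 K1 where "\<forall>K\<ge>K0. ALL v:set vs. EX c. ?D ^ M *s v - lcomb c (mon_list K) : van I"
   "\<forall>K\<ge>K1. EX c. ?D ^ M *s v - lcomb c (mon_list K) : van I"
   using mon_list_span[OF I, of "?D ^ M *s v"] by(auto simp: Om_def)
  thus ?case by(intro exI[of _ "max K0 K1"]) auto
 qed
 then obtain K where K: "!!v. v : set vs ==> EX c. ?D ^ M *s v - lcomb c (mon_list K) : van I" by blast
 define ps where "ps = map ((*s) (?d ^ M)) (mon_list K :: (base fls ^ 'n) list)"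
 have lc: "lcomb c (map ((*s) F) us) = F *s lcomb c us" for c F and us :: "(base fls ^ 'n) list"
  by(subst lcomb_map[where g = "%c. c"]) (auto simp: smult_add smult_assoc mult.commute)
 have 1: "set ps \<subseteq> Om I N x M"
 proof -
  have "u : poly_vecs I" if "u : set (mon_list K)" for u :: "base fls ^ 'n"
   using that polyfuns_power[OF I polyfuns_X_inv[OF I]] polyfuns_zero[OF I]
   by(auto simp: mon_list_def poly_vecs_def axis_def)
  thus ?thesis by(auto simp: ps_def Om_dinv)
 qed
 have 2: "EX c. v - lcomb c ps : van I" if v: "v : set vs" for v
 proof -
  obtain c where "?D ^ M *s v - lcomb c (mon_list K) : van I" using K[OF v] by blast
  from van_smult[OF I this, of "?d ^ M"] have "v - lcomb c ps : van I"
   by(simp add: ps_def lc smult_diff smult_assoc mult.commute dinv_pow)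
  thus ?thesis by blast
 qed
 have 3: "c a : J" if h: "ring_map h" and J: "is_ideal J" and c: "lcomb c (map (vmap h) ps) : van J" and a: "a < length ps" for h :: "base => base" and J c a
 proof -
  let ?d' = "dinv N (h o x)" and ?D' = "divisor_eq N (h o x)"
  have "map (vmap h) ps = map ((*s) (?d' ^ M)) (map (vmap h) (mon_list K))"
   by(simp add: ps_def ring_map.vmap_smult[OF h] map_dinv[OF h] ring_map.power[OF ring_map.ring_map_fls[OF h]])
  hence "?d' ^ M *s lcomb c (mon_list K) : (van J :: (base fls ^ 'n) set)" using c by(simp add: vmap_mon_list[OF h] lc)
  from van_smult[OF J this, of "?D' ^ M"] have "lcomb c (mon_list K) : (van J :: (base fls ^ 'n) set)"
   by(simp add: smult_assoc dinv_pow)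
  thus ?thesis using a by(intro mon_list_indep[OF refl J, of c K a]) (auto simp: ps_def)
 qed
 show ?thesis using 1 2 3 by(intro exI[of _ ps]) blast
qed

text \<open>Independence is expressed by matrices over a universally independent family
  \<open>ps\<close>: \<open>Z\<close> projects to the coordinates of A / B, while \<open>U\<close>
  and \<open>S\<close> express \<open>us\<close> and the elements \<open>es\<close> of
  \<open>B\<close> in \<open>ps\<close>. The identities U Z = 1 and S Z = 0 are preserved by
  \<open>h\<close>, and applied to a relation modulo the base change of \<open>B\<close> they kill
  its coefficients.\<close>

lemma frame_base_change_Om:
 fixes B :: "(base fls ^ 'n) set"
 assumes I: "is_ideal I" and J: "is_ideal J" and h: "ring_map h" "h ` I \<subseteq> J"
  and x: "!!i. i < N ==> x' i - h (x i) : J" and B: "csub I B" and f: "frame I (Om I N x M) B us"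
 shows "frame J (Om J N x' M) (base_change h J B) (map (vmap h) us)"
 unfolding frame_iff
proof(intro conjI ballI allI impI)
 interpret h: ring_map h by(rule h(1))
 have A': "(Om J N x' M :: (base fls ^ 'n) set) = base_change h J (Om I N x M)"
  by(rule base_change_Om[symmetric, of J I h N x' x M]) (use J I h x in auto)
 show "base_change h J B \<subseteq> Om J N x' M"
  unfolding A' using f by(intro base_change_mono[OF J]) (auto simp: frame_iff)
 show "set (map (vmap h) us) \<subseteq> Om J N x' M"
  unfolding A' using f by(auto simp: frame_iff intro!: base_change_mem[OF J])
 show "EX c. v - lcomb c (map (vmap h) us) : base_change h J B" if "v : Om J N x' M" for v
  using frame_base_change_gen[OF J h(1) f] that unfolding A' by blast
 fix c a assume c: "lcomb c (map (vmap h) us) : base_change h J B" and a: "a < length (map (vmap h) us)"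
 obtain es d where es: "set es \<subseteq> B" "lcomb c (map (vmap h) us) - lcomb d (map (vmap h) es) : van J"
  using c base_change_iff[OF J] by blast
 have "set (us @ es) \<subseteq> Om I N x M" using f es(1) by(auto simp: frame_iff)
 then obtain ps where ps: "set ps \<subseteq> Om I N x M" "ALL v:set (us @ es). EX c. v - lcomb c ps : van I"
  "!!c a. lcomb c (map (vmap h) ps) : van J ==> a < length ps ==> c a : J"
  using Om_basis[OF I, of "us @ es" N x M] h(1) J by blast
 have mat: "EX U. ALL t<length ws. ws ! t - lcomb (U t) ps : van I" if "set ws \<subseteq> set (us @ es)" for ws
 proof -
  have "ALL t. EX c. t < length ws --> ws ! t - lcomb c ps : van I"
   using ps(2) that nth_mem by(meson subsetD)
  from choice[OF this] show ?thesis by blast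
 qed
 obtain U where U: "!!t. t < length us ==> us ! t - lcomb (U t) ps : van I" using mat[of us] by auto
 obtain S where S: "!!t. t < length es ==> es ! t - lcomb (S t) ps : van I" using mat[of es] by auto
 obtain Z where Z: "!!p. p < length ps ==> ps ! p - lcomb (Z p) us : B"
  using frame_matrix[OF f ps(1)] by blast
 have vB: "van I \<subseteq> B" using csub_van[OF B] by blast
 have UZ: "(\<Sum>p<length ps. U t p * Z p b) - (if b = t then 1 else 0) : I" if t: "t < length us" "b < length us" for t b
 proof -
  have "lcomb (U t) ps - lcomb (%b. \<Sum>p<length ps. U t p * Z p b) us : B"
   by(rule lcomb_lcomb[OF B Z])
  hence "lcomb (%b. if b = t then 1 else 0) us - lcomb (%b. \<Sum>p<length ps. U t p * Z p b) us : B"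
   using U[OF t(1)] vB csub_trans[OF B] lcomb_delta[OF t(1)] by fastforce
  hence "lcomb (%b. \<Sum>p<length ps. U t p * Z p b) us - lcomb (%b. if b = t then 1 else 0) us : B"
   by(rule csub_sym[OF B])
  thus ?thesis by(rule frame_uniq[OF f B _ t(2)])
 qed
 have SZ: "(\<Sum>p<length ps. S t p * Z p b) : I" if t: "t < length es" "b < length us" for t b
 proof -
  have "lcomb (S t) ps - lcomb (%b. \<Sum>p<length ps. S t p * Z p b) us : B"
   by(rule lcomb_lcomb[OF B Z])
  hence "es ! t - lcomb (%b. \<Sum>p<length ps. S t p * Z p b) us : B"
   using S[OF t(1)] vB csub_trans[OF B] by blast
  moreover have "es ! t : B" using es(1) t(1) by auto
  ultimately have "lcomb (%b. \<Sum>p<length ps. S t p * Z p b) us : B" using csub_cong[OF B] by blast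
  thus ?thesis by(rule frame_indep[OF f _ t(2)])
 qed
 have hv: "map (vmap h) us ! t - lcomb (%p. h (U t p)) (map (vmap h) ps) : van J" if "t < length us" for t
  using h.vmap_van[OF h(2) U[OF that]] that by(simp add: h.vmap_diff vmap_lcomb[OF h(1)])
 have hS: "map (vmap h) es ! t - lcomb (%p. h (S t p)) (map (vmap h) ps) : van J" if "t < length es" for t
  using h.vmap_van[OF h(2) S[OF that]] that by(simp add: h.vmap_diff vmap_lcomb[OF h(1)])
 have 1: "lcomb c (map (vmap h) us) - lcomb (%p. \<Sum>t<length us. c t * h (U t p)) (map (vmap h) ps) : van J"
  using lcomb_lcomb[OF csub_self_van[OF J], of "map (vmap h) us"] hv by simp
 have 2: "lcomb d (map (vmap h) es) - lcomb (%p. \<Sum>t<length es. d t * h (S t p)) (map (vmap h) ps) : van J"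
  using lcomb_lcomb[OF csub_self_van[OF J], of "map (vmap h) es"] hS by simp
 have 3: "lcomb (%p. \<Sum>t<length us. c t * h (U t p)) (map (vmap h) ps) -
   lcomb (%p. \<Sum>t<length es. d t * h (S t p)) (map (vmap h) ps) : van J"
  using van_trans[OF J van_sym[OF J 1] van_trans[OF J es(2) 2]] .
 have eq: "(\<Sum>t<length us. c t * h (U t p)) - (\<Sum>t<length es. d t * h (S t p)) : J" if "p < length ps" for p
  using ps(3)[OF _ that, of "%p. (\<Sum>t<length us. c t * h (U t p)) - (\<Sum>t<length es. d t * h (S t p))"] 3
  by(simp add: lcomb_diff)
 have b: "a < length us" using a by simp
 have "(\<Sum>p<length ps. ((\<Sum>t<length us. c t * h (U t p)) - (\<Sum>t<length es. d t * h (S t p))) * h (Z p a)) : J"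
  by(intro ideal_sum[OF J] ideal_mult2[OF J] eq) simp
 also have "(\<Sum>p<length ps. ((\<Sum>t<length us. c t * h (U t p)) - (\<Sum>t<length es. d t * h (S t p))) * h (Z p a)) =
   (\<Sum>p<length ps. \<Sum>t<length us. c t * h (U t p * Z p a)) - (\<Sum>p<length ps. \<Sum>t<length es. d t * h (S t p * Z p a))"
  by(simp add: left_diff_distrib sum_subtractf sum_distrib_right h.mult mult.assoc)
 also have "(\<Sum>p<length ps. \<Sum>t<length us. c t * h (U t p * Z p a)) = (\<Sum>t<length us. c t * h (\<Sum>p<length ps. U t p * Z p a))"
  by(subst sum.swap) (simp add: h.sum sum_distrib_left)
 also have "(\<Sum>p<length ps. \<Sum>t<length es. d t * h (S t p * Z p a)) = (\<Sum>t<length es. d t * h (\<Sum>p<length ps. S t p * Z p a))"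
  by(subst sum.swap) (simp add: h.sum sum_distrib_left)
 finally have 4: "(\<Sum>t<length us. c t * h (\<Sum>p<length ps. U t p * Z p a)) - (\<Sum>t<length es. d t * h (\<Sum>p<length ps. S t p * Z p a)) : J" .
 have "(\<Sum>t<length es. d t * h (\<Sum>p<length ps. S t p * Z p a)) : J"
  using SZ[OF _ b] h(2) by(intro ideal_sum[OF J] ideal_mult[OF J]) auto
 with 4 have 5: "(\<Sum>t<length us. c t * h (\<Sum>p<length ps. U t p * Z p a)) : J"
  using ideal_eq_zeroI[OF J] by blast
 have "(\<Sum>t<length us. c t * h (\<Sum>p<length ps. U t p * Z p a)) - (\<Sum>t<length us. c t * (if a = t then 1 else 0)) : J"
 proof(intro cong_sum[OF J])
  fix t assume "t : {..<length us}"
  hence "h ((\<Sum>p<length ps. U t p * Z p a) - (if a = t then 1 else 0)) : J" using UZ[OF _ b] h(2) by blast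
  hence "h (\<Sum>p<length ps. U t p * Z p a) - (if a = t then 1 else 0) : J"
   by(simp add: h.diff h.one h.zero split: if_splits)
  from ideal_mult[OF J this, of "c t"]
  show "c t * h (\<Sum>p<length ps. U t p * Z p a) - c t * (if a = t then 1 else 0) : J" by(simp add: right_diff_distrib)
 qed
 hence "(\<Sum>t<length us. c t * (if a = t then 1 else 0)) : J" using 5 ideal_cong[OF J] by blast
 moreover have "(\<Sum>t<length us. c t * (if a = t then 1 else 0)) = (\<Sum>t<length us. if t = a then c t else 0)"
  by(rule sum.cong) auto
 ultimately show "c a : J" using b by simp
qed

lemma unit_cancel:
 assumes "is_ideal J" "w * u - 1 : J" "u * c : J" shows "c : (J :: 'a::comm_ring_1 set)"
proof -
 have "w * (u * c) - c * (w * u - 1) : J"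
  by(rule ideal_diff[OF assms(1) ideal_mult[OF assms(1,3)] ideal_mult[OF assms(1,2)]])
 thus ?thesis by(simp add: algebra_simps)
qed

lemma is_loc_denoms:
 fixes n :: nat
 assumes l: "is_loc I h J"
 shows "EX d w a. w * h d - 1 : J \<and> (ALL t<n. h d * c t - h (a t) : J)"
proof(induction n)
 case 0
 have "is_ideal J" "h 1 = 1" using l ring_map.one[OF alg_hom_ring_map] by(auto simp: is_loc_def)
 thus ?case by(intro exI[of _ 1]) (simp add: ideal_zero)
next
 case (Suc n)
 have J: "is_ideal J" and h: "ring_map h" using l alg_hom_ring_map by(auto simp: is_loc_def)
 interpret h: ring_map h by(rule h)
 obtain d w a where 1: "w * h d - 1 : J" "ALL t<n. h d * c t - h (a t) : J" using Suc by blast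
 obtain a1 d1 w1 where 2: "w1 * h d1 - 1 : J" "h d1 * c n - h a1 : J"
  using l unfolding is_loc_def by blast
 define a' where "a' t = (if t < n then d1 * a t else d * a1)" for t
 have "(w * w1) * h (d * d1) - 1 = (w * h d) * (w1 * h d1) - 1 * 1" by(simp add: h.mult mult_ac)
 hence "(w * w1) * h (d * d1) - 1 : J" using cong_mult[OF J 1(1) 2(1)] by(simp only: mult_1)
 moreover have "h (d * d1) * c t - h (a' t) : J" if t: "t < Suc n" for t
 proof(cases "t < n")
  case True
  hence "h (d * d1) * c t - h (a' t) = h d1 * (h d * c t - h (a t))"
   by(simp add: a'_def h.mult algebra_simps)
  thus ?thesis using 1(2) True J by(auto intro: ideal_mult)
 next
  case False
  hence "t = n" using t by simp
  hence "h (d * d1) * c t - h (a' t) = h d * (h d1 * c n - h a1)"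
   by(simp add: a'_def h.mult algebra_simps)
  thus ?thesis using 2(2) J by(auto intro: ideal_mult)
 qed
 ultimately show ?case by blast
qed

lemma is_loc_kill:
 fixes n :: nat
 assumes l: "is_loc I h J" and "ALL t<n. h (c t) : J"
 shows "EX d w. w * h d - 1 : J \<and> (ALL t<n. d * c t : I)"
 using assms(2)
proof(induction n)
 case 0
 have "is_ideal J" "h 1 = 1" using l ring_map.one[OF alg_hom_ring_map] by(auto simp: is_loc_def)
 thus ?case by(intro exI[of _ 1]) (simp add: ideal_zero)
next
 case (Suc n)
 have I: "is_ideal I" and J: "is_ideal J" and h: "ring_map h" using l alg_hom_ring_map by(auto simp: is_loc_def)
 interpret h: ring_map h by(rule h)
 obtain d w where 1: "w * h d - 1 : J" "ALL t<n. d * c t : I" using Suc by auto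
 obtain d1 w1 where 2: "w1 * h d1 - 1 : J" "d1 * c n : I"
  using l Suc.prems unfolding is_loc_def by blast
 have "(w * w1) * h (d * d1) - 1 = (w * h d) * (w1 * h d1) - 1 * 1" by(simp add: h.mult mult_ac)
 hence "(w * w1) * h (d * d1) - 1 : J" using cong_mult[OF J 1(1) 2(1)] by(simp only: mult_1)
 moreover have "d * d1 * c t : I" if t: "t < Suc n" for t
 proof(cases "t < n")
  case True
  have "d * d1 * c t = d1 * (d * c t)" by(simp add: mult_ac)
  thus ?thesis using 1(2) True ideal_mult[OF I] by metis
 next
  case False
  hence "t = n" using t by simp
  thus ?thesis using ideal_mult[OF I 2(2), of d] by(simp add: mult_ac)
 qed
 ultimately show ?case by blast
qed

text \<open>Localizations preserve the independence of any frame: clear denominators in a relation.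
  The resulting vector \<open>y\<close> vanishes after localization, so it is killed by some
  \<open>m\<close> that becomes a unit, and \<open>m\<close> times the relation holds before
  localization.\<close>

lemma frame_loc:
 fixes A :: "(base fls ^ 'n) set"
 assumes l: "is_loc I h J" and A: "csub I A" "A \<subseteq> Om I N x M" and B: "csub I B" and f: "frame I A B us"
 shows "frame J (base_change h J A) (base_change h J B) (map (vmap h) us)"
 unfolding frame_iff
proof(intro conjI ballI allI impI)
 have I: "is_ideal I" and J: "is_ideal J" and h: "ring_map h" "h ` I \<subseteq> J"
  using l alg_hom_ring_map by(auto simp: is_loc_def)
 interpret h: ring_map h by(rule h(1))
 show "base_change h J B \<subseteq> base_change h J A"
  using f by(intro base_change_mono[OF J]) (auto simp: frame_iff)
 show "set (map (vmap h) us) \<subseteq> base_change h J A"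
  using f by(auto simp: frame_iff intro!: base_change_mem[OF J])
 show "EX c. v - lcomb c (map (vmap h) us) : base_change h J B" if "v : base_change h J A" for v
  using frame_base_change_gen[OF J h(1) f] that by blast
 fix c a assume c: "lcomb c (map (vmap h) us) : base_change h J B" and a: "a < length (map (vmap h) us)"
 obtain es d where es: "set es \<subseteq> B" "lcomb c (map (vmap h) us) - lcomb d (map (vmap h) es) : van J"
  using c base_change_iff[OF J] by blast
 obtain s w c' where s: "w * h s - 1 : J" "ALL t<length us. h s * c t - h (c' t) : J"
  using is_loc_denoms[OF l] by blast
 obtain s' w' d' where s': "w' * h s' - 1 : J" "ALL t<length es. h s' * d t - h (d' t) : J"
  using is_loc_denoms[OF l] by blast
 define y where "y = lcomb (%t. s' * c' t) us - lcomb (%t. s * d' t) es"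
 have "vmap h y : van J"
 proof -
  have 1: "lcomb (%t. h (s' * c' t)) (map (vmap h) us) - lcomb (%t. (h s' * h s) * c t) (map (vmap h) us) : van J"
   unfolding lcomb_diff[symmetric]
  proof(rule lcomb_van[OF J])
   fix t assume "t < length (map (vmap h) us)"
   hence "h s * c t - h (c' t) : J" using s(2) by simp
   from ideal_mult[OF J ideal_uminus[OF J this], of "h s'"]
   show "h (s' * c' t) - h s' * h s * c t : J" by(simp add: h.mult algebra_simps)
  qed
  have 2: "lcomb (%t. h (s * d' t)) (map (vmap h) es) - lcomb (%t. (h s' * h s) * d t) (map (vmap h) es) : van J"
   unfolding lcomb_diff[symmetric]
  proof(rule lcomb_van[OF J])
   fix t assume "t < length (map (vmap h) es)"
   hence "h s' * d t - h (d' t) : J" using s'(2) by simp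
   from ideal_mult[OF J ideal_uminus[OF J this], of "h s"]
   show "h (s * d' t) - h s' * h s * d t : J" by(simp add: h.mult algebra_simps)
  qed
  have 3: "lcomb (%t. (h s' * h s) * c t) (map (vmap h) us) - lcomb (%t. (h s' * h s) * d t) (map (vmap h) es) : van J"
   using van_smult[OF J es(2), of "fls_const (h s' * h s)"]
   by(simp only: lcomb_smult smult_diff)
  have eq: "vmap h y = lcomb (%t. h (s' * c' t)) (map (vmap h) us) - lcomb (%t. h (s * d' t)) (map (vmap h) es)"
   by(simp only: y_def h.vmap_diff vmap_lcomb[OF h(1)])
  have "a - b : van J" if "a - c : van J" "b - d : van J" "c - d : van J" for a b c d :: "base fls ^ 'n"
   using van_diff[OF J van_add[OF J that(1,3)] that(2)] by simp
  from this[OF 1 2 3] show ?thesis unfolding eq .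
 qed
 have yA: "y : A" unfolding y_def using f es(1)
  by(intro csub_diff[OF A(1)] lcomb_in[OF A(1)]) (auto simp: frame_iff dest!: nth_mem)
 \<comment> \<open>One common \<open>m\<close> exists because \<open>y\<close> has finitely many
   coordinates in a universally independent family.\<close>
 hence "set [y] \<subseteq> Om I N x M" using A(2) by auto
 then obtain ps where ps: "ALL v:set [y]. EX c. v - lcomb c ps : van I"
  "!!c a. lcomb c (map (vmap h) ps) : van J ==> a < length ps ==> c a : J"
  using Om_basis[OF I, of "[y]" N x M] h(1) J by blast
 then obtain g where g: "y - lcomb g ps : van I" by auto
 have "vmap h y - lcomb (%a. h (g a)) (map (vmap h) ps) : van J"
  using h.vmap_van[OF h(2) g] by(simp add: h.vmap_diff vmap_lcomb[OF h(1)])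
 hence "lcomb (%a. h (g a)) (map (vmap h) ps) : van J"
  using \<open>vmap h y : van J\<close> csub_cong[OF csub_self_van[OF J]] by blast
 hence "ALL a<length ps. h (g a) : J" using ps(2) by blast
 then obtain m v where m: "v * h m - 1 : J" "ALL a<length ps. m * g a : I"
  using is_loc_kill[OF l] by blast
 have "lcomb (%a. m * g a) ps : van I" using m(2) by(intro lcomb_van[OF I]) auto
 moreover have "m *c y - lcomb (%a. m * g a) ps : van I"
  using van_smult[OF I g, of "fls_const m"] by(simp add: lcomb_smult smult_diff)
 ultimately have "m *c y : van I" using csub_cong[OF csub_self_van[OF I]] by blast
 hence "m *c y : B" by(rule csub_van[OF B])
 moreover have "lcomb (%t. m * (s * d' t)) es : B"
  using es(1) by(intro lcomb_in[OF B]) auto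
 ultimately have "m *c y + lcomb (%t. m * (s * d' t)) es : B" by(rule csub_add[OF B])
 moreover have "m *c y + lcomb (%t. m * (s * d' t)) es = lcomb (%t. m * (s' * c' t)) us"
  by(simp only: y_def smult_diff lcomb_smult[where k = m]) simp
 ultimately have "lcomb (%t. m * (s' * c' t)) us : B" by simp
 hence "m * (s' * c' a) : I" using frame_indep[OF f] a by simp
 hence "h (m * (s' * c' a)) : J" using h(2) by blast
 hence "h m * (h s' * h (c' a)) : J" by(simp add: h.mult)
 hence "h (c' a) : J"
  using unit_cancel[OF J m(1)] unit_cancel[OF J s'(1)] by blast
 hence "h s * c a : J" using s(2) a ideal_cong[OF J] by(metis length_map)
 thus "c a : J" by(rule unit_cancel[OF J s(1)])
qed

section \<open>The infinitesimal action\<close>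

definition gact :: "base => base fls ^ 'n ^ 'n => base fls ^ 'n => base fls ^ 'n" where
 "gact e F v = v + e *c (F *v v)"

definition vfpart :: "base fls ^ 'n => base fls ^ 'n" where
 "vfpart v = (\<chi> i. fpart (v $ i))"

text \<open>The action of \<open>1 + \<epsilon> F\<close> on classes modulo \<open>O^n\<close>, each class being represented by its principal part.\<close>

definition nact :: "base => base fls ^ 'n ^ 'n => base fls ^ 'n => base fls ^ 'n" where
 "nact e F v = v + e *c vfpart (F *v vfpart v)"

lemma vfpart_nth: "fls_nth (vfpart v $ i) j = (if j > 0 then fls_nth (v $ i) j else 0)"
 by(simp add: vfpart_def fpart_nth)

lemma vfpart_add: "vfpart (u + v) = vfpart u + vfpart v"
 by(simp add: vec_eq_iff fls_eq_iff vfpart_nth)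

lemma vfpart_diff: "vfpart (u - v) = vfpart u - vfpart v"
 by(simp add: vec_eq_iff fls_eq_iff vfpart_nth)

lemma vfpart_smult: "vfpart (c *c v) = c *c vfpart v"
 by(simp add: vec_eq_iff fls_eq_iff vfpart_nth)

lemma vfpart_idem: "vfpart (vfpart v) = vfpart v"
 by(simp add: vec_eq_iff fls_eq_iff vfpart_nth)

lemma vfpart_van: "is_ideal I ==> v : van I ==> vfpart v : van I"
 by(auto simp: van_def vfpart_nth ideal_zero)

lemma vfpart_poly: "is_ideal I ==> v - vfpart v : poly_vecs I"
 by(auto simp: poly_vecs_def polyfuns_def vfpart_nth ideal_zero)

lemma poly_vfpart: "is_ideal I ==> v : poly_vecs I ==> vfpart v : van I"
 by(auto simp: poly_vecs_def polyfuns_def van_def vfpart_nth ideal_zero)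

lemma vmap_vfpart: "ring_map h ==> vmap h (vfpart v) = vfpart (vmap h v)"
 by(auto simp: vec_eq_iff fls_eq_iff vfpart_nth ring_map.vmap_nth ring_map.map_nth ring_map.zero)

lemma gact_smult: "gact e F (c *s v) = c *s gact e F v"
 by(simp add: gact_def smult_mv smult_add smult_assoc mult.commute)

lemma gact_add: "gact e F (u + v) = gact e F u + gact e F v"
 by(simp add: gact_def mv_add smult_add)

lemma nact_smult: "nact e F (c *c v) = c *c nact e F v"
 by(simp add: nact_def smult_mv smult_add smult_assoc mult.commute vfpart_smult)

lemma nact_add: "nact e F (u + v) = nact e F u + nact e F v"
 by(simp add: nact_def mv_add smult_add vfpart_add)

lemma van_sq: "is_ideal I ==> e * e : I ==> e *c (e *c v) : van I"
 by(simp add: smult_assoc) (rule van_smult_left, simp_all add: cof_const)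

lemma linmap_gact:
 assumes I: "is_ideal I" and e: "e * e : I"
 shows "linmap I (gact e F)"
 unfolding linmap_def
proof(intro conjI allI I gact_add gact_smult iffI)
 show "gact e F v : van I" if "v : van I" for v
  unfolding gact_def using that by(intro van_add[OF I] van_smult[OF I] van_mv[OF I])
 show "v : van I" if "gact e F v : van I" for v
 proof -
  have "gact e F v - e *c (F *v gact e F v) : van I"
   using that by(intro van_diff[OF I] van_smult[OF I] van_mv[OF I])
  moreover have "gact e F v - e *c (F *v gact e F v) = v - e *c (e *c (F *v (F *v v)))"
   by(simp add: gact_def mv_add smult_mv smult_add)
  ultimately have "(v - e *c (e *c (F *v (F *v v)))) + e *c (e *c (F *v (F *v v))) : van I"
   using van_sq[OF I e] by(intro van_add[OF I]) auto
  thus ?thesis by simp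
 qed
qed

lemma linmap_nact:
 assumes I: "is_ideal I" and e: "e * e : I"
 shows "linmap I (nact e F)"
 unfolding linmap_def
proof(intro conjI allI I nact_add nact_smult iffI)
 show "nact e F v : van I" if "v : van I" for v
  unfolding nact_def using that by(intro van_add[OF I] van_smult[OF I] van_mv[OF I] vfpart_van[OF I])
 show "v : van I" if "nact e F v : van I" for v
 proof -
  have "nact e F v - e *c vfpart (F *v vfpart (nact e F v)) : van I"
   using that by(intro van_diff[OF I] van_smult[OF I] van_mv[OF I] vfpart_van[OF I])
  moreover have "nact e F v - e *c vfpart (F *v vfpart (nact e F v)) = v - e *c (e *c (vfpart (F *v vfpart (F *v vfpart v))))"
   by(simp add: nact_def mv_add smult_mv smult_add vfpart_add vfpart_smult vfpart_idem)
  ultimately have "(v - e *c (e *c (vfpart (F *v vfpart (F *v vfpart v))))) + e *c (e *c (vfpart (F *v vfpart (F *v vfpart v)))) : van I"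
   using van_sq[OF I e] by(intro van_add[OF I]) auto
  thus ?thesis by simp
 qed
qed

definition ratmat :: "base set => nat => (nat => base) => base fls ^ 'n ^ 'n => bool" where
 "ratmat I N x F \<longleftrightarrow> (EX m. ALL a b. divisor_eq N x ^ m * F $ a $ b : polyfuns I)"

lemma ratmat_mv_poly:
 assumes I: "is_ideal I" and m: "!!a b. divisor_eq N x ^ m * F $ a $ b : polyfuns I" and v: "v : Om I N x M"
 shows "F *v v : Om I N x (M + m)"
proof -
 have "divisor_eq N x ^ (M + m) * (F *v v) $ i = (\<Sum>j\<in>UNIV. (divisor_eq N x ^ m * F $ i $ j) * (divisor_eq N x ^ M * v $ j))" for i
  by(simp add: matrix_vector_mult_def sum_distrib_left power_add mult_ac)
 moreover have "divisor_eq N x ^ M * v $ j : polyfuns I" for j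
  using v by(simp add: Om_def poly_vecs_def)
 ultimately have "divisor_eq N x ^ (M + m) * (F *v v) $ i : polyfuns I" for i
  by(simp only:) (intro polyfuns_sum[OF I] polyfuns_mult[OF I m])
 thus ?thesis by(simp add: Om_def poly_vecs_def)
qed

lemma ratmat_mv:
 assumes I: "is_ideal I" and F: "ratmat I N x F" and v: "v : rat_vecs I N x"
 shows "F *v v : rat_vecs I N x"
proof -
 obtain m M where "!!a b. divisor_eq N x ^ m * F $ a $ b : polyfuns I" "v : Om I N x M"
  using F v rat_vecs_Om[OF I, of v] unfolding ratmat_def by blast
 from ratmat_mv_poly[OF I this] show ?thesis using rat_vecs_Om[OF I, of "F *v v"] by blast
qed

lemma mvset_submod:
 assumes I: "is_ideal I" and e: "e * e : I" and E: "submod I E"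
 shows "submod I (mvset I (gact e F) E)"
proof(rule submodI[OF mvset_csub[OF linmap_gact[OF I e] submod_csub[OF I E]]])
 fix v assume "v : mvset I (gact e F) E"
 then obtain w where w: "w : E" "v - gact e F w : van I" by(auto simp: mvset_def)
 hence "fls_X_inv *s v - gact e F (fls_X_inv *s w) : van I"
  using van_smult[OF I w(2), of fls_X_inv] by(simp add: gact_smult smult_diff)
 thus "fls_X_inv *s v : mvset I (gact e F) E"
  using submod_smult[OF E polyfuns_X_inv[OF I] w(1)] by(auto simp: mvset_def)
qed

lemma mvset_rat:
 assumes I: "is_ideal I" and F: "ratmat I N x F" and E: "E \<subseteq> rat_vecs I N x"
 shows "mvset I (gact e F) E \<subseteq> rat_vecs I N x"
proof
 note R = submod_csub[OF I rat_vecs_submod[OF I, of N x]]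
 fix v assume "v : mvset I (gact e F) E"
 then obtain w where w: "w : E" "v - gact e F w : van I" by(auto simp: mvset_def)
 have "gact e F w : rat_vecs I N x" unfolding gact_def
  using w(1) E by(intro csub_add[OF R] csub_smult[OF R] ratmat_mv[OF I F]) auto
 thus "v : rat_vecs I N x" using csub_cong[OF R] csub_van[OF R w(2)] by blast
qed

lemma bd_points_mvset:
 fixes E :: "(base fls ^ 'n) set"
 assumes I: "is_ideal I" and e: "e * e : I" and F: "ratmat I N x F" and E: "E : bd_points I N x"
 shows "mvset I (gact e F) E : bd_points I N x"
proof -
 have Es: "submod I E" "E \<subseteq> rat_vecs I N x" "locally_free I E"
  "!!v. v : rat_vecs I N x ==> EX m. divisor_eq N x ^ m *s v : E"
  using E by(auto simp: bd_points_def)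
 note lg = linmap_gact[OF I e, of F] and Ec = submod_csub[OF I Es(1)]
 let ?g = "gact e F"
 have lf: "locally_free I (mvset I ?g E)"
 proof -
  obtain G q where G: "finite G" "G \<subseteq> polyfuns I" "ALL g:G. q g : polyfuns I"
   "(\<Sum>g\<in>G. q g * g) - 1 : cof I" "ALL g:G. EX b. loc_basis I E g b"
   using Es(3) unfolding locally_free_iff by blast
  have gsum: "?g (\<Sum>i\<in>UNIV. c i *s b i) = (\<Sum>i\<in>UNIV. c i *s ?g (b i))" for c and b :: "'n => base fls ^ 'n"
  proof -
   have "?g (sum f A) = (\<Sum>x\<in>A. ?g (f x))" for f and A :: "'n set"
    by(induction A rule: infinite_finite_induct) (auto simp: gact_add, simp_all add: gact_def)
   thus ?thesis by(simp add: gact_smult)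
  qed
  have "loc_basis I (mvset I ?g E) g (%i. ?g (b i))" if b: "loc_basis I E g b" for g b
   unfolding loc_basis_def
  proof(intro conjI ballI allI impI)
   show "range (%i. ?g (b i)) \<subseteq> mvset I ?g E"
    using b mvset_in[OF lg Ec] by(auto simp: loc_basis_def)
   fix v assume "v : mvset I ?g E"
   then obtain w where w: "w : E" "v - ?g w : van I" by(auto simp: mvset_def)
   then obtain m c where c: "ALL i. c i : polyfuns I" "g ^ m *s w - (\<Sum>i\<in>UNIV. c i *s b i) : van I"
    using b unfolding loc_basis_def by blast
   have "?g (g ^ m *s w - (\<Sum>i\<in>UNIV. c i *s b i)) : van I" using c(2) lg by(simp add: linmap_def)
   hence "g ^ m *s ?g w - (\<Sum>i\<in>UNIV. c i *s ?g (b i)) : van I"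
    by(simp add: linmap_diff[OF lg] gsum gact_smult)
   moreover have "g ^ m *s v - g ^ m *s ?g w : van I"
    using van_smult[OF I w(2), of "g ^ m"] by(simp add: smult_diff)
   ultimately have "g ^ m *s v - (\<Sum>i\<in>UNIV. c i *s ?g (b i)) : van I" using van_trans[OF I] by blast
   thus "EX m c. (ALL i. c i : polyfuns I) \<and> g ^ m *s v - (\<Sum>i\<in>UNIV. c i *s ?g (b i)) : van I"
    using c(1) by(intro exI[of _ m] exI[of _ c] conjI)
  next
   fix c assume c: "(ALL i. c i : polyfuns I) \<and> (\<Sum>i\<in>UNIV. c i *s ?g (b i)) : van I"
   hence "?g (\<Sum>i\<in>UNIV. c i *s b i) : van I" by(simp add: gsum)
   hence "(\<Sum>i\<in>UNIV. c i *s b i) : van I" using lg by(simp add: linmap_def)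
   thus "EX m. ALL i j. fls_nth (g ^ m * c i) j : I" using b c unfolding loc_basis_def by blast
  qed
  hence "ALL g:G. EX b. loc_basis I (mvset I ?g E) g b" using G(5) by blast
  thus ?thesis unfolding locally_free_iff using G(1-4) by(intro exI[of _ G] conjI exI[of _ q])
 qed
 have "EX m. divisor_eq N x ^ m *s v : mvset I ?g E" if v: "v : rat_vecs I N x" for v
 proof -
  obtain m1 where m1: "divisor_eq N x ^ m1 *s v : E" using Es(4)[OF v] by blast
  obtain m2 where m2: "divisor_eq N x ^ m2 *s (F *v v) : E" using Es(4)[OF ratmat_mv[OF I F v]] by blast
  let ?D = "%m. divisor_eq N x ^ m"
  have D: "?D k : polyfuns I" for k by(intro polyfuns_power polyfuns_divisor I)
  have 1: "?D (m2 + m1) *s v : E" "?D (m2 + m1) *s (F *v v) : E"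
   using submod_smult[OF Es(1) D m1, of m2] submod_smult[OF Es(1) D m2, of m1]
   by(simp_all add: smult_assoc power_add mult.commute)
  \<comment> \<open>The preimage under 1 + e F, whose inverse is 1 - e F because \<open>e\<close>
    has square zero.\<close>
  define w where "w = ?D (m2 + m1) *s v - e *c (?D (m2 + m1) *s (F *v v))"
  have "w : E" unfolding w_def by(intro csub_diff[OF Ec] csub_smult[OF Ec] 1)
  moreover have "?D (m2 + m1) *s v - ?g w = e *c (e *c (?D (m2 + m1) *s (F *v (F *v v))))"
   by(simp add: w_def gact_def mv_diff smult_mv smult_diff)
  hence "?D (m2 + m1) *s v - ?g w : van I" using van_sq[OF I e] by simp
  ultimately show ?thesis by(auto simp: mvset_def)
 qed
 thus ?thesis
  using lf mvset_submod[OF I e Es(1)] mvset_rat[OF I F Es(2)] unfolding bd_points_def by blast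
qed

text \<open>A complex point kills the nilpotent element \<open>e\<close>, so specializations and
  their degrees do not change.\<close>

lemma gr1_points_mvset:
 fixes E :: "(base fls ^ 'n) set"
 assumes I: "is_ideal I" and e: "e * e : I" and F: "ratmat I N x F" and E: "E : gr1_points I N x"
 shows "mvset I (gact e F) E : gr1_points I N x"
proof -
 have "vmap tht ` mvset I (gact e F) E = vmap tht ` E" if t: "alg_hom id tht" "tht ` I \<subseteq> {0}" for tht :: "base => complex"
 proof -
  have r: "ring_map tht" by(rule alg_hom_id_ring_map[OF t(1)])
  have "tht e * tht e = 0" using t(2) e ring_map.mult[OF r, of e e] by auto
  hence "tht e = 0" by simp
  hence ge: "vmap tht (gact e F w) = vmap tht w" for w
   by(simp add: gact_def ring_map.vmap_add[OF r] ring_map.vmap_smult[OF r] ring_map.map_const[OF r])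
  have "vmap tht v = vmap tht w" if "v - gact e F w : van I" for v w
   using ring_map.vmap_van[OF r t(2) that] ge
   by(simp add: ring_map.vmap_diff[OF r] van_def vec_eq_iff fls_eq_iff)
  moreover have "gact e F w : mvset I (gact e F) E" if "w : E" for w
   using that van_zero[OF I] by(auto simp: mvset_def intro!: bexI[of _ w])
  ultimately show ?thesis using ge unfolding mvset_def by(force simp: image_iff)
 qed
 thus ?thesis
  using E bd_points_mvset[OF I e F, of E] unfolding gr1_points_def by auto
qed

lemma mvset_nact_poly:
 assumes I: "is_ideal I" and e: "e * e : I"
 shows "mvset I (nact e F) (poly_vecs I) = poly_vecs I"
proof -
 note P = polyvecs_csub[OF I]
 have "nact e F u - u : van I" if "u : poly_vecs I" for u
  using poly_vfpart[OF I that] by(simp add: nact_def van_smult[OF I] vfpart_van[OF I] van_mv[OF I])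
 hence 1: "u - nact e F u : van I" "nact e F u : poly_vecs I" if "u : poly_vecs I" for u
  using that van_sym[OF I] csub_van[OF P] csub_cong[OF P] by blast+
 show ?thesis
  using 1 csub_van[OF P] csub_cong[OF P] unfolding mvset_def by blast
qed

text \<open>The actions differ by \<open>e F\<close> applied to a polynomial vector and by a
  polynomial vector. Both differences lie in the moved module as soon as \<open>e F\<close> sends
  polynomial vectors into \<open>A\<close>, so both actions move \<open>A\<close> to the same
  module.\<close>

lemma mvset_gact_nact:
 fixes A :: "(base fls ^ 'n) set"
 assumes I: "is_ideal I" and e: "e * e : I" and A: "csub I A" and P: "poly_vecs I \<subseteq> A"
  and mov: "!!w. w : poly_vecs I ==> e *c (F *v w) : A"
 shows "mvset I (nact e F) A = mvset I (gact e F) A"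
  "w : poly_vecs I ==> w : mvset I (gact e F) A"
  "gact e F u - nact e F u : mvset I (gact e F) A"
  "w : poly_vecs I ==> e *c (F *v w) : mvset I (gact e F) A"
proof -
 note lg = linmap_gact[OF I e, of F] and ln = linmap_nact[OF I e, of F]
 note G = mvset_csub[OF lg A] and N = mvset_csub[OF ln A]
 have in_g: "e *c (F *v w) : mvset I (gact e F) A" if "w : poly_vecs I" for w
 proof -
  have "e *c (F *v w) - gact e F (e *c (F *v w)) = - (e *c (e *c (F *v (F *v w))))"
   by(simp add: gact_def smult_mv)
  hence "e *c (F *v w) - gact e F (e *c (F *v w)) : van I"
   using van_uminus[OF I van_sq[OF I e]] by simp
  thus ?thesis using mov[OF that] by(auto simp: mvset_def)
 qed
 thus "w : poly_vecs I ==> e *c (F *v w) : mvset I (gact e F) A" .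
 have P_g: "w : mvset I (gact e F) A" if "w : poly_vecs I" for w
 proof -
  have "gact e F w : mvset I (gact e F) A" using that P mvset_in[OF lg A] by blast
  from csub_diff[OF G this in_g[OF that]] show ?thesis by(simp add: gact_def)
 qed
 thus "w : poly_vecs I ==> w : mvset I (gact e F) A" .
 have in_n: "e *c (F *v w) : mvset I (nact e F) A" if "w : poly_vecs I" for w
 proof -
  have "e *c (F *v w) - nact e F (e *c (F *v w)) = - (e *c (e *c vfpart (F *v vfpart (F *v w))))"
   by(simp add: nact_def smult_mv vfpart_smult)
  hence "e *c (F *v w) - nact e F (e *c (F *v w)) : van I"
   using van_uminus[OF I van_sq[OF I e]] by simp
  thus ?thesis using mov[OF that] by(auto simp: mvset_def)
 qed
 have P_n: "w : mvset I (nact e F) A" if "w : poly_vecs I" for w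
  using that P mvset_nact_poly[OF I e, of F] unfolding mvset_def by blast
 have diff: "gact e F u - nact e F u = e *c (F *v (u - vfpart u)) + e *c (F *v vfpart u - vfpart (F *v vfpart u))" for u
  by(simp add: gact_def nact_def mv_diff smult_diff)
 have pe: "e *c (F *v vfpart u - vfpart (F *v vfpart u)) : poly_vecs I" for u
  by(intro csub_smult[OF polyvecs_csub[OF I]] vfpart_poly[OF I])
 have dg: "gact e F u - nact e F u : mvset I (gact e F) A" for u
  unfolding diff by(intro csub_add[OF G] in_g P_g vfpart_poly[OF I] pe)
 thus "gact e F u - nact e F u : mvset I (gact e F) A" .
 have dn: "gact e F u - nact e F u : mvset I (nact e F) A" for u
  unfolding diff by(intro csub_add[OF N] in_n P_n vfpart_poly[OF I] pe)
 show "mvset I (nact e F) A = mvset I (gact e F) A"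
 proof
  show "mvset I (nact e F) A \<subseteq> mvset I (gact e F) A"
  proof
   fix v assume "v : mvset I (nact e F) A"
   then obtain w where w: "w : A" "v - nact e F w : van I" by(auto simp: mvset_def)
   have "gact e F w : mvset I (gact e F) A" using w(1) mvset_in[OF lg A] by blast
   from csub_diff[OF G this dg[of w]] have "nact e F w : mvset I (gact e F) A" by simp
   thus "v : mvset I (gact e F) A" using csub_cong[OF G] csub_van[OF G w(2)] by blast
  qed
  show "mvset I (gact e F) A \<subseteq> mvset I (nact e F) A"
  proof
   fix v assume "v : mvset I (gact e F) A"
   then obtain w where w: "w : A" "v - gact e F w : van I" by(auto simp: mvset_def)
   have "nact e F w : mvset I (nact e F) A" using w(1) mvset_in[OF ln A] by blast
   from csub_add[OF N dn[of w] this] have "gact e F w : mvset I (nact e F) A" by simp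
   thus "v : mvset I (nact e F) A" using csub_cong[OF N] csub_van[OF N w(2)] by blast
  qed
 qed
qed

section \<open>Operations on framed points\<close>

text \<open>The module O^n is not moved. The frame of \<Omega> / O^n therefore follows
  \<open>nact\<close>, which preserves O^n, while everything about \<open>E\<close> follows
  \<open>gact\<close>.\<close>

definition mv_point :: "base => base fls ^ 'n ^ 'n => 'n::finite framed_point => 'n framed_point" where
 "mv_point e F p = \<lparr>alg = alg p, pts = pts p, lat = mvset (alg p) (gact e F) (lat p),
   big = mvset (alg p) (gact e F) (big p), frO = map (nact e F) (frO p), frE = map (gact e F) (frE p)\<rparr>"

definition bc_point :: "(base => base) => base set => (nat => base) => 'n::finite framed_point => 'n framed_point" where
 "bc_point h J x p = \<lparr>alg = J, pts = x, lat = base_change h J (lat p), big = base_change h J (big p),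
   frO = map (vmap h) (frO p), frE = map (vmap h) (frE p)\<rparr>"

text \<open>The condition under which the image of \<Omega> under 1 + e F contains O^n again, as a
  framed point requires.\<close>

definition movable :: "base => base fls ^ 'n ^ 'n => 'n::finite framed_point => bool" where
 "movable e F p \<longleftrightarrow> (ALL w:poly_vecs (alg p). e *c (F *v w) : big p)"

lemma Gr1D:
 assumes "p : Gr1 N"
 shows "is_ideal (alg p)" "lat p : gr1_points (alg p) N (pts p)" "lat p : bd_points (alg p) N (pts p)"
  "submod (alg p) (big p)" "submod (alg p) (lat p)"
  "big p \<subseteq> rat_vecs (alg p) N (pts p)" "frame (alg p) (big p) (poly_vecs (alg p)) (frO p)"
  "frame (alg p) (big p) (lat p) (frE p)" "csub (alg p) (big p)" "csub (alg p) (lat p)"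
  "poly_vecs (alg p) \<subseteq> big p" "lat p \<subseteq> big p"
 using assms submod_csub by(auto simp: Gr1_def gr1_points_def bd_points_def frame_def)

lemma mv_point_Gr1:
 assumes p: "p : Gr1 N" and e: "e * e : alg p" and F: "ratmat (alg p) N (pts p) F" and m: "movable e F p"
 shows "mv_point e F p : Gr1 N"
proof -
 note d = Gr1D[OF p]
 note lg = linmap_gact[OF d(1) e, of F] and ln = linmap_nact[OF d(1) e, of F]
 have "mvset (alg p) (nact e F) (big p) = mvset (alg p) (gact e F) (big p)"
  using m by(intro mvset_gact_nact(1) d e) (auto simp: movable_def)
 hence "frame (alg p) (mvset (alg p) (gact e F) (big p)) (poly_vecs (alg p)) (map (nact e F) (frO p))"
  using frame_mvset[OF ln d(9) polyvecs_csub[OF d(1)] d(7)] by(simp add: mvset_nact_poly[OF d(1) e])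
 thus ?thesis
  using gr1_points_mvset[OF d(1) e F d(2)] mvset_submod[OF d(1) e d(4)] mvset_rat[OF d(1) F d(6)]
   frame_mvset[OF lg d(9,10,8)] d(1)
  by(simp add: Gr1_def mv_point_def)
qed

lemma bc_point_pullback:
 assumes "p : Gr1 N" "is_ideal J" "alg_hom cst h" "h ` alg p \<subseteq> J" "!!i. i < N ==> x i - h (pts p i) : J"
 shows "is_pullback N h p (bc_point h J x p)"
proof -
 have "csub J (base_change h J (lat p))" "csub J (poly_vecs J)"
  by(rule base_change_csub[OF assms(2)], rule polyvecs_csub[OF assms(2)])
 thus ?thesis using assms
  by(auto simp: is_pullback_def bc_point_def list_all2_map1 intro!: list_all2_refl csub_zero)
qed

text \<open>Framed points are pulled back in two situations: along any map if \<Omega> is an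
  \<open>Om\<close>, and along a localization for general \<Omega>
  (\<open>bc_point_Gr1_loc\<close>).\<close>

lemma bc_point_Gr1_Om:
 assumes p: "p : Gr1 N" and J: "is_ideal J" and h: "alg_hom cst h" "h ` alg p \<subseteq> J"
  and x: "!!i. i < N ==> x i - h (pts p i) : J" and b: "big p = Om (alg p) N (pts p) M"
 shows "bc_point h J x p : Gr1 N" "big (bc_point h J x p) = Om J N x M"
proof -
 note d = Gr1D[OF p]
 have rh: "ring_map h" by(rule alg_hom_ring_map[OF h(1)])
 have bb: "base_change h J (big p) = Om J N x M"
  unfolding b by(rule base_change_Om[OF J d(1) rh h(2) x])
 thus "big (bc_point h J x p) = Om J N x M" by(simp add: bc_point_def)
 have f1: "frame J (Om J N x M) (poly_vecs J) (map (vmap h) (frO p))"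
  using frame_base_change_Om[OF d(1) J rh h(2) x polyvecs_csub[OF d(1)] d(7)[unfolded b]]
  by(simp add: base_change_poly_vecs[OF J d(1) rh h(2)])
 have f2: "frame J (Om J N x M) (base_change h J (lat p)) (map (vmap h) (frE p))"
  by(rule frame_base_change_Om[OF d(1) J rh h(2) x d(10) d(8)[unfolded b]])
 show "bc_point h J x p : Gr1 N"
  unfolding Gr1_def bc_point_def using J gr1_points_base_change[OF d(1) J h d(2) x] Om_submod[OF J] f1 f2
  by(auto simp: bb rat_vecs_Om[OF J])
qed

lemma bc_point_Gr1_loc:
 assumes p: "p : Gr1 N" and l: "is_loc (alg p) h J" and x: "!!i. i < N ==> x i - h (pts p i) : J"
 shows "bc_point h J x p : Gr1 N"
proof -
 note d = Gr1D[OF p]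
 have J: "is_ideal J" and h: "alg_hom cst h" "h ` alg p \<subseteq> J" and rh: "ring_map h"
  using l alg_hom_ring_map by(auto simp: is_loc_def)
 obtain M where M: "big p \<subseteq> Om (alg p) N (pts p) M"
  using frame_bounded[OF d(1,7,6)] by blast
 have f1: "frame J (base_change h J (big p)) (poly_vecs J) (map (vmap h) (frO p))"
  using frame_loc[OF l d(9) M polyvecs_csub[OF d(1)] d(7)]
  by(simp add: base_change_poly_vecs[OF J d(1) rh h(2)])
 have f2: "frame J (base_change h J (big p)) (base_change h J (lat p)) (map (vmap h) (frE p))"
  by(rule frame_loc[OF l d(9) M d(10) d(8)])
 have "base_change h J (big p) \<subseteq> Om J N x M"
  using base_change_mono[OF J M, of h] base_change_Om[of J "alg p" h N x "pts p" M] J d(1) rh h(2) x by blast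
 hence "base_change h J (big p) \<subseteq> rat_vecs J N x" using rat_vecs_Om[OF J] by blast
 thus ?thesis
  unfolding Gr1_def bc_point_def using J gr1_points_base_change[OF d(1) J h d(2) x]
   base_change_submod[OF J rh d(1,4)] f1 f2 by auto
qed

section \<open>Determinants\<close>

lemma frame_det_cong: "(!!i j. i < r ==> j < r ==> A i j = B i j) ==> frame_det r A = frame_det r B"
 unfolding frame_det_def by(rule arg_cong[where f = Determinant.det]) (auto intro!: Matrix.cong_mat)

lemma frame_det_leibniz:
 "frame_det r A = (\<Sum>p\<in>{p. p permutes {0..<r}}. signof p * (\<Prod>i=0..<r. A i (p i)))"
proof -
 have "(\<Prod>i=0..<r. Matrix.index_mat (Matrix.mat r r (%(a, b). A a b)) (i, p i)) = (\<Prod>i=0..<r. A i (p i))"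
  if "p permutes {0..<r}" for p
 proof(rule prod.cong[OF refl])
  fix i assume "i : {0..<r}"
  hence "i < r" "p i < r" using permutes_in_image[OF that, of i] by auto
  thus "Matrix.index_mat (Matrix.mat r r (%(a, b). A a b)) (i, p i) = A i (p i)" by simp
 qed
 thus ?thesis unfolding frame_det_def by(subst det_def'[of _ r]) auto
qed

lemma frame_det_cong_ideal:
 assumes I: "is_ideal I" and "!!i j. i < r ==> j < r ==> A i j - B i j : I"
 shows "frame_det r A - frame_det r B : I"
 unfolding frame_det_leibniz
proof(rule cong_sum[OF I])
 fix p assume p: "p : {p. p permutes {0..<r}}"
 have "(\<Prod>i=0..<r. A i (p i)) - (\<Prod>i=0..<r. B i (p i)) : I"
 proof(rule cong_prod[OF I])
  fix i assume "i : {0..<r}"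
  hence "i < r" "p i < r" using permutes_in_image[of p "{0..<r}" i] p by auto
  thus "A i (p i) - B i (p i) : I" by(rule assms(2))
 qed
 from ideal_mult[OF I this, of "signof p"]
 show "signof p * (\<Prod>i=0..<r. A i (p i)) - signof p * (\<Prod>i=0..<r. B i (p i)) : I"
  by(simp add: right_diff_distrib)
qed

lemma frame_det_mult: "frame_det r A * frame_det r B = frame_det r (%i j. \<Sum>k<r. A i k * B k j)"
proof -
 have "Matrix.mat r r (%(a, b). A a b) * Matrix.mat r r (%(a, b). B a b) =
   Matrix.mat r r (%(a, b). \<Sum>k<r. A a k * B k b)"
  by(rule Matrix.eq_matI) (auto simp: Matrix.scalar_prod_def lessThan_atLeast0)
 thus ?thesis
  unfolding frame_det_def by(subst det_mult[of _ r, symmetric]) auto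
qed

lemma frame_det_id: "frame_det r (%i j. if i = j then 1 else 0) = 1"
proof -
 have "Matrix.mat r r (%(i, j). if i = j then 1 else (0::base)) = Matrix.one_mat r"
  by(rule Matrix.eq_matI) auto
 thus ?thesis by(simp add: frame_det_def)
qed

lemma frame_det_transpose: "frame_det r (%i j. A j i) = frame_det r A"
proof -
 have "Matrix.mat r r (%(i, j). A j i) = Matrix.transpose_mat (Matrix.mat r r (%(i, j). A i j))"
  by(rule Matrix.eq_matI) auto
 thus ?thesis unfolding frame_det_def by(simp add: det_transpose[of _ r])
qed

lemma frame_det_block_lower:
 assumes "!!i j. i < n ==> j < m ==> A i (n + j) = 0"
 shows "frame_det (n + m) A = frame_det n A * frame_det m (%i j. A (n + i) (n + j))"
proof -
 have "Matrix.mat (n + m) (n + m) (%(i, j). A i j) =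
   four_block_mat (Matrix.mat n n (%(i, j). A i j)) (Matrix.zero_mat n m)
    (Matrix.mat m n (%(i, j). A (n + i) j)) (Matrix.mat m m (%(i, j). A (n + i) (n + j)))"
  (is "?L = ?R")
 proof(rule Matrix.eq_matI)
  fix i j assume ij: "i < Matrix.dim_row ?R" "j < Matrix.dim_col ?R"
  show "Matrix.index_mat ?L (i, j) = Matrix.index_mat ?R (i, j)"
   using ij assms[of i "j - n"] by auto
 qed auto
 thus ?thesis
  unfolding frame_det_def by(subst det_four_block_mat_upper_right_zero[symmetric]) auto
qed

lemma frame_det_block_upper:
 assumes "!!i j. i < m ==> j < n ==> A (n + i) j = 0"
 shows "frame_det (n + m) A = frame_det n A * frame_det m (%i j. A (n + i) (n + j))"
proof -
 have "frame_det (n + m) A = frame_det (n + m) (%i j. A j i)" by(rule frame_det_transpose[symmetric])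
 also have "\<dots> = frame_det n (%i j. A j i) * frame_det m (%i j. A (n + j) (n + i))"
  by(rule frame_det_block_lower) (use assms in auto)
 also have "frame_det n (%i j. A j i) = frame_det n A" by(rule frame_det_transpose)
 also have "frame_det m (%i j. A (n + j) (n + i)) = frame_det m (%i j. A (n + i) (n + j))"
  by(rule frame_det_transpose[of m "%i j. A (n + i) (n + j)"])
 finally show ?thesis .
qed

lemma frame_det_hom:
 assumes "ring_map h" shows "h (frame_det r A) = frame_det r (%i j. h (A i j))"
proof -
 interpret h: ring_map h by(rule assms)
 have "h (signof p) = signof p" for p :: "nat => nat"
  by(cases rule: sign_cases[of p]) (simp_all add: h.one h.uminus)
 thus ?thesis by(simp add: frame_det_leibniz h.sum h.mult h.prod)
qed

lemma frame_det_smult: "frame_det r (%i j. c * A i j) = c ^ r * frame_det r A"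
 by(simp add: frame_det_leibniz prod.distrib sum_distrib_left mult_ac)

section \<open>Sections\<close>

lemma sec_pullback:
 assumes "s : sections N k X" "p : X" "p' : X" "is_pullback N h p p'"
 shows "s p' - h (s p) : alg p'"
 using assms unfolding sections_def by blast

lemma sec_frame:
 assumes "s : sections N k X" "p : X" "p' : X" "alg p' = alg p" "pts p' = pts p" "lat p' = lat p" "big p' = big p"
  "changes_frame (poly_vecs (alg p)) H (frO p) (frO p')" "changes_frame (lat p) G (frE p) (frE p')"
 shows "s p' * frame_det (length (frE p)) G ^ k - s p * frame_det (length (frO p)) H ^ k : alg p"
 using assms unfolding sections_def by blast

lemma sec_enlarge:
 assumes "s : sections N k X" "p : X" "p' : X" "alg p' = alg p" "pts p' = pts p" "lat p' = lat p" "big p \<subseteq> big p'"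
  "frO p' = frO p @ q" "frE p' = frE p @ q"
 shows "s p' - s p : alg p"
 using assms unfolding sections_def by blast

lemma changes_frame_iff:
 "changes_frame B G us us' \<longleftrightarrow> length us' = length us \<and> (ALL a<length us. us' ! a - lcomb (G a) us : B)"
 by(simp add: changes_frame_def lcomb_def)

lemma changes_frame_id:
 assumes "length us' = length us" "!!a. a < length us ==> us' ! a - us ! a : B"
 shows "changes_frame B (%i j. if i = j then 1 else 0) us us'"
proof -
 have "lcomb (%j. if a = j then 1 else 0) us = us ! a" if "a < length us" for a
  using lcomb_delta[OF that] by(simp add: eq_commute)
 thus ?thesis using assms by(simp add: changes_frame_iff)
qed

lemma changes_frame_map:
 assumes "changes_frame B G us us'" and "!!u v. f (u + v) = f u + f v"
  "!!c v. f (c *c v) = g c *c f v" "!!v. v : B ==> f v : B'"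
 shows "changes_frame B' (%a b. g (G a b)) (map f us) (map f us')"
 unfolding changes_frame_iff
proof(intro conjI allI impI)
 show "length (map f us') = length (map f us)" using assms(1) by(simp add: changes_frame_iff)
 fix a assume a: "a < length (map f us)"
 have df: "f (u - v) = f u - f v" for u v using assms(2)[of "u - v" v] by simp
 have "f (us' ! a - lcomb (G a) us) : B'" using assms(1,4) a by(auto simp: changes_frame_iff)
 moreover have "f (us' ! a) = map f us' ! a" using assms(1) a by(simp add: changes_frame_iff)
 ultimately show "map f us' ! a - lcomb (%b. g (G a b)) (map f us) : B'"
  by(simp add: df lcomb_map[OF assms(2,3)])
qed

lemma sec_same:
 assumes s: "s : sections N k X" "p : X" "p' : X" "alg p' = alg p" "pts p' = pts p" "lat p' = lat p" "big p' = big p"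
  and O: "length (frO p') = length (frO p)" "!!a. a < length (frO p) ==> frO p' ! a - frO p ! a : poly_vecs (alg p)"
  and E: "length (frE p') = length (frE p)" "!!a. a < length (frE p) ==> frE p' ! a - frE p ! a : lat p"
 shows "s p' - s p : alg p"
 using sec_frame[OF s changes_frame_id[OF O] changes_frame_id[OF E]] by(simp add: frame_det_id)

lemma frame_quot:
 assumes "frame I A C (us @ qs)" "frame I B C us" "B \<subseteq> A" "csub I B" "csub I C"
 shows "frame I A B qs"
 unfolding frame_iff
proof(intro conjI ballI allI impI)
 show "B \<subseteq> A" "set qs \<subseteq> A" using assms by(auto simp: frame_iff)
 have uB: "lcomb c us : B" for c using assms(2) by(intro lcomb_in[OF assms(4)]) (auto simp: frame_iff)
 have CB: "C \<subseteq> B" using assms(2) by(simp add: frame_iff)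
 show "EX c. v - lcomb c qs : B" if "v : A" for v
 proof -
  obtain c where "v - lcomb c (us @ qs) : C" using frame_coords[OF assms(1) \<open>v : A\<close>] by blast
  hence "v - lcomb c (us @ qs) + lcomb c us : B" using CB uB by(intro csub_add[OF assms(4)]) auto
  thus ?thesis by(auto simp: lcomb_append algebra_simps)
 qed
 fix c a assume c: "lcomb c qs : B" and a: "a < length qs"
 obtain d where d: "lcomb c qs - lcomb d us : C" using assms(2) c by(auto simp: frame_iff)
 define e where "e a = (if a < length us then - d a else c (a - length us))" for a
 have "lcomb e (us @ qs) = lcomb (%a. - d a) us + lcomb c qs"
  by(rule lcomb_append_eq) (auto simp: e_def)
 hence "lcomb e (us @ qs) : C" using d by(simp add: lcomb_uminus)
 hence "e (length us + a) : I" using frame_indep[OF assms(1)] a by simp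
 thus "c a : I" by(simp add: e_def)
qed

text \<open>Moving \<open>p1\<close> changes the added vectors \<open>q\<close> by
  \<open>nact\<close> in one frame and by \<open>gact\<close> in the other, whereas the rule for
  enlargements wants the same vectors in both. The auxiliary point \<open>P2\<close> uses
  \<open>gact\<close> twice. Since both images of \<open>q\<close> agree modulo the moved smaller
  \<Omega>, the change to \<open>P2\<close> is block triangular with identity blocks and has
  determinant 1.\<close>

lemma mv_point_enlarge:
 fixes p :: "'n::finite framed_point"
 assumes s: "s : sections N k (Gr1 N)" and p: "p : Gr1 N" and p1: "p1 : Gr1 N"
  and eq: "alg p1 = alg p" "pts p1 = pts p" "lat p1 = lat p" "big p \<subseteq> big p1" "frO p1 = frO p @ q" "frE p1 = frE p @ q"
  and e: "e * e : alg p" and F: "ratmat (alg p) N (pts p) F" and m: "movable e F p"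
 shows "s (mv_point e F p1) - s (mv_point e F p) : alg p"
proof -
 note d = Gr1D[OF p] and d1 = Gr1D[OF p1, unfolded eq(1,2)]
 let ?I = "alg p"
 note lg = linmap_gact[OF d(1) e, of F] and ln = linmap_nact[OF d(1) e, of F]
 have m1: "movable e F p1" using m eq(1,4) by(auto simp: movable_def)
 have P: "mv_point e F p : Gr1 N" by(rule mv_point_Gr1[OF p e F m])
 have P1: "mv_point e F p1 : Gr1 N" using e F m1 by(intro mv_point_Gr1[OF p1]) (simp_all add: eq)
 note D = Gr1D[OF P, unfolded mv_point_def framed_point.simps]
  and D1 = Gr1D[OF P1, unfolded mv_point_def framed_point.simps eq(1,2)]
 have q: "frame ?I (big p1) (big p) q"
  using frame_quot[OF d1(7)[unfolded eq(5)] d(7) eq(4) d(9) polyvecs_csub[OF d(1)]] .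
 have gq: "frame ?I (mvset ?I (gact e F) (big p1)) (mvset ?I (gact e F) (big p)) (map (gact e F) q)"
  by(rule frame_mvset[OF lg d1(9) d(9) q])
 define P2 where "P2 = (mv_point e F p1) \<lparr>frO := map (nact e F) (frO p) @ map (gact e F) q\<rparr>"
 have P2: "P2 : Gr1 N"
  using P1 frame_concat[OF gq D(7) D1(9) D(9) polyvecs_csub[OF d(1)]]
  by(simp add: P2_def Gr1_def mv_point_def eq(1,2))
 have "s P2 - s (mv_point e F p) : ?I"
  using sec_enlarge[OF s P P2, of "map (gact e F) q"] eq
  by(auto simp: P2_def mv_point_def mvset_def)
 moreover have "s P2 - s (mv_point e F p1) : ?I"
 proof -
  let ?u = "map (nact e F) (frO p)" and ?r = "length (frO p)"
  have "gact e F (q ! i) - nact e F (q ! i) : mvset ?I (gact e F) (big p)" for i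
   using m by(intro mvset_gact_nact(3)[OF d(1) e d(9,11)]) (auto simp: movable_def)
  hence "EX c. gact e F (q ! i) - nact e F (q ! i) - lcomb c ?u : poly_vecs ?I" for i
   using frame_coords[OF D(7)] by blast
  then obtain W where W: "!!i. gact e F (q ! i) - nact e F (q ! i) - lcomb (W i) ?u : poly_vecs ?I" by metis
  define H where "H i j = (if i < ?r \<or> ?r \<le> j then (if i = j then 1 else 0) else W (i - ?r) j)" for i j
  have ch: "changes_frame (poly_vecs ?I) H (map (nact e F) (frO p1)) (frO P2)"
   unfolding changes_frame_iff
  proof(intro conjI allI impI)
   show "length (frO P2) = length (map (nact e F) (frO p1))" by(simp add: P2_def eq)
   fix a assume a: "a < length (map (nact e F) (frO p1))"
   have O0: "0 : poly_vecs ?I" by(rule csub_zero[OF polyvecs_csub[OF d(1)]])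
   show "frO P2 ! a - lcomb (H a) (map (nact e F) (frO p1)) : poly_vecs ?I"
   proof(cases "a < ?r")
    case True
    have "lcomb (H a) (map (nact e F) (frO p1)) = lcomb (%b. if b = a then 1 else 0) (map (nact e F) (frO p1))"
     using True by(intro lcomb_cong) (auto simp: H_def)
    thus ?thesis using True a lcomb_delta[OF a] O0 by(simp add: P2_def eq nth_append)
   next
    case False
    define i where "i = a - ?r"
    have i: "i < length q" "a = ?r + i" using False a by(auto simp: i_def eq)
    have "lcomb (H a) ?u = lcomb (W i) ?u" using i by(intro lcomb_cong) (auto simp: H_def)
    moreover have "lcomb (%j. H a (?r + j)) (map (nact e F) q) = lcomb (%j. if j = i then 1 else 0) (map (nact e F) q)"
     using i by(intro lcomb_cong) (auto simp: H_def)
    ultimately have "lcomb (H a) (map (nact e F) (frO p1)) = lcomb (W i) ?u + nact e F (q ! i)"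
     using i lcomb_delta[of i "map (nact e F) q"] by(simp add: eq lcomb_append)
    thus ?thesis using W[of i] i by(simp add: P2_def nth_append algebra_simps)
   qed
  qed
  have "frame_det (length (frO p1)) H = 1"
  proof -
   have "frame_det (?r + length q) H = frame_det ?r H * frame_det (length q) (%i j. H (?r + i) (?r + j))"
    by(rule frame_det_block_lower) (auto simp: H_def)
   also have "frame_det ?r H = 1"
    using frame_det_id[of ?r] by(subst frame_det_cong[where B = "%i j. if i = j then 1 else 0"]) (auto simp: H_def)
   also have "frame_det (length q) (%i j. H (?r + i) (?r + j)) = 1"
    using frame_det_id[of "length q"] by(subst frame_det_cong[where B = "%i j. if i = j then 1 else 0"]) (auto simp: H_def)
   finally show ?thesis by(simp add: eq)
  qed
  moreover have "changes_frame (mvset ?I (gact e F) (lat p)) (%i j. if i = j then 1 else 0) (map (gact e F) (frE p1)) (map (gact e F) (frE p1))"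
   using csub_zero[OF D(10)] by(intro changes_frame_id) auto
  ultimately show ?thesis
   using sec_frame[OF s P1 P2, of H "%i j. if i = j then 1 else 0"] ch
   by(simp add: P2_def mv_point_def eq frame_det_id)
 qed
 ultimately have "(s P2 - s (mv_point e F p)) - (s P2 - s (mv_point e F p1)) : ?I" by(rule ideal_diff[OF d(1)])
 thus ?thesis by simp
qed

section \<open>The derivative along a homogeneous family\<close>

text \<open>The matrix \<open>Y\<close> times z^a / D^m. It is defined over every configuration and
  compatible with base change, and scaling multiplies it by a power (\<open>sc_fam\<close>).\<close>

definition fam :: "nat => nat => nat => complex ^ 'n ^ 'n => (nat => base) => base fls ^ 'n ^ 'n" where
 "fam N m a Y x = (\<chi> i j. fls_const (cst (Y $ i $ j)) * (fls_X_inv ^ a * dinv N x ^ m))"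

lemma fam_poly: "is_ideal I ==> divisor_eq N x ^ m * fam N m a Y x $ i $ j : polyfuns I"
proof -
 assume I: "is_ideal I"
 have "divisor_eq N x ^ m * fam N m a Y x $ i $ j = (divisor_eq N x ^ m * dinv N x ^ m) * (fls_const (cst (Y $ i $ j)) * fls_X_inv ^ a)"
  by(simp add: fam_def mult_ac)
 thus ?thesis using I
  by(simp add: dinv_pow polyfuns_mult polyfuns_const polyfuns_power polyfuns_X_inv)
qed

lemma ratmat_fam: "is_ideal I ==> ratmat I N x (fam N m a Y x)"
 unfolding ratmat_def using fam_poly by blast

lemma mmap_fam: "alg_hom cst h ==> mmap h (fam N m a Y x) = fam N m a Y (h o x)"
proof -
 assume h: "alg_hom cst h"
 have r: "ring_map h" by(rule alg_hom_ring_map[OF h])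
 show ?thesis using alg_homD[OF h]
  by(simp add: mmap_def fam_def vec_eq_iff ring_map.mult[OF ring_map.ring_map_fls[OF r]]
   ring_map.power[OF ring_map.ring_map_fls[OF r]] ring_map.map_const[OF r] ring_map.map_X_inv[OF r] map_dinv[OF r])
qed

lemma fam_cong:
 assumes "is_ideal I" "!!i. i < N ==> x i - x' i : I"
 shows "fam N m a Y x $ i $ j - fam N m a Y x' $ i $ j : cof I"
 unfolding fam_def vec_lambda_beta right_diff_distrib[symmetric]
 by(intro ideal_mult[OF cof_ideal[OF assms(1)]] cong_power[OF cof_ideal[OF assms(1)]] dinv_cong assms)

text \<open>Framed points that keep their frames under all base changes and are movable by
  \<open>fam\<close> of pole order at most \<open>M\<close>.\<close>

definition nice :: "nat => nat => 'n::finite framed_point => bool" where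
 "nice N M p \<longleftrightarrow> p : Gr1 N \<and> big p = Om (alg p) N (pts p) M"

lemma nice_movable:
 fixes p :: "'n::finite framed_point"
 shows "nice N M p ==> m \<le> M ==> movable e (fam N m a Y (pts p)) p"
proof -
 assume n: "nice N M p" and m: "m \<le> M"
 have I: "is_ideal (alg p)" using n Gr1D(1) by(auto simp: nice_def)
 show ?thesis unfolding movable_def
 proof
  fix w :: "base fls ^ 'n" assume "w : poly_vecs (alg p)"
  hence "w : Om (alg p) N (pts p) 0" by(simp add: Om_0)
  from ratmat_mv_poly[OF I fam_poly[OF I] this]
  have "fam N m a Y (pts p) *v w : Om (alg p) N (pts p) m" by simp
  thus "e *c (fam N m a Y (pts p) *v w) : big p"
   using n m by(auto simp: nice_def intro!: csub_smult[OF Om_csub[OF I]] intro: Om_monoD[OF I])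
 qed
qed

lemma mv_point_cong:
 assumes s: "s : sections N k (Gr1 N)" and p: "p : Gr1 N" and e: "e * e : alg p"
  and F: "ratmat (alg p) N (pts p) F" and F': "ratmat (alg p) N (pts p) F'"
  and FF: "!!i j. F $ i $ j - F' $ i $ j : cof (alg p)" and m: "movable e F p" and m': "movable e F' p"
 shows "s (mv_point e F' p) - s (mv_point e F p) : alg p"
proof -
 note d = Gr1D[OF p]
 have P: "mv_point e F p : Gr1 N" by(rule mv_point_Gr1[OF p e F m])
 have P': "mv_point e F' p : Gr1 N" by(rule mv_point_Gr1[OF p e F' m'])
 have FFv: "F *v v - F' *v v : van (alg p)" for v
  unfolding diff_mv[symmetric] by(rule van_mv_left[OF d(1)]) (simp add: FF)
 have g: "gact e F v - gact e F' v : van (alg p)" for v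
  using van_smult[OF d(1) FFv] by(simp add: gact_def smult_diff[symmetric])
 have n: "nact e F' v - nact e F v : van (alg p)" for v
  using van_smult[OF d(1) vfpart_van[OF d(1) FFv[of "vfpart v", THEN van_sym[OF d(1)]]]]
  by(simp add: nact_def smult_diff[symmetric] vfpart_diff[symmetric])
 have ms: "mvset (alg p) (gact e F) A = mvset (alg p) (gact e F') A" for A
  unfolding mvset_def using g van_trans[OF d(1)] van_sym[OF d(1)] by blast
 have gE: "gact e F' v - gact e F v : mvset (alg p) (gact e F) (lat p)" for v
  by(rule csub_van[OF Gr1D(10)[OF P, unfolded mv_point_def framed_point.simps] van_sym[OF d(1) g]])
 have nO: "nact e F' v - nact e F v : poly_vecs (alg p)" for v
  by(rule csub_van[OF polyvecs_csub[OF d(1)] n])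
 have "s (mv_point e F' p) - s (mv_point e F p) : alg (mv_point e F p)"
  by(rule sec_same[OF s P P']) (use ms gE nO in \<open>simp_all add: mv_point_def\<close>)
 thus ?thesis by(simp add: mv_point_def)
qed

lemma mv_point_pullback:
 assumes p: "p : Gr1 N" and e: "e * e : alg p" and F: "ratmat (alg p) N (pts p) F"
  and J: "is_ideal J" and k: "alg_hom cst k" "k ` alg p \<subseteq> J" and x: "!!i. i < N ==> x i - k (pts p i) : J"
  and FF: "!!i j. mmap k F $ i $ j - F' $ i $ j : cof J" and e': "k e = e'"
 shows "is_pullback N k (mv_point e F p) (mv_point e' F' (bc_point k J x p))"
proof -
 note d = Gr1D[OF p]
 have rk: "ring_map k" by(rule alg_hom_ring_map[OF k(1)])
 interpret k: ring_map k by(rule rk)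
 have e2: "e' * e' : J" using k(2) e by(auto simp: e'[symmetric] k.mult[symmetric])
 note lg = linmap_gact[OF d(1) e, of F] and lg' = linmap_gact[OF J e2, of F']
 have FFv: "mmap k F *v v - F' *v v : van J" for v
  unfolding diff_mv[symmetric] by(rule van_mv_left[OF J]) (simp add: FF)
 have g: "vmap k (gact e F v) - gact e' F' (vmap k v) : van J" for v
  using van_smult[OF J FFv]
  by(simp add: gact_def k.vmap_add k.vmap_smult k.map_const k.vmap_mv e' smult_diff[symmetric])
 have n: "vmap k (nact e F v) - nact e' F' (vmap k v) : van J" for v
  using van_smult[OF J vfpart_van[OF J FFv]]
  by(simp add: nact_def k.vmap_add k.vmap_smult k.map_const k.vmap_mv e' vmap_vfpart[OF rk]
   smult_diff[symmetric] vfpart_diff[symmetric])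
 have bcm: "base_change k J (mvset (alg p) (gact e F) A) = mvset J (gact e' F') (base_change k J A)" for A
  by(rule base_change_mvset[OF d(1) J rk k(2) lg lg' g])
 have cl: "csub J (mvset J (gact e' F') (base_change k J (lat p)))"
  by(rule mvset_csub[OF lg' base_change_csub[OF J]])
 have nO: "nact e' F' (vmap k v) - vmap k (nact e F v) : poly_vecs J" for v
  by(rule csub_van[OF polyvecs_csub[OF J] van_sym[OF J n]])
 have gE: "gact e' F' (vmap k v) - vmap k (gact e F v) : mvset J (gact e' F') (base_change k J (lat p))" for v
  by(rule csub_van[OF cl van_sym[OF J g]])
 show ?thesis
  unfolding is_pullback_def mv_point_def bc_point_def framed_point.simps bcm
  using k x nO gE by(simp add: list_all2_conv_all_nth)
qed

lemma bc_point_id: assumes "p : Gr1 N" shows "bc_point (%a. a) (alg p) (pts p) p = p"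
proof -
 note d = Gr1D[OF assms]
 have v: "vmap (%a. a) v = v" for v :: "base fls ^ 'a"
  by(auto simp: vec_eq_iff fls_eq_iff vmap_def fls_map_nth)
 have b: "base_change (%a. a) (alg p) E = E" if "csub (alg p) E" for E :: "(base fls ^ 'a) set"
  using base_change_least[OF that, of E "%a. a"] base_change_mem[OF d(1), of _ E "%a. a"] by(auto simp: v)
 show ?thesis by(simp add: bc_point_def b d(9,10) v map_idI)
qed

lemma mv_point_zero: assumes "p : Gr1 N" shows "mv_point 0 F p = p"
proof -
 note d = Gr1D[OF assms]
 have "gact 0 F = (%v. v)" "nact 0 F = (%v. v)" by(auto simp: gact_def nact_def)
 moreover have "mvset (alg p) (%v. v) A = A" if "csub (alg p) A" for A :: "(base fls ^ 'a) set"
 proof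
  show "mvset (alg p) (%v. v) A \<subseteq> A"
   using csub_cong[OF that] csub_van[OF that] by(auto simp: mvset_def)
  show "A \<subseteq> mvset (alg p) (%v. v) A"
   using van_zero[OF d(1)] by(force simp: mvset_def)
 qed
 ultimately show ?thesis using d(9,10) by(simp add: mv_point_def)
qed

lemma bc_point_comp:
 assumes "is_ideal J" "is_ideal K" "ring_map h" "ring_map k" "k ` J \<subseteq> K"
 shows "bc_point k K x' (bc_point h J x p) = bc_point (%a. k (h a)) K x' p"
 by(simp add: bc_point_def vmap_vmap[OF assms(3,4)] base_change_comp[OF assms])

lemma bc_point_sel [simp]: "alg (bc_point h J x p) = J" "pts (bc_point h J x p) = x"
 "lat (bc_point h J x p) = base_change h J (lat p)" "big (bc_point h J x p) = base_change h J (big p)"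
 "frO (bc_point h J x p) = map (vmap h) (frO p)" "frE (bc_point h J x p) = map (vmap h) (frE p)"
 by(simp_all add: bc_point_def)

lemma mv_point_sel [simp]: "alg (mv_point e F p) = alg p" "pts (mv_point e F p) = pts p"
 "lat (mv_point e F p) = mvset (alg p) (gact e F) (lat p)" "big (mv_point e F p) = mvset (alg p) (gact e F) (big p)"
 "frO (mv_point e F p) = map (nact e F) (frO p)" "frE (mv_point e F p) = map (gact e F) (frE p)"
 by(simp_all add: mv_point_def)

lemma dual_expand:
 assumes "is_ideal I"
 shows "c - (shift (coeff (unshift c) 0) + Var 0 * shift (coeff (unshift c) 1)) : dual_ideal I"
 using assms
 by(auto simp: dual_ideal_def unshift_Var unshift_shift ring_map.add[OF ring_map_unshift]
  ring_map.mult[OF ring_map_unshift] ring_map.diff[OF ring_map_unshift] ideal_zero)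

locale homogeneous_family =
 fixes N k :: nat and s :: "'n::finite framed_point => base" and m a :: nat and Y :: "complex ^ 'n ^ 'n"
 assumes sec: "s : sections N k (Gr1 N)"
begin

abbreviation F where "F \<equiv> fam N m a Y"

text \<open>The universal first order motion of \<open>p\<close>: adjoin \<open>Var 0\<close> with
  square zero and move by 1 + \<open>Var 0\<close> F.\<close>

definition dual_point :: "'n framed_point => 'n framed_point" where
 "dual_point p = mv_point (Var 0) (F (shift o pts p)) (bc_point shift (dual_ideal (alg p)) (shift o pts p) p)"

definition deriv_coeff :: "'n framed_point => base" where
 "deriv_coeff p = coeff (unshift (s (dual_point p))) 1"

lemma nice_bc:
 assumes n: "nice N M p" and J: "is_ideal J" and h: "alg_hom cst h" "h ` alg p \<subseteq> J"
  and x: "!!i. i < N ==> x i - h (pts p i) : J"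
 shows "nice N M (bc_point h J x p)"
 using bc_point_Gr1_Om[of p N J h x M] assms unfolding nice_def by(auto simp: bc_point_def)

lemma nice_mv_Gr1:
 assumes n: "nice N M p" and "m \<le> M" and e: "e * e : alg p"
 shows "mv_point e (F (pts p)) p : Gr1 N"
 using n Gr1D(1) by(intro mv_point_Gr1 e ratmat_fam nice_movable[OF n assms(2)]) (auto simp: nice_def)

lemma dual_point_Gr1:
 assumes n: "nice N M p" and mM: "m \<le> M"
 shows "dual_point p : Gr1 N"
proof -
 have I: "is_ideal (alg p)" using n Gr1D(1) by(auto simp: nice_def)
 note K = dual_ideal[OF I]
 have nP: "nice N M (bc_point shift (dual_ideal (alg p)) (shift o pts p) p)"
  using K(1,2) ideal_zero by(intro nice_bc[OF n K(1) alg_hom_shift K(2)]) auto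
 show ?thesis unfolding dual_point_def
  using nice_mv_Gr1[OF nP mM, of "Var 0"] K(3) by simp
qed

text \<open>Any motion of any base change is the pullback of the universal motion along the map with
  \<open>Var 0\<close> going to \<open>e\<close>. The constant term is left unidentified until
  \<open>deriv_expand\<close>.\<close>

lemma deriv_expand_aux:
 assumes n: "nice N M p" and mM: "m \<le> M" and J: "is_ideal J" and h: "alg_hom cst h" "h ` alg p \<subseteq> J"
  and x: "!!i. i < N ==> x i - h (pts p i) : J" and e: "e * e : J"
 shows "s (mv_point e (F x) (bc_point h J x p)) - (h (coeff (unshift (s (dual_point p))) 0) + e * h (deriv_coeff p)) : J"
proof -
 have I: "is_ideal (alg p)" using n Gr1D(1) by(auto simp: nice_def)
 let ?K = "dual_ideal (alg p)"
 note K = dual_ideal[OF I] and eh = ext_hom[OF h(1), of e]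
 let ?P = "bc_point shift ?K (shift o pts p) p" and ?k = "ext_hom h e"
 have nP: "nice N M ?P"
  using K(1,2) ideal_zero by(intro nice_bc[OF n K(1) alg_hom_shift K(2)]) auto
 have P: "?P : Gr1 N" using nP by(simp add: nice_def)
 have rk: "ring_map ?k" by(rule alg_hom_ring_map[OF eh(1)])
 have kK: "?k ` ?K \<subseteq> J" by(rule ext_hom_dual[OF h(1) I J h(2) e])
 have Q: "dual_point p : Gr1 N" by(rule dual_point_Gr1[OF n mM])
 have nP': "nice N M (bc_point h J x p)" by(rule nice_bc[OF n J h x])
 have R: "mv_point e (F x) (bc_point h J x p) : Gr1 N"
  using nice_mv_Gr1[OF nP' mM, of e] e by(simp add: bc_point_def)
 have bP: "bc_point ?k J x ?P = bc_point h J x p"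
  by(subst bc_point_comp[OF K(1) J ring_map_shift rk kK]) (simp add: eh(2))
 have "is_pullback N ?k (dual_point p) (mv_point e (F x) (bc_point ?k J x ?P))"
  unfolding dual_point_def
 proof(rule mv_point_pullback[OF P _ _ J eh(1)])
  show "Var 0 * Var 0 : alg ?P" using K(3) by(simp add: bc_point_def)
  show "ratmat (alg ?P) N (pts ?P) (F (shift o pts p))" using ratmat_fam[OF K(1)] by(simp add: bc_point_def)
  show "?k ` alg ?P \<subseteq> J" using kK by(simp add: bc_point_def)
  show "x i - ?k (pts ?P i) : J" if "i < N" for i using x[OF that] by(simp add: bc_point_def eh(2))
  have "?k o (shift o pts p) = h o pts p" by(auto simp: eh(2))
  thus "mmap ?k (F (shift o pts p)) $ i $ j - F x $ i $ j : cof J" for i j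
   unfolding mmap_fam[OF eh(1)] using x cong_sym[OF J] by(simp add: fam_cong[OF J])
  show "?k (Var 0) = e" by(rule eh(3))
 qed
 note pb = this[unfolded bP]
 have "alg (mv_point e (F x) (bc_point h J x p)) = J" by(simp add: mv_point_def bc_point_def)
 hence 1: "s (mv_point e (F x) (bc_point h J x p)) - ?k (s (dual_point p)) : J"
  using sec_pullback[OF sec Q R pb] by(simp only:)
 have "?k (s (dual_point p) - (shift (coeff (unshift (s (dual_point p))) 0) + Var 0 * shift (coeff (unshift (s (dual_point p))) 1))) : J"
  using kK dual_expand[OF I] by blast
 hence "?k (s (dual_point p)) - (h (coeff (unshift (s (dual_point p))) 0) + e * h (coeff (unshift (s (dual_point p))) 1)) : J"
  by(simp add: ring_map.diff[OF rk] ring_map.add[OF rk] ring_map.mult[OF rk] eh)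
 from cong_trans[OF J 1 this] show ?thesis by(simp add: deriv_coeff_def)
qed

lemma deriv_expand:
 assumes n: "nice N M p" and mM: "m \<le> M" and J: "is_ideal J" and h: "alg_hom cst h" "h ` alg p \<subseteq> J"
  and x: "!!i. i < N ==> x i - h (pts p i) : J" and e: "e * e : J"
 shows "s (mv_point e (F x) (bc_point h J x p)) - (h (s p) + e * h (deriv_coeff p)) : J"
proof -
 have p: "p : Gr1 N" using n by(simp add: nice_def)
 have I: "is_ideal (alg p)" by(rule Gr1D(1)[OF p])
 interpret h: ring_map h by(rule alg_hom_ring_map[OF h(1)])
 \<comment> \<open>The motion with \<open>e = 0\<close> along the identity leaves \<open>p\<close>
   alone and identifies the constant term with \<open>s p\<close>.\<close>
 have "s (mv_point 0 (F (pts p)) (bc_point (%a. a) (alg p) (pts p) p)) - (coeff (unshift (s (dual_point p))) 0 + 0 * deriv_coeff p) : alg p"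
  by(rule deriv_expand_aux[OF n mM I]) (use I in \<open>auto simp: alg_hom_def ideal_zero\<close>)
 hence "s p - coeff (unshift (s (dual_point p))) 0 : alg p"
  by(simp add: bc_point_id[OF p] mv_point_zero[OF p])
 hence "h (s p) - h (coeff (unshift (s (dual_point p))) 0) : J" using h(2) by(auto simp flip: h.diff)
 from ideal_diff[OF J deriv_expand_aux[OF n mM J h x e] this] show ?thesis by(simp add: algebra_simps)
qed

lemma deriv_dual:
 assumes n: "nice N M p" and mM: "m \<le> M"
 shows "s (dual_point p) - (shift (s p) + Var 0 * shift (deriv_coeff p)) : dual_ideal (alg p)"
proof -
 have I: "is_ideal (alg p)" using n Gr1D(1) by(auto simp: nice_def)
 note K = dual_ideal[OF I]
 show ?thesis unfolding dual_point_def
  by(rule deriv_expand[OF n mM K(1) alg_hom_shift K(2) _ K(3)]) (simp add: ideal_zero[OF K(1)])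
qed

text \<open>The universal motion of the base change is a motion of \<open>p\<close> along
  \<open>h\<close> followed by \<open>shift\<close>. Its value is thus expanded in two ways, and the
  coefficients of \<open>Var 0\<close> agree.\<close>

lemma deriv_pullback:
 assumes n: "nice N M p" and mM: "m \<le> M" and J: "is_ideal J" and h: "alg_hom cst h" "h ` alg p \<subseteq> J"
  and x: "!!i. i < N ==> x i - h (pts p i) : J"
 shows "deriv_coeff (bc_point h J x p) - h (deriv_coeff p) : J"
proof -
 let ?P = "bc_point h J x p" and ?K = "dual_ideal J"
 note K = dual_ideal[OF J]
 have rh: "ring_map h" by(rule alg_hom_ring_map[OF h(1)])
 interpret sh: ring_map shift by(rule ring_map_shift)
 have nP: "nice N M ?P" by(rule nice_bc[OF n J h x])
 have 1: "s (dual_point ?P) - (shift (s ?P) + Var 0 * shift (deriv_coeff ?P)) : ?K"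
  using deriv_dual[OF nP mM] by(simp add: bc_point_def)
 have dp: "dual_point ?P = mv_point (Var 0) (F (shift o x)) (bc_point (%a. shift (h a)) ?K (shift o x) p)"
  unfolding dual_point_def bc_point_sel bc_point_comp[OF J K(1) rh ring_map_shift K(2)] ..
 have 2: "s (dual_point ?P) - (shift (h (s p)) + Var 0 * shift (h (deriv_coeff p))) : ?K"
  unfolding dp
 proof(rule deriv_expand[OF n mM K(1) _ _ _ K(3)])
  show "alg_hom cst (%a. shift (h a))" using h(1) alg_hom_shift by(simp add: alg_hom_def)
  show "(%a. shift (h a)) ` alg p \<subseteq> ?K" using h(2) K(2) by auto
  show "(shift o x) i - shift (h (pts p i)) : ?K" if "i < N" for i
   using x[OF that] K(2) by(auto simp flip: sh.diff)
 qed
 have "shift (s ?P - h (s p)) + Var 0 * shift (deriv_coeff ?P - h (deriv_coeff p)) : ?K"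
  using ideal_diff[OF K(1) 2 1] by(simp add: sh.diff algebra_simps)
 thus ?thesis using K(4) by blast
qed

text \<open>The transformation determinants of the universal motions are the given ones, without a
  term in \<open>Var 0\<close>. Hence the rule for \<open>s\<close> over the dual numbers holds
  coefficient by coefficient.\<close>

lemma deriv_frame:
 assumes n: "nice N M p" and mM: "m \<le> M" and n1: "p1 : Gr1 N"
  and eq: "alg p1 = alg p" "pts p1 = pts p" "lat p1 = lat p" "big p1 = big p"
  and H: "changes_frame (poly_vecs (alg p)) H (frO p) (frO p1)" and G: "changes_frame (lat p) G (frE p) (frE p1)"
 shows "deriv_coeff p1 * frame_det (length (frE p)) G ^ k - deriv_coeff p * frame_det (length (frO p)) H ^ k : alg p"
proof -
 have n1: "nice N M p1" using n n1 eq by(simp add: nice_def)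
 have I: "is_ideal (alg p)" using n Gr1D(1) by(auto simp: nice_def)
 let ?K = "dual_ideal (alg p)"
 note K = dual_ideal[OF I]
 interpret sh: ring_map shift by(rule ring_map_shift)
 let ?F = "F (shift o pts p)"
 let ?fO = "%v. nact (Var 0) ?F (vmap shift v)" and ?fE = "%v. gact (Var 0) ?F (vmap shift v)"
 have lg: "linmap ?K (gact (Var 0) ?F)" by(rule linmap_gact[OF K(1,3)])
 have 1: "changes_frame (poly_vecs ?K) (%a b. shift (H a b)) (map ?fO (frO p)) (map ?fO (frO p1))"
 proof(rule changes_frame_map[OF H])
  show "?fO v : poly_vecs ?K" if "v : poly_vecs (alg p)" for v
  proof -
   have "vmap shift v : poly_vecs ?K" by(rule vmap_poly_vecs[OF ring_map_shift K(2) that])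
   hence "nact (Var 0) ?F (vmap shift v) : mvset ?K (nact (Var 0) ?F) (poly_vecs ?K)"
    using mvset_in[OF linmap_nact[OF K(1,3)] polyvecs_csub[OF K(1)]] by blast
   thus ?thesis by(simp add: mvset_nact_poly[OF K(1,3)])
  qed
 qed (simp_all add: sh.vmap_add sh.vmap_smult sh.map_const nact_add nact_smult)
 have 2: "changes_frame (mvset ?K (gact (Var 0) ?F) (base_change shift ?K (lat p))) (%a b. shift (G a b)) (map ?fE (frE p)) (map ?fE (frE p1))"
 proof(rule changes_frame_map[OF G])
  show "?fE v : mvset ?K (gact (Var 0) ?F) (base_change shift ?K (lat p))" if "v : lat p" for v
   using base_change_mem[OF K(1) that] mvset_in[OF lg base_change_csub[OF K(1)]] by blast
 qed (simp_all add: sh.vmap_add sh.vmap_smult sh.map_const gact_add gact_smult)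
 have "s (dual_point p1) * frame_det (length (frE (dual_point p))) (%a b. shift (G a b)) ^ k
   - s (dual_point p) * frame_det (length (frO (dual_point p))) (%a b. shift (H a b)) ^ k : alg (dual_point p)"
  using 1 2 eq
  by(intro sec_frame[OF sec dual_point_Gr1[OF n mM] dual_point_Gr1[OF n1 mM]])
   (simp_all add: dual_point_def mv_point_def bc_point_def comp_def)
 hence 3: "s (dual_point p1) * shift (frame_det (length (frE p)) G ^ k)
   - s (dual_point p) * shift (frame_det (length (frO p)) H ^ k) : ?K"
  by(simp add: dual_point_def mv_point_def bc_point_def sh.power frame_det_hom[OF ring_map_shift])
 define g where "g = frame_det (length (frE p)) G ^ k"
 define h where "h = frame_det (length (frO p)) H ^ k"
 have 4: "(shift (s p1) + Var 0 * shift (deriv_coeff p1)) * shift g - (shift (s p) + Var 0 * shift (deriv_coeff p)) * shift h : ?K"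
 proof -
  have a: "s (dual_point p1) * shift g - (shift (s p1) + Var 0 * shift (deriv_coeff p1)) * shift g : ?K"
   using ideal_mult2[OF K(1) deriv_dual[OF n1 mM, unfolded eq(1)], of "shift g"] by(simp add: left_diff_distrib)
  have b: "s (dual_point p) * shift h - (shift (s p) + Var 0 * shift (deriv_coeff p)) * shift h : ?K"
   using ideal_mult2[OF K(1) deriv_dual[OF n mM], of "shift h"] by(simp add: left_diff_distrib)
  have "c - d : ?K" if "a - b : ?K" "a - c : ?K" "b - d : ?K" for a b c d
   using ideal_diff[OF K(1) ideal_add[OF K(1) that(1) that(3)] that(2)] by simp
  from this[OF 3[folded g_def h_def] a b] show ?thesis .
 qed
 have "(shift (s p1) + Var 0 * shift (deriv_coeff p1)) * shift g - (shift (s p) + Var 0 * shift (deriv_coeff p)) * shift h =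
   shift (s p1 * g - s p * h) + Var 0 * shift (deriv_coeff p1 * g - deriv_coeff p * h)"
  by(simp add: sh.diff sh.mult algebra_simps)
 hence "shift (s p1 * g - s p * h) + Var 0 * shift (deriv_coeff p1 * g - deriv_coeff p * h) : ?K" using 4 by simp
 thus ?thesis using K(4) by(auto simp: g_def h_def)
qed

lemma deriv_enlarge:
 assumes n: "nice N M p" and mM: "m \<le> M" and n1: "nice N M1 p1" and mM1: "m \<le> M1"
  and eq: "alg p1 = alg p" "pts p1 = pts p" "lat p1 = lat p" "big p \<subseteq> big p1" "frO p1 = frO p @ q" "frE p1 = frE p @ q"
 shows "deriv_coeff p1 - deriv_coeff p : alg p"
proof -
 have p: "p : Gr1 N" using n by(simp add: nice_def)
 have I: "is_ideal (alg p)" by(rule Gr1D(1)[OF p])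
 let ?K = "dual_ideal (alg p)"
 note K = dual_ideal[OF I]
 interpret sh: ring_map shift by(rule ring_map_shift)
 let ?B = "%p. bc_point shift ?K (shift o pts p) p"
 have nB: "nice N M (?B p)" by(rule nice_bc[OF n K(1) alg_hom_shift K(2)]) (simp add: ideal_zero[OF K(1)])
 have nB1: "nice N M1 (?B p1)" using nice_bc[OF n1 K(1) alg_hom_shift, of "shift o pts p1"] K(2) eq(1)
  by(simp add: ideal_zero[OF K(1)])
 have "s (mv_point (Var 0) (F (shift o pts p)) (?B p1)) - s (mv_point (Var 0) (F (shift o pts p)) (?B p)) : alg (?B p)"
 proof(rule mv_point_enlarge[OF sec])
  show "?B p : Gr1 N" "?B p1 : Gr1 N" using nB nB1 by(auto simp: nice_def)
  show "big (?B p) \<subseteq> big (?B p1)" using base_change_mono[OF K(1) eq(4)] by(simp add: bc_point_def)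
  show "frO (?B p1) = frO (?B p) @ map (vmap shift) q" "frE (?B p1) = frE (?B p) @ map (vmap shift) q"
   "alg (?B p1) = alg (?B p)" "pts (?B p1) = pts (?B p)" "lat (?B p1) = lat (?B p)"
   by(simp_all add: bc_point_def eq)
  show "Var 0 * Var 0 : alg (?B p)" using K(3) by(simp add: bc_point_def)
  show "ratmat (alg (?B p)) N (pts (?B p)) (F (shift o pts p))" using ratmat_fam[OF K(1)] by(simp add: bc_point_def)
  show "movable (Var 0) (F (shift o pts p)) (?B p)" using nice_movable[OF nB mM] by(simp add: bc_point_def)
 qed
 hence 1: "s (dual_point p1) - s (dual_point p) : ?K"
  by(simp add: dual_point_def eq bc_point_def)
 have "shift (s p1 - s p) + Var 0 * shift (deriv_coeff p1 - deriv_coeff p) =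
   (s (dual_point p1) - s (dual_point p)) - (s (dual_point p1) - (shift (s p1) + Var 0 * shift (deriv_coeff p1))) +
   (s (dual_point p) - (shift (s p) + Var 0 * shift (deriv_coeff p)))"
  by(simp add: sh.diff algebra_simps)
 also have "\<dots> : ?K"
  by(intro ideal_add[OF K(1)] ideal_diff[OF K(1)] 1 deriv_dual[OF n mM] deriv_dual[OF n1 mM1, unfolded eq(1)])
 finally show ?thesis using K(4) by blast
qed

end

section \<open>Splitting injective matrices\<close>

definition dot :: "nat => (nat => base) => (nat => base) => base" where
 "dot L x y = (\<Sum>j<L. x j * y j)"

lemma dot_diff: "dot L x (%j. y j - z j) = dot L x y - dot L x z"
 by(simp add: dot_def right_diff_distrib sum_subtractf)

lemma dot_diff2: "dot L (%j. y j - z j) x = dot L y x - dot L z x"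
 by(simp add: dot_def left_diff_distrib sum_subtractf)

lemma dot_sum: "dot L x (%j. \<Sum>a<n. f a j) = (\<Sum>a<n. dot L x (f a))"
 unfolding dot_def sum_distrib_left by(rule sum.swap)

lemma dot_sum2: "dot L (%j. \<Sum>a<n. f a j) x = (\<Sum>a<n. dot L (f a) x)"
 unfolding dot_def sum_distrib_right by(rule sum.swap)

lemma dot_scale: "dot L x (%j. y j * c) = dot L x y * c"
 by(simp add: dot_def sum_distrib_left sum_distrib_right mult_ac)

lemma dot_scale2: "dot L (%j. c * y j) x = c * dot L y x"
 by(simp add: dot_def sum_distrib_left sum_distrib_right mult_ac)

text \<open>The matrix \<open>T\<close> is a right inverse of the \<open>r\<close> by
  \<open>L\<close> matrix \<open>kap\<close>, so the rows of \<open>kap\<close> span a free direct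
  summand.\<close>

definition splits :: "base set => (nat => nat => base) => nat => nat => (nat => nat => base) => bool" where
 "splits I kap L r T \<longleftrightarrow> (ALL a<r. ALL b<r. dot L (kap a) (%j. T j b) - (if a = b then 1 else 0) : I)"

definition row_inj :: "base set => (nat => nat => base) => nat => nat => bool" where
 "row_inj I kap L r \<longleftrightarrow> (ALL c. (ALL j<L. (\<Sum>a<r. c a * kap a j) : I) --> (ALL a<r. c a : I))"

lemma row_injD:
 "row_inj I kap L r ==> (!!j. j < L ==> (\<Sum>a<r. c a * kap a j) : I) ==> a < r ==> c a : I"
 by(simp add: row_inj_def)

text \<open>Row \<open>i\<close> minus its projection to the earlier rows, for the projection that
  is given by their splitting \<open>T\<close>.\<close>

definition reduced_row :: "(nat => nat => base) => nat => (nat => nat => base) => nat => nat => base" where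
 "reduced_row kap L T i j = kap i j - (\<Sum>a<i. dot L (kap i) (%l. T l a) * kap a j)"

text \<open>The vector \<open>t\<close> is corrected to \<open>z\<close>, which pairs to 0 with the
  earlier rows and to 1 with row \<open>i\<close>. Then the old columns of \<open>T\<close> are
  corrected by multiples of \<open>z\<close> to pair to 0 with row \<open>i\<close>.\<close>

lemma splits_step:
 assumes I: "is_ideal I" and T: "splits I kap L i T" and t: "dot L (reduced_row kap L T i) t - 1 : I"
 shows "EX T'. splits I kap L (Suc i) T'"
proof -
 define p where "p a = dot L (kap i) (%l. T l a)" for a
 define z where "z j = t j - (\<Sum>a<i. T j a * dot L (kap a) t)" for j
 define T' where "T' j b = (if b = i then z j else T j b - z j * p b)" for j b
 have dz: "dot L x z = dot L x t - (\<Sum>a<i. dot L x (%j. T j a) * dot L (kap a) t)" for x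
  unfolding z_def dot_diff dot_sum dot_scale ..
 have z0: "dot L (kap b) z : I" if b: "b < i" for b
 proof -
  have "(\<Sum>a<i. dot L (kap b) (%j. T j a) * dot L (kap a) t) - (\<Sum>a<i. (if b = a then 1 else 0) * dot L (kap a) t) : I"
   using T b by(intro cong_sum[OF I] cong_mult[OF I]) (auto simp: splits_def ideal_zero[OF I])
  moreover have "(\<Sum>a<i. (if b = a then 1 else 0) * dot L (kap a) t) = (\<Sum>a<i. if a = b then dot L (kap b) t else 0)"
   by(rule sum.cong) auto
  ultimately have "(\<Sum>a<i. dot L (kap b) (%j. T j a) * dot L (kap a) t) - dot L (kap b) t : I" using b by simp
  thus ?thesis unfolding dz by(rule cong_sym[OF I])
 qed
 have z1: "dot L (kap i) z - 1 : I"
 proof -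
  have "dot L (reduced_row kap L T i) t = dot L (kap i) z"
   unfolding dz reduced_row_def dot_diff2 dot_sum2 dot_scale2 ..
  thus ?thesis using t by simp
 qed
 have dT: "dot L x (%j. T' j b) = (if b = i then dot L x z else dot L x (%j. T j b) - dot L x z * p b)" for x b
  by(simp add: T'_def dot_diff dot_scale)
 have "dot L (kap a) (%j. T' j b) - (if a = b then 1 else 0) : I" if ab: "a < Suc i" "b < Suc i" for a b
 proof -
  consider "a < i" "b < i" | "a < i" "b = i" | "a = i" "b < i" | "a = i" "b = i" using ab by linarith
  thus ?thesis
  proof cases
   case 1
   have "dot L (kap a) (%j. T j b) - (if a = b then 1 else 0) : I"
    using T 1 unfolding splits_def by blast
   from ideal_diff[OF I this ideal_mult2[OF I z0[OF 1(1)], of "p b"]] show ?thesis using 1 by(simp add: dT algebra_simps)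
  next
   case 2
   thus ?thesis using z0 by(simp add: dT)
  next
   case 3
   have "(1 - dot L (kap i) z) * p b : I" by(intro ideal_mult2[OF I] cong_sym[OF I z1])
   thus ?thesis using 3 by(simp add: dT p_def algebra_simps)
  next
   case 4
   thus ?thesis using z1 by(simp add: dT)
  qed
 qed
 thus ?thesis unfolding splits_def by blast
qed

lemma reduced_row_comb:
 assumes "i < r"
 shows "(\<Sum>a<r. (if a = i then y else if a < i then - dot L (kap i) (%l. T l a) * y else 0) * kap a j) = y * reduced_row kap L T i j"
proof -
 let ?c = "%a. if a = i then y else if a < i then - dot L (kap i) (%l. T l a) * y else 0"
 have "(\<Sum>a<r. ?c a * kap a j) = (\<Sum>a<Suc i. ?c a * kap a j)"
  using assms by(intro sum.mono_neutral_right) auto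
 also have "\<dots> = (\<Sum>a<i. ?c a * kap a j) + y * kap i j" by simp
 also have "(\<Sum>a<i. ?c a * kap a j) = - (\<Sum>a<i. y * (dot L (kap i) (%l. T l a) * kap a j))"
  unfolding sum_negf[symmetric] by(rule sum.cong) (auto simp: mult_ac)
 finally show ?thesis by(simp add: reduced_row_def right_diff_distrib sum_distrib_left)
qed

text \<open>Let \<open>A\<close> be the ideal of values of the reduced row. Modulo \<open>A\<close>
  this row vanishes, which is a relation among the rows with coefficient 1 at row \<open>i\<close>.
  Injectivity modulo \<open>A\<close> forces 1 into \<open>A\<close>, and \<open>splits_step\<close>
  applies.\<close>

lemma splits_exists:
 assumes I: "is_ideal I" and inj: "!!A. is_ideal A ==> I \<subseteq> A ==> row_inj A kap L r"
 shows "EX T. splits I kap L r T"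
proof -
 have "i \<le> r ==> EX T. splits I kap L i T" for i
 proof(induction i)
  case 0
  show ?case by(simp add: splits_def)
 next
  case (Suc i)
  then obtain T where T: "splits I kap L i T" by auto
  let ?w = "reduced_row kap L T i"
  define A where "A = {x. EX t. dot L ?w t - x : I}"
  have A: "is_ideal A"
   unfolding is_ideal_def A_def
  proof(intro conjI ballI allI CollectI)
   show "EX t. dot L ?w t - 0 : I" by(rule exI[of _ "%_. 0"]) (simp add: dot_def ideal_zero[OF I])
   fix x y assume "x : {x. EX t. dot L ?w t - x : I}" "y : {x. EX t. dot L ?w t - x : I}"
   then obtain t u where "dot L ?w t - x : I" "dot L ?w u - y : I" by blast
   from ideal_add[OF I this] have "dot L ?w (%j. t j + u j) - (x + y) : I"
    by(simp add: dot_def distrib_left sum.distrib algebra_simps)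
   thus "EX t. dot L ?w t - (x + y) : I" by blast
  next
   fix c y assume "y : {x. EX t. dot L ?w t - x : I}"
   then obtain u where "dot L ?w u - y : I" by blast
   moreover have "dot L ?w (%j. u j * c) - c * y = (dot L ?w u - y) * c"
    unfolding dot_scale by(simp add: algebra_simps)
   ultimately have "dot L ?w (%j. u j * c) - c * y : I" using ideal_mult2[OF I] by metis
   thus "EX t. dot L ?w t - c * y : I" by blast
  qed
  have IA: "I \<subseteq> A"
  proof
   fix x assume "x : I"
   thus "x : A" unfolding A_def
    by(intro CollectI exI[of _ "%_. 0"]) (simp add: dot_def ideal_uminus[OF I])
  qed
  have w: "?w j : A" if "j < L" for j
  proof -
   have "dot L ?w (%l. if l = j then 1 else 0) = (\<Sum>l<L. if l = j then ?w j else 0)"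
    unfolding dot_def by(rule sum.cong) auto
   hence "dot L ?w (%l. if l = j then 1 else 0) = ?w j" using that by simp
   thus ?thesis unfolding A_def
    by(intro CollectI exI[of _ "%l. if l = j then 1 else 0"]) (simp add: ideal_zero[OF I])
  qed
  have i: "i < r" using Suc.prems by simp
  define c where "c a = (if a = i then 1 else if a < i then - dot L (kap i) (%l. T l a) * 1 else 0)" for a
  have cr: "(\<Sum>a<r. c a * kap a j) = 1 * ?w j" for j unfolding c_def by(rule reduced_row_comb[OF i])
  have "ALL j<L. (\<Sum>a<r. c a * kap a j) : A" unfolding cr using w by simp
  hence "c i : A" using row_injD[OF inj[OF A IA], of c i] i by simp
  hence "1 : A" by(simp add: c_def)
  then obtain t where "dot L ?w t - 1 : I" by(auto simp: A_def)
  from splits_step[OF I T this] show ?case .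
 qed
 thus ?thesis by blast
qed

lemma row_inj_loc:
 assumes l: "is_loc I h J" and k: "row_inj I kap L r"
 shows "row_inj J (%a j. h (kap a j)) L r"
 unfolding row_inj_def
proof(intro allI impI)
 have I: "is_ideal I" and J: "is_ideal J" and h: "ring_map h" "h ` I \<subseteq> J"
  using l alg_hom_ring_map by(auto simp: is_loc_def)
 interpret h: ring_map h by(rule h(1))
 fix c a assume c: "ALL j<L. (\<Sum>a<r. c a * h (kap a j)) : J" and a: "a < r"
 obtain d w c' where d: "w * h d - 1 : J" "ALL t<r. h d * c t - h (c' t) : J"
  using is_loc_denoms[OF l] by blast
 have "h (\<Sum>a<r. c' a * kap a j) : J" if j: "j < L" for j
 proof -
  have "h (c' a) - h d * c a : J" if "a < r" for a using cong_sym[OF J] d(2) that by blast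
  hence 1: "(\<Sum>a<r. h (c' a) * h (kap a j)) - (\<Sum>a<r. (h d * c a) * h (kap a j)) : J"
   by(intro cong_sum[OF J] cong_mult[OF J]) (auto simp: ideal_zero[OF J])
  have 2: "(\<Sum>a<r. (h d * c a) * h (kap a j)) = h d * (\<Sum>a<r. c a * h (kap a j))"
   by(simp add: sum_distrib_left mult.assoc)
  have "h d * (\<Sum>a<r. c a * h (kap a j)) : J" using ideal_mult[OF J c[rule_format, OF j]] .
  from ideal_eq_zeroI[OF J this 1[unfolded 2]] have "(\<Sum>a<r. h (c' a) * h (kap a j)) : J" .
  thus ?thesis by(simp only: h.sum h.mult)
 qed
 hence "ALL j<L. h (\<Sum>a<r. c' a * kap a j) : J" by simp
 from is_loc_kill[OF l this] obtain e v where
  e: "v * h e - 1 : J" "ALL j<L. e * (\<Sum>a<r. c' a * kap a j) : I"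
  by(elim exE conjE)
 have "(\<Sum>a<r. (e * c' a) * kap a j) : I" if "j < L" for j
  using e(2) that by(simp add: sum_distrib_left mult.assoc)
 from row_injD[OF k this a] have "e * c' a : I" .
 hence "h e * h (c' a) : J" using h(2) by(auto simp flip: h.mult)
 hence "h (c' a) : J" by(rule unit_cancel[OF J e(1)])
 hence "h d * c a : J" using d(2) a ideal_cong[OF J] by blast
 thus "c a : J" by(rule unit_cancel[OF J d(1)])
qed

text \<open>Induction on the sum of the exponents: each \<open>w j * x\<close> is killed with one
  exponent lowered, so it vanishes, and then \<open>x\<close> is a common annihilator of the
  \<open>w j\<close>.\<close>

lemma power_annihilator:
 fixes w :: "nat => base" and e :: "nat => nat"
 assumes I: "is_ideal I" and ann: "!!y. (ALL j<L. w j * y : I) ==> y : I"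
  and x: "ALL j<L. w j ^ e j * x : I"
 shows "(x :: base) : I"
 using x
proof(induction "\<Sum>j<L. e j" arbitrary: x e rule: less_induct)
 case less
 show ?case
 proof(cases "EX j<L. e j = 0")
  case True
  thus ?thesis using less.prems by fastforce
 next
  case False
  have "w j * x : I" if j: "j < L" for j
  proof(rule less.hyps[of "e(j := e j - 1)"])
   have "(\<Sum>i<L. (e(j := e j - 1)) i) < (\<Sum>i<L. e i)"
   proof(rule sum_strict_mono_ex1)
    show "EX i:{..<L}. (e(j := e j - 1)) i < e i" using j False by(intro bexI[of _ j]) auto
   qed auto
   thus "sum (e(j := e j - 1)) {..<L} < sum e {..<L}" .
   show "ALL i<L. w i ^ (e(j := e j - 1)) i * (w j * x) : I"
   proof(intro allI impI)
    fix i assume i: "i < L"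
    show "w i ^ (e(j := e j - 1)) i * (w j * x) : I"
    proof(cases "i = j")
     case True
     have "e j = Suc (e j - 1)" using False j by auto
     hence "w j ^ e j = w j ^ (e j - 1) * w j" by(metis power_Suc2)
     hence "w j ^ (e j - 1) * (w j * x) = w j ^ e j * x" by(simp only: mult.assoc)
     moreover have "w j ^ e j * x : I" using less.prems j by blast
     ultimately show ?thesis unfolding True fun_upd_same by argo
    next
     case False
     have "w j * (w i ^ e i * x) : I" using less.prems i ideal_mult[OF I] by blast
     thus ?thesis using False by(simp add: mult_ac)
    qed
   qed
  qed
  thus ?thesis using ann by blast
 qed
qed

text \<open>Injectivity without base change does not split a matrix, but it leaves the entries of
  the next reduced row without a common annihilator. Where one entry is inverted, the splitting
  extends by one row. If \<open>x\<close> vanishes in all these localizations, a power of each entry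
  kills it, and \<open>power_annihilator\<close> applies. The induction runs over the rows that
  remain to be split.\<close>

lemma localize_split:
 assumes "is_ideal I" and "row_inj I kap L r"
  and "!!h J T. is_loc I h J ==> splits J (%a j. h (kap a j)) L r T ==> h x : J"
 shows "x : I"
proof -
 have "x : I" if "is_ideal I" "row_inj I kap L r" "i \<le> r" "splits I kap L i T"
  "!!h J T. is_loc I h J ==> splits J (%a j. h (kap a j)) L r T ==> h x : J" for i T I kap x
  using that
 proof(induction "r - i" arbitrary: i T I kap x)
  case 0
  thus ?case using is_loc_id[OF 0(2)] by simp
 next
  case (Suc n)
  let ?w = "reduced_row kap L T i"
  interpret sh: ring_map shift by(rule ring_map_shift)
  have i: "i < r" using Suc(2) by simp
  have ann: "y : I" if y: "ALL j<L. ?w j * y : I" for y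
  proof -
   define c where "c a = (if a = i then y else if a < i then - dot L (kap i) (%l. T l a) * y else 0)" for a
   have cr: "(\<Sum>a<r. c a * kap a j) = y * ?w j" for j unfolding c_def by(rule reduced_row_comb[OF i])
   have "ALL j<L. (\<Sum>a<r. c a * kap a j) : I" unfolding cr using y by(simp add: mult.commute)
   hence "c i : I" using row_injD[OF Suc.prems(2), of c i] i by simp
   thus ?thesis by(simp add: c_def)
  qed
  have "EX e. ?w j ^ e * x : I" if j: "j < L" for j
  proof -
   let ?J = "loc_ideal I (?w j)"
   note l = loc_ideal[OF Suc.prems(1), where m = "?w j"]
   have J: "is_ideal ?J" "shift ` I \<subseteq> ?J" using l(1) by(auto simp: is_loc_def)
   let ?k = "%a j. shift (kap a j)" and ?T = "%j a. shift (T j a)"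
   have sd: "shift (dot L u v) = dot L (%j. shift (u j)) (%j. shift (v j))" for u v
    by(simp add: dot_def sh.sum sh.mult)
   have T: "splits ?J ?k L i ?T"
    unfolding splits_def
   proof(intro allI impI)
    fix a b assume "a < i" "b < i"
    hence "shift (dot L (kap a) (%j. T j b) - (if a = b then 1 else 0)) : ?J"
     using Suc.prems(4) J(2) unfolding splits_def by blast
    thus "dot L (?k a) (%j. ?T j b) - (if a = b then 1 else 0) : ?J"
     by(simp add: sh.diff sd sh.one sh.zero split: if_splits)
   qed
   have rw: "reduced_row ?k L ?T i l = shift (?w l)" for l
    by(simp add: reduced_row_def sh.diff sh.sum sh.mult sd)
   \<comment> \<open>The unit vector at \<open>j\<close>, divided by the inverted entry, pairs to 1
     with the reduced row.\<close>
   have "dot L (reduced_row ?k L ?T i) (%l. if l = j then Var 0 else 0) = (\<Sum>l<L. if l = j then shift (?w j) * Var 0 else 0)"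
    unfolding dot_def rw by(rule sum.cong) auto
   also have "\<dots> = Var 0 * shift (?w j)" using j by simp
   finally have "dot L (reduced_row ?k L ?T i) (%l. if l = j then Var 0 else 0) - 1 : ?J" using l(2) by simp
   from splits_step[OF J(1) T this] obtain T' where T': "splits ?J ?k L (Suc i) T'" by blast
   have "shift x : ?J"
   proof(rule Suc(1)[OF _ J(1) row_inj_loc[OF l(1) Suc.prems(2)] _ T'])
    show "n = r - Suc i" "Suc i \<le> r" using Suc(2) i by auto
    fix h K U assume h: "is_loc ?J h K" and U: "splits K (%a j. h (?k a j)) L r U"
    show "h (shift x) : K"
     by(rule Suc.prems(5)[OF is_loc_comp[OF l(1) h] U])
   qed
   thus ?thesis by(rule l(3))
  qed
  then obtain e where "ALL j<L. ?w j ^ e j * x : I" by metis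
  thus ?case using power_annihilator[of I L ?w e x] Suc.prems(1) ann by blast
 qed
 from this[OF assms(1,2), of 0] show ?thesis using assms(3) by(auto simp: splits_def)
qed

text \<open>If the relations \<open>kap\<close> among generators \<open>ws\<close> of \<open>A1 / C\<close> split, then \<open>A1 / C\<close> is stably free: adding
 as many free generators as there are relations makes it free.\<close>

lemma frame_split:
 fixes C :: "(base fls ^ 'n) set"
 assumes A1: "csub I A1" and C: "csub I C" "C \<subseteq> A1" and f: "frame I A2 A1 (es @ rest)"
  and A2: "csub I A2" and ws: "set ws \<subseteq> A1" and gen: "!!v. v : A1 ==> EX c. v - lcomb c ws : C"
  and k: "!!a. a < r ==> lcomb (kap a) ws : C"
  and rel: "!!c. lcomb c ws : C ==> EX g. ALL j<length ws. c j - (\<Sum>a<r. g a * kap a j) : I"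
  and T: "splits I kap (length ws) r T" and r: "length es = r"
 shows "frame I A2 C (map (%j. ws ! j + lcomb (T j) es) [0..<length ws] @ rest)"
proof -
 have I: "is_ideal I" using A1 by(simp add: csub_def)
 let ?L = "length ws"
 \<comment> \<open>A coefficient vector c is sent to its class in \<open>A1 / C\<close> together
   with c T in the free part on \<open>es\<close>. As kap T = 1, this identifies the free module on
   \<open>ws\<close> with the sum of \<open>A1 / C\<close> and that free part.\<close>
 let ?z = "map (%j. ws ! j + lcomb (T j) es) [0..<?L]"
 have lz: "lcomb c ?z = lcomb c ws + lcomb (%b. dot ?L c (%j. T j b)) es" for c
 proof -
  have "lcomb c ?z = (\<Sum>j<?L. c j *c (ws ! j)) + (\<Sum>j<?L. c j *c lcomb (T j) es)"
   by(simp add: lcomb_def smult_add sum.distrib)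
  also have "(\<Sum>j<?L. c j *c lcomb (T j) es) = lcomb (%b. \<Sum>j<?L. c j * T j b) es"
   by(simp add: lcomb_sum lcomb_smult)
  finally show ?thesis by(simp add: lcomb_def[of c ws] dot_def)
 qed
 have er: "set es \<subseteq> A2" "set rest \<subseteq> A2" "A1 \<subseteq> A2" using f by(auto simp: frame_iff)
 have ind: "(ALL a<r. c a : I) \<and> (ALL a<length rest. d a : I)" if "lcomb c es + lcomb d rest : A1" for c d
 proof -
  define e where "e a = (if a < r then c a else d (a - r))" for a
  have "lcomb e (es @ rest) = lcomb c es + lcomb d rest"
   by(rule lcomb_append_eq) (auto simp: e_def r)
  hence e: "e a : I" if "a < r + length rest" for a
   using frame_indep[OF f, of e a] \<open>lcomb c es + lcomb d rest : A1\<close> that by(simp add: r)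
  show ?thesis
  proof(intro conjI allI impI)
   fix a assume "a < r" thus "c a : I" using e[of a] by(simp add: e_def)
  next
   fix a assume "a < length rest" thus "d a : I" using e[of "r + a"] by(simp add: e_def)
  qed
 qed
 show ?thesis unfolding frame_iff
 proof(intro conjI ballI allI impI)
  show "C \<subseteq> A2" using C(2) er(3) by blast
  show "set (?z @ rest) \<subseteq> A2"
  proof -
   have "lcomb c es : A2" for c using er(1) by(intro lcomb_in[OF A2]) auto
   moreover have "ws ! j : A2" if "j < ?L" for j using ws er(3) that by(meson nth_mem subsetD)
   ultimately show ?thesis using er(2) csub_add[OF A2] by auto
  qed
  fix x assume "x : A2"
  then obtain c where c: "x - lcomb c (es @ rest) : A1" using frame_coords[OF f] by blast
  let ?d = "%a. c (r + a)"
  obtain al where al: "x - lcomb c (es @ rest) - lcomb al ws : C" using gen[OF c] by blast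
  \<comment> \<open>The lift \<open>al\<close> has the right class in \<open>A1 / C\<close> but the
    wrong coordinates along \<open>es\<close>. Adding the relations with coefficients
    \<open>g\<close> corrects these and leaves the class alone.\<close>
  define g where "g a = c a - dot ?L al (%j. T j a)" for a
  define ga where "ga j = al j + (\<Sum>a<r. g a * kap a j)" for j
  have "dot ?L ga (%j. T j b) - c b : I" if b: "b < r" for b
  proof -
   have A: "dot ?L ga (%j. T j b) = dot ?L al (%j. T j b) + (\<Sum>a<r. g a * dot ?L (kap a) (%j. T j b))"
   proof -
    have "dot ?L ga (%j. T j b) = dot ?L al (%j. T j b) + dot ?L (%j. \<Sum>a<r. g a * kap a j) (%j. T j b)"
     by(simp add: dot_def ga_def distrib_right sum.distrib)
    thus ?thesis by(simp add: dot_sum2 dot_scale2)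
   qed
   have "(\<Sum>a<r. g a * dot ?L (kap a) (%j. T j b)) - (\<Sum>a<r. g a * (if a = b then 1 else 0)) : I"
    using T b by(intro cong_sum[OF I] cong_mult[OF I]) (auto simp: splits_def ideal_zero[OF I])
   moreover have "(\<Sum>a<r. g a * (if a = b then 1 else 0)) = g b"
   proof -
    have "(\<Sum>a<r. g a * (if a = b then 1 else 0)) = (\<Sum>a<r. if a = b then g b else 0)" by(rule sum.cong) auto
    thus ?thesis using b by simp
   qed
   moreover have "dot ?L ga (%j. T j b) - c b = (\<Sum>a<r. g a * dot ?L (kap a) (%j. T j b)) - g b"
    unfolding A g_def[of b] by(simp only: algebra_simps)
   ultimately show ?thesis by metis
  qed
  hence 1: "lcomb (%b. dot ?L ga (%j. T j b)) es - lcomb c es : C"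
   unfolding lcomb_diff[symmetric] using r by(intro csub_van[OF C(1)] lcomb_van[OF I]) auto
  have 2: "lcomb ga ws - lcomb al ws : C"
  proof -
   have "lcomb ga ws - lcomb al ws = (\<Sum>a<r. g a *c lcomb (kap a) ws)"
   proof -
    have "ga = (%j. al j + (\<Sum>a<r. g a * kap a j))" by(simp add: ga_def fun_eq_iff)
    thus ?thesis by(simp add: lcomb_add lcomb_sum lcomb_smult)
   qed
   thus ?thesis using k by(auto intro!: csub_sum[OF C(1)] csub_smult[OF C(1)])
  qed
  define e where "e a = (if a < ?L then ga a else ?d (a - ?L))" for a
  have le: "lcomb e (?z @ rest) = lcomb ga ?z + lcomb ?d rest"
   by(rule lcomb_append_eq) (auto simp: e_def)
  have lc: "lcomb c (es @ rest) = lcomb c es + lcomb ?d rest" by(simp add: lcomb_append r)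
  have "x - lcomb e (?z @ rest) = (x - lcomb c (es @ rest) - lcomb al ws) - (lcomb ga ws - lcomb al ws) - (lcomb (%b. dot ?L ga (%j. T j b)) es - lcomb c es)"
   unfolding le lz lc by(simp only: algebra_simps)
  also have "\<dots> : C" by(rule csub_diff[OF C(1) csub_diff[OF C(1) al 2] 1])
  finally show "EX c. x - lcomb c (?z @ rest) : C" by blast
 next
  fix c a assume c: "lcomb c (?z @ rest) : C" and a: "a < length (?z @ rest)"
  let ?d = "%a. c (?L + a)" and ?t = "%b. dot ?L c (%j. T j b)"
  have e: "lcomb c (?z @ rest) = lcomb c ws + (lcomb ?t es + lcomb ?d rest)"
   by(simp add: lcomb_append lz add.assoc)
  have cw: "lcomb c ws : A1" using ws by(intro lcomb_in[OF A1]) auto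
  have "lcomb ?t es + lcomb ?d rest = lcomb c (?z @ rest) - lcomb c ws" unfolding e by simp
  hence "lcomb ?t es + lcomb ?d rest : A1"
   using csub_diff[OF A1 subsetD[OF C(2) c] cw] by argo
  from ind[OF this] have t: "ALL b<r. ?t b : I" and d: "ALL a<length rest. ?d a : I" by auto
  hence "lcomb ?t es + lcomb ?d rest : van I"
   using r by(intro van_add[OF I] lcomb_van[OF I]) auto
  hence "lcomb ?t es + lcomb ?d rest : C" by(rule csub_van[OF C(1)])
  from csub_diff[OF C(1) c this] have "lcomb c ws : C" unfolding e by simp
  from rel[OF this] obtain g where g: "ALL j<?L. c j - (\<Sum>a<r. g a * kap a j) : I" by(elim exE)
  have gb: "g b : I" if b: "b < r" for b
  proof -
   have s1: "?t b - dot ?L (%j. \<Sum>a<r. g a * kap a j) (%j. T j b) : I"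
    unfolding dot_def using g by(intro cong_sum[OF I] cong_mult[OF I]) (auto simp: ideal_zero[OF I])
   have s2: "dot ?L (%j. \<Sum>a<r. g a * kap a j) (%j. T j b) - (\<Sum>a<r. g a * (if a = b then 1 else 0)) : I"
    unfolding dot_sum2 dot_scale2 using T b
    by(intro cong_sum[OF I] cong_mult[OF I]) (auto simp: splits_def ideal_zero[OF I])
   have s3: "(\<Sum>a<r. g a * (if a = b then 1 else 0)) = g b"
   proof -
    have "(\<Sum>a<r. g a * (if a = b then 1 else 0)) = (\<Sum>a<r. if a = b then g b else 0)" by(rule sum.cong) auto
    thus ?thesis using b by simp
   qed
   from cong_trans[OF I s1 s2[unfolded s3]] have "g b - ?t b : I" by(rule cong_sym[OF I])
   thus ?thesis by(rule ideal_eq_zeroI[OF I t[rule_format, OF b]])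
  qed
  show "c a : I"
  proof(cases "a < ?L")
   case True
   have "(\<Sum>b<r. g b * kap b a) : I" using gb by(intro ideal_sum[OF I] ideal_mult2[OF I]) auto
   thus ?thesis by(rule ideal_eq_zeroI[OF I _ g[rule_format, OF True]])
  next
   case False
   thus ?thesis using d a by(auto dest!: spec[of _ "a - ?L"])
  qed
 qed
qed

section \<open>Comparison of frames\<close>

lemma sum_split: "(\<Sum>j<a + b. f j) = (\<Sum>j<a. f j) + (\<Sum>j<b. f (a + j))" for a b :: nat and f :: "nat => 'a::comm_monoid_add"
proof -
 have "(\<Sum>j<a + b. f j) = (\<Sum>j<a. f j) + (\<Sum>j=a..<a + b. f j)"
  by(simp add: lessThan_atLeast0 sum.atLeastLessThan_concat)
 also have "(\<Sum>j=a..<a + b. f j) = (\<Sum>j<b. f (a + j))"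
  by(rule sum.reindex_bij_witness[of _ "%j. a + j" "%j. j - a"]) auto
 finally show ?thesis .
qed

lemma sum_delta_less:
 fixes f :: "nat => base" and n i :: nat
 shows "(\<Sum>j<n. (if j = i then 1 else 0) * f j) = (if i < n then f i else 0)"
proof -
 have "(\<Sum>j<n. (if j = i then 1 else 0) * f j) = (\<Sum>j<n. if j = i then f i else 0)" by(rule sum.cong) auto
 thus ?thesis by simp
qed

lemma changes_frame_inverse:
 assumes I: "is_ideal I" and f: "frame I A B us" and f': "frame I A B us'" and B: "csub I B"
  and ch: "changes_frame B G us us'"
 obtains G' where "changes_frame B G' us' us" "frame_det (length us) G' * frame_det (length us) G - 1 : I"
proof -
 have len: "length us' = length us" and G: "!!a. a < length us ==> us' ! a - lcomb (G a) us : B"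
  using ch by(auto simp: changes_frame_iff)
 have "set us \<subseteq> A" using f by(simp add: frame_iff)
 from frame_matrix[OF f' this] obtain G' where G': "ALL a<length us. us ! a - lcomb (G' a) us' : B" by(elim exE)
 have "(\<Sum>b<length us. G' a b * G b c) - (if a = c then 1 else 0) : I" if ac: "a < length us" "c < length us" for a c
 proof -
  have "lcomb (G' a) us' - lcomb (%c. \<Sum>b<length us'. G' a b * G b c) us : B"
   by(rule lcomb_lcomb[OF B]) (simp add: G len)
  from csub_trans[OF B G'[rule_format, OF ac(1)] this]
  have "us ! a - lcomb (%c. \<Sum>b<length us. G' a b * G b c) us : B" by(simp add: len)
  hence "lcomb (%b. if b = a then 1 else 0) us - lcomb (%c. \<Sum>b<length us. G' a b * G b c) us : B"
   by(simp add: lcomb_delta[OF ac(1)])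
  from frame_uniq[OF f B this ac(2)] have "(if c = a then 1 else 0) - (\<Sum>b<length us. G' a b * G b c) : I" .
  from cong_sym[OF I this] show ?thesis by(simp add: eq_commute)
 qed
 hence "frame_det (length us) (%a c. \<Sum>b<length us. G' a b * G b c) - frame_det (length us) (%a c. if a = c then 1 else 0) : I"
  by(intro frame_det_cong_ideal[OF I])
 hence "frame_det (length us) G' * frame_det (length us) G - 1 : I"
  by(simp add: frame_det_mult frame_det_id)
 moreover have "changes_frame B G' us' us" using G' by(simp add: changes_frame_iff len)
 ultimately show ?thesis using that by blast
qed

text \<open>
 For framed points \<open>p\<close> and \<open>P\<close> with the same \<open>E\<close> and with \<open>\<Omega>\<close> contained in \<open>\<Omega>'\<close>, the determinant of the matrix
 below compares the generators of the relative determinants of \<open>E\<close> defined by the two frames. Unlike the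
 determinants in the definition of a section, it makes sense when \<open>\<Omega>' / \<Omega>\<close> is not projective.
\<close>

definition cmat :: "'n::finite framed_point => 'n framed_point => (nat => nat => base) => bool" where
 "cmat p P M \<longleftrightarrow>
  (ALL j<length (frE P). frE P ! j - lcomb (M j) (frO P @ frE p) : lat p) \<and>
  (ALL a<length (frO p). lcomb (M (length (frE P) + a)) (frO P @ frE p) : lat p \<and>
    frO p ! a + lcomb (M (length (frE P) + a)) (frO P) : poly_vecs (alg p))"

text \<open>The equation between lengths makes the comparison matrix square. Lengths are tracked
  explicitly throughout, as a free module over the zero ring has no definite rank.\<close>

definition comparable :: "'n::finite framed_point => 'n framed_point => bool" where
 "comparable p P \<longleftrightarrow> alg P = alg p \<and> pts P = pts p \<and> lat P = lat p \<and> big p \<subseteq> big P \<and>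
   length (frE P) + length (frO p) = length (frO P) + length (frE p)"

text \<open>Modulo \<open>E\<close>, the larger \<Omega>' is generated by \<open>frO P\<close> and
  \<open>frE p\<close>. The relations are generated by the elements of \<open>frO p\<close>, each
  written once in \<open>frO P\<close> and once in \<open>frE p\<close>. The rows of the matrix are
  lifts of \<open>frE P\<close>, followed by these relations.\<close>

lemma cmat_exists:
 assumes p: "p : Gr1 N" and P: "P : Gr1 N" and c: "comparable p P"
 shows "EX M. cmat p P M"
proof -
 note d = Gr1D[OF p] and D = Gr1D[OF P]
 have eq: "alg P = alg p" "lat P = lat p" "big p \<subseteq> big P" using c by(auto simp: comparable_def)
 note f = D(7)[unfolded eq]
 have uP: "set (frO p) \<subseteq> big p" "set (frO p) \<subseteq> big P" "set (frE P) \<subseteq> big P"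
  using d(7) eq(3) D(8) by(auto simp: frame_iff)
 from frame_matrix[OF f uP(2)] obtain A where A: "ALL a<length (frO p). frO p ! a - lcomb (A a) (frO P) : poly_vecs (alg p)" by(elim exE)
 have "EX c. lcomb (A a) (frO P) - lcomb c (frE p) : lat p" if a: "a < length (frO p)" for a
 proof -
  have "frO p ! a - lcomb (A a) (frO P) : big p" using A a d(11) by blast
  moreover have "frO p ! a : big p" using uP(1) a by auto
  ultimately have "lcomb (A a) (frO P) : big p" using csub_diff[OF d(9), of "frO p ! a" "frO p ! a - lcomb (A a) (frO P)"] by simp
  thus ?thesis by(rule frame_coords[OF d(8)])
 qed
 hence "ALL a. EX c. a < length (frO p) --> lcomb (A a) (frO P) - lcomb c (frE p) : lat p" by blast
 from choice[OF this] obtain B where B: "ALL a. a < length (frO p) --> lcomb (A a) (frO P) - lcomb (B a) (frE p) : lat p" by(elim exE)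
 from frame_matrix[OF f uP(3)] obtain Y where Y: "ALL j<length (frE P). frE P ! j - lcomb (Y j) (frO P) : poly_vecs (alg p)" by(elim exE)
 have "EX c. frE P ! j - lcomb (Y j) (frO P) - lcomb c (frE p) : lat p" if "j < length (frE P)" for j
  using Y that d(11) by(intro frame_coords[OF d(8)]) blast
 hence "ALL j. EX c. j < length (frE P) --> frE P ! j - lcomb (Y j) (frO P) - lcomb c (frE p) : lat p" by blast
 from choice[OF this] obtain X where X: "ALL j. j < length (frE P) --> frE P ! j - lcomb (Y j) (frO P) - lcomb (X j) (frE p) : lat p" by(elim exE)
 \<comment> \<open>Block form with rows (Y, X) and (- A, B).\<close>
 define M where "M i l = (if i < length (frE P) then (if l < length (frO P) then Y i l else X i (l - length (frO P)))
  else (if l < length (frO P) then - A (i - length (frE P)) l else B (i - length (frE P)) (l - length (frO P))))" for i l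
 have 1: "lcomb (M j) (frO P @ frE p) = lcomb (Y j) (frO P) + lcomb (X j) (frE p)" if "j < length (frE P)" for j
  using that by(intro lcomb_append_eq) (auto simp: M_def)
 have 2: "lcomb (M (length (frE P) + a)) (frO P) = - lcomb (A a) (frO P)" for a
  unfolding lcomb_uminus[symmetric] by(rule lcomb_cong) (auto simp: M_def)
 have 3: "lcomb (M (length (frE P) + a)) (frO P @ frE p) = - lcomb (A a) (frO P) + lcomb (B a) (frE p)" for a
  unfolding lcomb_append 2 by(intro arg_cong2[of _ _ _ _ "(+)"] lcomb_cong) (auto simp: M_def)
 have "cmat p P M" unfolding cmat_def
 proof(intro conjI allI impI)
  fix j assume "j < length (frE P)"
  thus "frE P ! j - lcomb (M j) (frO P @ frE p) : lat p" using X 1 by(simp add: algebra_simps)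
 next
  fix a assume a: "a < length (frO p)"
  show "lcomb (M (length (frE P) + a)) (frO P @ frE p) : lat p"
   using csub_uminus[OF d(10) B[rule_format, OF a]] unfolding 3 by simp
  show "frO p ! a + lcomb (M (length (frE P) + a)) (frO P) : poly_vecs (alg p)"
   using A a unfolding 2 by simp
 qed
 thus ?thesis by blast
qed

lemma changes_frame_block:
 assumes f: "frame I A B us" and B: "csub I B" and H: "changes_frame B H us us'" and len: "length q' = length q"
  and W: "ALL i<length q. q' ! i - lcomb (W i) q : A"
 shows "EX G. changes_frame B G (us @ q) (us' @ q') \<and> frame_det (length us + length q) G = frame_det (length us) H * frame_det (length q) W"
proof -
 have "ALL i. EX c. i < length q --> q' ! i - lcomb (W i) q - lcomb c us : B" using frame_coords[OF f] W by blast
 from choice[OF this] obtain X where X: "ALL i. i < length q --> q' ! i - lcomb (W i) q - lcomb (X i) us : B" by(elim exE)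
 define G where "G i j = (if i < length us then (if j < length us then H i j else 0) else
  if j < length us then X (i - length us) j else W (i - length us) (j - length us))" for i j
 have l: "length us' = length us" using H by(simp add: changes_frame_iff)
 have "(us' @ q') ! a - lcomb (G a) (us @ q) : B" if a: "a < length (us @ q)" for a
 proof(cases "a < length us")
  case True
  hence "lcomb (G a) (us @ q) = lcomb (H a) us + lcomb (%_. 0) q" by(intro lcomb_append_eq) (auto simp: G_def)
  thus ?thesis using True H by(simp add: nth_append changes_frame_iff lcomb_zero)
 next
  case False
  define i where "i = a - length us"
  have i: "a = length us + i" "i < length q" using a False by(auto simp: i_def)
  have "lcomb (G a) (us @ q) = lcomb (X i) us + lcomb (W i) q" by(rule lcomb_append_eq) (auto simp: G_def i)
  moreover have "(us' @ q') ! a = q' ! i" by(simp add: i l nth_append)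
  ultimately show ?thesis using X[rule_format, OF i(2)] by(simp only: diff_diff_add add.commute)
 qed
 moreover have "frame_det (length us + length q) G = frame_det (length us) G * frame_det (length q) (%i j. G (length us + i) (length us + j))"
  by(rule frame_det_block_lower) (auto simp: G_def)
 moreover have "frame_det (length us) G = frame_det (length us) H" by(rule frame_det_cong) (auto simp: G_def)
 moreover have "frame_det (length q) (%i j. G (length us + i) (length us + j)) = frame_det (length q) W"
  by(rule frame_det_cong) (auto simp: G_def)
 ultimately show ?thesis by(intro exI[of _ G]) (simp add: changes_frame_iff len l)
qed

text \<open>Enlarging by \<open>q\<close> adds rows (- Q, - W, 1), since \<open>q\<close> is
  expressed in the old generators. The matrix becomes block triangular with an identity
  block.\<close>

lemma cmat_enlarge:
 assumes p: "p : Gr1 N" and p1: "p1 : Gr1 N" and P: "P : Gr1 N" and c: "comparable p P" and c1: "big p1 \<subseteq> big P"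
  and eq: "alg p1 = alg p" "pts p1 = pts p" "lat p1 = lat p" "big p \<subseteq> big p1" "frO p1 = frO p @ q" "frE p1 = frE p @ q"
  and M: "cmat p P M"
 shows "comparable p1 P" "EX M1. cmat p1 P M1 \<and> frame_det (length (frE P) + length (frO p1)) M1 = frame_det (length (frE P) + length (frO p)) M"
proof -
 note d = Gr1D[OF p] and d1 = Gr1D[OF p1, unfolded eq] and D = Gr1D[OF P]
 let ?s = "length (frO P)" and ?s' = "length (frE P)" and ?r = "length (frO p)" and ?r' = "length (frE p)"
 have n: "?s' + ?r = ?s + ?r'" and eP: "alg P = alg p" using c by(auto simp: comparable_def)
 show "comparable p1 P" using c c1 eq by(auto simp: comparable_def)
 have "set q \<subseteq> big P" using d1(7) c1 by(auto simp: frame_iff)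
 from frame_matrix[OF D(7)[unfolded eP] this] obtain Q where Q: "ALL i<length q. q ! i - lcomb (Q i) (frO P) : poly_vecs (alg p)" by(elim exE)
 have "EX c. q ! i - lcomb (Q i) (frO P) - lcomb c (frE p) : lat p" if "i < length q" for i
  using Q that d(11) by(intro frame_coords[OF d(8)]) blast
 hence "ALL i. EX c. i < length q --> q ! i - lcomb (Q i) (frO P) - lcomb c (frE p) : lat p" by blast
 from choice[OF this] obtain W where W: "ALL i. i < length q --> q ! i - lcomb (Q i) (frO P) - lcomb (W i) (frE p) : lat p" by(elim exE)
 define M1 where "M1 i l = (if i < ?s' + ?r then (if l < ?s + ?r' then M i l else 0) else
   (if l < ?s then - Q (i - (?s' + ?r)) l else if l < ?s + ?r' then - W (i - (?s' + ?r)) (l - ?s) else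
   (if l - (?s + ?r') = i - (?s' + ?r) then 1 else 0)))" for i l
 have sp: "lcomb c (frO P @ frE p @ q) = lcomb c (frO P @ frE p) + lcomb (%l. c (?s + ?r' + l)) q" for c
  using lcomb_append[of c "frO P @ frE p" q] by simp
 have 1: "lcomb (M1 i) (frO P @ frE p @ q) = lcomb (M i) (frO P @ frE p)" if "i < ?s' + ?r" for i
 proof -
  have "lcomb (M1 i) (frO P @ frE p) = lcomb (M i) (frO P @ frE p)" using that by(intro lcomb_cong) (auto simp: M1_def)
  moreover have "lcomb (%l. M1 i (?s + ?r' + l)) q = lcomb (%l. 0) q" using that by(intro lcomb_cong) (auto simp: M1_def)
  ultimately show ?thesis unfolding sp by(simp add: lcomb_zero)
 qed
 have 2: "lcomb (M1 i) (frO P) = lcomb (M i) (frO P)" if "i < ?s' + ?r" for i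
  using that by(intro lcomb_cong) (auto simp: M1_def)
 have 3: "lcomb (M1 (?s' + ?r + i)) (frO P) = - lcomb (Q i) (frO P)" for i
  unfolding lcomb_uminus[symmetric] by(rule lcomb_cong) (auto simp: M1_def)
 have 4: "lcomb (M1 (?s' + ?r + i)) (frO P @ frE p @ q) = - lcomb (Q i) (frO P) - lcomb (W i) (frE p) + q ! i" if "i < length q" for i
 proof -
  have "lcomb (%l. M1 (?s' + ?r + i) (?s + l)) (frE p) = - lcomb (W i) (frE p)"
   unfolding lcomb_uminus[symmetric] by(rule lcomb_cong) (auto simp: M1_def)
  moreover have "lcomb (%l. M1 (?s' + ?r + i) (?s + ?r' + l)) q = lcomb (%l. if l = i then 1 else 0) q"
   by(rule lcomb_cong) (auto simp: M1_def)
  ultimately show ?thesis unfolding sp lcomb_append 3 lcomb_delta[OF that] by(simp only: uminus_add_conv_diff) (simp add: algebra_simps)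
 qed
 have "cmat p1 P M1" unfolding cmat_def eq
 proof(intro conjI allI impI)
  fix j assume "j < ?s'"
  thus "frE P ! j - lcomb (M1 j) (frO P @ frE p @ q) : lat p" using M 1[of j] by(simp add: cmat_def)
 next
  fix a assume a: "a < length (frO p @ q)"
  show "lcomb (M1 (?s' + a)) (frO P @ frE p @ q) : lat p"
  proof(cases "a < ?r")
   case True
   thus ?thesis using M 1[of "?s' + a"] by(simp add: cmat_def)
  next
   case False
   define i where "i = a - ?r"
   have i: "?s' + a = ?s' + ?r + i" "i < length q" using False a by(auto simp: i_def)
   show ?thesis unfolding i(1) 4[OF i(2)] using W[rule_format, OF i(2)] by(simp add: algebra_simps)
  qed
  show "(frO p @ q) ! a + lcomb (M1 (?s' + a)) (frO P) : poly_vecs (alg p)"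
  proof(cases "a < ?r")
   case True
   thus ?thesis using M 2[of "?s' + a"] by(simp add: cmat_def nth_append)
  next
   case False
   define i where "i = a - ?r"
   have i: "?s' + a = ?s' + ?r + i" "i < length q" "a = ?r + i" using False a by(auto simp: i_def)
   show ?thesis unfolding i(1) 3 using Q[rule_format, OF i(2)] i(3) by(simp add: nth_append)
  qed
 qed
 moreover have "frame_det (?s' + length (frO p1)) M1 = frame_det (?s' + ?r) M"
 proof -
  have "frame_det ((?s' + ?r) + length q) M1 = frame_det (?s' + ?r) M1 * frame_det (length q) (%i j. M1 ((?s' + ?r) + i) ((?s' + ?r) + j))"
   by(rule frame_det_block_lower) (use n in \<open>auto simp: M1_def\<close>)
  also have "frame_det (?s' + ?r) M1 = frame_det (?s' + ?r) M"
   by(rule frame_det_cong) (use n in \<open>auto simp: M1_def\<close>)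
  also have "frame_det (length q) (%i j. M1 ((?s' + ?r) + i) ((?s' + ?r) + j)) = frame_det (length q) (%i j. if i = j then 1 else 0)"
   by(rule frame_det_cong) (use n in \<open>auto simp: M1_def\<close>)
  finally show ?thesis by(simp add: frame_det_id eq add.assoc)
 qed
 ultimately show "EX M1. cmat p1 P M1 \<and> frame_det (?s' + length (frO p1)) M1 = frame_det (?s' + ?r) M" by blast
qed

text \<open>The conditions on the matrix are congruences between linear combinations, so they may be
  mapped entry by entry.\<close>

lemma cmat_pullback:
 assumes p: "p : Gr1 N" and P: "P : Gr1 N" and c: "comparable p P" and pb: "is_pullback N h p p'" and p': "p' : Gr1 N"
  and M: "cmat p P M"
 shows "comparable p' (bc_point h (alg p') (pts p') P)" "cmat p' (bc_point h (alg p') (pts p') P) (%i j. h (M i j))"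
proof -
 have h: "alg_hom cst h" "h ` alg p \<subseteq> alg p'" and lat: "lat p' = base_change h (alg p') (lat p)" "big p' = base_change h (alg p') (big p)"
  and O: "list_all2 (%u' u. u' - vmap h u : poly_vecs (alg p')) (frO p') (frO p)"
  and E: "list_all2 (%v' v. v' - vmap h v : lat p') (frE p') (frE p)"
  using pb by(auto simp: is_pullback_def)
 have rh: "ring_map h" by(rule alg_hom_ring_map[OF h(1)])
 interpret h: ring_map h by(rule rh)
 note d = Gr1D[OF p'] and d0 = Gr1D[OF p]
 have eP: "alg P = alg p" "lat P = lat p" "big p \<subseteq> big P" using c by(auto simp: comparable_def)
 have len: "length (frO p') = length (frO p)" "length (frE p') = length (frE p)" using O E by(auto dest: list_all2_lengthD)
 let ?P = "bc_point h (alg p') (pts p') P"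
 show "comparable p' ?P"
  using c base_change_mono[OF d(1) eP(3), of h] by(auto simp: comparable_def lat len)
 have cong: "lcomb (%l. h (M i l)) (map (vmap h) (frO P) @ frE p') - vmap h (lcomb (M i) (frO P @ frE p)) : lat p'" for i
 proof -
  have "lcomb (%l. h (M i (length (frO P) + l))) (frE p') - lcomb (%l. h (M i (length (frO P) + l))) (map (vmap h) (frE p)) =
    (\<Sum>b<length (frE p). fls_const (h (M i (length (frO P) + b))) *s (frE p' ! b - vmap h (frE p ! b)))"
   by(simp add: lcomb_def len smult_diff sum_subtractf)
  also have "\<dots> : lat p'"
   using E by(intro csub_sum[OF d(10)] csub_smult[OF d(10)]) (auto simp: list_all2_conv_all_nth)
  finally show ?thesis by(simp add: vmap_lcomb[OF rh] lcomb_append h.vmap_add)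
 qed
 have inl: "vmap h v : lat p'" if "v : lat p" for v unfolding lat(1) by(rule base_change_mem[OF d(1) that])
 show "cmat p' ?P (%i j. h (M i j))"
  unfolding cmat_def
 proof(intro conjI allI impI)
  fix j assume j: "j < length (frE ?P)"
  hence "frE P ! j - lcomb (M j) (frO P @ frE p) : lat p" using M by(simp add: cmat_def)
  from inl[OF this] have "vmap h (frE P ! j) - vmap h (lcomb (M j) (frO P @ frE p)) : lat p'" by(simp add: h.vmap_diff)
  from csub_trans[OF d(10) this csub_sym[OF d(10) cong]]
  show "frE ?P ! j - lcomb (%l. h (M j l)) (frO ?P @ frE p') : lat p'" using j by simp
 next
  fix a assume a: "a < length (frO p')"
  hence 1: "lcomb (M (length (frE P) + a)) (frO P @ frE p) : lat p"
   "frO p ! a + lcomb (M (length (frE P) + a)) (frO P) : poly_vecs (alg p)" using M len by(simp_all add: cmat_def)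
  from csub_cong[OF d(10) cong] inl[OF 1(1)]
  show "lcomb (%l. h (M (length (frE ?P) + a) l)) (frO ?P @ frE p') : lat p'" by simp
  have "vmap h (frO p ! a) + lcomb (%l. h (M (length (frE P) + a) l)) (map (vmap h) (frO P)) : poly_vecs (alg p')"
   using vmap_poly_vecs[OF rh h(2) 1(2)] by(simp add: h.vmap_add vmap_lcomb[OF rh])
  moreover have "frO p' ! a - vmap h (frO p ! a) : poly_vecs (alg p')" using O a by(auto simp: list_all2_conv_all_nth)
  ultimately have "(frO p' ! a - vmap h (frO p ! a)) + (vmap h (frO p ! a) + lcomb (%l. h (M (length (frE P) + a) l)) (map (vmap h) (frO P))) : poly_vecs (alg p')"
   using csub_add[OF polyvecs_csub[OF d(1)]] by blast
  thus "frO p' ! a + lcomb (%l. h (M (length (frE ?P) + a) l)) (frO ?P) : poly_vecs (alg p')" by simp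
 qed
qed

text \<open>The sign that relates the determinant of a comparison matrix to those of the changes of frames.\<close>

definition swap_sign :: "nat => nat => base" where
 "swap_sign s s' = (-1) ^ s * frame_det (s + s') (%i j. if j = (if i < s then s' + i else i - s) then 1 else 0)"

text \<open>Express \<open>frO P\<close> and \<open>frE p\<close> in \<open>frE P\<close>.
  Multiplying \<open>M\<close> by the corresponding square matrix, whose determinant is that of
  \<open>G\<close> times the sign of a block swap, gives a block triangular matrix with diagonal
  blocks 1 and - H. The minus sign contributes (-1)^s.\<close>

lemma cmat_same:
 assumes p: "p : Gr1 N" and P: "P : Gr1 N"
  and eq: "alg p = alg P" "pts p = pts P" "lat p = lat P" "big p = big P"
  and H: "changes_frame (poly_vecs (alg P)) H (frO P) (frO p)" and G: "changes_frame (lat P) G (frE P) (frE p)"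
  and M: "cmat p P M"
 shows "swap_sign (length (frO P)) (length (frE P)) * frame_det (length (frE P) + length (frO p)) M * frame_det (length (frE P)) G
  - frame_det (length (frO P)) H : alg P"
proof -
 note d = Gr1D[OF P]
 let ?I = "alg P"
 define s where "s = length (frO P)"
 define s' where "s' = length (frE P)"
 have len: "length (frO p) = s" "length (frE p) = s'" using H G by(auto simp: changes_frame_iff s_def s'_def)
 have Hl: "frO p ! a - lcomb (H a) (frO P) : poly_vecs ?I" if "a < s" for a
  using H that by(simp add: changes_frame_iff s_def)
 have Gl: "frE p ! b - lcomb (G b) (frE P) : lat P" if "b < s'" for b
  using G that by(simp add: changes_frame_iff s'_def)
 have "set (frO P) \<subseteq> big P" using d(7) by(simp add: frame_iff)
 from frame_matrix[OF d(8) this] obtain W where W: "ALL i<s. frO P ! i - lcomb (W i) (frE P) : lat P"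
  unfolding s_def by(elim exE)
 define T where "T i = (if i < s then W i else G (i - s))" for i
 have Tw: "(frO P @ frE p) ! i - lcomb (T i) (frE P) : lat P" if "i < length (frO P @ frE p)" for i
  using that W Gl[of "i - s"] len by(auto simp: T_def nth_append s_def)
 define MT where "MT x l = (\<Sum>i<s + s'. M x i * T i l)" for x l
 have MTl: "lcomb (M x) (frO P @ frE p) - lcomb (MT x) (frE P) : lat P" for x
  using lcomb_lcomb[OF d(10) Tw, of "M x"] len by(simp add: MT_def[abs_def] s_def)
 have MT1: "MT j l - (if j = l then 1 else 0) : ?I" if jl: "j < s'" "l < s'" for j l
 proof -
  have "frE P ! j - lcomb (M j) (frO P @ frE p) : lat P" using M jl by(simp add: cmat_def eq s'_def)
  from csub_trans[OF d(10) this MTl[of j]] have "lcomb (%b. if b = j then 1 else 0) (frE P) - lcomb (MT j) (frE P) : lat P"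
   using jl(1) by(simp add: lcomb_delta s'_def)
  from frame_uniq[OF d(8,10) this jl(2)[unfolded s'_def]] have "(if l = j then 1 else 0) - MT j l : ?I" .
  from cong_sym[OF d(1) this] show ?thesis by(simp add: eq_commute)
 qed
 have MT2: "MT (s' + a) l : ?I" if al: "a < s" "l < s'" for a l
 proof -
  have "lcomb (M (s' + a)) (frO P @ frE p) : lat P" using M al len by(simp add: cmat_def eq s'_def)
  hence "lcomb (MT (s' + a)) (frE P) : lat P" using csub_cong[OF d(10) MTl] by blast
  from frame_indep[OF d(8) this] show ?thesis using al(2) by(simp add: s'_def)
 qed
 have MH: "M (s' + a) i - (- H a i) : ?I" if ai: "a < s" "i < s" for a i
 proof -
  have "frO p ! a + lcomb (M (s' + a)) (frO P) : poly_vecs ?I" using M ai len by(simp add: cmat_def eq s'_def)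
  from csub_diff[OF polyvecs_csub[OF d(1)] this Hl[OF ai(1)]]
  have "lcomb (%i. M (s' + a) i + H a i) (frO P) : poly_vecs ?I" by(simp add: lcomb_add)
  from frame_indep[OF d(7) this] show ?thesis using ai(2) by(simp add: s_def)
 qed
 \<comment> \<open>\<open>U\<close> has rows (1, W) and (0, G), and \<rho> moves its last
   \<open>s'\<close> columns to the front.\<close>
 define U where "U i j = (if j < s then (if j = i then 1 else 0) else T i (j - s))" for i j
 define \<rho> where "\<rho> c = (if c < s' then s + c else c - s')" for c
 define T' where "T' i c = U i (\<rho> c)" for i c
 let ?kap = "frame_det (s + s') (%i j. if j = (if i < s then s' + i else i - s) then 1 else 0)"
 have detT': "frame_det (s + s') T' = frame_det s' G * ?kap"
 proof -
  have "frame_det (s + s') U = frame_det s U * frame_det s' (%i j. U (s + i) (s + j))"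
   by(rule frame_det_block_upper) (auto simp: U_def)
  also have "frame_det s U = frame_det s (%i j. if i = j then 1 else 0)" by(rule frame_det_cong) (auto simp: U_def)
  also have "frame_det s' (%i j. U (s + i) (s + j)) = frame_det s' G" by(rule frame_det_cong) (auto simp: U_def T_def)
  finally have U: "frame_det (s + s') U = frame_det s' G" by(simp add: frame_det_id)
  have "frame_det (s + s') U * ?kap = frame_det (s + s') T'"
   unfolding frame_det_mult
  proof(rule frame_det_cong)
   fix i c assume ic: "i < s + s'" "c < s + s'"
   have "(\<Sum>k<s + s'. U i k * (if c = (if k < s then s' + k else k - s) then 1 else 0)) = (\<Sum>k<s + s'. (if k = \<rho> c then 1 else 0) * U i k)"
    using ic(2) by(intro sum.cong) (auto simp: \<rho>_def)
   also have "\<dots> = T' i c" using ic(2) by(simp add: sum_delta_less T'_def) (auto simp: \<rho>_def)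
   finally show "(\<Sum>k<s + s'. U i k * (if c = (if k < s then s' + k else k - s) then 1 else 0)) = T' i c" .
  qed
  thus ?thesis by(simp add: U)
 qed
 define Z where "Z x c = (if c < s' then (if x = c then 1 else 0) else if x < s' then M x (c - s') else - H (x - s') (c - s'))" for x c
 have MZ: "(\<Sum>i<s' + s. M x i * T' i c) - Z x c : ?I" if xc: "x < s' + s" "c < s' + s" for x c
 proof(cases "c < s'")
  case True
  have "(\<Sum>i<s' + s. M x i * T' i c) = MT x c" using True by(simp add: MT_def T'_def U_def \<rho>_def add.commute)
  thus ?thesis using MT1[of x c] MT2[of "x - s'" c] xc True by(cases "x < s'") (auto simp: Z_def)
 next
  case False
  have "(\<Sum>i<s' + s. M x i * T' i c) = (\<Sum>i<s' + s. (if i = c - s' then 1 else 0) * M x i)"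
   using False xc(2) by(intro sum.cong) (auto simp: T'_def U_def \<rho>_def)
  also have "\<dots> = M x (c - s')" using False xc(2) by(simp add: sum_delta_less)
  finally show ?thesis using MH[of "x - s'" "c - s'"] False xc ideal_zero[OF d(1)] by(cases "x < s'") (auto simp: Z_def)
 qed
 have detZ: "frame_det (s' + s) Z = (-1) ^ s * frame_det s H"
 proof -
  have "frame_det (s' + s) Z = frame_det s' Z * frame_det s (%i j. Z (s' + i) (s' + j))"
   by(rule frame_det_block_upper) (auto simp: Z_def)
  also have "frame_det s' Z = frame_det s' (%i j. if i = j then 1 else 0)" by(rule frame_det_cong) (auto simp: Z_def)
  also have "frame_det s (%i j. Z (s' + i) (s' + j)) = frame_det s (%i j. (-1) * H i j)" by(rule frame_det_cong) (auto simp: Z_def)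
  finally show ?thesis by(simp only: frame_det_id frame_det_smult mult_1)
 qed
 have "frame_det (s' + s) M * frame_det (s' + s) T' - (-1) ^ s * frame_det s H : ?I"
  unfolding frame_det_mult detZ[symmetric] by(rule frame_det_cong_ideal[OF d(1) MZ])
 hence 1: "frame_det (s' + s) M * (frame_det s' G * ?kap) - (-1) ^ s * frame_det s H : ?I"
  using detT' by(simp add: add.commute)
 have sq: "(-1) ^ s * (-1) ^ s = (1 :: base)" by(simp flip: power_mult_distrib)
 have "swap_sign s s' * frame_det (s' + s) M * frame_det s' G - frame_det s H =
   (-1) ^ s * (frame_det (s' + s) M * (frame_det s' G * ?kap) - (-1) ^ s * frame_det s H)"
  unfolding right_diff_distrib mult.assoc[symmetric] sq by(simp add: swap_sign_def mult_ac)
 thus ?thesis using ideal_mult[OF d(1) 1] by(simp add: len s_def s'_def)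
qed

section \<open>Extending framed points to standard ones\<close>

lemma Om_frame:
 assumes "is_ideal I"
 shows "EX et. frame I (Om I N x M :: (base fls ^ 'n) set) (poly_vecs I) et \<and> length et = M * (N * CARD('n))"
 using frame_Om[OF assms, where M = 0 and d = M and N = N and x = x and 'n = 'n] by(simp add: Om_0)

text \<open>Supplies the \<open>r\<close> free generators that \<open>frame_split\<close> spends on
  relations. The bound on \<open>M\<close> is enough because each further pole order adds at least
  one generator when \<open>N > 0\<close>.\<close>

lemma Om_frame_split:
 assumes I: "is_ideal I" and N: "N > 0" and M: "M1 + r \<le> M"
 shows "EX es rest. frame I (Om I N x M :: (base fls ^ 'n) set) (Om I N x M1) (es @ rest) \<and> length es = r \<and>
  M1 * (N * CARD('n)) + (r + length rest) = M * (N * CARD('n))"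
proof -
 obtain qs :: "(base fls ^ 'n) list" where qs: "frame I (Om I N x (M1 + (M - M1))) (Om I N x M1) qs"
  "length qs = (M - M1) * (N * CARD('n))"
  using frame_Om[OF I, where M = M1 and d = "M - M1" and N = N and x = x and 'n = 'n] by blast
 have "1 \<le> N * CARD('n)" using N by(simp add: Suc_le_eq)
 hence "M - M1 \<le> (M - M1) * (N * CARD('n))" by simp
 hence r: "r \<le> length qs" using M qs(2) by linarith
 have "frame I (Om I N x M) (Om I N x M1) (take r qs @ drop r qs)" using qs(1) M by simp
 moreover have "length (take r qs) = r" using r by simp
 moreover have "M1 * (N * CARD('n)) + (r + length (drop r qs)) = M * (N * CARD('n))"
  using r qs(2) M by(simp flip: add_mult_distrib)
 ultimately show ?thesis by blast
qed

context
 fixes N M1 :: nat and p :: "'n::finite framed_point" and et A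
 assumes p: "p : Gr1 N" and et: "frame (alg p) (Om (alg p) N (pts p) M1) (poly_vecs (alg p)) et"
  and b: "big p \<subseteq> Om (alg p) N (pts p) M1"
  and A: "ALL a<length (frO p). frO p ! a - lcomb (A a) et : poly_vecs (alg p)"
begin

lemma coord_lcomb: "lcomb c (frO p) - lcomb (%j. \<Sum>a<length (frO p). c a * A a j) et : poly_vecs (alg p)"
 using lcomb_lcomb[OF polyvecs_csub[OF Gr1D(1)[OF p]], of "frO p" A et c] A by simp

lemma coord_big: assumes "a < length (frO p)" shows "lcomb (A a) et : big p"
proof -
 note d = Gr1D[OF p]
 have "frO p ! a : big p" using assms d(7) by(auto simp: frame_iff)
 moreover have "frO p ! a - lcomb (A a) et : big p" using A assms d(11) by blast
 ultimately show ?thesis using csub_cong[OF d(9)] by blast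
qed

lemma coord_rel:
 assumes "lcomb c et : big p"
 shows "EX g. ALL j<length et. c j - (\<Sum>a<length (frO p). g a * A a j) : alg p"
proof -
 note d = Gr1D[OF p] and O = polyvecs_csub[OF Gr1D(1)[OF p]]
 obtain g where "lcomb c et - lcomb g (frO p) : poly_vecs (alg p)" using frame_coords[OF d(7) assms] by(elim exE)
 from csub_trans[OF O this coord_lcomb]
 have "lcomb c et - lcomb (%j. \<Sum>a<length (frO p). g a * A a j) et : poly_vecs (alg p)" .
 from frame_uniq[OF et O this] show ?thesis by blast
qed

lemma coord_inj: "row_inj (alg p) A (length et) (length (frO p))"
 unfolding row_inj_def
proof(intro allI impI)
 note d = Gr1D[OF p] and O = polyvecs_csub[OF Gr1D(1)[OF p]]
 fix c a assume c: "ALL j<length et. (\<Sum>a<length (frO p). c a * A a j) : alg p" and a: "a < length (frO p)"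
 have "lcomb (%j. \<Sum>a<length (frO p). c a * A a j) et : poly_vecs (alg p)"
  using c by(intro csub_van[OF O] lcomb_van[OF d(1)]) auto
 hence "lcomb c (frO p) : poly_vecs (alg p)" using coord_lcomb csub_cong[OF O] by blast
 from frame_indep[OF d(7) this a] show "c a : alg p" .
qed

text \<open>The rows of \<open>A\<close> are the relations of the quotient of \<open>Om\<close> by
  \<open>big p\<close> with respect to the generators \<open>et\<close>. Where they split, the
  quotient becomes free after the pole order is raised.\<close>

lemma extension_exists:
 assumes N: "N > 0" and l: "length et = M1 * (N * CARD('n))" and T: "splits (alg p) A (length et) (length (frO p)) T"
  and M: "M1 + length (frO p) \<le> M"
 shows "EX q. frame (alg p) (Om (alg p) N (pts p) M) (big p) q \<and> length (frO p) + length q = M * (N * CARD('n))"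
proof -
 note d = Gr1D[OF p]
 obtain es rest :: "(base fls ^ 'n) list" where f: "frame (alg p) (Om (alg p) N (pts p) M) (Om (alg p) N (pts p) M1) (es @ rest)"
  and len: "length es = length (frO p)" "M1 * (N * CARD('n)) + (length (frO p) + length rest) = M * (N * CARD('n))"
  using Om_frame_split[OF d(1) N M, where x = "pts p" and 'n = 'n] by blast
 let ?q = "map (%j. et ! j + lcomb (T j) es) [0..<length et] @ rest"
 have "frame (alg p) (Om (alg p) N (pts p) M) (big p) ?q"
 proof(rule frame_split[OF Om_csub[OF d(1)] d(9) b f Om_csub[OF d(1)] _ _ coord_big coord_rel T len(1)])
  show "set et \<subseteq> Om (alg p) N (pts p) M1" using et by(simp add: frame_iff)
  show "EX c. v - lcomb c et : big p" if "v : Om (alg p) N (pts p) M1" for v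
   using frame_coords[OF et that] d(11) by blast
 qed
 moreover have "length (frO p) + length ?q = M * (N * CARD('n))" using len l by simp
 ultimately show ?thesis by blast
qed

text \<open>The rows (- A, B) present the quotient of \<open>Om\<close> by \<open>E\<close>, and
  flatness of \<open>E\<close> makes them injective modulo every larger ideal. Thus they split
  without any localization, in contrast to \<open>A\<close> alone.\<close>

lemma resolution_matrices:
 "EX B. (ALL a<length (frO p). lcomb (A a) et - lcomb (B a) (frE p) : lat p) \<and>
  (ALL I'. is_ideal I' --> alg p \<subseteq> I' -->
   row_inj I' (%a j. if j < length et then - A a j else B a (j - length et)) (length et + length (frE p)) (length (frO p)))"
proof -
 note d = Gr1D[OF p] and O = polyvecs_csub[OF Gr1D(1)[OF p]]
 let ?r = "length (frO p)" and ?L = "length et"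
 have "ALL a. EX c. a < ?r --> lcomb (A a) et - lcomb c (frE p) : lat p"
  using frame_coords[OF d(8) coord_big] by blast
 from choice[OF this] obtain B where B: "ALL a. a < ?r --> lcomb (A a) et - lcomb (B a) (frE p) : lat p" by(elim exE)
 let ?K = "%a j. if j < ?L then - A a j else B a (j - ?L)"
 have "row_inj I' ?K (?L + length (frE p)) ?r" if I': "is_ideal I'" "alg p \<subseteq> I'" for I'
  unfolding row_inj_def
 proof(intro allI impI)
  fix c a assume c: "ALL j<?L + length (frE p). (\<Sum>a<?r. c a * ?K a j) : I'" and a: "a < ?r"
  define cA where "cA j = (\<Sum>a<?r. c a * A a j)" for j
  define cB where "cB j = (\<Sum>a<?r. c a * B a j)" for j
  have cA: "cA j : I'" if "j < ?L" for j
   using c[rule_format, of j] that ideal_uminus[OF I'(1), of "- cA j"] by(simp add: cA_def sum_negf)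
  have cB: "cB j : I'" if "j < length (frE p)" for j
   using c[rule_format, of "?L + j"] that by(simp add: cB_def)
  have E: "lcomb cA et - lcomb cB (frE p) : lat p"
  proof -
   have "lcomb cA et - lcomb cB (frE p) = (\<Sum>a<?r. c a *c (lcomb (A a) et - lcomb (B a) (frE p)))"
    by(simp add: cA_def[abs_def] cB_def[abs_def] lcomb_sum lcomb_smult smult_diff sum_subtractf)
   thus ?thesis using B by(auto intro!: csub_sum[OF d(10)] csub_smult[OF d(10)])
  qed
  have "lcomb cA et - lcomb cB (frE p) : van I'"
   using cA cB by(intro van_diff[OF I'(1)] lcomb_van[OF I'(1)]) auto
  \<comment> \<open>A relation modulo \<open>I'\<close> produces an element of \<open>E\<close> with
    all coefficients in \<open>I'\<close>. By flatness it is a combination of elements of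
    \<open>E\<close> with coefficients in \<open>I'\<close>. Rewritten in \<open>frO p\<close>, this
    puts the coefficients of the relation into \<open>I'\<close>.\<close>
  from bd_points_flat[OF d(1,3) I' E this] obtain es \<alpha> where es: "set es \<subseteq> lat p" "ALL a<length es. \<alpha> a : I'"
   "lcomb cA et - lcomb cB (frE p) - lcomb \<alpha> es : van (alg p)" by blast
  let ?ws = "frE p @ es"
  define \<beta> where "\<beta> j = (if j < length (frE p) then cB j else \<alpha> (j - length (frE p)))" for j
  have "lcomb \<beta> ?ws = lcomb cB (frE p) + lcomb \<alpha> es"
   by(rule lcomb_append_eq) (auto simp: \<beta>_def)
  hence 1: "lcomb cA et - lcomb \<beta> ?ws : poly_vecs (alg p)" using csub_van[OF O es(3)] by(simp add: diff_diff_add)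
  have "set ?ws \<subseteq> big p" using es(1) d(8) d(12) by(auto simp: frame_iff)
  from frame_matrix[OF d(7) this] obtain G where G: "ALL i<length ?ws. ?ws ! i - lcomb (G i) (frO p) : poly_vecs (alg p)" by(elim exE)
  have "lcomb \<beta> ?ws - lcomb (%b. \<Sum>i<length ?ws. \<beta> i * G i b) (frO p) : poly_vecs (alg p)"
   by(rule lcomb_lcomb[OF O]) (use G in simp)
  from csub_trans[OF O csub_trans[OF O coord_lcomb[of c, folded cA_def] 1] this]
  have "lcomb c (frO p) - lcomb (%b. \<Sum>i<length ?ws. \<beta> i * G i b) (frO p) : poly_vecs (alg p)" .
  from frame_uniq[OF d(7) O this a] have 2: "c a - (\<Sum>i<length ?ws. \<beta> i * G i a) : alg p" .
  have "(\<Sum>i<length ?ws. \<beta> i * G i a) : I'"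
   using cB es(2) by(intro ideal_sum[OF I'(1)] ideal_mult2[OF I'(1)]) (auto simp: \<beta>_def)
  from ideal_eq_zeroI[OF I'(1) this subsetD[OF I'(2) 2]] show "c a : I'" .
 qed
 thus ?thesis using B by blast
qed

end

text \<open>A nice point \<open>P\<close> with the same \<open>E\<close> as \<open>p\<close>,
  together with the factor \<open>D\<close> between the generators of the two determinant lines. The
  bound on \<open>M\<close> leaves room for extending \<open>p\<close> itself, locally, to the same
  pole order.\<close>

definition resolution :: "nat => nat => nat => 'n::finite framed_point => 'n framed_point => base => bool" where
 "resolution N M1 M p P D \<longleftrightarrow> nice N M P \<and> comparable p P \<and> length (frO P) = M * (N * CARD('n)) \<and>
   big p \<subseteq> Om (alg p) N (pts p) M1 \<and> M1 + length (frO p) \<le> M \<and>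
   (EX C. cmat p P C \<and> D = swap_sign (length (frO P)) (length (frE P)) * frame_det (length (frE P) + length (frO p)) C)"

text \<open>\<open>frame_split\<close> with the relations (- A, B), which split by
  \<open>resolution_matrices\<close> and \<open>splits_exists\<close>.\<close>

lemma resolution_exists:
 fixes p :: "'n::finite framed_point"
 assumes N: "N > 0" and p: "p : Gr1 N" and b: "big p \<subseteq> Om (alg p) N (pts p) M1" and M: "M1 + length (frO p) \<le> M"
 shows "EX P D. resolution N M1 M p P D"
proof -
 note d = Gr1D[OF p] and O = polyvecs_csub[OF Gr1D(1)[OF p]]
 let ?I = "alg p" and ?r = "length (frO p)"
 let ?Om = "Om ?I N (pts p) :: nat => (base fls ^ 'n) set"
 obtain et where et: "frame ?I (?Om M1) (poly_vecs ?I) et" "length et = M1 * (N * CARD('n))"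
  using Om_frame[OF d(1), where M = M1 and N = N and x = "pts p" and 'n = 'n] by blast
 have "set (frO p) \<subseteq> ?Om M1" using d(7) b by(auto simp: frame_iff)
 from frame_matrix[OF et(1) this] obtain A where A: "ALL a<?r. frO p ! a - lcomb (A a) et : poly_vecs ?I" by(elim exE)
 note c = p et(1) b A
 obtain B where B: "ALL a<?r. lcomb (A a) et - lcomb (B a) (frE p) : lat p"
  and inj: "!!I'. is_ideal I' ==> ?I \<subseteq> I' ==>
   row_inj I' (%a j. if j < length et then - A a j else B a (j - length et)) (length et + length (frE p)) ?r"
  using resolution_matrices[OF c] by blast
 let ?K = "%a j. if j < length et then - A a j else B a (j - length et)" and ?ws = "et @ frE p"
 obtain T where T: "splits ?I ?K (length ?ws) ?r T" using splits_exists[OF d(1) inj] by auto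
 obtain es rest where f: "frame ?I (?Om M) (?Om M1) (es @ rest)"
  and len: "length es = ?r" "M1 * (N * CARD('n)) + (?r + length rest) = M * (N * CARD('n))"
  using Om_frame_split[OF d(1) N M, where x = "pts p" and 'n = 'n] by blast
 let ?z = "map (%j. ?ws ! j + lcomb (T j) es) [0..<length ?ws] @ rest"
 have K: "lcomb (?K a) ?ws = - lcomb (A a) et + lcomb (B a) (frE p)" for a
  unfolding lcomb_append lcomb_uminus[symmetric] by(intro arg_cong2[of _ _ _ _ "(+)"] lcomb_cong) auto
 have frE: "frame ?I (?Om M) (lat p) ?z"
 proof(rule frame_split[OF Om_csub[OF d(1)] d(10) _ f Om_csub[OF d(1)] _ _ _ _ T len(1)])
  show "lat p \<subseteq> ?Om M1" using d(12) b by blast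
  show "set ?ws \<subseteq> ?Om M1" using et(1) d(8) b by(auto simp: frame_iff)
  show "EX c. v - lcomb c ?ws : lat p" if "v : ?Om M1" for v
  proof -
   obtain c where "v - lcomb c et : poly_vecs ?I" using frame_coords[OF et(1) \<open>v : ?Om M1\<close>] by(elim exE)
   hence "v - lcomb c et : big p" using d(11) by blast
   from frame_coords[OF d(8) this] obtain c' where c': "v - lcomb c et - lcomb c' (frE p) : lat p" by(elim exE)
   define e where "e j = (if j < length et then c j else c' (j - length et))" for j
   have "lcomb e ?ws = lcomb c et + lcomb c' (frE p)"
    by(rule lcomb_append_eq) (auto simp: e_def)
   thus ?thesis using c' by(intro exI[of _ e]) (simp add: diff_diff_add)
  qed
  show "lcomb (?K a) ?ws : lat p" if "a < ?r" for a
   unfolding K using csub_uminus[OF d(10) B[rule_format, OF that]] by simp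
  show "EX g. ALL j<length ?ws. c j - (\<Sum>a<?r. g a * ?K a j) : ?I" if w: "lcomb c ?ws : lat p" for c
  proof -
   let ?c' = "%j. c (length et + j)"
   have w: "lcomb c et + lcomb ?c' (frE p) : lat p" using w by(simp add: lcomb_append)
   have "lcomb ?c' (frE p) : big p" using d(8) by(intro lcomb_in[OF d(9)]) (auto simp: frame_iff)
   from csub_diff[OF d(9) subsetD[OF d(12) w] this] have "lcomb c et : big p" by simp
   from coord_rel[OF c this] obtain g where g: "ALL j<length et. c j - (\<Sum>a<?r. g a * A a j) : ?I" by(elim exE)
   have gK: "(\<Sum>a<?r. - g a * ?K a j) = (\<Sum>a<?r. g a * A a j)" if "j < length et" for j using that by simp
   have 1: "lcomb c et - lcomb (%j. \<Sum>a<?r. g a * A a j) et : lat p"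
    unfolding lcomb_diff[symmetric] using g by(intro csub_van[OF d(10)] lcomb_van[OF d(1)]) auto
   have 2: "lcomb (%j. \<Sum>a<?r. g a * A a j) et - lcomb (%j. \<Sum>a<?r. g a * B a j) (frE p) : lat p"
   proof -
    have "lcomb (%j. \<Sum>a<?r. g a * A a j) et - lcomb (%j. \<Sum>a<?r. g a * B a j) (frE p) =
      (\<Sum>a<?r. g a *c (lcomb (A a) et - lcomb (B a) (frE p)))"
     by(simp add: lcomb_sum lcomb_smult smult_diff sum_subtractf)
    thus ?thesis using B by(auto intro!: csub_sum[OF d(10)] csub_smult[OF d(10)])
   qed
   have "lcomb ?c' (frE p) + lcomb (%j. \<Sum>a<?r. g a * B a j) (frE p) : lat p"
    using csub_diff[OF d(10) w csub_trans[OF d(10) 1 2]] by(simp add: algebra_simps)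
   hence "lcomb (%j. ?c' j + (\<Sum>a<?r. g a * B a j)) (frE p) : lat p" by(simp add: lcomb_add)
   from frame_indep[OF d(8) this] have 3: "?c' j + (\<Sum>a<?r. g a * B a j) : ?I" if "j < length (frE p)" for j using that .
   have "c j - (\<Sum>a<?r. - g a * ?K a j) : ?I" if j: "j < length ?ws" for j
   proof(cases "j < length et")
    case True
    thus ?thesis using g gK[OF True] by simp
   next
    case False
    thus ?thesis using 3[of "j - length et"] j by(simp add: sum_negf)
   qed
   thus ?thesis by(intro exI[of _ "%a. - g a"] allI impI)
  qed
 qed
 let ?P = "p\<lparr>big := ?Om M, frO := et @ es @ rest, frE := ?z\<rparr>"
 have frO: "frame ?I (?Om M) (poly_vecs ?I) (et @ es @ rest)"
  by(rule frame_concat[OF f et(1) Om_csub[OF d(1)] Om_csub[OF d(1)] O])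
 have P: "?P : Gr1 N"
 proof -
  have "?Om M \<subseteq> rat_vecs ?I N (pts p)" 
   by(rule subsetI) (rule iffD2[OF rat_vecs_Om[OF d(1)]], rule exI)
  thus ?thesis using p frO frE Om_submod[OF d(1), of N "pts p" M] by(simp add: Gr1_def)
 qed
 have cP: "comparable p ?P"
  using b Om_mono[OF d(1), of M1 M] M len et(2) by(auto simp: comparable_def)
 obtain C where "cmat p ?P C" using cmat_exists[OF p P cP] by(elim exE)
 hence "resolution N M1 M p ?P (swap_sign (length (frO ?P)) (length (frE ?P)) * frame_det (length (frE ?P) + ?r) C)"
  using P cP b M len et(2) by(auto simp: resolution_def nice_def)
 thus ?thesis by blast
qed

lemma swap_sign_hom: assumes "ring_map h" shows "h (swap_sign s s') = swap_sign s s'"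
proof -
 interpret h: ring_map h by(rule assms)
 have "h (frame_det (s + s') (%i j. if j = (if i < s then s' + i else i - s) then 1 else 0)) =
   frame_det (s + s') (%i j. if j = (if i < s then s' + i else i - s) then 1 else 0)"
  unfolding frame_det_hom[OF assms] by(rule frame_det_cong) (simp add: h.one h.zero)
 thus ?thesis unfolding swap_sign_def h.mult h.power h.uminus h.one by(rule arg_cong)
qed

lemma resolution_pullback:
 fixes p :: "'n::finite framed_point"
 assumes p: "p : Gr1 N" and p': "p' : Gr1 N" and pb: "is_pullback N h p p'" and r: "resolution N M1 M p P D"
 shows "resolution N M1 M p' (bc_point h (alg p') (pts p') P) (h D)"
proof -
 have h: "alg_hom cst h" "h ` alg p \<subseteq> alg p'" and x: "!!i. i < N ==> pts p' i - h (pts p i) : alg p'"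
  and bg: "big p' = base_change h (alg p') (big p)" and lO: "length (frO p') = length (frO p)"
  using pb by(auto simp: is_pullback_def dest: list_all2_lengthD)
 have rh: "ring_map h" by(rule alg_hom_ring_map[OF h(1)])
 interpret h: ring_map h by(rule rh)
 note d = Gr1D(1)[OF p] and d' = Gr1D(1)[OF p']
 have n: "nice N M P" and c: "comparable p P" and b: "big p \<subseteq> Om (alg p) N (pts p) M1"
  using r by(auto simp: resolution_def)
 have P: "P : Gr1 N" using n by(simp add: nice_def)
 have eq: "alg P = alg p" "pts P = pts p" using c by(auto simp: comparable_def)
 obtain C where C: "cmat p P C" "D = swap_sign (length (frO P)) (length (frE P)) * frame_det (length (frE P) + length (frO p)) C"
  using r unfolding resolution_def by blast
 let ?P = "bc_point h (alg p') (pts p') P"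
 have "big P = Om (alg P) N (pts P) M" using n by(simp add: nice_def)
 from bc_point_Gr1_Om[OF P d' h(1) _ _ this] h(2) x eq
 have n': "nice N M ?P" by(auto simp: nice_def)
 from cmat_pullback[OF p P c pb p' C(1)]
 have c': "comparable p' ?P" "cmat p' ?P (%i j. h (C i j))" .
 have "big p' \<subseteq> Om (alg p') N (pts p') M1"
 proof -
  have "base_change h (alg p') (Om (alg p) N (pts p) M1) = (Om (alg p') N (pts p') M1 :: (base fls ^ 'n) set)"
   by(rule base_change_Om[OF d' d rh h(2)]) (rule x)
  thus ?thesis using base_change_mono[OF d' b, of h] bg by simp
 qed
 moreover have "h D = swap_sign (length (frO ?P)) (length (frE ?P)) * frame_det (length (frE ?P) + length (frO p')) (%i j. h (C i j))"
  by(simp add: C(2) h.mult swap_sign_hom[OF rh] frame_det_hom[OF rh] lO)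
 ultimately show ?thesis using n' c' r unfolding resolution_def by(auto simp: lO)
qed

definition extend :: "nat => nat => (base fls ^ 'n) list => 'n::finite framed_point => 'n framed_point" where
 "extend N M q p = p\<lparr>big := Om (alg p) N (pts p) M, frO := frO p @ q, frE := frE p @ q\<rparr>"

lemma extend_sel [simp]: "alg (extend N M q p) = alg p" "pts (extend N M q p) = pts p" "lat (extend N M q p) = lat p"
 "big (extend N M q p) = Om (alg p) N (pts p) M" "frO (extend N M q p) = frO p @ q" "frE (extend N M q p) = frE p @ q"
 by(simp_all add: extend_def)

lemma nice_extend:
 assumes p: "p : Gr1 N" and q: "frame (alg p) (Om (alg p) N (pts p) M) (big p) q"
 shows "nice N M (extend N M q p)"
proof -
 note d = Gr1D[OF p]
 have "Om (alg p) N (pts p) M \<subseteq> rat_vecs (alg p) N (pts p)"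
  by(rule subsetI) (rule iffD2[OF rat_vecs_Om[OF d(1)]], rule exI)
 thus ?thesis
  using frame_concat[OF q d(7) Om_csub[OF d(1)] d(9) polyvecs_csub[OF d(1)]]
   frame_concat[OF q d(8) Om_csub[OF d(1)] d(9,10)] d(1,2) Om_submod[OF d(1), of N "pts p" M]
  by(simp add: nice_def Gr1_def)
qed

text \<open>An equation may be checked on those localizations where \<open>p\<close> extends to a
  nice point by adding vectors \<open>q\<close> to both frames. They come from
  \<open>localize_split\<close> for the coordinates of \<open>frO p\<close>, which are injective
  since \<open>frO p\<close> is independent.\<close>

lemma localize_extension:
 fixes p :: "'n::finite framed_point"
 assumes N: "N > 0" and p: "p : Gr1 N" and b: "big p \<subseteq> Om (alg p) N (pts p) M1"
  and loc: "!!h J. is_loc (alg p) h J ==> bc_point h J (h o pts p) p : Gr1 N ==>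
   (!!M. M1 + length (frO p) \<le> M ==> EX q. frame J (Om J N (h o pts p) M) (base_change h J (big p)) q \<and>
    length (frO p) + length q = M * (N * CARD('n))) ==> h x : J"
 shows "x : alg p"
proof -
 note d = Gr1D[OF p]
 let ?I = "alg p" and ?r = "length (frO p)"
 obtain et :: "(base fls ^ 'n) list" where et: "frame ?I (Om ?I N (pts p) M1) (poly_vecs ?I) et" "length et = M1 * (N * CARD('n))"
  using Om_frame[OF d(1), where M = M1 and N = N and x = "pts p" and 'n = 'n] by blast
 have "set (frO p) \<subseteq> Om ?I N (pts p) M1" using d(7) b by(auto simp: frame_iff)
 from frame_matrix[OF et(1) this] obtain A where A: "ALL a<?r. frO p ! a - lcomb (A a) et : poly_vecs ?I" by(elim exE)
 show ?thesis
 proof(rule localize_split[OF d(1) coord_inj[OF p et(1) b A]])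
  fix h J T assume l: "is_loc ?I h J" and T: "splits J (%a j. h (A a j)) (length et) ?r T"
  have J: "is_ideal J" and h: "ring_map h" "h ` ?I \<subseteq> J" using l alg_hom_ring_map by(auto simp: is_loc_def)
  interpret h: ring_map h by(rule h(1))
  let ?p = "bc_point h J (h o pts p) p"
  have x: "(h o pts p) i - h (pts p i) : J" if "i < N" for i by(simp add: ideal_zero[OF J])
  have p': "?p : Gr1 N" by(rule bc_point_Gr1_loc[OF p l x])
  have f: "frame J (Om J N (h o pts p) M1) (poly_vecs J) (map (vmap h) et)"
   using frame_base_change_Om[OF d(1) J h _ polyvecs_csub[OF d(1)] et(1), of "h o pts p"] x
    base_change_poly_vecs[OF J d(1) h, where 'n = 'n] by simp
  have Om: "base_change h J (Om ?I N (pts p) M1) = (Om J N (h o pts p) M1 :: (base fls ^ 'n) set)"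
   by(rule base_change_Om[OF J d(1) h]) (rule x)
  have b': "base_change h J (big p) \<subseteq> Om J N (h o pts p) M1" using base_change_mono[OF J b, of h] Om by simp
  have "vmap h (frO p ! a) - lcomb (%j. h (A a j)) (map (vmap h) et) : poly_vecs J" if "a < ?r" for a
   using vmap_poly_vecs[OF h A[rule_format, OF that]] by(simp add: h.vmap_diff vmap_lcomb[OF h(1)])
  hence A': "ALL a<length (frO ?p). frO ?p ! a - lcomb (%j. h (A a j)) (map (vmap h) et) : poly_vecs (alg ?p)" by simp
  show "h x : J"
  proof(rule loc[OF l p'])
   fix M assume M: "M1 + ?r \<le> M"
   have "EX q. frame (alg ?p) (Om (alg ?p) N (pts ?p) M) (big ?p) q \<and> length (frO ?p) + length q = M * (N * CARD('n))"
    by(rule extension_exists[OF p' _ _ A' N, of M1]) (use f b' T M et(2) in auto)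
   thus "EX q. frame J (Om J N (h o pts p) M) (base_change h J (big p)) q \<and> ?r + length q = M * (N * CARD('n))" by simp
  qed
 qed
qed

section \<open>The derivative as a section over all framed points\<close>

context homogeneous_family
begin

text \<open>If \<open>p\<close> itself extends to a nice point, then that point and \<open>P\<close>
  differ by a change of frames. By \<open>cmat_enlarge\<close> and \<open>cmat_same\<close> the
  determinants of this change have quotient \<open>D\<close>, and \<open>deriv_frame\<close>
  compares the derivatives. The determinant \<open>?g\<close> is cancelled as a unit.\<close>

lemma deriv_resolution:
 assumes p: "p : Gr1 N" and r: "resolution N M1 M p P D" and m: "m \<le> M"
  and q: "frame (alg p) (Om (alg p) N (pts p) M) (big p) q" "length (frO p) + length q = M * (N * CARD('n))"
 shows "D ^ k * deriv_coeff P - deriv_coeff (extend N M q p) : alg p"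
proof -
 note d = Gr1D[OF p]
 let ?p = "extend N M q p"
 have n: "nice N M P" and c: "comparable p P" and lP: "length (frO P) = M * (N * CARD('n))"
  and bM: "big p \<subseteq> Om (alg p) N (pts p) M"
  using r Om_mono[OF d(1), of M1 M] by(auto simp: resolution_def)
 have P: "P : Gr1 N" using n by(simp add: nice_def)
 note dP = Gr1D[OF P]
 have eq: "alg P = alg p" "pts P = pts p" "lat P = lat p" using c by(auto simp: comparable_def)
 have bP: "big P = Om (alg p) N (pts p) M" using n eq by(simp add: nice_def)
 obtain C where C: "cmat p P C" "D = swap_sign (length (frO P)) (length (frE P)) * frame_det (length (frE P) + length (frO p)) C"
  using r unfolding resolution_def by blast
 have n': "nice N M ?p" by(rule nice_extend[OF p q(1)])
 hence p': "?p : Gr1 N" by(simp add: nice_def)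
 note d' = Gr1D[OF p', simplified]
 have "EX C1. cmat ?p P C1 \<and> frame_det (length (frE P) + length (frO ?p)) C1 = frame_det (length (frE P) + length (frO p)) C"
  by(rule cmat_enlarge(2)[OF p p' P c _ _ _ _ _ _ _ C(1), where q = q]) (use bP bM in auto)
 then obtain C1 where C1: "cmat ?p P C1"
  "frame_det (length (frE P) + length (frO ?p)) C1 = frame_det (length (frE P) + length (frO p)) C" by blast
 have len: "length (frO ?p) = length (frO P)" "length (frE ?p) = length (frE P)"
  using lP q(2) c by(auto simp: comparable_def)
 have "set (frO ?p) \<subseteq> big P" "set (frE ?p) \<subseteq> big P" using d'(7,8) bP by(auto simp: frame_iff)
 from frame_matrix[OF dP(7) this(1)] frame_matrix[OF dP(8) this(2)]
 obtain H G where H: "changes_frame (poly_vecs (alg P)) H (frO P) (frO ?p)" and G: "changes_frame (lat P) G (frE P) (frE ?p)"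
  unfolding changes_frame_iff len by auto
 let ?g = "frame_det (length (frE P)) G" and ?h = "frame_det (length (frO P)) H"
 have 1: "D * ?g - ?h : alg p"
  using cmat_same[OF p' P _ _ _ _ H G C1(1)] C1(2) by(simp add: eq bP C(2))
 have 2: "deriv_coeff ?p * ?g ^ k - deriv_coeff P * ?h ^ k : alg p"
  using deriv_frame[OF n m p' _ _ _ _ H G] by(simp add: eq bP)
 obtain G' where "frame_det (length (frE P)) G' * ?g - 1 : alg P"
  using changes_frame_inverse[OF dP(1,8) _ dP(10) G] d'(8) by(auto simp: eq bP)
 from cong_power[OF d(1) this[unfolded eq], of k] have u: "frame_det (length (frE P)) G' ^ k * ?g ^ k - 1 : alg p"
  by(simp add: power_mult_distrib)
 have "D ^ k * ?g ^ k - ?h ^ k : alg p" using cong_power[OF d(1) 1, of k] by(simp add: power_mult_distrib)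
 from ideal_mult[OF d(1) this, of "deriv_coeff P"]
 have "deriv_coeff P * (D ^ k * ?g ^ k) - deriv_coeff P * ?h ^ k : alg p" by(simp add: right_diff_distrib)
 from ideal_diff[OF d(1) this 2] have "?g ^ k * (D ^ k * deriv_coeff P - deriv_coeff ?p) : alg p"
  by(simp add: algebra_simps)
 from unit_cancel[OF d(1) u this] show ?thesis .
qed

text \<open>The extension is allowed a smaller pole order \<open>M'\<close> than the resolution. A
  frame \<open>t\<close> between the two orders enlarges it, and \<open>deriv_enlarge\<close> shows
  that this does not change the derivative.\<close>

lemma resolution_local:
 assumes p: "p : Gr1 N" and J: "is_ideal J" and h: "alg_hom cst h" "h ` alg p \<subseteq> J"
  and p': "bc_point h J (h o pts p) p : Gr1 N" (is "?p : _")
  and r: "resolution N M1 M p P D" and m: "m \<le> M'" "M' \<le> M"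
  and q: "frame J (Om J N (h o pts p) M') (base_change h J (big p)) q" "length (frO p) + length q = M' * (N * CARD('n))"
 shows "h (D ^ k * deriv_coeff P) - deriv_coeff (extend N M' q ?p) : J"
proof -
 interpret h: ring_map h by(rule alg_hom_ring_map[OF h(1)])
 note d = Gr1D[OF p', unfolded bc_point_sel]
 have mM: "m \<le> M" using m by simp
 obtain t :: "(base fls ^ 'n) list" where t: "frame J (Om J N (h o pts p) (M' + (M - M'))) (Om J N (h o pts p) M') t"
  "length t = (M - M') * (N * CARD('n))"
  using frame_Om[OF J, where M = M' and d = "M - M'" and N = N and x = "h o pts p" and 'n = 'n] by blast
 have t1: "frame J (Om J N (h o pts p) M) (Om J N (h o pts p) M') t" using t(1) m by simp
 have qt: "frame J (Om J N (h o pts p) M) (base_change h J (big p)) (q @ t)"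
  by(rule frame_concat[OF t1 q(1) Om_csub[OF J] Om_csub[OF J] d(9)])
 have len: "length (frO p) + length (q @ t) = M * (N * CARD('n))"
  using q(2) t(2) le_add_diff_inverse[OF mult_le_mono1[OF m(2), of "N * CARD('n)"]] by(simp add: diff_mult_distrib)
 have "deriv_coeff (extend N M (q @ t) ?p) - deriv_coeff (extend N M' q ?p) : alg (extend N M' q ?p)"
  by(rule deriv_enlarge[OF nice_extend[OF p'] m(1) nice_extend[OF p'] mM])
   (simp_all only: bc_point_sel extend_sel q(1) qt Om_mono[OF J m(2)] append_assoc)
 hence 1: "deriv_coeff (extend N M (q @ t) ?p) - deriv_coeff (extend N M' q ?p) : J" by simp
 have pb: "is_pullback N h p ?p" by(rule bc_point_pullback[OF p J h]) (simp add: ideal_zero[OF J])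
 have "h D ^ k * deriv_coeff (bc_point h J (h o pts p) P) - deriv_coeff (extend N M (q @ t) ?p) : alg ?p"
  by(rule deriv_resolution[OF p' resolution_pullback[OF p p' pb r, unfolded bc_point_sel] mM])
   (simp_all only: bc_point_sel qt len length_map)
 hence 2: "h D ^ k * deriv_coeff (bc_point h J (h o pts p) P) - deriv_coeff (extend N M (q @ t) ?p) : J" by simp
 have n: "nice N M P" and eq: "alg P = alg p" "pts P = pts p" using r by(auto simp: resolution_def comparable_def)
 have "deriv_coeff (bc_point h J (h o pts p) P) - h (deriv_coeff P) : J"
  using deriv_pullback[OF n mM J h(1)] h(2) by(simp add: eq ideal_zero[OF J])
 from ideal_mult[OF J cong_sym[OF J this], of "h D ^ k"]
 have "h (D ^ k * deriv_coeff P) - h D ^ k * deriv_coeff (bc_point h J (h o pts p) P) : J"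
  by(simp add: right_diff_distrib h.mult h.power)
 from cong_trans[OF J this cong_trans[OF J 2 1]] show ?thesis .
qed

text \<open>Locally both values agree with the derivative at one extension of
  \<open>p\<close>.\<close>

lemma deriv_resolution_unique:
 assumes N: "N > 0" and p: "p : Gr1 N" and m: "m \<le> M" and m': "m \<le> M'"
  and r: "resolution N M1 M p P D" and r': "resolution N M1' M' p P' D'"
 shows "D ^ k * deriv_coeff P - D' ^ k * deriv_coeff P' : alg p"
proof -
 define M0 where "M0 = min M1 M1'"
 \<comment> \<open>A pole order at most both \<open>M\<close> and \<open>M'\<close>, but large
   enough for the extension to exist locally and to be movable.\<close>
 define M2 where "M2 = max m (M0 + length (frO p))"
 have M2: "m \<le> M2" "M2 \<le> M" "M2 \<le> M'" and b: "big p \<subseteq> Om (alg p) N (pts p) M0"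
  using r r' m m' by(auto simp: M2_def M0_def resolution_def min_def)
 show ?thesis
 proof(rule localize_extension[OF N p b])
  fix h J assume l: "is_loc (alg p) h J" and p': "bc_point h J (h o pts p) p : Gr1 N"
   and ex: "!!M. M0 + length (frO p) \<le> M ==> EX q. frame J (Om J N (h o pts p) M) (base_change h J (big p)) q \<and>
    length (frO p) + length q = M * (N * CARD('n))"
  have J: "is_ideal J" and h: "alg_hom cst h" "h ` alg p \<subseteq> J" using l by(auto simp: is_loc_def)
  obtain q where q: "frame J (Om J N (h o pts p) M2) (base_change h J (big p)) q" "length (frO p) + length q = M2 * (N * CARD('n))"
   using ex[of M2] by(auto simp: M2_def)
  from cong_trans[OF J resolution_local[OF p J h p' r M2(1,2) q] cong_sym[OF J resolution_local[OF p J h p' r' M2(1,3) q]]]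
  show "h (D ^ k * deriv_coeff P - D' ^ k * deriv_coeff P') : J"
   by(simp only: ring_map.diff[OF alg_hom_ring_map[OF h(1)]])
 qed
qed

text \<open>The derivative at a nice point \<open>P\<close>, transported to \<open>p\<close>. The
  exponent \<open>k\<close> enters because sections of O(k) use the \<open>k\<close>-th power of the
  generator. The choice is immaterial modulo \<open>alg p\<close> by
  \<open>deriv_resolution_unique\<close>.\<close>

definition deriv_sec :: "'n framed_point => base" where
 "deriv_sec p = (SOME v. EX M1 M P D. m \<le> M \<and> resolution N M1 M p P D \<and> v = D ^ k * deriv_coeff P)"

lemma resolution_large:
 assumes "N > 0" "p : Gr1 N"
 shows "EX M1 M P D. m \<le> M \<and> M0 \<le> M1 \<and> M1 + length (frO p) + r \<le> M \<and> resolution N M1 M p P D"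
proof -
 note d = Gr1D[OF assms(2)]
 obtain M2 where M2: "\<forall>M\<ge>M2. big p \<subseteq> Om (alg p) N (pts p) M" using frame_bounded[OF d(1,7,6)] by blast
 define M1 where "M1 = max M0 M2"
 define M where "M = max m (M1 + length (frO p) + r)"
 have "big p \<subseteq> Om (alg p) N (pts p) M1" "M1 + length (frO p) \<le> M" using M2 by(auto simp: M1_def M_def)
 from resolution_exists[OF assms this] obtain P D where "resolution N M1 M p P D" by blast
 moreover have "m \<le> M" "M0 \<le> M1" "M1 + length (frO p) + r \<le> M" by(auto simp: M1_def M_def)
 ultimately show ?thesis by blast
qed

lemma deriv_sec_eq:
 assumes N: "N > 0" and p: "p : Gr1 N" and m: "m \<le> M" and r: "resolution N M1 M p P D"
 shows "deriv_sec p - D ^ k * deriv_coeff P : alg p"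
proof -
 have "EX v M1 M P D. m \<le> M \<and> resolution N M1 M p P D \<and> v = D ^ k * deriv_coeff P" using m r by blast
 from someI_ex[OF this] obtain M1' M' P' D' where "m \<le> M'" "resolution N M1' M' p P' D'" "deriv_sec p = D' ^ k * deriv_coeff P'"
  unfolding deriv_sec_def by blast
 thus ?thesis using deriv_resolution_unique[OF N p _ m _ r] by simp
qed

lemma deriv_sec_local:
 assumes N: "N > 0" and p: "p : Gr1 N" and J: "is_ideal J" and h: "alg_hom cst h" "h ` alg p \<subseteq> J"
  and p': "bc_point h J (h o pts p) p : Gr1 N" (is "?p : _") and m: "m \<le> M'"
  and q: "frame J (Om J N (h o pts p) M') (base_change h J (big p)) q" "length (frO p) + length q = M' * (N * CARD('n))"
 shows "h (deriv_sec p) - deriv_coeff (extend N M' q ?p) : J"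
proof -
 obtain M1 M P D where M: "m \<le> M" "M1 + length (frO p) + M' \<le> M" and r: "resolution N M1 M p P D"
  using resolution_large[OF N p] by blast
 have "h (deriv_sec p - D ^ k * deriv_coeff P) : J" using deriv_sec_eq[OF N p M(1) r] h(2) by blast
 hence "h (deriv_sec p) - h (D ^ k * deriv_coeff P) : J" by(simp only: ring_map.diff[OF alg_hom_ring_map[OF h(1)]])
 from cong_trans[OF J this resolution_local[OF p J h p' r m _ q]] show ?thesis using M by simp
qed

text \<open>Compatibility with base change is seen on resolutions, which pull back. The two rules
  for frames are checked where the points extend to nice ones, where they become
  \<open>deriv_frame\<close> and an equality of extended points.\<close>

lemma deriv_sec_section:
 assumes N: "N > 0"
 shows "deriv_sec : sections N k (Gr1 N)"
 unfolding sections_def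
proof(intro CollectI conjI ballI allI impI)
 fix p p' :: "'n framed_point" and h assume p: "p : Gr1 N" and p': "p' : Gr1 N" and pb: "is_pullback N h p p'"
 note J = Gr1D(1)[OF p']
 have h: "alg_hom cst h" "h ` alg p \<subseteq> alg p'" and x: "!!i. i < N ==> pts p' i - h (pts p i) : alg p'"
  using pb by(auto simp: is_pullback_def)
 interpret h: ring_map h by(rule alg_hom_ring_map[OF h(1)])
 obtain M1 M P D where m: "m \<le> M" and r: "resolution N M1 M p P D" using resolution_large[OF N p] by blast
 have n: "nice N M P" and eq: "alg P = alg p" "pts P = pts p" using r by(auto simp: resolution_def comparable_def)
 have 1: "deriv_sec p' - h D ^ k * deriv_coeff (bc_point h (alg p') (pts p') P) : alg p'"
  by(rule deriv_sec_eq[OF N p' m resolution_pullback[OF p p' pb r]])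
 have "deriv_coeff (bc_point h (alg p') (pts p') P) - h (deriv_coeff P) : alg p'"
  using deriv_pullback[OF n m J h(1)] h(2) x by(simp add: eq)
 from ideal_mult[OF J this, of "h D ^ k"]
 have 2: "h D ^ k * deriv_coeff (bc_point h (alg p') (pts p') P) - h (D ^ k * deriv_coeff P) : alg p'"
  by(simp add: right_diff_distrib h.mult h.power)
 have "h (deriv_sec p - D ^ k * deriv_coeff P) : alg p'" using deriv_sec_eq[OF N p m r] h(2) by blast
 hence "h (D ^ k * deriv_coeff P) - h (deriv_sec p) : alg p'" using cong_sym[OF J] by(simp add: h.diff)
 from cong_trans[OF J 1 cong_trans[OF J 2 this]] show "deriv_sec p' - h (deriv_sec p) : alg p'" .
next
 fix p p1 :: "'n framed_point" and G H assume p: "p : Gr1 N" and p1: "p1 : Gr1 N"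
  and "alg p1 = alg p \<and> pts p1 = pts p \<and> lat p1 = lat p \<and> big p1 = big p \<and>
   changes_frame (poly_vecs (alg p)) H (frO p) (frO p1) \<and> changes_frame (lat p) G (frE p) (frE p1)"
 hence a: "alg p1 = alg p" "pts p1 = pts p" "lat p1 = lat p" "big p1 = big p" and H: "changes_frame (poly_vecs (alg p)) H (frO p) (frO p1)"
  and G: "changes_frame (lat p) G (frE p) (frE p1)" by blast+
 let ?g = "frame_det (length (frE p)) G" and ?h = "frame_det (length (frO p)) H"
 have len: "length (frO p1) = length (frO p)" using H by(simp add: changes_frame_iff)
 obtain M1 where b: "big p \<subseteq> Om (alg p) N (pts p) M1" using frame_bounded[OF Gr1D(1,7,6)[OF p]] by blast
 show "deriv_sec p1 * ?g ^ k - deriv_sec p * ?h ^ k : alg p"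
 proof(rule localize_extension[OF N p b])
  fix h J assume l: "is_loc (alg p) h J" and p': "bc_point h J (h o pts p) p : Gr1 N"
   and ex: "!!M. M1 + length (frO p) \<le> M ==> EX q. frame J (Om J N (h o pts p) M) (base_change h J (big p)) q \<and>
    length (frO p) + length q = M * (N * CARD('n))"
  have J: "is_ideal J" and h: "alg_hom cst h" "h ` alg p \<subseteq> J" using l by(auto simp: is_loc_def)
  have rh: "ring_map h" by(rule alg_hom_ring_map[OF h(1)])
  interpret h: ring_map h by(rule rh)
  define M where "M = max m (M1 + length (frO p))"
  obtain q where q: "frame J (Om J N (h o pts p) M) (base_change h J (big p)) q" "length (frO p) + length q = M * (N * CARD('n))"
   using ex[of M] by(auto simp: M_def)
  have m: "m \<le> M" by(simp add: M_def)
  let ?p = "bc_point h J (h o pts p) p" and ?p1 = "bc_point h J (h o pts p1) p1"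
  have p1': "?p1 : Gr1 N" by(rule bc_point_Gr1_loc[OF p1]) (simp_all add: a l ideal_zero[OF J])
  note d = Gr1D[OF p', unfolded bc_point_sel]
  have q1: "ALL i<length q. q ! i - lcomb (%j. if i = j then 1 else 0) q : base_change h J (big p)"
  proof(intro allI impI)
   fix i assume "i < length q"
   hence "lcomb (%j. if i = j then 1 else 0) q = q ! i" using lcomb_delta[of i q] by(simp add: eq_commute)
   thus "q ! i - lcomb (%j. if i = j then 1 else 0) q : base_change h J (big p)" by(simp add: csub_zero[OF d(9)])
  qed
  have "changes_frame (poly_vecs J) (%i j. h (H i j)) (map (vmap h) (frO p)) (map (vmap h) (frO p1))"
   by(rule changes_frame_map[OF H]) (auto simp: h.vmap_add h.vmap_smult h.map_const intro: vmap_poly_vecs[OF rh h(2)])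
  from changes_frame_block[OF d(7) polyvecs_csub[OF J] this refl q1] obtain H' where
   H': "changes_frame (poly_vecs J) H' (map (vmap h) (frO p) @ q) (map (vmap h) (frO p1) @ q)"
    "frame_det (length (frO p) + length q) H' = h ?h" by(auto simp: frame_det_id frame_det_hom[OF rh])
  have "changes_frame (base_change h J (lat p)) (%i j. h (G i j)) (map (vmap h) (frE p)) (map (vmap h) (frE p1))"
   by(rule changes_frame_map[OF G]) (auto simp: h.vmap_add h.vmap_smult h.map_const intro: base_change_mem[OF J])
  from changes_frame_block[OF d(8,10) this refl q1] obtain G' where
   G': "changes_frame (base_change h J (lat p)) G' (map (vmap h) (frE p) @ q) (map (vmap h) (frE p1) @ q)"
    "frame_det (length (frE p) + length q) G' = h ?g" by(auto simp: frame_det_id frame_det_hom[OF rh])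
  let ?e = "deriv_coeff (extend N M q ?p)" and ?e1 = "deriv_coeff (extend N M q ?p1)"
  have n: "nice N M (extend N M q ?p)" "nice N M (extend N M q ?p1)"
   using q(1) p1' by(auto intro!: nice_extend p' simp: a)
  have "extend N M q ?p1 : Gr1 N" using n(2) by(simp add: nice_def)
  from deriv_frame[OF n(1) m this, of H' G'] H' G'
  have 1: "?e1 * h ?g ^ k - ?e * h ?h ^ k : J" by(simp add: a)
  have 2: "h (deriv_sec p) - ?e : J" by(rule deriv_sec_local[OF N p J h p' m q])
  have "h (deriv_sec p1) - ?e1 : J" by(rule deriv_sec_local[OF N p1 J h(1) _ p1' m]) (simp_all only: a h(2) q len)
  hence 3: "h (deriv_sec p1) * h ?g ^ k - ?e1 * h ?g ^ k : J"
   using ideal_mult2[OF J] by(simp flip: left_diff_distrib)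
  have "?e * h ?h ^ k - h (deriv_sec p) * h ?h ^ k : J"
   using ideal_mult2[OF J cong_sym[OF J 2]] by(simp flip: left_diff_distrib)
  from cong_trans[OF J 3 cong_trans[OF J 1 this]]
  show "h (deriv_sec p1 * ?g ^ k - deriv_sec p * ?h ^ k) : J" by(simp only: h.diff h.mult h.power)
 qed
next
 fix p p1 :: "'n framed_point" and q assume p: "p : Gr1 N" and p1: "p1 : Gr1 N"
  and "alg p1 = alg p \<and> pts p1 = pts p \<and> lat p1 = lat p \<and> big p \<subseteq> big p1 \<and> frO p1 = frO p @ q \<and> frE p1 = frE p @ q"
 hence a: "alg p1 = alg p" "pts p1 = pts p" "lat p1 = lat p" "big p \<subseteq> big p1" "frO p1 = frO p @ q" "frE p1 = frE p @ q" by blast+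
 obtain M1 where b: "big p1 \<subseteq> Om (alg p1) N (pts p1) M1" using frame_bounded[OF Gr1D(1,7,6)[OF p1]] by blast
 have "deriv_sec p1 - deriv_sec p : alg p1"
 proof(rule localize_extension[OF N p1 b])
  fix h J assume l: "is_loc (alg p1) h J" and p1': "bc_point h J (h o pts p1) p1 : Gr1 N"
   and ex: "!!M. M1 + length (frO p1) \<le> M ==> EX q. frame J (Om J N (h o pts p1) M) (base_change h J (big p1)) q \<and>
    length (frO p1) + length q = M * (N * CARD('n))"
  have J: "is_ideal J" and h: "alg_hom cst h" "h ` alg p1 \<subseteq> J" using l by(auto simp: is_loc_def)
  define M where "M = max m (M1 + length (frO p1))"
  obtain q1 where q1: "frame J (Om J N (h o pts p1) M) (base_change h J (big p1)) q1" "length (frO p1) + length q1 = M * (N * CARD('n))"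
   using ex[of M] by(auto simp: M_def)
  have m: "m \<le> M" by(simp add: M_def)
  let ?p = "bc_point h J (h o pts p) p" and ?p1 = "bc_point h J (h o pts p1) p1"
  have p': "?p : Gr1 N" by(rule bc_point_Gr1_loc[OF p]) (use l in \<open>simp_all add: a ideal_zero[OF J]\<close>)
  note d = Gr1D[OF p', unfolded bc_point_sel] and d1 = Gr1D[OF p1', unfolded bc_point_sel]
  have "frame J (base_change h J (big p1)) (base_change h J (big p)) (map (vmap h) q)"
   by(rule frame_quot[OF d1(7)[unfolded a(5) map_append] d(7) base_change_mono[OF J a(4)] d(9) polyvecs_csub[OF J]])
  from frame_concat[OF q1(1) this Om_csub[OF J] d1(9) d(9)]
  have q: "frame J (Om J N (h o pts p) M) (base_change h J (big p)) (map (vmap h) q @ q1)" by(simp only: a)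
  have "length (frO p) + length (map (vmap h) q @ q1) = M * (N * CARD('n))" using q1(2) by(simp add: a)
  from deriv_sec_local[OF N p J h(1) _ p' m q this] h(2) a
  have "h (deriv_sec p) - deriv_coeff (extend N M (map (vmap h) q @ q1) ?p) : J" by simp
  moreover have "extend N M (map (vmap h) q @ q1) ?p = extend N M q1 ?p1"
   by(simp add: extend_def bc_point_def a)
  ultimately have "h (deriv_sec p) - deriv_coeff (extend N M q1 ?p1) : J" by(simp only:)
  from cong_trans[OF J deriv_sec_local[OF N p1 J h p1' m q1] cong_sym[OF J this]]
  show "h (deriv_sec p1 - deriv_sec p) : J" by(simp only: ring_map.diff[OF alg_hom_ring_map[OF h(1)]])
 qed
 thus "deriv_sec p1 - deriv_sec p : alg p" by(simp only: a)
qed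

end

section \<open>Weights\<close>

definition sc :: "complex => base fls => base fls" where
 "sc l F = Abs_fls (%j. cst (l powi j) * fls_nth F j)"

lemma sc_nth: "fls_nth (sc l F) j = cst (l powi j) * fls_nth F j"
 unfolding sc_def by(rule fls_nth_Abs[of "fls_subdegree F"]) simp

lemma scale_vec_nth: "scale_vec l v $ i = sc l (v $ i)"
 by(simp add: scale_vec_def sc_def)

lemma sc_add: "sc l (F + G) = sc l F + sc l G"
 by(rule fls_eqI) (simp add: sc_nth distrib_left)

lemma sc_const: "sc l (fls_const c) = fls_const c"
 by(rule fls_eqI) (simp add: sc_nth cst_simps)

lemma sc_sc: "sc l (sc l' F) = sc (l * l') F"
 by(rule fls_eqI) (simp add: sc_nth power_int_mult_distrib cst_simps mult.assoc)

lemma sc_one: "sc 1 F = F"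
 by(rule fls_eqI) (simp add: sc_nth cst_simps)

lemma sc_mult:
 assumes "l \<noteq> 0" shows "sc l (F * G) = sc l F * sc l G"
proof(rule fls_eqI)
 fix n
 let ?a = "fls_subdegree F" and ?b = "fls_subdegree G"
 have "fls_nth (sc l F * sc l G) n = (\<Sum>i=?a..n - ?b. fls_nth (sc l F) i * fls_nth (sc l G) (n - i))"
  by(rule fls_times_nth_bounds) (simp_all add: sc_nth)
 also have "\<dots> = (\<Sum>i=?a..n - ?b. cst (l powi n) * (fls_nth F i * fls_nth G (n - i)))"
 proof(rule sum.cong[OF refl])
  fix i
  have "cst (l powi n) = cst (l powi i) * cst (l powi (n - i))"
   using assms by(simp flip: cst_simps power_int_add)
  thus "fls_nth (sc l F) i * fls_nth (sc l G) (n - i) = cst (l powi n) * (fls_nth F i * fls_nth G (n - i))"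
   by(simp add: sc_nth mult_ac)
 qed
 also have "\<dots> = cst (l powi n) * fls_nth (F * G) n"
  by(subst fls_times_nth_bounds[of ?a F ?b G]) (simp_all add: sum_distrib_left)
 finally show "fls_nth (sc l (F * G)) n = fls_nth (sc l F * sc l G) n" by(simp add: sc_nth)
qed

lemma ring_map_sc: "l \<noteq> 0 ==> ring_map (sc l)"
 using sc_const[of l 1] by(simp add: ring_map_def sc_add sc_mult)

context
 fixes l :: complex
 assumes l: "l \<noteq> 0"
begin

interpretation sc: ring_map "sc l" by(rule ring_map_sc[OF l])

lemma sc_divisor: "sc l (divisor_eq N x) = fls_const (cst (1 / l) ^ N) * divisor_eq N (%i. cst l * x i)"
proof -
 have "sc l (fls_X_inv - fls_const (x i)) = fls_const (cst (1 / l)) * (fls_X_inv - fls_const (cst l * x i))" for i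
 proof -
  have "sc l fls_X_inv = fls_const (cst (1 / l)) * fls_X_inv"
   by(rule fls_eqI) (auto simp: sc_nth power_int_minus divide_inverse)
  moreover have "fls_const (cst (1 / l)) * fls_const (cst l * x i) = fls_const (x i)"
   using l by(simp add: fls_const_mult_const cst_simps flip: mult.assoc cst_simps(4))
  ultimately show ?thesis by(simp add: sc.diff sc_const right_diff_distrib)
 qed
 thus ?thesis
  by(simp add: divisor_eq_def sc.prod prod.distrib fls_const_power)
qed

lemma scale_vec_inverse: "scale_vec (1 / l) (scale_vec l v) = v" "scale_vec l (scale_vec (1 / l) v) = v"
 using l by(simp_all add: vec_eq_iff scale_vec_nth sc_sc sc_one)

lemma scale_vec_add: "scale_vec l (u + v) = scale_vec l u + scale_vec l v"
 by(simp add: vec_eq_iff scale_vec_nth sc.add)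

lemma scale_vec_smult: "scale_vec l (F *s v) = sc l F *s scale_vec l v"
 by(simp add: vec_eq_iff scale_vec_nth sc.mult)

lemma scale_vec_mv:
 assumes "!!i j. sc l (F $ i $ j) = fls_const c * F' $ i $ j"
 shows "scale_vec l (F *v v) = c *c (F' *v scale_vec l v)"
 by(simp add: vec_eq_iff scale_vec_nth matrix_vector_mult_def sc.sum sc.mult assms sum_distrib_left mult.assoc)

lemma scale_vec_diff: "scale_vec l (u - v) = scale_vec l u - scale_vec l v"
 by(simp add: vec_eq_iff scale_vec_nth sc.diff)

lemma scale_vec_lcomb:
 fixes us :: "(base fls ^ 'n) list"
 shows "scale_vec l (lcomb c us) = lcomb c (map (scale_vec l) us)"
proof -
 have "scale_vec l (sum w A) = (\<Sum>x\<in>A. scale_vec l (w x))" for w :: "nat => base fls ^ 'n" and A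
  by(rule additive.sum) (simp add: additive_def scale_vec_add)
 thus ?thesis by(simp add: lcomb_def scale_vec_smult sc_const)
qed

lemma scale_mem: "scale_vec l v : scale_vec l ` A \<longleftrightarrow> v : A"
proof -
 have "v = u" if "scale_vec l v = scale_vec l u" for u
  using arg_cong[OF that, of "scale_vec (1 / l)"] by(simp only: scale_vec_inverse(1))
 thus ?thesis by blast
qed

lemma powi_mem: "is_ideal I ==> cst (l powi j) * c : I \<longleftrightarrow> c : I"
 using ideal_mult[of I "cst (l powi j) * c" "cst (l powi (- j))"] ideal_mult[of I c "cst (l powi j)"] l
 by(auto simp: cst_simps simp flip: mult.assoc cst_simps(4) power_int_add)

lemma scale_van: "is_ideal I ==> scale_vec l v : van I \<longleftrightarrow> v : van I"
 by(simp add: van_def scale_vec_nth sc_nth powi_mem)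

lemma scale_poly: "is_ideal I ==> scale_vec l v : poly_vecs I \<longleftrightarrow> v : poly_vecs I"
 by(simp add: poly_vecs_def polyfuns_def scale_vec_nth sc_nth powi_mem)

lemma image_scale: "(!!v. scale_vec l v : B \<longleftrightarrow> v : A) ==> scale_vec l ` A = B"
proof(intro subset_antisym subsetI)
 fix v assume *: "!!v. scale_vec l v : B \<longleftrightarrow> v : A" and "v : B"
 hence "scale_vec (1 / l) v : A" using *[of "scale_vec (1 / l) v"] by(simp add: scale_vec_inverse(2))
 hence "scale_vec l (scale_vec (1 / l) v) : scale_vec l ` A" by(rule imageI)
 thus "v : scale_vec l ` A" by(simp add: scale_vec_inverse(2))
qed auto

lemma scale_Om: "is_ideal I ==> scale_vec l ` Om I N x M = Om I N (%i. cst l * x i) M"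
proof(rule image_scale)
 fix v :: "base fls ^ 'n" assume I: "is_ideal I"
 let ?c = "cst (1 / l) ^ N" and ?c' = "cst l ^ N" and ?D = "divisor_eq N (%i. cst l * x i)"
 have "?c' * ?c = (cst l * cst (1 / l)) ^ N" by(simp add: power_mult_distrib)
 also have "\<dots> = 1" using l by(simp flip: cst_simps(4)) (simp add: cst_simps)
 finally have cc: "?c' ^ M * ?c ^ M = 1" by(simp flip: power_mult_distrib)
 have e: "scale_vec l (divisor_eq N x ^ M *s v) = (?c ^ M) *c (?D ^ M *s scale_vec l v)"
  by(simp add: scale_vec_smult sc.power sc_divisor power_mult_distrib fls_const_power smult_assoc)
 have "?D ^ M *s scale_vec l v = (?c' ^ M) *c ((?c ^ M) *c (?D ^ M *s scale_vec l v))"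
  by(simp only: smult_assoc mult.assoc[symmetric] fls_const_mult_const cc) simp
 hence "?D ^ M *s scale_vec l v : poly_vecs I \<longleftrightarrow> (?c ^ M) *c (?D ^ M *s scale_vec l v) : poly_vecs I"
  using csub_smult[OF polyvecs_csub[OF I]] by metis
 thus "scale_vec l v : Om I N (%i. cst l * x i) M \<longleftrightarrow> v : Om I N x M"
  by(simp add: Om_def flip: e) (simp add: scale_poly[OF I])
qed

text \<open>Scaling multiplies z by 1/l and turns the divisor equation of \<open>x\<close> into l^-N
  times that of l x. Hence z^a / D^m acquires the factor l^(m N - a).\<close>

lemma sc_fam: "sc l (fam N m a Y x $ i $ j) = fls_const (cst (l powi (int (m * N) - int a))) * fam N m a Y (%i. cst l * x i) $ i $ j"
proof -
 let ?D = "%x. divisor_eq N x ^ m" and ?f = "%x. fam N m a Y x $ i $ j" and ?y = "%i. cst l * x i"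
 let ?g = "fls_const (cst (Y $ i $ j)) * fls_X_inv ^ a"
 have f: "?D x * ?f x = ?g" for x
 proof -
  have "?D x * ?f x = ?g * (?D x * dinv N x ^ m)" by(simp add: fam_def mult_ac)
  thus ?thesis by(simp add: dinv_pow)
 qed
 have X: "sc l fls_X_inv = fls_const (cst (1 / l)) * fls_X_inv"
  by(rule fls_eqI) (auto simp: sc_nth power_int_minus divide_inverse)
 have cp: "cst c ^ n = cst (c ^ n)" "fls_const (cst c) ^ n = fls_const (cst (c ^ n))" for c n
  by(simp_all add: ring_map.power[OF ring_map_cst] flip: fls_const_power)
 have "fls_const (cst ((1 / l) ^ (N * m))) * ?D ?y * sc l (?f x) = sc l (?D x * ?f x)"
  by(simp add: sc.mult sc.power sc_divisor power_mult_distrib cp power_mult)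
 also have "\<dots> = fls_const (cst ((1 / l) ^ a)) * ?g"
  by(simp add: f sc.mult sc.power sc_const X power_mult_distrib cp mult_ac del: fls_const_mult_const)
 also have "\<dots> = fls_const (cst ((1 / l) ^ a)) * (?D ?y * ?f ?y)" by(simp only: f)
 finally have 1: "fls_const (cst ((1 / l) ^ (N * m))) * (?D ?y * sc l (?f x)) = fls_const (cst ((1 / l) ^ a)) * (?D ?y * ?f ?y)"
  by(simp only: mult.assoc)
 have "?D ?y * sc l (?f x) = fls_const (cst (l ^ (N * m))) * (fls_const (cst ((1 / l) ^ (N * m))) * (?D ?y * sc l (?f x)))"
  using l by(simp add: fls_const_mult_const cst_simps power_divide flip: mult.assoc cst_simps(4))
 also have "\<dots> = fls_const (cst (l ^ (N * m) * (1 / l) ^ a)) * (?D ?y * ?f ?y)"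
  unfolding 1 by(simp add: cst_simps(4) mult.assoc flip: fls_const_mult_const)
 also have "l ^ (N * m) * (1 / l) ^ a = l powi (int (m * N) - int a)"
  using l by(simp add: power_int_diff power_divide mult.commute[of N] del: of_nat_mult)
 finally have "?D ?y * sc l (?f x) = ?D ?y * (fls_const (cst (l powi (int (m * N) - int a))) * ?f ?y)"
  by(simp only: mult_ac)
 from arg_cong[OF this, of "%F. dinv N ?y ^ m * F"] show ?thesis by(simp only: dinv_pow2)
qed

lemma frame_scale:
 assumes "frame I A B us"
 shows "frame I (scale_vec l ` A) (scale_vec l ` B) (map (scale_vec l) us)"
 unfolding frame_iff
proof(intro conjI ballI allI impI)
 show "scale_vec l ` B \<subseteq> scale_vec l ` A" "set (map (scale_vec l) us) \<subseteq> scale_vec l ` A"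
  using assms by(auto simp: frame_iff)
 fix v assume "v : scale_vec l ` A"
 then obtain u where "v = scale_vec l u" "u : A" by blast
 thus "EX c. v - lcomb c (map (scale_vec l) us) : scale_vec l ` B"
  using frame_coords[OF assms] by(metis scale_mem scale_vec_diff scale_vec_lcomb)
next
 fix c a assume "lcomb c (map (scale_vec l) us) : scale_vec l ` B" "a < length (map (scale_vec l) us)"
 thus "c a : I" using frame_indep[OF assms, of c a] by(simp add: scale_mem flip: scale_vec_lcomb)
qed

lemma vmap_scale: "alg_hom cst h ==> vmap h (scale_vec l v) = scale_vec l (vmap h v)"
 using alg_hom_ring_map[of h] alg_homD[of h]
 by(auto simp: vec_eq_iff scale_vec_nth ring_map.vmap_nth ring_map.map_nth ring_map.mult sc_nth intro!: fls_eqI)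

lemma vfpart_scale: "vfpart (scale_vec l v) = scale_vec l (vfpart v)"
 by(auto simp: vec_eq_iff vfpart_def scale_vec_nth sc_nth fpart_nth intro!: fls_eqI)

lemma scale_point_sel [simp]: "alg (scale_point l p) = alg p" "pts (scale_point l p) = (%i. cst l * pts p i)"
 "lat (scale_point l p) = scale_vec l ` lat p" "big (scale_point l p) = scale_vec l ` big p"
 "frO (scale_point l p) = map (scale_vec l) (frO p)" "frE (scale_point l p) = map (scale_vec l) (frE p)"
 by(simp_all add: scale_point_def)

text \<open>The homogeneity factor of \<open>F\<close> is absorbed into the infinitesimal
  parameter.\<close>

lemma scale_mv_point:
 fixes p :: "'n::finite framed_point"
 assumes F: "!!i j. sc l (F $ i $ j) = fls_const c * F' $ i $ j" and I: "is_ideal (alg p)"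
 shows "scale_point l (mv_point e F p) = mv_point (e * c) F' (scale_point l p)"
proof -
 have g: "scale_vec l (gact e F v) = gact (e * c) F' (scale_vec l v)" for v :: "base fls ^ 'n"
  by(simp add: gact_def scale_vec_add scale_vec_smult sc_const scale_vec_mv[OF F] smult_assoc fls_const_mult_const)
 have n: "scale_vec l (nact e F v) = nact (e * c) F' (scale_vec l v)" for v :: "base fls ^ 'n"
  by(simp add: nact_def scale_vec_add scale_vec_smult sc_const vfpart_scale scale_vec_mv[OF F] vfpart_smult
   smult_assoc fls_const_mult_const flip: vfpart_scale)
 have "scale_vec l ` mvset (alg p) (gact e F) A = mvset (alg p) (gact (e * c) F') (scale_vec l ` A)" for A
  by(rule image_scale) (auto simp: mvset_def scale_van[OF I] simp flip: g scale_vec_diff)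
 thus ?thesis by(simp add: mv_point_def scale_point_def g n)
qed

end

lemma scale_base_change:
 assumes J: "is_ideal J" and h: "alg_hom cst h" and l: "l \<noteq> 0"
 shows "scale_vec l ` base_change h J E = base_change h J (scale_vec l ` E)"
proof -
 have 1: "scale_vec l ` base_change h J E \<subseteq> base_change h J (scale_vec l ` E)" if l: "l \<noteq> 0" for l and E :: "(base fls ^ 'n) set"
 proof
  fix v assume "v : scale_vec l ` base_change h J E"
  then obtain w where w: "v = scale_vec l w" "w : base_change h J E" by blast
  then obtain us c where us: "set us \<subseteq> E" "w - lcomb c (map (vmap h) us) : van J"
   using base_change_iff[OF J] by blast
  have "v - lcomb c (map (vmap h) (map (scale_vec l) us)) = scale_vec l (w - lcomb c (map (vmap h) us))"
   by(simp add: w(1) scale_vec_diff[OF l] scale_vec_lcomb[OF l] comp_def vmap_scale[OF l h])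
  hence "v - lcomb c (map (vmap h) (map (scale_vec l) us)) : van J" using us(2) by(simp add: scale_van[OF l J])
  moreover have "set (map (scale_vec l) us) \<subseteq> scale_vec l ` E" using us(1) by auto
  ultimately show "v : base_change h J (scale_vec l ` E)" using base_change_iff[OF J] by blast
 qed
 have "scale_vec (1 / l) ` base_change h J (scale_vec l ` E) \<subseteq> base_change h J (scale_vec (1 / l) ` scale_vec l ` E)"
  using l by(intro 1) simp
 hence "scale_vec (1 / l) ` base_change h J (scale_vec l ` E) \<subseteq> base_change h J E"
  by(simp add: image_image scale_vec_inverse(1)[OF l])
 hence "scale_vec l ` scale_vec (1 / l) ` base_change h J (scale_vec l ` E) \<subseteq> scale_vec l ` base_change h J E"
  by(rule image_mono)
 hence "base_change h J (scale_vec l ` E) \<subseteq> scale_vec l ` base_change h J E"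
  by(simp add: image_image scale_vec_inverse(2)[OF l])
 with 1[OF l, of E] show ?thesis by(rule subset_antisym)
qed

lemma scale_bc_point:
 assumes "is_ideal J" "alg_hom cst h" "l \<noteq> 0"
 shows "scale_point l (bc_point h J x p) = bc_point h J (%i. cst l * x i) (scale_point l p)"
 by(simp add: bc_point_def scale_point_def scale_base_change[OF assms] vmap_scale[OF assms(3,2)])

lemma resolution_scale:
 fixes p :: "'n::finite framed_point"
 assumes l: "l \<noteq> 0" and p: "p : Gr1 N" and p': "scale_point l p : Gr1 N" and r: "resolution N M1 M p P D"
 shows "resolution N M1 M (scale_point l p) (scale_point l P) D"
proof -
 note I = Gr1D(1)[OF p]
 have c: "comparable p P" and n: "nice N M P" and lO: "length (frO P) = M * (N * CARD('n))"
  and b: "big p \<subseteq> Om (alg p) N (pts p) M1" and M1: "M1 + length (frO p) \<le> M"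
  using r by(auto simp: resolution_def)
 have eq: "alg P = alg p" "pts P = pts p" "lat P = lat p" using c by(auto simp: comparable_def)
 have P: "P : Gr1 N" using n by(simp add: nice_def)
 note dP = Gr1D[OF P]
 obtain C where C: "cmat p P C" "D = swap_sign (length (frO P)) (length (frE P)) * frame_det (length (frE P) + length (frO p)) C"
  using r unfolding resolution_def by blast
 have O: "scale_vec l ` poly_vecs (alg p) = (poly_vecs (alg p) :: (base fls ^ 'n) set)"
  by(rule image_scale[OF l scale_poly[OF l I]])
 have bP: "scale_vec l ` big P = Om (alg p) N (%i. cst l * pts p i) M"
  using n eq scale_Om[OF l I] by(simp add: nice_def)
 have "Om (alg p) N (%i. cst l * pts p i) M \<subseteq> rat_vecs (alg p) N (%i. cst l * pts p i)"
  by(rule subsetI) (rule iffD2[OF rat_vecs_Om[OF I]], rule exI)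
 hence n': "nice N M (scale_point l P)"
  using I Gr1D(2)[OF p'] Om_submod[OF I, of N "%i. cst l * pts p i" M] frame_scale[OF l dP(7)] frame_scale[OF l dP(8)]
  by(simp add: nice_def Gr1_def scale_point_sel[OF l] eq bP O)
 have c': "comparable (scale_point l p) (scale_point l P)"
  using c by(auto simp: comparable_def scale_point_sel[OF l])
 have e: "map (scale_vec l) (frO P) @ map (scale_vec l) (frE p) = map (scale_vec l) (frO P @ frE p)" by simp
 have "cmat (scale_point l p) (scale_point l P) C"
  using C(1) unfolding cmat_def scale_point_sel[OF l] e scale_vec_lcomb[OF l, symmetric] length_map
  by(simp add: scale_mem[OF l] scale_poly[OF l I] flip: scale_vec_diff[OF l] scale_vec_add[OF l])
 moreover have "scale_vec l ` big p \<subseteq> Om (alg p) N (%i. cst l * pts p i) M1"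
 proof -
  have "scale_vec l ` Om (alg p) N (pts p) M1 = (Om (alg p) N (%i. cst l * pts p i) M1 :: (base fls ^ 'n) set)"
   by(rule scale_Om[OF l I])
  thus ?thesis using image_mono[OF b, of "scale_vec l"] by simp
 qed
 ultimately show ?thesis using n' c' lO M1 C(2) by(auto simp: resolution_def scale_point_sel[OF l])
qed

text \<open>Serves for restriction to a fibre and for replacing a section by a function congruent to
  it.\<close>

lemma sections_restrict:
 assumes s: "s : sections N k Y" and X: "X \<subseteq> Y" "Y \<subseteq> Gr1 N" and t: "!!p. p : X ==> t p - s p : alg p"
 shows "t : sections N k X"
 unfolding sections_def
proof(intro CollectI conjI ballI allI impI)
 fix p p' h assume p: "p : X" "p' : X" and pb: "is_pullback N h p p'"
 have J: "is_ideal (alg p')" using p X Gr1D(1) by blast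
 have h: "ring_map h" "h ` alg p \<subseteq> alg p'" using pb alg_hom_ring_map by(auto simp: is_pullback_def)
 have "h (t p - s p) : alg p'" using t[OF p(1)] h(2) by blast
 hence 1: "h (s p) - h (t p) : alg p'" using cong_sym[OF J] by(simp add: ring_map.diff[OF h(1)])
 have "s p' - h (s p) : alg p'" using sec_pullback[OF s] p X pb by blast
 from cong_trans[OF J t[OF p(2)] cong_trans[OF J this 1]] show "t p' - h (t p) : alg p'" .
next
 fix p p' G H assume p: "p : X" "p' : X" and a: "alg p' = alg p \<and> pts p' = pts p \<and> lat p' = lat p \<and> big p' = big p \<and>
   changes_frame (poly_vecs (alg p)) H (frO p) (frO p') \<and> changes_frame (lat p) G (frE p) (frE p')"
 have J: "is_ideal (alg p)" using p X Gr1D(1) by blast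
 have 0: "s p' * frame_det (length (frE p)) G ^ k - s p * frame_det (length (frO p)) H ^ k : alg p"
  using sec_frame[OF s] p X a by blast
 have "t p' - s p' : alg p" using t[OF p(2)] a by simp
 from ideal_mult2[OF J this] have 1: "t p' * frame_det (length (frE p)) G ^ k - s p' * frame_det (length (frE p)) G ^ k : alg p"
  by(simp add: left_diff_distrib)
 from ideal_mult2[OF J cong_sym[OF J t[OF p(1)]]] have "s p * frame_det (length (frO p)) H ^ k - t p * frame_det (length (frO p)) H ^ k : alg p"
  by(simp add: left_diff_distrib)
 from cong_trans[OF J 1 cong_trans[OF J 0 this]]
 show "t p' * frame_det (length (frE p)) G ^ k - t p * frame_det (length (frO p)) H ^ k : alg p" .
next
 fix p p' q assume p: "p : X" "p' : X" and a: "alg p' = alg p \<and> pts p' = pts p \<and> lat p' = lat p \<and> big p \<subseteq> big p' \<and>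
   frO p' = frO p @ q \<and> frE p' = frE p @ q"
 have J: "is_ideal (alg p)" using p X Gr1D(1) by blast
 have 0: "s p' - s p : alg p" using sec_enlarge[OF s] p X a by blast
 have "t p' - s p' : alg p" using t[OF p(2)] a by simp
 from cong_trans[OF J this cong_trans[OF J 0 cong_sym[OF J t[OF p(1)]]]] show "t p' - t p : alg p" .
qed

lemma scale_point_scale: "l \<noteq> 0 ==> l' \<noteq> 0 ==> scale_point l (scale_point l' p) = scale_point (l * l') p"
proof -
 assume l: "l \<noteq> 0" "l' \<noteq> 0"
 have "scale_vec l (scale_vec l' v) = scale_vec (l * l') v" for v :: "base fls ^ 'a"
  by(simp add: vec_eq_iff scale_vec_nth sc_sc)
 thus ?thesis by(simp add: scale_point_def image_image comp_def cst_simps mult.assoc)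
qed

lemma scale_point_one: "scale_point 1 p = p"
proof -
 have "scale_vec 1 v = v" for v :: "base fls ^ 'a" by(simp add: vec_eq_iff scale_vec_nth sc_one)
 thus ?thesis by(cases p) (simp add: scale_point_def cst_simps map_idI)
qed

section \<open>The weight of the derivative\<close>

context homogeneous_family
begin

text \<open>The universal motion of the scaled point is the scaling of a motion of \<open>P\<close>
  with rescaled parameter. The weight of \<open>s\<close> and the first order expansion of that
  motion yield two expressions for one value, and the coefficients of \<open>Var 0\<close> are
  compared.\<close>

lemma deriv_scale:
 assumes l: "l \<noteq> 0" and n: "nice N M P" and n': "nice N M (scale_point l P)" and m: "m \<le> M"
  and w: "!!p. p : Gr1 N ==> s (scale_point l p) - cst (l powi w) * s p : alg p"
 shows "deriv_coeff (scale_point l P) - cst (l powi (w + int a - int (m * N))) * deriv_coeff P : alg P"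
proof -
 have I: "is_ideal (alg P)" using n Gr1D(1) by(auto simp: nice_def)
 let ?K = "dual_ideal (alg P)" and ?x = "shift o pts P"
 note K = dual_ideal[OF I]
 interpret sh: ring_map shift by(rule ring_map_shift)
 define b where "b = int a - int (m * N)"
 \<comment> \<open>Chosen so that the factor from \<open>sc_fam\<close> turns it back into
   \<open>Var 0\<close>.\<close>
 define e where "e = Var 0 * cst (l powi b)"
 let ?Q = "mv_point e (F ?x) (bc_point shift ?K ?x P)"
 have e2: "e * e : ?K" using ideal_mult2[OF K(1,3), of "cst (l powi b) * cst (l powi b)"] by(simp add: e_def mult_ac)
 have ec: "e * cst (l powi (int (m * N) - int a)) = Var 0"
  using l by(simp add: e_def b_def cst_simps mult.assoc flip: cst_simps(4) power_int_add)
 have x: "shift o pts (scale_point l P) = (%i. cst l * ?x i)"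
  by(simp add: fun_eq_iff scale_point_sel[OF l] sh.mult shift_cst)
 have dp: "dual_point (scale_point l P) = scale_point l ?Q"
 proof -
  have q: "scale_point l ?Q = mv_point (e * cst (l powi (int (m * N) - int a))) (F (%i. cst l * ?x i)) (scale_point l (bc_point shift ?K ?x P))"
   by(rule scale_mv_point[OF l sc_fam[OF l]]) (simp add: K(1))
  show ?thesis unfolding dual_point_def x q ec scale_bc_point[OF K(1) alg_hom_shift l] by(simp add: scale_point_sel[OF l])
 qed
 have nB: "nice N M (bc_point shift ?K ?x P)"
  by(rule nice_bc[OF n K(1) alg_hom_shift K(2)]) (simp add: ideal_zero[OF K(1)])
 have Q: "?Q : Gr1 N" using nice_mv_Gr1[OF nB m, of e] e2 by simp
 have 1: "s (scale_point l ?Q) - cst (l powi w) * s ?Q : ?K" using w[OF Q] by simp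
 have "s ?Q - (shift (s P) + e * shift (deriv_coeff P)) : ?K"
  by(rule deriv_expand[OF n m K(1) alg_hom_shift K(2) _ e2]) (simp add: ideal_zero[OF K(1)])
 from ideal_mult[OF K(1) this, of "cst (l powi w)"]
 have 2: "cst (l powi w) * s ?Q - cst (l powi w) * (shift (s P) + e * shift (deriv_coeff P)) : ?K"
  by(simp add: right_diff_distrib)
 have 3: "s (scale_point l ?Q) - (shift (s (scale_point l P)) + Var 0 * shift (deriv_coeff (scale_point l P))) : ?K"
  using deriv_dual[OF n' m] unfolding dp by(simp add: scale_point_sel[OF l])
 from cong_trans[OF K(1) cong_sym[OF K(1) 3] cong_trans[OF K(1) 1 2]]
 have "shift (s (scale_point l P)) + Var 0 * shift (deriv_coeff (scale_point l P)) -
  cst (l powi w) * (shift (s P) + e * shift (deriv_coeff P)) : ?K" .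
 moreover have "shift (s (scale_point l P)) + Var 0 * shift (deriv_coeff (scale_point l P)) -
  cst (l powi w) * (shift (s P) + e * shift (deriv_coeff P)) =
  shift (s (scale_point l P) - cst (l powi w) * s P) + Var 0 * shift (deriv_coeff (scale_point l P) - cst (l powi w) * cst (l powi b) * deriv_coeff P)"
  by(simp add: e_def sh.diff sh.mult shift_cst algebra_simps)
 ultimately have "deriv_coeff (scale_point l P) - cst (l powi w) * cst (l powi b) * deriv_coeff P : alg P"
  using K(4) by simp
 moreover have "cst (l powi w) * cst (l powi b) = cst (l powi (w + int a - int (m * N)))"
  using l by(simp add: b_def algebra_simps flip: cst_simps(4) power_int_add)
 ultimately show ?thesis by simp
qed

lemma deriv_sec_scale:
 assumes N: "N > 0" and l: "l \<noteq> 0" and p: "p : Gr1 N" and p': "scale_point l p : Gr1 N"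
  and w: "!!p. p : Gr1 N ==> s (scale_point l p) - cst (l powi w) * s p : alg p"
 shows "deriv_sec (scale_point l p) - cst (l powi (w + int a - int (m * N))) * deriv_sec p : alg p"
proof -
 note I = Gr1D(1)[OF p]
 let ?c = "cst (l powi (w + int a - int (m * N)))"
 obtain M1 M P D where m: "m \<le> M" and r: "resolution N M1 M p P D" using resolution_large[OF N p] by blast
 note r' = resolution_scale[OF l p p' r]
 have n: "nice N M P" "nice N M (scale_point l P)" "alg P = alg p"
  using r r' by(auto simp: resolution_def comparable_def)
 have 1: "deriv_sec (scale_point l p) - D ^ k * deriv_coeff (scale_point l P) : alg p"
  using deriv_sec_eq[OF N p' m r'] by(simp add: scale_point_sel[OF l])
 from ideal_mult[OF I deriv_scale[OF l n(1,2) m w, unfolded n(3)], of "D ^ k"]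
 have 2: "D ^ k * deriv_coeff (scale_point l P) - ?c * (D ^ k * deriv_coeff P) : alg p"
  by(simp add: right_diff_distrib mult.left_commute)
 from ideal_mult[OF I cong_sym[OF I deriv_sec_eq[OF N p m r]], of ?c]
 have "?c * (D ^ k * deriv_coeff P) - ?c * deriv_sec p : alg p" by(simp add: right_diff_distrib)
 from cong_trans[OF I 1 cong_trans[OF I 2 this]] show ?thesis .
qed

text \<open>
 The derivative has smaller weight than \<open>s\<close>, hence vanishes. As it is not clear from the definitions that
 scaling preserves \<^term>\<open>Gr1 N\<close>, it is first modified outside of \<^term>\<open>Gr1 N\<close>.
\<close>

lemma deriv_sec_zero:
 assumes N: "N > 0" and a: "a < m * N" and w: "is_smallest_weight TYPE('n) N k w" "s : weight_space N k w" and p: "p : Gr1 N"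
 shows "deriv_sec p : alg p"
proof -
 define v where "v = w + int a - int (m * N)"
 have sw: "!!p. p : Gr1 N ==> s (scale_point l p) - cst (l powi w) * s p : alg p" if "l \<noteq> 0" for l
  using w(2) that by(simp add: weight_space_def)
 have scale: "deriv_sec (scale_point l p) - cst (l powi v) * deriv_sec p : alg p"
  if "l \<noteq> 0" "p : Gr1 N" "scale_point l p : Gr1 N" for l p
  unfolding v_def by(rule deriv_sec_scale[OF N that sw[OF that(1)]])
 \<comment> \<open>For \<open>q\<close> in the orbit of a point \<open>p'\<close> of
   \<open>Gr1 N\<close>, homogeneity prescribes the value of \<open>t\<close> at \<open>q\<close>.
   The chosen presentation does not matter on \<open>Gr1 N\<close>, and scaled points have one by
   construction.\<close>
 define rep where "rep q z \<longleftrightarrow> fst z \<noteq> 0 \<and> snd z : Gr1 N \<and> q = scale_point (fst z) (snd z)" for q :: "'n framed_point" and z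
 define t where "t q = (let z = SOME z. rep q z in cst (fst z powi v) * deriv_sec (snd z))" for q
 have rep: "EX l p'. l \<noteq> 0 \<and> p' : Gr1 N \<and> scale_point l' q = scale_point l p' \<and> t (scale_point l' q) = cst (l powi v) * deriv_sec p'"
  if "q : Gr1 N" "l' \<noteq> 0" for q l'
 proof -
  have "rep (scale_point l' q) (l', q)" using that by(simp add: rep_def)
  hence "rep (scale_point l' q) (SOME z. rep (scale_point l' q) z)" by(rule someI)
  thus ?thesis unfolding rep_def t_def Let_def by blast
 qed
 have t: "t q - deriv_sec q : alg q" if q: "q : Gr1 N" for q
 proof -
  obtain l p' where l: "l \<noteq> 0" "p' : Gr1 N" "q = scale_point l p'" "t q = cst (l powi v) * deriv_sec p'"
   using rep[OF q, of 1] by(auto simp: scale_point_one)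
  have "deriv_sec q - t q : alg p'" using scale[OF l(1,2)] q l(3,4) by simp
  hence "deriv_sec q - t q : alg q" using l(3) by(simp add: scale_point_sel[OF l(1)])
  thus ?thesis by(rule cong_sym[OF Gr1D(1)[OF q]])
 qed
 have "t : weight_space N k v" unfolding weight_space_def
 proof(intro CollectI conjI allI impI)
  show "t : sections N k (Gr1 N)" using t by(intro sections_restrict[OF deriv_sec_section[OF N]]) auto
  fix l' :: complex and q :: "'n framed_point" assume a: "l' \<noteq> 0 \<and> q : Gr1 N"
  note I = Gr1D(1)[OF conjunct2[OF a]]
  obtain l p' where l: "l \<noteq> 0" "p' : Gr1 N" "scale_point l' q = scale_point l p'" "t (scale_point l' q) = cst (l powi v) * deriv_sec p'"
   using rep[of q l'] a by auto
  have "p' = scale_point (1 / l) (scale_point l p')" using l(1) by(simp add: scale_point_scale scale_point_one)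
  also have "\<dots> = scale_point (l' / l) q"
   unfolding l(3)[symmetric] using scale_point_scale[of "1 / l" l' q] a l(1) by simp
  finally have p': "p' = scale_point (l' / l) q" .
  have "deriv_sec p' - cst ((l' / l) powi v) * deriv_sec q : alg q"
   unfolding p' by(rule scale) (use a l(1) l(2)[unfolded p'] in auto)
  from ideal_mult[OF I this, of "cst (l powi v)"]
  have 1: "t (scale_point l' q) - cst (l powi v) * cst ((l' / l) powi v) * deriv_sec q : alg q"
   by(simp add: l(4) right_diff_distrib mult.assoc)
  have "cst (l powi v) * cst ((l' / l) powi v) = cst (l' powi v)"
   using l(1) by(simp flip: cst_simps(4) power_int_mult_distrib)
  from cong_trans[OF I 1[unfolded this]] ideal_mult[OF I cong_sym[OF I t[OF conjunct2[OF a]]], of "cst (l' powi v)"]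
  show "t (scale_point l' q) - cst (l' powi v) * t q : alg q" by(simp add: right_diff_distrib)
 qed
 moreover have "v < w" using a by(simp add: v_def flip: of_nat_mult)
 ultimately have "t p : alg p" using w(1) p unfolding is_smallest_weight_def zero_section_def by blast
 thus ?thesis using cong_sym[OF Gr1D(1)[OF p] t[OF p]] ideal_cong[OF Gr1D(1)[OF p]] by blast
qed

text \<open>After enlargement to the pole order of a resolution, \<open>p\<close> becomes an
  extension to which \<open>deriv_resolution\<close> applies. The length condition is what makes the
  two points comparable.\<close>

lemma deriv_sec_nice:
 assumes N: "N > 0" and n: "nice N M p" and m: "m \<le> M" and len: "length (frO p) = M * (N * CARD('n))"
 shows "deriv_sec p - deriv_coeff p : alg p"
proof -
 have p: "p : Gr1 N" using n by(simp add: nice_def)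
 note I = Gr1D(1)[OF p]
 obtain M1 M' P D where m': "m \<le> M'" and M': "M1 + length (frO p) + M \<le> M'" and r: "resolution N M1 M' p P D"
  using resolution_large[OF N p] by blast
 have MM: "M \<le> M'" using M' by simp
 obtain q :: "(base fls ^ 'n) list" where q: "frame (alg p) (Om (alg p) N (pts p) (M + (M' - M))) (Om (alg p) N (pts p) M) q"
  "length q = (M' - M) * (N * CARD('n))"
  using frame_Om[OF I, where M = M and d = "M' - M" and N = N and x = "pts p" and 'n = 'n] by blast
 have q1: "frame (alg p) (Om (alg p) N (pts p) M') (big p) q" using q(1) n MM by(simp add: nice_def)
 have q2: "length (frO p) + length q = M' * (N * CARD('n))"
  unfolding len q(2) add_mult_distrib[symmetric] using MM by simp
 have b: "big p \<subseteq> Om (alg p) N (pts p) M'" using q1 by(simp add: frame_iff)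
 have "deriv_coeff (extend N M' q p) - deriv_coeff p : alg p"
  by(rule deriv_enlarge[OF n m nice_extend[OF p q1] m', where q = q]) (simp_all add: b)
 from cong_trans[OF I deriv_sec_eq[OF N p m' r] cong_trans[OF I deriv_resolution[OF p r m' q1 q2] this]]
 show ?thesis .
qed

end

section \<open>Invariance under rational matrices vanishing at infinity\<close>

lemma movable_pullback:
 fixes p :: "'n::finite framed_point"
 assumes I: "is_ideal (alg p)" and J: "is_ideal J" and h: "ring_map h" "h ` alg p \<subseteq> J" and m: "movable e F p"
 shows "movable (h e) (mmap h F) (bc_point h J x p)"
proof -
 interpret h: ring_map h by(rule h(1))
 let ?S = "{w. h e *c (mmap h F *v w) : base_change h J (big p)}"
 note cb = base_change_csub[OF J, of h "big p"]
 have "h e *c (mmap h F *v (c *c v)) = c *c (h e *c (mmap h F *v v))" for c v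
  by(simp add: smult_mv smult_assoc mult.commute)
 moreover have "van J \<subseteq> ?S" using csub_van[OF cb van_smult[OF J van_mv[OF J]]] by blast
 ultimately have "csub J ?S" unfolding csub_def
  using csub_add[OF cb] csub_smult[OF cb] J by(simp add: mv_add smult_add)
 moreover have "vmap h u : ?S" if "u : poly_vecs (alg p)" for u
  using m that base_change_mem[OF J, of "e *c (F *v u)" "big p" h]
  by(simp add: movable_def h.vmap_smult h.vmap_mv h.map_const)
 ultimately have "base_change h J (poly_vecs (alg p)) \<subseteq> ?S" by(rule base_change_least)
 thus ?thesis by(auto simp: movable_def base_change_poly_vecs[OF J I h])
qed

text \<open>Locally \<open>p\<close> is enlarged to a nice point. By
  \<open>mv_point_enlarge\<close>, motion commutes with the enlargement as far as \<open>s\<close>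
  can see, so invariance there descends to \<open>p\<close>. The family \<open>X\<close> has to be
  natural in order to be carried along the localization.\<close>

lemma nice_invariance:
 fixes p :: "'n::finite framed_point"
 assumes N: "N > 0" and s: "s : sections N k (Gr1 N)"
  and nat: "!!h x. alg_hom cst h ==> mmap h (X x) = X (h o x)" and rat: "!!I x. is_ideal I ==> ratmat I N x (X x)"
  and inv: "!!M (q :: 'n framed_point) e. nice N M q ==> m \<le> M ==> length (frO q) = M * (N * CARD('n)) ==> e * e : alg q ==>
   s (mv_point e (X (pts q)) q) - s q : alg q"
  and p: "p : Gr1 N" and e: "e * e : alg p" and mov: "movable e (X (pts p)) p"
 shows "s (mv_point e (X (pts p)) p) - s p : alg p"
proof -
 note d = Gr1D[OF p]
 obtain M1 where M1: "big p \<subseteq> Om (alg p) N (pts p) M1" using frame_bounded[OF d(1,7,6)] by blast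
 define M where "M = max m (M1 + length (frO p))"
 show ?thesis
 proof(rule localize_extension[OF N p M1])
  fix h J assume l: "is_loc (alg p) h J" and p': "bc_point h J (h o pts p) p : Gr1 N"
   and ex: "!!M. M1 + length (frO p) \<le> M ==> EX q. frame J (Om J N (h o pts p) M) (base_change h J (big p)) q \<and>
    length (frO p) + length q = M * (N * CARD('n))"
  have J: "is_ideal J" and h: "alg_hom cst h" "h ` alg p \<subseteq> J" using l by(auto simp: is_loc_def)
  have rh: "ring_map h" by(rule alg_hom_ring_map[OF h(1)])
  interpret h: ring_map h by(rule rh)
  let ?x = "h o pts p" and ?p = "bc_point h J (h o pts p) p" and ?e = "h e"
  have x: "?x i - h (pts p i) : J" for i by(simp add: ideal_zero[OF J])
  have e': "?e * ?e : J" using h(2) e by(auto simp flip: h.mult)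
  have mov': "movable ?e (X ?x) ?p" using movable_pullback[OF d(1) J rh h(2) mov] by(simp only: nat[OF h(1)])
  obtain q where q: "frame J (Om J N ?x M) (base_change h J (big p)) q" "length (frO p) + length q = M * (N * CARD('n))"
   using ex[of M] by(auto simp: M_def)
  let ?q = "extend N M q ?p"
  have n: "nice N M ?q" by(rule nice_extend[OF p']) (simp only: bc_point_sel q(1))
  hence q': "?q : Gr1 N" by(simp add: nice_def)
  have 1: "s (mv_point ?e (X ?x) ?q) - s ?q : J"
   using inv[OF n, of ?e] e' q(2) by(simp add: M_def)
  have b: "big ?p \<subseteq> big ?q" using q(1) by(simp add: frame_iff)
  have 2: "s (mv_point ?e (X ?x) ?q) - s (mv_point ?e (X ?x) ?p) : J"
   using mv_point_enlarge[OF s p' q' _ _ _ b, of q ?e "X ?x"] e' rat[OF J] mov' by simp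
  have 3: "s ?q - s ?p : J" using sec_enlarge[OF s p' q' _ _ _ b, of q] by simp
  have 4: "s (mv_point ?e (X ?x) ?p) - h (s (mv_point e (X (pts p)) p)) : J"
  proof -
   have "is_pullback N h (mv_point e (X (pts p)) p) (mv_point ?e (X ?x) ?p)"
    by(rule mv_point_pullback[OF p e rat[OF d(1)] J h x]) (simp_all add: nat[OF h(1)] ideal_zero[OF cof_ideal[OF J]])
   from sec_pullback[OF s mv_point_Gr1[OF p e rat[OF d(1)] mov] mv_point_Gr1[OF p' _ _ mov'] this]
   show ?thesis using e' rat[OF J] by simp
  qed
  have 5: "s ?p - h (s p) : J"
   using sec_pullback[OF s p p' bc_point_pullback[OF p J h x]] by(simp only: bc_point_sel)
  have 6: "s (mv_point ?e (X ?x) ?p) - s ?p : J"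
   by(rule cong_trans[OF J cong_sym[OF J 2] cong_trans[OF J 1 3]])
  from cong_trans[OF J cong_sym[OF J 4] cong_trans[OF J 6 5]]
  show "h (s (mv_point e (X (pts p)) p) - s p) : J" by(simp only: h.diff)
 qed
qed

lemma (in homogeneous_family) invariance:
 assumes N: "N > 0" and a: "a < m * N" and w: "is_smallest_weight TYPE('n) N k w" "s : weight_space N k w"
  and p: "p : Gr1 N" and e: "e * e : alg p" and mov: "movable e (F (pts p)) p"
 shows "s (mv_point e (F (pts p)) p) - s p : alg p"
proof(rule nice_invariance[where X = F, OF N sec mmap_fam ratmat_fam _ p e mov])
 fix M e and q :: "'n framed_point"
 assume n: "nice N M q" and m: "m \<le> M" and len: "length (frO q) = M * (N * CARD('n))" and e: "e * e : alg q"
 have q: "q : Gr1 N" using n by(simp add: nice_def)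
 note I = Gr1D(1)[OF q]
 have "s (mv_point e (F (pts q)) (bc_point (%a. a) (alg q) (pts q) q)) - (s q + e * deriv_coeff q) : alg q"
  using deriv_expand[OF n m I _ _ _ e, of "%a. a" "pts q"] by(simp add: alg_hom_def ideal_zero[OF I])
 hence 1: "s (mv_point e (F (pts q)) q) - (s q + e * deriv_coeff q) : alg q" by(simp only: bc_point_id[OF q])
 have "deriv_coeff q : alg q"
  using ideal_eq_zeroI[OF I deriv_sec_zero[OF N a w q] cong_sym[OF I deriv_sec_nice[OF N n m len]]] .
 from ideal_add[OF I 1 ideal_mult[OF I this, of e]] show "s (mv_point e (F (pts q)) q) - s q : alg q" by simp
qed

section \<open>Sums of homogeneous families\<close>

lemma mvset_comp:
 assumes I: "is_ideal I" and g2: "linmap I g2" and g: "!!v. g2 (g1 v) - g v : van I"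
 shows "mvset I g2 (mvset I g1 A) = mvset I g A"
proof(intro equalityI subsetI)
 fix v assume "v : mvset I g2 (mvset I g1 A)"
 then obtain u w where u: "u : A" "w - g1 u : van I" "v - g2 w : van I" by(auto simp: mvset_def)
 have "g2 (w - g1 u) : van I" using u(2) g2 by(simp add: linmap_def)
 hence "g2 w - g2 (g1 u) : van I" by(simp only: linmap_diff[OF g2])
 from van_trans[OF I u(3) van_trans[OF I this g]] show "v : mvset I g A" using u(1) by(auto simp: mvset_def)
next
 fix v assume "v : mvset I g A"
 then obtain u where u: "u : A" "v - g u : van I" by(auto simp: mvset_def)
 have "g1 u - g1 u : van I" by(simp add: van_zero[OF I])
 hence "g1 u : mvset I g1 A" using u(1) unfolding mvset_def by blast
 moreover have "v - g2 (g1 u) : van I" by(rule van_trans[OF I u(2) van_sym[OF I g]])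
 ultimately show "v : mvset I g2 (mvset I g1 A)" unfolding mvset_def by blast
qed

text \<open>To first order motions add up: the product of 1 + e F2 and 1 + e F1 is 1 + e (F1 + F2),
  as \<open>e\<close> has square zero. The frames of both results are congruent, so \<open>s\<close>
  takes congruent values.\<close>

lemma mv_point_comp:
 fixes p :: "'n::finite framed_point"
 assumes s: "s : sections N k (Gr1 N)" and p: "p : Gr1 N" and e: "e * e : alg p"
  and F: "ratmat (alg p) N (pts p) F1" "ratmat (alg p) N (pts p) F2" "ratmat (alg p) N (pts p) (F1 + F2)"
  and m: "movable e F1 p" "movable e F2 p"
 shows "movable e F2 (mv_point e F1 p)" "movable e (F1 + F2) p"
  "s (mv_point e F2 (mv_point e F1 p)) - s (mv_point e (F1 + F2) p) : alg p"
proof -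
 note d = Gr1D[OF p]
 have v2: "e *c (A *v (e *c w)) : van (alg p)" for A :: "base fls ^ 'n ^ 'n" and w
  using van_sq[OF d(1) e] by(simp add: smult_mv)
 note lg = linmap_gact[OF d(1) e]
 show m2: "movable e F2 (mv_point e F1 p)"
  unfolding movable_def mv_point_sel
 proof
  fix w :: "base fls ^ 'n" assume "w : poly_vecs (alg p)"
  hence 1: "e *c (F2 *v w) : big p" using m(2) by(simp add: movable_def)
  have "e *c (F2 *v w) - gact e F1 (e *c (F2 *v w)) : van (alg p)"
   using van_uminus[OF d(1) v2[of F1 "F2 *v w"]] by(simp add: gact_def)
  thus "e *c (F2 *v w) : mvset (alg p) (gact e F1) (big p)" using 1 by(auto simp: mvset_def)
 qed
 show m12: "movable e (F1 + F2) p"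
  using m csub_add[OF d(9)] by(simp add: movable_def add_mv smult_add)
 have g: "gact e F2 (gact e F1 v) - gact e (F1 + F2) v : van (alg p)" for v :: "base fls ^ 'n"
  using v2[of F2 "F1 *v v"]
  by(simp add: gact_def add_mv mv_add smult_add)
 have n: "nact e F2 (nact e F1 v) - nact e (F1 + F2) v : van (alg p)" for v :: "base fls ^ 'n"
  using vfpart_van[OF d(1) v2[of F2 "vfpart (F1 *v vfpart v)"]]
  by(simp add: nact_def add_mv mv_add smult_add vfpart_add vfpart_smult vfpart_idem)
 have p1: "mv_point e F1 p : Gr1 N" by(rule mv_point_Gr1[OF p e F(1) m(1)])
 have c: "mvset (alg p) (gact e F2) (mvset (alg p) (gact e F1) A) = mvset (alg p) (gact e (F1 + F2)) A" for A :: "(base fls ^ 'n) set"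
  by(rule mvset_comp[OF d(1) lg g])
 have cl: "csub (alg p) (mvset (alg p) (gact e (F1 + F2)) (lat p))" by(rule mvset_csub[OF lg d(10)])
 let ?p = "mv_point e (F1 + F2) p" and ?q = "mv_point e F2 (mv_point e F1 p)"
 have q: "?q : Gr1 N" by(rule mv_point_Gr1[OF p1 _ _ m2]) (simp_all add: e F)
 have O: "frO ?q ! a - frO ?p ! a : poly_vecs (alg ?p)" if "a < length (frO ?p)" for a
  using csub_van[OF polyvecs_csub[OF d(1)] n] that by simp
 have E: "frE ?q ! a - frE ?p ! a : lat ?p" if "a < length (frE ?p)" for a
  using csub_van[OF cl g] that by simp
 have "s ?q - s ?p : alg ?p"
  by(rule sec_same[OF s mv_point_Gr1[OF p e F(3) m12] q _ _ _ _ _ O _ E]) (simp_all add: c)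
 thus "s ?q - s ?p : alg p" by simp
qed

lemma fam_sum_nth: "(\<Sum>a<L. fam N m a (Y a) x) $ i $ j = (\<Sum>a<L. fam N m a (Y a) x $ i $ j)"
 by(simp add: sum_component)

lemma ratmat_fam_sum: "is_ideal I ==> ratmat I N x (\<Sum>a<L. fam N m a (Y a) x)"
 unfolding ratmat_def fam_sum_nth sum_distrib_left
 by(intro exI[of _ m] allI polyfuns_sum fam_poly)

lemma mmap_fam_sum:
 assumes "alg_hom cst h" shows "mmap h (\<Sum>a<L. fam N m a (Y a) x) = (\<Sum>a<L. fam N m a (Y a) (h o x))"
proof -
 have rh: "ring_map h" by(rule alg_hom_ring_map[OF assms])
 have "fls_map h (fam N m a (Y a) x $ i $ j) = fam N m a (Y a) (h o x) $ i $ j" for a i j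
  unfolding mmap_fam[OF assms, symmetric] by(simp add: mmap_def)
 thus ?thesis
  by(simp add: mmap_def vec_eq_iff fam_sum_nth ring_map.sum[OF ring_map.ring_map_fls[OF rh]])
qed

text \<open>At \<open>p\<close> the sum alone is known to be movable, not its summands, so they
  cannot be applied in turn. After the reduction to nice points of large pole order each summand is
  movable, and induction on the number of summands works.\<close>

lemma fam_sum_invariance:
 fixes p :: "'n::finite framed_point"
 assumes N: "N > 0" and s: "s : sections N k (Gr1 N)" and L: "L \<le> m * N"
  and w: "is_smallest_weight TYPE('n) N k w" "s : weight_space N k w"
  and p: "p : Gr1 N" and e: "e * e : alg p" and mov: "movable e (\<Sum>a<L. fam N m a (Y a) (pts p)) p"
 shows "s (mv_point e (\<Sum>a<L. fam N m a (Y a) (pts p)) p) - s p : alg p"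
proof(rule nice_invariance[where X = "%x. \<Sum>a<L. fam N m a (Y a) x", OF N s mmap_fam_sum ratmat_fam_sum _ p e mov])
 fix M e and q :: "'n framed_point"
 assume n: "nice N M q" and m: "m \<le> M" and e: "e * e : alg q"
 have q: "q : Gr1 N" using n by(simp add: nice_def)
 note d = Gr1D[OF q]
 let ?F = "%a. fam N m a (Y a) (pts q)"
 have "movable e (\<Sum>a<K. ?F a) q \<and> s (mv_point e (\<Sum>a<K. ?F a) q) - s q : alg q" if "K \<le> m * N" for K
  using that
 proof(induction K)
  case 0
  have "movable e 0 q" using csub_zero[OF d(9)] by(simp add: movable_def)
  moreover have "mv_point e 0 q = q"
  proof -
   have "vfpart (0 :: base fls ^ 'n) = 0" using vfpart_diff[of 0 0] by simp
   hence g: "gact e 0 v = v" "nact e 0 v = v" for v :: "base fls ^ 'n" by(simp_all add: gact_def nact_def)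
   have "mvset (alg q) (gact e 0) A = A" if A: "csub (alg q) A" for A :: "(base fls ^ 'n) set"
   proof(intro subset_antisym subsetI)
    fix v assume "v : A"
    moreover have "v - v : van (alg q)" by(simp add: van_zero[OF d(1)])
    ultimately show "v : mvset (alg q) (gact e 0) A" unfolding mvset_def g by blast
   qed (use csub_cong[OF A csub_van[OF A]] in \<open>auto simp: mvset_def g\<close>)
   from this[OF d(9)] this[OF d(10)] show ?thesis by(cases q) (simp add: mv_point_def g map_idI)
  qed
  ultimately show ?case by(simp add: ideal_zero[OF d(1)])
 next
  case (Suc K)
  let ?S = "\<Sum>a<K. ?F a"
  have IH: "movable e ?S q" "s (mv_point e ?S q) - s q : alg q" using Suc by auto
  have mK: "movable e (?F K) q" by(rule nice_movable[OF n m])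
  have r: "ratmat (alg q) N (pts q) (?S + ?F K)" using ratmat_fam_sum[OF d(1), where L = "Suc K"] by simp
  note c = mv_point_comp[OF s q e ratmat_fam_sum[OF d(1)] ratmat_fam[OF d(1)] r IH(1) mK]
  have q1: "mv_point e ?S q : Gr1 N" by(rule mv_point_Gr1[OF q e ratmat_fam_sum[OF d(1)] IH(1)])
  interpret homogeneous_family N k s m K "Y K" by unfold_locales (rule s)
  have "s (mv_point e (?F K) (mv_point e ?S q)) - s (mv_point e ?S q) : alg q"
   using invariance[OF N _ w q1, of e] Suc.prems e c(1) by simp
  from cong_trans[OF d(1) cong_sym[OF d(1) c(3)] cong_trans[OF d(1) this IH(2)]] c(2)
  show ?case by simp
 qed
 thus "s (mv_point e (\<Sum>a<L. ?F a) q) - s q : alg q" using L by blast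
qed

section \<open>Laurent expansions\<close>

definition pev :: "'a::comm_ring_1 fls => 'a poly => 'a fls" where
 "pev w P = poly (map_poly fls_const P) w"

lemma ring_map_pev: "ring_map (pev w)"
proof -
 have "ring_map (fls_const :: 'a::comm_ring_1 => 'a fls)" by(simp add: ring_map_def fls_const_add)
 from ring_map_comp[OF ring_map_poly ring_map_map_poly[OF this]] show ?thesis unfolding pev_def .
qed

interpretation pev: ring_map "pev w" for w by(rule ring_map_pev)

lemma pev_pCons: "pev w (pCons a P) = fls_const a + w * pev w P"
 by(simp add: pev_def map_poly_pCons)

lemma pev_0: "pev w 0 = 0" by(simp add: pev_def)

lemma pev_pcompose: "pev w (pcompose P Q) = pev (pev w Q) P"
 by(induction P) (simp_all add: pcompose_pCons pev.add pev.mult pev_pCons pev_0)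

lemma pev_cof: "is_ideal I ==> (!!k. coeff P k : I) ==> pev w P : cof I"
proof(induction P)
 case (pCons a P)
 have "a : I" "!!k. coeff P k : I" using pCons.prems(2)[of 0] pCons.prems(2)[of "Suc k" for k] by auto
 thus ?case using pCons by(simp add: pev_pCons ideal_add[OF cof_ideal] ideal_mult[OF cof_ideal] cof_const)
qed (simp add: pev_0 ideal_zero[OF cof_ideal])

lemma pev_X_nth: "fls_nth (pev fls_X P) j = (if j < 0 then 0 else coeff P (nat j))"
proof(induction P arbitrary: j)
 case (pCons a P)
 show ?case
 proof(cases "j \<le> 0")
  case False
  hence "nat j = Suc (nat (j - 1))" by simp
  thus ?thesis using False by(simp add: pev_pCons fls_X_times_conv_shift pCons.IH)
 qed (auto simp: pev_pCons fls_X_times_conv_shift pCons.IH)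
qed (simp add: pev_0)

lemma pev_polyfuns: "is_ideal I ==> w : polyfuns I ==> pev w P : polyfuns I"
 by(induction P) (auto simp: pev_pCons pev_0 intro!: polyfuns_zero polyfuns_add polyfuns_mult polyfuns_const)

lemma fls_map_pev: assumes "ring_map h" shows "fls_map h (pev w P) = pev (fls_map h w) (map_poly h P)"
proof -
 interpret h: ring_map h by(rule assms)
 interpret fh: ring_map "fls_map h" by(rule h.ring_map_fls)
 show ?thesis by(induction P) (simp_all add: pev_pCons pev_0 map_poly_pCons h.zero fh.zero fh.add fh.mult h.map_const)
qed

definition dpoly :: "nat => (nat => 'a::comm_ring_1) => 'a poly" where
 "dpoly N x = (\<Prod>i<N. [:- x i, 1:])"

lemma pev_dpoly: "pev fls_X_inv (dpoly N x) = divisor_eq N x"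
 "pev (fls_X + fls_const c) (dpoly N x) = (\<Prod>i<N. fls_X + fls_const (c - x i))"
proof -
 have *: "pev w [:- a, 1:] = w - fls_const a" for w and a :: 'a
  by(simp add: pev_pCons pev_0 fls_const_minus)
 show "pev fls_X_inv (dpoly N x) = divisor_eq N x"
  by(simp add: dpoly_def divisor_eq_def pev.prod *)
 show "pev (fls_X + fls_const c) (dpoly N x) = (\<Prod>i<N. fls_X + fls_const (c - x i))"
  by(simp add: dpoly_def pev.prod * fls_const_diff algebra_simps)
qed

text \<open>An expansion evaluates one numerator and one denominator at two series, z at infinity
  and t + c at the point \<open>c\<close>. Rules for expansions then follow from \<open>pev\<close>
  being a ring map.\<close>

lemma expands_iff: "expands I N x c F L \<longleftrightarrow> (EX m P. pev fls_X_inv (dpoly N x) ^ m * F - pev fls_X_inv P : cof I \<and>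
  pev (fls_X + fls_const c) (dpoly N x) ^ m * L - pev (fls_X + fls_const c) P : cof I)"
 unfolding expands_def pev_dpoly unfolding pev_def cof_def mem_Collect_eq ..

context
 fixes I :: "'a::comm_ring_1 set" and N :: nat and x :: "nat => 'a" and c :: 'a
 assumes I: "is_ideal I"
begin

lemmas cI = cof_ideal[OF I]

abbreviation "expd \<equiv> expands I N x c"

lemma expands_witness:
 assumes "expd F L"
 shows "EX m P. (ALL n. pev fls_X_inv (dpoly N x) ^ (m + n) * F - pev fls_X_inv (dpoly N x ^ n * P) : cof I) \<and>
  (ALL n. pev (fls_X + fls_const c) (dpoly N x) ^ (m + n) * L - pev (fls_X + fls_const c) (dpoly N x ^ n * P) : cof I)"
proof -
 have *: "pev w d ^ (m + n) * F - pev w (d ^ n * P) : cof I" if "pev w d ^ m * F - pev w P : cof I"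
  for w d m n F P
  using ideal_mult[OF cI that, of "pev w d ^ n"] by(simp add: pev.mult pev.power power_add algebra_simps)
 obtain m P where "pev fls_X_inv (dpoly N x) ^ m * F - pev fls_X_inv P : cof I"
  "pev (fls_X + fls_const c) (dpoly N x) ^ m * L - pev (fls_X + fls_const c) P : cof I"
  using assms unfolding expands_iff by blast
 from *[OF this(1)] *[OF this(2)] show ?thesis by(intro exI conjI allI)
qed

lemma expands_cong: "expd F L ==> F - F' : cof I ==> L - L' : cof I ==> expd F' L'"
proof -
 assume a: "expd F L" "F - F' : cof I" "L - L' : cof I"
 have *: "A * F' - C : cof I" if "A * F - C : cof I" "F - F' : cof I" for A C F F'
  using ideal_diff[OF cI that(1) ideal_mult[OF cI that(2), of A]] by(simp add: algebra_simps)
 show "expd F' L'" using a * unfolding expands_iff by meson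
qed

lemma expands_add: assumes "expd F L" "expd F' L'" shows "expd (F + F') (L + L')"
proof -
 let ?d = "dpoly N x" and ?a = "fls_X_inv :: 'a fls" and ?b = "fls_X + fls_const c"
 from expands_witness[OF assms(1)] obtain m P where
  P: "ALL n. pev ?a ?d ^ (m + n) * F - pev ?a (?d ^ n * P) : cof I" "ALL n. pev ?b ?d ^ (m + n) * L - pev ?b (?d ^ n * P) : cof I"
  by(elim exE conjE)
 from expands_witness[OF assms(2)] obtain m' P' where
  P': "ALL n. pev ?a ?d ^ (m' + n) * F' - pev ?a (?d ^ n * P') : cof I" "ALL n. pev ?b ?d ^ (m' + n) * L' - pev ?b (?d ^ n * P') : cof I"
  by(elim exE conjE)
 have *: "pev w ?d ^ (m + m') * (G + G') - pev w (?d ^ m' * P + ?d ^ m * P') : cof I"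
  if "pev w ?d ^ (m + m') * G - pev w (?d ^ m' * P) : cof I" "pev w ?d ^ (m' + m) * G' - pev w (?d ^ m * P') : cof I" for w G G'
  using ideal_add[OF cI that] by(simp add: pev.add algebra_simps)
 show ?thesis unfolding expands_iff 
  using *[OF P(1)[rule_format] P'(1)[rule_format]] *[OF P(2)[rule_format] P'(2)[rule_format]] by(intro exI conjI)
qed

lemma expands_mult: assumes "expd F L" "expd F' L'" shows "expd (F * F') (L * L')"
proof -
 have *: "A ^ (m + m') * (G * G') - pev w (P * P') : cof I"
  if "A ^ m * G - pev w P : cof I" "A ^ m' * G' - pev w P' : cof I" for A m m' G G' w P P'
  using cong_mult[OF cI that] by(simp add: pev.mult power_add mult_ac)
 obtain m P m' P' where "pev fls_X_inv (dpoly N x) ^ m * F - pev fls_X_inv P : cof I"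
  "pev (fls_X + fls_const c) (dpoly N x) ^ m * L - pev (fls_X + fls_const c) P : cof I"
  "pev fls_X_inv (dpoly N x) ^ m' * F' - pev fls_X_inv P' : cof I"
  "pev (fls_X + fls_const c) (dpoly N x) ^ m' * L' - pev (fls_X + fls_const c) P' : cof I"
  using assms unfolding expands_iff by blast
 from *[OF this(1,3)] *[OF this(2,4)] show ?thesis unfolding expands_iff by(intro exI conjI)
qed

lemma expands_const: "expd (fls_const a) (fls_const a)"
 unfolding expands_iff by(intro exI[of _ 0] exI[of _ "[:a:]"]) (simp add: pev_pCons pev_0 ideal_zero[OF cI])

lemma expands_sum: "finite A ==> (!!j. j : A ==> expd (F j) (L j)) ==> expd (sum F A) (sum L A)"
 by(induction A rule: finite_induct) (use expands_const[of 0] expands_add in auto)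

lemma expands_diff: "expd F L ==> expd F' L' ==> expd (F - F') (L - L')"
 using expands_add[of F L "fls_const (- 1) * F'" "fls_const (- 1) * L'"] expands_mult[OF expands_const, of F' L' "- 1"]
 by(simp add: fls_const_minus)

lemma expands_power: "expd F L ==> expd (F ^ n) (L ^ n)"
 by(induction n) (use expands_const[of 1] expands_mult in auto)

end

locale constant_points =
 fixes I :: "base set" and N l :: nat and x :: "nat => base" and b y :: "nat => complex"
 assumes I: "is_ideal I" and xb: "j < N ==> x j - cst (b j) : I" and inj: "inj_on y {..<l}"
  and bl: "j < N ==> EX i<l. b j = y i" and yb: "i < l ==> EX j<N. b j = y i"
begin

abbreviation lin :: "complex => base poly" where "lin c \<equiv> [:- cst c, 1:]"
abbreviation Z :: "nat => base fls" where "Z i \<equiv> pev fls_X_inv (lin (y i))"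
abbreviation loc :: "nat => base fls" where "loc i \<equiv> fls_X + fls_const (cst (y i))"

lemmas cI = cof_ideal[OF I]

lemma pev_lin: "pev w (lin c) = w - fls_const (cst c)"
 by(simp add: pev_pCons pev_0 fls_const_minus)

lemma dpoly_cong: "pev w (dpoly N x) - pev w (\<Prod>j<N. lin (b j)) : cof I"
proof -
 have "pev w [:- x j, 1:] - pev w (lin (b j)) : cof I" if "j < N" for j
 proof -
  have "pev w [:- x j, 1:] - pev w (lin (b j)) = - fls_const (x j - cst (b j))"
   by(simp add: pev_pCons pev_0 fls_const_minus fls_const_diff)
  thus ?thesis using xb[OF that] ideal_uminus[OF cI, of "fls_const (x j - cst (b j))"] by(simp only: cof_const[OF I])
 qed
 thus ?thesis unfolding dpoly_def pev.prod by(intro cong_prod[OF cI]) simp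
qed

lemma expandsI:
 assumes "pev fls_X_inv (\<Prod>j<N. lin (b j)) ^ m * F = pev fls_X_inv P" "pev (loc i) (\<Prod>j<N. lin (b j)) ^ m * L = pev (loc i) P"
 shows "expands I N x (cst (y i)) F L"
proof -
 have "A ^ m * F - pev w P : cof I" if "A - B : cof I" "B ^ m * F = pev w P" for A B w and F :: "base fls"
  using ideal_mult2[OF cI cong_power[OF cI that(1), of m], of F] that(2) by(simp add: algebra_simps)
 from this[OF dpoly_cong assms(1)] this[OF dpoly_cong assms(2)] show ?thesis unfolding expands_iff by blast
qed

text \<open>Each \<open>y i\<close> occurs among the \<open>b j\<close>, at different indices for
  different \<open>i\<close>. Poles along the \<open>y i\<close> are thus poles along the divisor of
  the configuration.\<close>

lemma divisor_factor: "EX C. (\<Prod>j<N. lin (b j)) = (\<Prod>i<l. lin (y i)) * C"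
proof -
 obtain t where t: "ALL i<l. t i < N \<and> b (t i) = y i" using yb by metis
 have it: "inj_on t {..<l}"
 proof(rule inj_onI)
  fix i j assume a: "i : {..<l}" "j : {..<l}" "t i = t j"
  hence "y i = y j" using t by(metis lessThan_iff)
  thus "i = j" using inj_onD[OF inj] a by blast
 qed
 have "(\<Prod>j<N. lin (b j)) = (\<Prod>j\<in>t ` {..<l}. lin (b j)) * (\<Prod>j\<in>{..<N} - t ` {..<l}. lin (b j))"
  using t by(subst prod.subset_diff[of "t ` {..<l}"]) (auto simp: mult.commute)
 also have "(\<Prod>j\<in>t ` {..<l}. lin (b j)) = (\<Prod>i<l. lin (y i))"
  using t by(subst prod.reindex[OF it]) (auto intro!: prod.cong)
 finally show ?thesis by blast
qed

text \<open>In the local coordinate t = z - y_i, the function 1 / (z - y_i) is 1 / t.\<close>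

lemma expands_geom:
 assumes "i < l" shows "expands I N x (cst (y i)) (geom (cst (y i))) fls_X_inv"
proof -
 obtain C where C: "(\<Prod>j<N. lin (b j)) = (\<Prod>i<l. lin (y i)) * C" using divisor_factor by blast
 define P where "P = (\<Prod>j\<in>{..<l} - {i}. lin (y j)) * C"
 have P: "(\<Prod>j<N. lin (b j)) = lin (y i) * P"
 proof -
  have "(\<Prod>j<l. lin (y j)) = lin (y i) * (\<Prod>j\<in>{..<l} - {i}. lin (y j))" using assms by(intro prod.remove) auto
  thus ?thesis unfolding C P_def by(simp only: mult.assoc)
 qed
 show ?thesis
 proof(rule expandsI[where m = 1 and P = P])
  have "pev fls_X_inv (lin (y i)) * geom (cst (y i)) = 1" unfolding pev_lin by(rule geom_mult)
  from arg_cong[OF this, of "%a. a * pev fls_X_inv P"]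
  show "pev fls_X_inv (\<Prod>j<N. lin (b j)) ^ 1 * geom (cst (y i)) = pev fls_X_inv P"
   unfolding P pev.mult power_one_right by(simp only: mult_ac mult_1_left mult_1_right)
  have "pev (loc i) (lin (y i)) * fls_X_inv = 1" unfolding pev_lin by(simp add: fls_X_times_conv_shift)
  from arg_cong[OF this, of "%a. a * pev (loc i) P"]
  show "pev (loc i) (\<Prod>j<N. lin (b j)) ^ 1 * fls_X_inv = pev (loc i) P"
   unfolding P pev.mult power_one_right by(simp only: mult_ac mult_1_left mult_1_right)
 qed
qed

lemma expands_cst:
 assumes i: "i < l" and e: "expands {0} l y (y i) f g"
 shows "expands I N x (cst (y i)) (fls_map cst f) (fls_map cst g)"
proof -
 interpret c: ring_map cst by(rule ring_map_cst)
 interpret fc: ring_map "fls_map cst" by(rule c.ring_map_fls)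
 obtain m P where mP: "pev fls_X_inv (dpoly l y) ^ m * f = pev fls_X_inv P"
  "pev (fls_X + fls_const (y i)) (dpoly l y) ^ m * g = pev (fls_X + fls_const (y i)) P"
  using e unfolding expands_iff cof_def by(auto simp: fls_eq_iff)
 have d: "map_poly cst (dpoly l y) = (\<Prod>i<l. lin (y i))"
  unfolding dpoly_def ring_map.prod[OF ring_map_map_poly[OF ring_map_cst]]
  by(simp add: map_poly_pCons cst_simps)
 obtain C where C: "(\<Prod>j<N. lin (b j)) = (\<Prod>i<l. lin (y i)) * C" using divisor_factor by blast
 have *: "pev (fls_map cst w) (\<Prod>j<N. lin (b j)) ^ m * fls_map cst F = pev (fls_map cst w) (C ^ m * map_poly cst P)"
  if "pev w (dpoly l y) ^ m * F = pev w P" for w F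
  using arg_cong[OF that, of "%F. pev (fls_map cst w) C ^ m * fls_map cst F"]
  by(simp add: C fc.mult fc.power fls_map_pev[OF ring_map_cst] d pev.mult pev.power power_mult_distrib mult_ac)
 show ?thesis using *[OF mP(1)] *[OF mP(2)]
  by(intro expandsI[where P = "C ^ m * map_poly cst P"]) (simp_all add: c.map_X_inv c.map_X c.map_const fc.add)
qed

text \<open>It vanishes at the points other than \<open>y i\<close>. Accordingly, a rational
  function is regular at \<open>y i\<close> if some power of \<open>G i\<close> makes it polynomial,
  a criterion without local expansions.\<close>

definition G :: "nat => base fls" where "G i = (\<Prod>j\<in>{..<l} - {i}. Z j)"

lemma G_poly: "G i : polyfuns I" and Z_poly: "Z i : polyfuns I"
 by(auto simp: G_def intro!: polyfuns_prod[OF I] pev_polyfuns[OF I] polyfuns_X_inv[OF I])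

lemma pow_mult:
 assumes "!!j. j < 0 ==> fls_nth A j = 0" "ALL j<0. fls_nth L j : I" and "j < int n"
 shows "fls_nth (fls_X ^ n * (A * L)) j : I"
proof -
 define L0 where "L0 = Abs_fls (%j. if j \<ge> 0 then fls_nth L j else 0)"
 have L0: "fls_nth L0 j = (if j \<ge> 0 then fls_nth L j else 0)" for j
  unfolding L0_def by(rule fls_nth_Abs[of 0]) simp
 have "L - L0 : cof I" using assms(2) ideal_zero[OF I] by(simp add: cof_def L0)
 from ideal_mult[OF cI this, of "fls_X ^ n * A"]
 have 1: "fls_nth (fls_X ^ n * (A * L)) j - fls_nth (fls_X ^ n * (A * L0)) j : I"
  by(simp add: cof_def right_diff_distrib mult.assoc)
 have "fls_nth (A * L0) j = 0" if "j < 0" for j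
  by(rule nth_prod_low[where a = 0 and b = 0]) (use assms(1) that in \<open>auto simp: L0\<close>)
 hence "fls_nth (fls_X ^ n * (A * L0)) j = 0" using assms(3)
  by(simp add: fls_X_power_times_conv_shift)
 thus ?thesis using 1 by simp
qed

text \<open>In the local coordinate the numerator equals the denominator times a power series, so it
  is divisible by the power of t in the denominator. The corresponding power of z - y_i cancels
  globally, and a power of \<open>G i\<close> clears the remaining linear factors.\<close>

lemma expands_regular:
 assumes i: "i < l" and e: "expands I N x (cst (y i)) F L" and L: "ALL j<0. fls_nth L j : I"
 shows "EX m. G i ^ m * F : polyfuns I"
proof -
 obtain m P where P: "pev fls_X_inv (dpoly N x) ^ m * F - pev fls_X_inv P : cof I" "pev (loc i) (dpoly N x) ^ m * L - pev (loc i) P : cof I"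
  using e unfolding expands_iff by blast
 let ?A = "{j. j < N \<and> b j = y i}" and ?B = "{j. j < N \<and> b j \<noteq> y i}"
 \<comment> \<open>The multiplicity of \<open>y i\<close> in the denominator.\<close>
 define n where "n = card ?A * m"
 define R where "R = (\<Prod>j\<in>?B. lin (b j))"
 have "(\<Prod>j<N. lin (b j)) = (\<Prod>j\<in>?A. lin (b j)) * R"
  unfolding R_def by(subst prod.union_disjoint[symmetric]) (auto intro!: prod.cong)
 also have "(\<Prod>j\<in>?A. lin (b j)) = lin (y i) ^ card ?A" by(simp add: prod.cong[of ?A ?A "%j. lin (b j)" "%j. lin (y i)"])
 finally have pR: "pev w (\<Prod>j<N. lin (b j)) ^ m = pev w (lin (y i)) ^ n * pev w R ^ m" for w
  by(simp add: pev.mult pev.power power_mult_distrib n_def power_mult del: pev.power[symmetric])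
 define q where "q = pcompose P [:cst (y i), 1:]"
 have q: "pev (loc i) P = pev fls_X q" "pev fls_X_inv P = pev (Z i) q"
  unfolding q_def pev_pcompose by(simp_all add: pev_pCons pev_0 pev_lin add.commute)
 have "pev (loc i) R = pev fls_X (pcompose R [:cst (y i), 1:])" unfolding pev_pcompose by(simp add: pev_pCons pev_0 add.commute)
 hence R0: "fls_nth (pev (loc i) R ^ m) j = 0" if "j < 0" for j
  using that by(simp add: pev_X_nth flip: pev.power)
 \<comment> \<open>The polynomial \<open>q\<close> is the numerator in the local coordinate. Below
   order \<open>n\<close> its coefficients vanish modulo \<open>I\<close>, since \<open>L\<close>
   has no polar part.\<close>
 have "coeff q k : I" if "k < n" for k
 proof -
  have "pev (loc i) (\<Prod>j<N. lin (b j)) ^ m * L - pev fls_X q : cof I"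
   using cong_trans[OF cI ideal_mult2[OF cI cong_sym[OF cI cong_power[OF cI dpoly_cong]], of "loc i" m L, unfolded left_diff_distrib] P(2)] q(1) by simp
  hence "fls_nth (fls_X ^ n * (pev (loc i) R ^ m * L)) (int k) - coeff q k : I"
   unfolding pR pev_lin cof_def mem_Collect_eq fls_minus_nth by(auto simp: pev_X_nth mult.assoc dest!: spec[of _ "int k"])
  from cong_sym[OF I this] pow_mult[OF R0 L, of "int k" n] show ?thesis using that ideal_cong[OF I] by auto
 qed
 hence "pev (Z i) (poly_cutoff n q) : cof I"
  by(intro pev_cof[OF I]) (simp add: coeff_poly_cutoff ideal_zero[OF I])
 moreover have "q = monom 1 n * poly_shift n q + poly_cutoff n q"
  by(rule poly_eqI) (auto simp: coeff_monom_mult coeff_poly_shift coeff_poly_cutoff)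
 hence "pev (Z i) q = pev (Z i) (monom 1 n) * pev (Z i) (poly_shift n q) + pev (Z i) (poly_cutoff n q)"
  by(metis pev.add pev.mult)
 moreover have "pev (Z i) (monom 1 n) = Z i ^ n" by(induction n) (simp_all add: monom_Suc monom_0 pev_pCons pev_0)
 ultimately have 1: "pev fls_X_inv P - Z i ^ n * pev (Z i) (poly_shift n q) : cof I" unfolding q(2) by simp
 have "pev fls_X_inv (\<Prod>j<N. lin (b j)) ^ m * F - pev fls_X_inv P : cof I"
  using cong_trans[OF cI ideal_mult2[OF cI cong_sym[OF cI cong_power[OF cI dpoly_cong]], of fls_X_inv m F, unfolded left_diff_distrib] P(1)] .
 from ideal_mult[OF cI cong_trans[OF cI this 1], of "geom (cst (y i)) ^ n"]
 have 2: "pev fls_X_inv R ^ m * F - pev (Z i) (poly_shift n q) : cof I"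
 proof -
  have g: "geom (cst (y i)) ^ n * (Z i ^ n * H) = H" for H
   by(simp add: pev_lin geom_mult mult.assoc[symmetric] mult.commute[of "geom _"] flip: power_mult_distrib)
  assume "geom (cst (y i)) ^ n * (pev fls_X_inv (\<Prod>j<N. lin (b j)) ^ m * F - Z i ^ n * pev (Z i) (poly_shift n q)) : cof I"
  thus ?thesis unfolding pR right_diff_distrib mult.assoc g .
 qed
 have "EX C:polyfuns I. C * pev fls_X_inv R = G i ^ card ?B"
 proof -
  have "EX C:polyfuns I. C * pev fls_X_inv (lin (b j)) = G i" if j: "j : ?B" for j
  proof -
   obtain h where h: "h < l" "b j = y h" using bl[of j] j by auto
   have "G i = Z h * (\<Prod>j\<in>{..<l} - {i} - {h}. Z j)"
    unfolding G_def using h j by(intro prod.remove) auto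
   moreover have "(\<Prod>j\<in>{..<l} - {i} - {h}. Z j) : polyfuns I"
    by(intro polyfuns_prod[OF I] Z_poly)
   ultimately show ?thesis unfolding h(2) by(intro bexI[of _ "\<Prod>j\<in>{..<l} - {i} - {h}. Z j"]) (simp_all only: mult.commute)
  qed
  hence "ALL j. EX C. j : ?B --> C : polyfuns I \<and> C * pev fls_X_inv (lin (b j)) = G i" by blast
  from choice[OF this] obtain C where "ALL j. j : ?B --> C j : polyfuns I \<and> C j * pev fls_X_inv (lin (b j)) = G i"
   by(elim exE)
  hence C: "!!j. j : ?B ==> C j : polyfuns I" "!!j. j : ?B ==> C j * pev fls_X_inv (lin (b j)) = G i" by blast+
  have "(\<Prod>j\<in>?B. C j) * pev fls_X_inv R = G i ^ card ?B"
   unfolding R_def pev.prod prod.distrib[symmetric] using C(2) by simp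
  moreover have "(\<Prod>j\<in>?B. C j) : polyfuns I" by(rule polyfuns_prod[OF I C(1)])
  ultimately show ?thesis by blast
 qed
 then obtain C where C: "C : polyfuns I" "C * pev fls_X_inv R = G i ^ card ?B" by blast
 have "C ^ m * (pev fls_X_inv R ^ m * F - pev (Z i) (poly_shift n q)) : polyfuns I" by(intro polyfuns_cof ideal_mult[OF cI 2])
 moreover have "C ^ m * pev (Z i) (poly_shift n q) : polyfuns I"
  by(intro polyfuns_mult[OF I] polyfuns_power[OF I] C pev_polyfuns[OF I] Z_poly)
 ultimately have "C ^ m * (pev fls_X_inv R ^ m * F - pev (Z i) (poly_shift n q)) + C ^ m * pev (Z i) (poly_shift n q) : polyfuns I"
  by(rule polyfuns_add[OF I])
 hence "G i ^ (card ?B * m) * F : polyfuns I"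
  by(simp add: power_mult C(2)[symmetric] power_mult_distrib right_diff_distrib mult.assoc)
 thus ?thesis by blast
qed

text \<open>The difference of the two linear factors is a nonzero complex number, so they generate
  the unit ideal. A double induction removes the exponents.\<close>

lemma coprime_linear:
 assumes Q: "!!a b. a : Q ==> b : Q ==> a + b : Q" "!!a b. a : polyfuns I ==> b : Q ==> a * b : Q"
  and ij: "i < l" "j < l" "i \<noteq> j" and g: "Z i ^ n * g : Q" "Z j ^ k * g : Q"
 shows "g : Q"
 using g
proof(induction n arbitrary: g k)
 case (Suc n)
 thus ?case
 proof(induction k arbitrary: g)
  case (Suc k)
  note IHk = Suc.IH and IHn = Suc.prems(1)
  have 1: "Z j * g : Q"
   by(rule IHk[OF IHn]) (use Q(2)[OF Z_poly[of j] Suc.prems(2)] Suc.prems(3) in \<open>simp_all add: mult_ac\<close>)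
  have 2: "Z i * g : Q"
   by(rule IHn[of _ "Suc k"]) (use Q(2)[OF Z_poly[of i] Suc.prems(3)] Suc.prems(2) in \<open>simp_all add: mult_ac\<close>)
  let ?c = "1 / (y i - y j)"
  have "y i \<noteq> y j" using inj ij by(auto simp: inj_on_def)
  hence "cst ?c * cst (y i - y j) = 1" by(simp add: cst_simps(2) flip: cst_simps(4))
  moreover have "Z j - Z i = fls_const (cst (y i - y j))" by(simp add: pev_lin fls_const_diff cst_simps(6))
  ultimately have "fls_const (cst ?c) * (Z j - Z i) = 1" by simp
  moreover have "c * (A * g) + - c * (B * g) = c * (A - B) * g" for A B c :: "base fls" by(simp add: algebra_simps)
  note this[of "fls_const (cst ?c)" "Z j" "Z i", folded fls_const_minus]
  ultimately have "fls_const (cst ?c) * (Z j * g) + fls_const (- cst ?c) * (Z i * g) = g" by simp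
  thus ?case
   using Q(1)[OF Q(2)[OF polyfuns_const[OF I, of "cst ?c"] 1] Q(2)[OF polyfuns_const[OF I, of "- cst ?c"] 2]] by(simp only:)
 qed simp
qed simp

text \<open>The linear factors are removed one at a time by \<open>coprime_linear\<close>. Claim
  \<open>1\<close> strips the factors of a product against one coprime factor, and claim
  \<open>2\<close> strips the products \<open>G i\<close> down to the constant 1.\<close>

lemma comaximal:
 assumes Q: "!!a b. a : Q ==> b : Q ==> a + b : Q" "!!a b. a : polyfuns I ==> b : Q ==> a * b : Q"
  and G: "!!i. i < l ==> G i ^ n : Q" and l: "l > 0"
 shows "1 : Q"
proof -
 have 1: "h : Q" if "finite S" "S \<subseteq> {..<l}" "i < l" "i \<notin> S" "Z i ^ n * h : Q" "(\<Prod>j\<in>S. Z j) ^ n * h : Q" for S i h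
  using that
 proof(induction S arbitrary: h rule: finite_induct)
  case (insert j S)
  have "(\<Prod>j\<in>S. Z j) ^ n * h : Q"
  proof(rule coprime_linear[of Q i j n _ n, OF Q])
   show "Z i ^ n * ((\<Prod>j\<in>S. Z j) ^ n * h) : Q"
    using Q(2)[OF _ insert.prems(4), of "(\<Prod>j\<in>S. Z j) ^ n"]
    by(auto simp: mult_ac intro!: polyfuns_power[OF I] polyfuns_prod[OF I] Z_poly)
   show "Z j ^ n * ((\<Prod>j\<in>S. Z j) ^ n * h) : Q" using insert by(simp add: power_mult_distrib mult.assoc)
  qed (use insert.prems in auto)
  thus ?case using insert by auto
 qed simp
 have 2: "h : Q" if "finite S" "S \<noteq> {}" "S \<subseteq> {..<l}" "!!i. i : S ==> (\<Prod>j\<in>S - {i}. Z j) ^ n * h : Q" for S h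
  using that
 proof(induction S arbitrary: h rule: finite_ne_induct)
  case (insert i S)
  have "Z i ^ n * h : Q"
  proof(rule insert.IH)
   fix c assume c: "c : S"
   have "insert i S - {c} = insert i (S - {c})" using c insert.hyps by auto
   thus "(\<Prod>j\<in>S - {c}. Z j) ^ n * (Z i ^ n * h) : Q"
    using insert.prems(2)[of c] c insert.hyps by(simp add: power_mult_distrib mult_ac)
  qed (use insert.prems in auto)
  moreover have "(\<Prod>j\<in>S. Z j) ^ n * h : Q" using insert.prems(2)[of i] insert.hyps by simp
  moreover have "S \<subseteq> {..<l}" "i < l" using insert.prems by auto
  ultimately show ?case using insert.hyps by(intro 1[of S i h])
 qed simp
 show ?thesis using 2[of "{..<l}" 1] G l by(auto simp: G_def)
qed

end

text \<open>Both sides are the determinant of the block matrix with rows \<open>(1, X)\<close> and \<open>(Y, 1)\<close>.\<close>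

lemma frame_det_one_minus_commute:
 "frame_det r (%i j. (if i = j then 1 else 0) - (\<Sum>k<r. X i k * Y k j)) =
  frame_det r (%i j. (if i = j then 1 else 0) - (\<Sum>k<r. Y i k * X k j))"
proof -
 define bm :: "_ => _ => _ => _ => nat => nat => base" where
  "bm A B C D i j = (if i < r then if j < r then A i j else B i (j - r) else if j < r then C (i - r) j else D (i - r) (j - r))"
  for A B C D i j
 have mult: "(\<Sum>k<r + r. bm A B C D i k * bm A' B' C' D' k j) =
  bm (%i j. (\<Sum>k<r. A i k * A' k j) + (\<Sum>k<r. B i k * C' k j)) (%i j. (\<Sum>k<r. A i k * B' k j) + (\<Sum>k<r. B i k * D' k j))
   (%i j. (\<Sum>k<r. C i k * A' k j) + (\<Sum>k<r. D i k * C' k j)) (%i j. (\<Sum>k<r. C i k * B' k j) + (\<Sum>k<r. D i k * D' k j)) i j"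
  for A B C D A' B' C' D' i j
  by(simp add: sum_split bm_def)
 have lower: "frame_det (r + r) (bm A (%i j. 0) C D) = frame_det r A * frame_det r D" for A C D
  using frame_det_block_lower[of r r "bm A (%i j. 0) C D"] frame_det_cong[of r "bm A (%i j. 0) C D" A]
  by(simp add: bm_def)
 let ?d = "%i j. if i = j then 1 else (0 :: base)"
 have d: "i < r ==> (\<Sum>k<r. ?d i k * W k) = W i" "i < r ==> (\<Sum>k<r. W k * ?d k i) = W i" for i and W :: "nat => base"
  by(simp_all add: mult_delta_left mult_delta_right)
 let ?B = "bm ?d X Y ?d" and ?U = "bm ?d (%i j. - X i j) (%i j. 0) ?d"
 have "frame_det (r + r) (%i j. \<Sum>k<r + r. ?B i k * ?U k j) = frame_det (r + r) (bm ?d (%i j. 0) Y (%i j. ?d i j - (\<Sum>k<r. Y i k * X k j)))"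
  unfolding mult by(rule frame_det_cong) (simp add: bm_def d sum_negf)
 moreover have "frame_det (r + r) (%i j. \<Sum>k<r + r. ?U i k * ?B k j) = frame_det (r + r) (bm (%i j. ?d i j - (\<Sum>k<r. X i k * Y k j)) (%i j. 0) Y ?d)"
  unfolding mult by(rule frame_det_cong) (simp add: bm_def d sum_negf)
 moreover have "frame_det (r + r) (%i j. \<Sum>k<r + r. ?U i k * ?B k j) = frame_det (r + r) (%i j. \<Sum>k<r + r. ?B i k * ?U k j)"
  unfolding frame_det_mult[symmetric] by(rule mult.commute)
 ultimately show ?thesis by(simp add: lower frame_det_id)
qed

section \<open>Regularity at the points and decomposition into principal parts\<close>

context constant_points
begin

text \<open>Vectors regular at \<open>y i\<close>, in the form given by
  \<open>expands_regular\<close>.\<close>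

definition reg :: "nat => (base fls ^ 'n) set" where
 "reg i = {v. EX m. G i ^ m *s v : poly_vecs I}"

lemmas Os = polyvecs_submod[OF I] and Oc = polyvecs_csub[OF I]

lemma reg_raise: "G i ^ m *s v : poly_vecs I ==> m \<le> n ==> G i ^ n *s v : poly_vecs I"
 using submod_smult[OF Os polyfuns_power[OF I G_poly], of "G i ^ m *s v" i "n - m"]
 by(simp add: smult_assoc flip: power_add)

lemma reg_add: assumes "u : reg i" "v : reg i" shows "u + v : reg i"
proof -
 obtain m n where "G i ^ m *s u : poly_vecs I" "G i ^ n *s v : poly_vecs I" using assms by(auto simp: reg_def)
 hence "G i ^ (m + n) *s u : poly_vecs I" "G i ^ (m + n) *s v : poly_vecs I" by(auto intro: reg_raise)
 from csub_add[OF Oc this] show ?thesis by(auto simp: reg_def simp flip: smult_add)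
qed

lemma reg_smult: "A : polyfuns I ==> v : reg i ==> A *s v : reg i"
proof -
 assume A: "A : polyfuns I" "v : reg i"
 then obtain m where "G i ^ m *s v : poly_vecs I" by(auto simp: reg_def)
 from submod_smult[OF Os A(1) this] have "G i ^ m *s (A *s v) : poly_vecs I" by(simp add: smult_assoc mult.commute)
 thus ?thesis by(auto simp: reg_def)
qed

lemma reg_csub: "csub I (reg i)"
proof -
 have "van I \<subseteq> reg i" using csub_van[OF Oc] by(auto simp: reg_def intro!: exI[of _ 0])
 thus ?thesis unfolding csub_def by(intro conjI ballI allI I reg_add reg_smult polyfuns_const)
qed

lemma reg_poly: "v : poly_vecs I ==> v : reg i"
 by(auto simp: reg_def intro!: exI[of _ 0])

text \<open>The multipliers that make \<open>v\<close> polynomial form an ideal. It contains powers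
  of all \<open>G i\<close>, hence 1.\<close>

lemma reg_all: assumes "l > 0" "!!i. i < l ==> v : reg i" shows "v : poly_vecs I"
proof -
 have "ALL i. EX m. i < l --> G i ^ m *s v : poly_vecs I" using assms(2) by(auto simp: reg_def)
 from choice[OF this] obtain m where m: "ALL i. i < l --> G i ^ m i *s v : poly_vecs I" by(elim exE)
 let ?n = "\<Sum>i<l. m i"
 have "1 : {h. h *s v : poly_vecs I}"
 proof(rule comaximal[where n = ?n])
  fix i assume "i < l"
  hence "m i \<le> ?n" by(intro member_le_sum) auto
  thus "G i ^ ?n : {h. h *s v : poly_vecs I}" using m \<open>i < l\<close> by(auto intro: reg_raise)
 qed (use assms(1) csub_add[OF Oc] submod_smult[OF Os] in \<open>auto simp: add_smult simp flip: smult_assoc\<close>)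
 thus ?thesis by simp
qed

text \<open>The source of the approximate projections \<epsilon> i: the summand with index
  \<open>i\<close> vanishes to order \<open>n\<close> at all other points, and hence is 1 to that
  order at \<open>y i\<close>.\<close>

lemma partition_of_unity: assumes "l > 0" shows "EX a. (ALL i<l. a i : polyfuns I) \<and> (\<Sum>i<l. a i * G i ^ n) = 1"
proof -
 let ?Q = "{h. EX a. (ALL i<l. a i : polyfuns I) \<and> (\<Sum>i<l. a i * G i ^ n) = h}"
 have "1 : ?Q"
 proof(rule comaximal[where n = n and Q = ?Q])
  fix g h assume "g : ?Q" "h : ?Q"
  then obtain a c where "ALL i<l. a i : polyfuns I" "ALL i<l. c i : polyfuns I" "(\<Sum>i<l. a i * G i ^ n) = g" "(\<Sum>i<l. c i * G i ^ n) = h" by blast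
  thus "g + h : ?Q"
   by(intro CollectI exI[of _ "%i. a i + c i"]) (auto simp: distrib_right sum.distrib intro: polyfuns_add[OF I])
 next
  fix A h assume "A : polyfuns I" "h : ?Q"
  then obtain a where "ALL i<l. a i : polyfuns I" "(\<Sum>i<l. a i * G i ^ n) = h" by blast
  thus "A * h : ?Q" using \<open>A : polyfuns I\<close>
   by(intro CollectI exI[of _ "%i. A * a i"]) (auto simp: sum_distrib_left mult.assoc intro: polyfuns_mult[OF I])
 next
  fix i assume "i < l"
  thus "G i ^ n : ?Q" by(intro CollectI exI[of _ "%j. if j = i then 1 else 0"])
   (auto simp: mult_delta_left polyfuns_one[OF I] polyfuns_zero[OF I])
 qed (rule assms)
 thus ?thesis by simp
qed

definition Yp :: "base fls" where "Yp = (\<Prod>j<l. Z j)"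

lemma Yp_raise: "Yp ^ m *s v : poly_vecs I ==> m \<le> n ==> Yp ^ n *s v : poly_vecs I"
 using submod_smult[OF Os polyfuns_power[OF I polyfuns_prod[OF I Z_poly]], of "Yp ^ m *s v" "%j. j" "{..<l}" "n - m"]
 by(simp add: smult_assoc Yp_def flip: power_add)

lemma G_mult:
 assumes "i < l" "j < l" "i \<noteq> j" shows "EX C:polyfuns I. C * Yp = G i * G j"
proof -
 have "G j = Z i * (\<Prod>j\<in>{..<l} - {j} - {i}. Z j)" unfolding G_def using assms by(intro prod.remove) auto
 moreover have "Yp = Z i * G i" unfolding G_def Yp_def using assms by(intro prod.remove) auto
 ultimately have "(\<Prod>j\<in>{..<l} - {j} - {i}. Z j) * Yp = G i * G j" by(simp only: mult_ac)
 moreover have "(\<Prod>j\<in>{..<l} - {j} - {i}. Z j) : polyfuns I" by(intro polyfuns_prod[OF I] Z_poly)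
 ultimately show ?thesis by blast
qed

lemma G_cross:
 assumes "i < l" "j < l" "i \<noteq> j" "Yp ^ n *s v : poly_vecs I"
 shows "G i ^ n *s (G j ^ n *s v) : poly_vecs I"
proof -
 obtain C where C: "C : polyfuns I" "C * Yp = G i * G j" using G_mult[OF assms(1-3)] by blast
 have "G i ^ n *s (G j ^ n *s v) = C ^ n *s (Yp ^ n *s v)"
  by(simp add: smult_assoc C(2) flip: power_mult_distrib)
 thus ?thesis using submod_smult[OF Os polyfuns_power[OF I C(1)] assms(4)] by simp
qed

text \<open>Each of the \<open>N\<close> linear factors of the divisor equation divides
  \<open>Yp\<close>, so \<open>Yp ^ N\<close> clears one pole order along the divisor.\<close>

lemma Om_Yp:
 fixes v :: "base fls ^ 'n"
 assumes "v : Om I N x M" shows "Yp ^ (N * M) *s v : poly_vecs I"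
proof -
 have "ALL j. EX C. j < N --> C : polyfuns I \<and> C * pev fls_X_inv (lin (b j)) = Yp"
 proof(intro allI)
  fix j show "EX C. j < N --> C : polyfuns I \<and> C * pev fls_X_inv (lin (b j)) = Yp"
  proof(cases "j < N")
   case True
   then obtain h where h: "h < l" "b j = y h" using bl by blast
   have "Yp = Z h * G h" unfolding G_def Yp_def using h by(intro prod.remove) auto
   thus ?thesis using G_poly[of h] h(2) by(intro exI[of _ "G h"]) (simp add: mult.commute)
  qed simp
 qed
 from choice[OF this] obtain C where C: "ALL j. j < N --> C j : polyfuns I \<and> C j * pev fls_X_inv (lin (b j)) = Yp" by(elim exE)
 have "(\<Prod>j<N. C j) * (\<Prod>j<N. pev fls_X_inv (lin (b j))) = Yp ^ N"
  unfolding prod.distrib[symmetric] using C by simp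
 moreover have "(\<Prod>j<N. pev fls_X_inv (lin (b j))) = divisor_eq N (cst o b)"
  by(simp add: divisor_eq_def pev_lin)
 ultimately have Y: "Yp ^ (N * M) = (\<Prod>j<N. C j) ^ M * divisor_eq N (cst o b) ^ M"
  by(simp add: power_mult flip: power_mult_distrib)
 have "Om I N x M = (Om I N (cst o b) M :: (base fls ^ 'n) set)" by(rule Om_cong[OF I]) (simp add: xb)
 hence "v : Om I N (cst o b) M" using assms by simp
 thus ?thesis using C submod_smult[OF Os polyfuns_power[OF I polyfuns_prod[OF I]], of "{..<N}" C _ M]
  unfolding Y Om_def by(simp flip: smult_assoc)
qed

lemma vexpands_reg:
 fixes v :: "base fls ^ 'n::finite"
 assumes i: "i < l" and e: "vexpands I N x (cst (y i)) v L" and L: "L : pow_vecs I"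
 shows "v : reg i"
proof -
 have "EX m. ALL a. G i ^ m * v $ a : polyfuns I"
 proof(rule uniform_exponent)
  fix a show "EX m. G i ^ m * v $ a : polyfuns I"
   using e L by(intro expands_regular[OF i, of _ "L $ a"]) (auto simp: vexpands_def pow_vecs_def)
 next
  fix m m' :: nat and a assume a: "G i ^ m * v $ a : polyfuns I" "m \<le> m'"
  have "G i ^ m' = G i ^ (m' - m) * G i ^ m" using a(2) by(simp flip: power_add)
  thus "G i ^ m' * v $ a : polyfuns I"
   using polyfuns_mult[OF I polyfuns_power[OF I G_poly] a(1), of i "m' - m"] by(simp only: mult.assoc)
 qed
 thus ?thesis by(simp add: reg_def poly_vecs_def)
qed

lemma vexpands_diff: "vexpands I N x c u L ==> vexpands I N x c v M ==> vexpands I N x c (u - v) (L - M)"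
 by(simp add: vexpands_def expands_diff[OF I])

lemma vexpands_cong: "vexpands I N x c u L ==> L - M : van I ==> vexpands I N x c u M"
 unfolding vexpands_def van_iff using ideal_zero[OF cI] by(intro allI) (rule expands_cong[OF I], auto)

text \<open>Substitute 1 / (z - y_i) for 1 / t in the given principal part. The result vanishes at
  infinity and has no other poles.\<close>

lemma principal_part:
 fixes w :: "base fls ^ 'n::finite"
 assumes i: "i < l" and w: "w : polar_vecs I"
 shows "EX v. vexpands I N x (cst (y i)) v w \<and> vfpart v = v \<and> (ALL j<l. j \<noteq> i --> v : reg j)"
proof -
 have "EX m. ALL a. ALL j < - int m. fls_nth (w $ a) j = 0"
 proof(rule uniform_exponent)
  fix a show "EX m. ALL j < - int m. fls_nth (w $ a) j = 0"
   by(intro exI[of _ "nat (- fls_subdegree (w $ a))"]) auto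
 qed auto
 then obtain K where K: "!!a j. j < - int K ==> fls_nth (w $ a) j = 0" by blast
 let ?g = "geom (cst (y i))" and ?c = "%a k. fls_const (fls_nth (w $ a) (- int k))"
 define v where "v = (\<chi> a. \<Sum>k=1..K. ?c a k * ?g ^ k)"
 define W where "W = (\<chi> a. \<Sum>k=1..K. ?c a k * fls_X_inv ^ k)"
 have "vexpands I N x (cst (y i)) v W"
  unfolding vexpands_def v_def W_def
  by(auto intro!: expands_sum[OF I] expands_mult[OF I] expands_const[OF I] expands_power[OF I] expands_geom i)
 moreover have "W - w : van I" unfolding van_def
 proof(intro CollectI allI)
  fix a j
  have "fls_nth (W $ a) j = (\<Sum>k=1..K. if k = nat (- j) \<and> j < 0 then fls_nth (w $ a) j else 0)"
   unfolding W_def by(auto simp: fls_nth_sum X_inv_power_nth intro!: sum.cong)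
  also have "\<dots> = (if - int K \<le> j \<and> j < 0 then fls_nth (w $ a) j else 0)"
   by(cases "j < 0") auto
  finally show "fls_nth ((W - w) $ a) j : I"
   using K[of j a] w ideal_uminus[OF I, of "fls_nth (w $ a) j"] ideal_zero[OF I] by(auto simp: polar_vecs_def)
 qed
 moreover have "vfpart v = v"
 proof -
  have 0: "fls_nth (?g ^ k) j = 0" if "j < 0 \<or> k \<ge> 1 \<and> j < 1" for k j
   using that
  proof(induction k arbitrary: j)
   case (Suc k)
   show ?case unfolding power_Suc by(rule nth_prod_low[where a = 1 and b = 0]) (use Suc in \<open>auto simp: geom_nth\<close>)
  qed auto
  have "fls_nth (v $ a) j = 0" if "\<not> j > 0" for a j
   unfolding v_def by(simp add: fls_nth_sum) (use that 0 in \<open>auto intro!: sum.neutral\<close>)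
  thus ?thesis by(auto simp: vec_eq_iff vfpart_nth intro!: fls_eqI)
 qed
 moreover have "v : reg j" if j: "j < l" "j \<noteq> i" for j
 proof -
  obtain C where C: "C : polyfuns I" "G j = Z i * C"
  proof
   show "G j = Z i * (\<Prod>j\<in>{..<l} - {j} - {i}. Z j)" unfolding G_def using i j by(intro prod.remove) auto
   show "(\<Prod>j\<in>{..<l} - {j} - {i}. Z j) : polyfuns I" by(intro polyfuns_prod[OF I] Z_poly)
  qed
  have "Z i * ?g = 1" unfolding pev_lin by(rule geom_mult)
  hence "G j ^ k * ?g ^ k = C ^ k" for k
   unfolding C(2) power_mult_distrib[symmetric] by(simp add: mult_ac flip: mult.assoc[of C])
  moreover have "G j ^ K = G j ^ (K - k) * G j ^ k" if "k \<le> K" for k using that by(simp flip: power_add)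
  ultimately have "G j ^ K * ?g ^ k = G j ^ (K - k) * C ^ k" if "k \<le> K" for k
   using that by(simp only: mult.assoc)
  hence "G j ^ K * (?c a k * ?g ^ k) : polyfuns I" if "k \<le> K" for a k
   unfolding mult.left_commute[of _ "?c a k"] using that C(1) G_poly
   by(auto intro!: polyfuns_mult[OF I] polyfuns_power[OF I] polyfuns_const[OF I])
  hence "G j ^ K *s v : poly_vecs I"
   by(auto simp: poly_vecs_def v_def sum_distrib_left intro!: polyfuns_sum[OF I])
  thus ?thesis by(auto simp: reg_def)
 qed
 ultimately show ?thesis using vexpands_cong by blast
qed

end

section \<open>The standard lift of the Lie algebra action\<close>

text \<open>
 The normally ordered lift \<open>\<nu>\<close> at infinity differs from the one at the points \<open>y i\<close> by the sum of the operators
 \<open>e T i\<close>, where \<open>\<epsilon> i\<close> projects to the principal part at \<open>y i\<close>. They are off-diagonal for this projection.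
\<close>

locale moved_frame = constant_points I N l x b y
 for I N l x b y +
 fixes e :: base and f :: "complex fls ^ 'n::finite ^ 'n" and K K2 :: nat and a :: "nat => base fls"
 assumes e: "e * e : I" and l: "l > 0" and K: "K \<le> K2"
  and HF: "Yp ^ K *s w : poly_vecs I ==> Yp ^ K2 *s (mmap cst f *v w) : poly_vecs I"
  and ap: "i < l ==> a i : polyfuns I" and asum: "(\<Sum>i<l. a i * G i ^ K2) = 1"
begin

abbreviation \<epsilon> where "\<epsilon> i \<equiv> a i * G i ^ K2"
abbreviation f' where "f' \<equiv> mmap cst f"
abbreviation P where "P i u \<equiv> f' *v vfpart ((1 - \<epsilon> i) *s u)"
abbreviation \<tau> where "\<tau> i u \<equiv> e *c (\<epsilon> i *s P i u)"

lemma eps_poly: "i < l ==> \<epsilon> i : polyfuns I"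
 by(intro polyfuns_mult[OF I] polyfuns_power[OF I] G_poly ap)

lemma eps_cross: "i < l ==> j < l ==> i \<noteq> j ==> Yp ^ K2 *s v : poly_vecs I ==> \<epsilon> j *s v : reg i"
 unfolding smult_assoc[symmetric] using G_cross[of i j K2 v] by(intro reg_smult[OF ap]) (auto simp: reg_def)

lemma eps_eps: "i < l ==> j < l ==> i \<noteq> j ==> Yp ^ K2 *s v : poly_vecs I ==> \<epsilon> i *s (\<epsilon> j *s v) : poly_vecs I"
 using submod_smult[OF Os polyfuns_mult[OF I ap ap] G_cross[of i j K2 v], of i j]
 by(simp add: smult_assoc mult_ac)

lemma compl: "i < l ==> (1 - \<epsilon> i) *s v = (\<Sum>j\<in>{..<l} - {i}. \<epsilon> j *s v)"
proof -
 assume "i < l"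
 hence "(\<Sum>j<l. \<epsilon> j) = \<epsilon> i + (\<Sum>j\<in>{..<l} - {i}. \<epsilon> j)" by(intro sum.remove) auto
 hence "1 - \<epsilon> i = (\<Sum>j\<in>{..<l} - {i}. \<epsilon> j)" unfolding asum by(simp only: diff_eq_eq add.commute)
 thus ?thesis by(simp only: smult_sum_left)
qed

lemma compl_reg: "i < l ==> Yp ^ K2 *s v : poly_vecs I ==> (1 - \<epsilon> i) *s v : reg i"
 unfolding compl by(rule csub_sum[OF reg_csub]) (auto intro!: eps_cross)

lemma eps_compl: "i < l ==> Yp ^ K2 *s v : poly_vecs I ==> \<epsilon> i *s ((1 - \<epsilon> i) *s v) : poly_vecs I"
 unfolding compl smult_sum_right by(rule csub_sum[OF Oc]) (auto intro!: eps_eps)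

text \<open>Removing the polynomial part does not increase pole orders, so \<open>f'\<close> alone
  is responsible for the passage from \<open>K\<close> to \<open>K2\<close>.\<close>

lemma P_bound: assumes i: "i < l" and u: "Yp ^ K *s u : poly_vecs I" shows "Yp ^ K2 *s P i u : poly_vecs I"
proof(rule HF)
 let ?v = "(1 - \<epsilon> i) *s u"
 have Y: "Yp ^ K : polyfuns I" unfolding Yp_def by(intro polyfuns_power[OF I] polyfuns_prod[OF I] Z_poly)
 have "(1 - \<epsilon> i) *s (Yp ^ K *s u) : poly_vecs I"
  by(intro submod_smult[OF Os _ u] polyfuns_diff[OF I] polyfuns_one[OF I] eps_poly i)
 hence 1: "Yp ^ K *s ?v : poly_vecs I" by(simp add: smult_assoc mult.commute)
 have "Yp ^ K *s (?v - vfpart ?v) : poly_vecs I" by(rule submod_smult[OF Os Y vfpart_poly[OF I]])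
 from csub_diff[OF Oc 1 this] show "Yp ^ K *s vfpart ?v : poly_vecs I" by(simp add: smult_diff)
qed

lemma e2: "e *c (A *v (e *c v)) : van I"
 using van_sq[OF I e] by(simp add: smult_mv)

text \<open>At infinity \<open>f'\<close> acts on all principal parts of \<open>u\<close> together;
  at \<open>y i\<close> it acts only on the principal part there. The surplus at \<open>y i\<close>
  is the principal part of \<open>f'\<close> applied to the parts at the other points, which is
  \<tau> i u. The congruence is verified at one point at a time, by \<open>reg_all\<close>.\<close>

lemma moved_polar:
 assumes u: "Yp ^ K *s u : poly_vecs I" and m: "moves_polar_part I N x l y e f u u'"
 shows "u' - nact e f' u + (\<Sum>j<l. \<tau> j u) : poly_vecs I"
proof(rule reg_all[OF l])
 fix i assume i: "i < l"
 note R = csub_add[OF reg_csub] csub_diff[OF reg_csub] csub_van[OF reg_csub] csub_smult[OF reg_csub]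
 have u2: "Yp ^ K2 *s u : poly_vecs I" by(rule Yp_raise[OF u K])
 obtain L L' fi w q where L: "vexpands I N x (cst (y i)) u L" "vexpands I N x (cst (y i)) u' L'"
  and fi: "ALL a b. expands {0} l y (y i) (f $ a $ b) (fi $ a $ b)"
  and w: "w : polar_vecs I" "L' - w : pow_vecs I" "q : pow_vecs I" "w - gact e (mmap cst fi) (L + q) : van I"
  using m i unfolding moves_polar_part_def inf_act_def gact_def by blast
 obtain v where v: "vexpands I N x (cst (y i)) v w" "vfpart v = v" "!!j. j < l ==> j \<noteq> i ==> v : reg j"
  using principal_part[OF i w(1)] by blast
 let ?F = "mmap cst fi"
 have fv: "vexpands I N x (cst (y i)) (gact e f' v) (gact e ?F w)"
  unfolding vexpands_def gact_def using v(1)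
  by(auto simp: matrix_vector_mult_def mmap_def vexpands_def intro!: expands_add[OF I] expands_mult[OF I] expands_const[OF I]
   expands_sum[OF I] expands_cst[OF i] fi[rule_format])
 \<comment> \<open>The vector \<open>v\<close> is the rational vector with principal part
   \<open>w\<close> at \<open>y i\<close>, and by hypothesis \<open>u'\<close> has the same
   principal part there.\<close>
 have 1: "u' - v : reg i" by(rule vexpands_reg[OF i vexpands_diff[OF L(2) v(1)] w(2)])
 \<comment> \<open>Apply the inverse 1 - e f of the group element to \<open>w\<close>: the result is
   \<open>L\<close> up to the power series vector \<open>q\<close>.\<close>
 have 2: "v - e *c (f' *v v) - u : reg i"
 proof -
  let ?d = "w - gact e ?F (L + q)"
  have "e *c (w - (L + q)) : van I"
  proof -
   have "e *c (w - (L + q)) = e *c ?d + e *c (mat 1 *v (e *c (?F *v (L + q))))"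
    by(simp add: gact_def smult_diff smult_add)
   thus ?thesis using van_add[OF I van_smult[OF I w(4), of "fls_const e"] e2[of "mat 1" "?F *v (L + q)"]] by(simp only:)
  qed
  from van_mv[OF I this, of ?F] have "e *c (?F *v w) - e *c (?F *v (L + q)) : van I"
   by(simp add: smult_mv mv_diff smult_diff)
  from van_diff[OF I w(4) this] have "w - e *c (?F *v w) - L - q : van I"
   by(simp add: gact_def algebra_simps)
  hence c: "(w - (gact e ?F w - w)) - L - q : van I" by(simp add: gact_def algebra_simps)
  have "vexpands I N x (cst (y i)) ((v - (gact e f' v - v)) - u) ((w - (gact e ?F w - w)) - L)"
   by(intro vexpands_diff v(1) fv L(1))
  from vexpands_reg[OF i vexpands_cong[OF this c] w(3)] show ?thesis by(simp add: gact_def algebra_simps)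
 qed
 \<comment> \<open>To first order \<open>v\<close> is the principal part of \<open>u\<close> at
   \<open>y i\<close>, which \<epsilon> i cuts out. The difference is regular at every point, hence
   polynomial; as it also vanishes at infinity, it is zero modulo \<open>I\<close>.\<close>
 let ?z = "e *c v - e *c vfpart (\<epsilon> i *s u)"
 have "?z : poly_vecs I"
 proof(rule reg_all[OF l])
  fix j assume j: "j < l"
  have r: "\<epsilon> i *s u - vfpart (\<epsilon> i *s u) : reg j" for j by(rule reg_poly[OF vfpart_poly[OF I]])
  show "?z : reg j"
  proof(cases "j = i")
   case True
   have "?z = e *c (v - e *c (f' *v v) - u) + e *c (f' *v (e *c v)) +
     e *c ((1 - \<epsilon> i) *s u) + e *c (\<epsilon> i *s u - vfpart (\<epsilon> i *s u))"
    by(simp add: smult_diff diff_smult smult_mv)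
   also have "\<dots> : reg i" by(rule R(1)[OF R(1)[OF R(1)[OF R(4)[OF 2] R(3)[OF e2]] R(4)[OF compl_reg[OF i u2]]] R(4)[OF r]])
   finally show ?thesis using True by(simp only:)
  next
   case False
   have "?z = e *c v - e *c (\<epsilon> i *s u) + e *c (\<epsilon> i *s u - vfpart (\<epsilon> i *s u))"
    by(simp add: smult_diff)
   also have "\<dots> : reg j" by(rule R(1)[OF R(2)[OF R(4)[OF v(3)[OF j False]] R(4)[OF eps_cross[OF j i False u2]]] R(4)[OF r]])
   finally show ?thesis .
  qed
 qed
 from poly_vfpart[OF I this] have "?z : van I" by(simp add: vfpart_diff vfpart_smult v(2) vfpart_idem)
 from van_mv[OF I this, of f']
 have 3: "e *c (f' *v v) - e *c (f' *v vfpart (\<epsilon> i *s u)) : van I"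
  by(simp add: mv_diff smult_mv)
 have fP: "f' *v vfpart u = P i u + f' *v vfpart (\<epsilon> i *s u)"
  by(simp add: diff_smult vfpart_diff mv_diff)
 have 4: "f' *v vfpart u - vfpart (f' *v vfpart u) : reg i" by(rule reg_poly[OF vfpart_poly[OF I]])
 have 5: "(1 - \<epsilon> i) *s P i u : reg i" by(rule compl_reg[OF i P_bound[OF i u]])
 have 6: "(\<Sum>j\<in>{..<l} - {i}. \<tau> j u) : reg i"
  by(intro csub_sum[OF reg_csub] R(4) eps_cross) (use i P_bound u in auto)
 \<comment> \<open>A decomposition into terms regular at \<open>y i\<close>. The term with index
   \<open>i\<close> of the sum cancels the part of \<open>f'\<close> applied to the other principal
   parts, up to the factor 1 - \<epsilon> i.\<close>
 have "u' - nact e f' u + (\<Sum>j<l. \<tau> j u) = (u' - v) + (v - e *c (f' *v v) - u) +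
   (e *c (f' *v v) - e *c (f' *v vfpart (\<epsilon> i *s u))) +
   e *c (f' *v vfpart u - vfpart (f' *v vfpart u)) - e *c ((1 - \<epsilon> i) *s P i u) + (\<Sum>j\<in>{..<l} - {i}. \<tau> j u)"
  using i by(simp add: sum.remove[of "{..<l}" i] nact_def fP smult_diff smult_add diff_smult)
 also have "\<dots> : reg i" by(rule R(1)[OF R(2)[OF R(1)[OF R(1)[OF R(1)[OF 1 2] R(3)[OF 3]] R(4)[OF 4]] R(4)[OF 5]] 6])
 finally show "u' - nact e f' u + (\<Sum>j<l. \<tau> j u) : reg i" .
qed

lemma tau_add: "\<tau> i (u + v) = \<tau> i u + \<tau> i v"
 by(simp add: smult_add vfpart_add mv_add)

lemma tau_smult: "\<tau> i (c *c v) = c *c \<tau> i v"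
proof -
 have "(1 - \<epsilon> i) *s (c *c v) = c *c ((1 - \<epsilon> i) *s v)" by(simp add: smult_assoc mult.commute)
 hence "P i (c *c v) = c *c P i v" by(simp add: vfpart_smult smult_mv)
 thus ?thesis by(simp add: smult_assoc mult_ac)
qed

lemma tau_poly: assumes "i < l" "v : poly_vecs I" shows "\<tau> i v : poly_vecs I"
proof -
 have "(1 - \<epsilon> i) *s v : poly_vecs I"
  by(intro submod_smult[OF Os _ assms(2)] polyfuns_diff[OF I] polyfuns_one[OF I] eps_poly assms(1))
 from poly_vfpart[OF I this] show ?thesis
  by(intro csub_van[OF Oc] van_smult[OF I] van_mv[OF I])
qed

lemma tau_e: "\<tau> i (e *c v) : van I"
 unfolding tau_smult using van_sq[OF I e] .

context
 fixes us :: "(base fls ^ 'n) list" and B :: "(base fls ^ 'n) set"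
 assumes fr: "frame I B (poly_vecs I) us" and B: "submod I B"
begin

lemma op_compose:
 assumes T: "!!u v. T (u + v) = T u + T v" "!!c v. T (c *c v) = c *c T v" "!!v. v : poly_vecs I ==> T v : poly_vecs I"
  and M: "ALL b<length us. T (us ! b) - lcomb (M b) us : poly_vecs I" and v: "v - lcomb c us : poly_vecs I"
 shows "T v - lcomb (%d. \<Sum>b<length us. c b * M b d) us : poly_vecs I"
proof -
 have "T (v - lcomb c us + lcomb c us) = T (v - lcomb c us) + T (lcomb c us)" by(rule T(1))
 moreover have "T (lcomb c us) = lcomb c (map T us)" by(rule lcomb_map) (simp_all add: T)
 ultimately have "T v - lcomb c (map T us) : poly_vecs I" using T(3)[OF v] by simp
 moreover have "lcomb c (map T us) - lcomb (%d. \<Sum>b<length (map T us). c b * M b d) us : poly_vecs I"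
  by(rule lcomb_lcomb[OF Oc]) (use M in simp)
 ultimately show ?thesis using csub_trans[OF Oc] by simp
qed

text \<open>The matrix \<open>A i\<close> of \<tau> i need not be \<open>e\<close> times a matrix
  over the ring, since \<tau> i alone, and not the operator before multiplication by
  \<open>e\<close>, preserves \<open>B\<close>. Instead let \<open>E\<close> be the matrix of
  \<epsilon> i. Then A E = A and E A = 0, and det (1 - A E) = det (1 - E A) gives det (1 - A) = 1.
  Products of two such matrices vanish because \<open>e\<close> has square zero, so the determinant
  for the sum is the product of the determinants.\<close>

lemma moved_change:
 assumes len: "length us' = length us" and \<tau>B: "!!i b. i < l ==> b < length us ==> \<tau> i (us ! b) : B"
  and Y: "!!b. b < length us ==> Yp ^ K *s (us ! b) : poly_vecs I"
  and mv: "!!b. b < length us ==> us' ! b - nact e f' (us ! b) + (\<Sum>j<l. \<tau> j (us ! b)) : poly_vecs I"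
 shows "EX H. changes_frame (poly_vecs I) H (map (nact e f') us) us' \<and> frame_det (length us) H - 1 : I"
proof -
 let ?r = "length us" and ?d = "%i j. if i = j then 1 else (0::base)"
 note Bc = submod_csub[OF I B]
 have "ALL i. EX A. i < l --> (ALL b<?r. \<tau> i (us ! b) - lcomb (A b) us : poly_vecs I)"
 proof(intro allI)
  fix i show "EX A. i < l --> (ALL b<?r. \<tau> i (us ! b) - lcomb (A b) us : poly_vecs I)"
  proof(cases "i < l")
   case True
   have "set (map (\<tau> i) us) \<subseteq> B" using \<tau>B[OF True] by(auto simp: in_set_conv_nth)
   from frame_matrix[OF fr this] show ?thesis by auto
  qed simp
 qed
 from choice[OF this] obtain A where A: "!!i b. i < l ==> b < ?r ==> \<tau> i (us ! b) - lcomb (A i b) us : poly_vecs I" by blast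
 have usB: "us ! b : B" if "b < ?r" for b using fr that by(auto simp: frame_iff)
 have det: "frame_det ?r (%b c. ?d b c - A i b c) - 1 : I" if i: "i < l" for i
 proof -
  have "\<epsilon> i *s us ! b : B" if "b < ?r" for b by(rule submod_smult[OF B eps_poly[OF i] usB[OF that]])
  hence "set (map (%v. \<epsilon> i *s v) us) \<subseteq> B" by(auto simp: in_set_conv_nth)
  from frame_matrix[OF fr this] obtain E where E: "ALL b<?r. \<epsilon> i *s us ! b - lcomb (E b) us : poly_vecs I" by auto
  \<comment> \<open>Multiplying by \<epsilon> i first leaves nothing away from \<open>y i\<close>: 1
    - \<epsilon> i times \<epsilon> i times the vector is polynomial, and its principal part
    vanishes.\<close>
  have EA: "(\<Sum>k<?r. E b k * A i k c) : I" if bc: "b < ?r" "c < ?r" for b c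
  proof -
   have "\<tau> i (\<epsilon> i *s us ! b) - lcomb (%c. \<Sum>k<?r. E b k * A i k c) us : poly_vecs I"
    by(rule op_compose[where T = "\<tau> i", OF tau_add tau_smult tau_poly[OF i]]) (use A[OF i] E bc in auto)
   moreover have "\<tau> i (\<epsilon> i *s us ! b) : poly_vecs I"
   proof -
    have "\<epsilon> i *s ((1 - \<epsilon> i) *s us ! b) : poly_vecs I" by(rule eps_compl[OF i Yp_raise[OF Y[OF bc(1)] K]])
    hence "(1 - \<epsilon> i) *s (\<epsilon> i *s us ! b) : poly_vecs I" by(simp add: smult_assoc mult.commute)
    from poly_vfpart[OF I this] show ?thesis by(intro csub_van[OF Oc] van_smult[OF I] van_mv[OF I])
   qed
   ultimately have "lcomb (%c. \<Sum>k<?r. E b k * A i k c) us : poly_vecs I" using csub_cong[OF Oc] by blast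
   from frame_indep[OF fr this bc(2)] show ?thesis .
  qed
  \<comment> \<open>The image of \<tau> i is concentrated at \<open>y i\<close>, where \<epsilon> i
    acts as the identity modulo polynomial vectors.\<close>
  have AE: "(\<Sum>k<?r. A i b k * E k c) - A i b c : I" if bc: "b < ?r" "c < ?r" for b c
  proof -
   have "\<epsilon> i *s \<tau> i (us ! b) - lcomb (%c. \<Sum>k<?r. A i b k * E k c) us : poly_vecs I"
    by(rule op_compose[where T = "%v. \<epsilon> i *s v"])
     (use E A[OF i bc(1)] submod_smult[OF Os eps_poly[OF i]] in \<open>auto simp: smult_add smult_assoc mult.commute\<close>)
   moreover have "\<tau> i (us ! b) - \<epsilon> i *s \<tau> i (us ! b) : poly_vecs I"
   proof -
    have "e *c (\<epsilon> i *s ((1 - \<epsilon> i) *s P i (us ! b))) : poly_vecs I"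
     by(intro csub_smult[OF Oc] eps_compl[OF i] P_bound[OF i] Y bc)
    moreover have "c *s (E *s w) - E *s (c *s (E *s w)) = c *s (E *s ((1 - E) *s w))" for c E and w :: "base fls ^ 'n"
     by(simp add: vec_eq_iff algebra_simps)
    ultimately show ?thesis by(simp only:)
   qed
   ultimately have "lcomb (A i b) us - lcomb (%c. \<Sum>k<?r. A i b k * E k c) us : poly_vecs I"
    using csub_trans[OF Oc csub_sym[OF Oc A[OF i bc(1)]] csub_trans[OF Oc]] by blast
   from cong_sym[OF I frame_uniq[OF fr Oc this bc(2)]] show ?thesis .
  qed
  have "frame_det ?r (%b c. ?d b c - (\<Sum>k<?r. A i b k * E k c)) - frame_det ?r (%b c. ?d b c - A i b c) : I"
   using ideal_uminus[OF I AE] by(intro frame_det_cong_ideal[OF I]) (simp add: algebra_simps)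
  moreover have "frame_det ?r (%b c. ?d b c - (\<Sum>k<?r. E b k * A i k c)) - frame_det ?r ?d : I"
   using ideal_uminus[OF I EA] by(intro frame_det_cong_ideal[OF I]) simp
  ultimately show ?thesis
   unfolding frame_det_one_minus_commute[of ?r "A i"] frame_det_id using cong_trans[OF I cong_sym[OF I]] by blast
 qed
 have AA: "(\<Sum>k<?r. A i b k * A j k c) : I" if ij: "i < l" "j < l" and bc: "b < ?r" "c < ?r" for i j b c
 proof -
  have "\<tau> j (\<tau> i (us ! b)) - lcomb (%c. \<Sum>k<?r. A i b k * A j k c) us : poly_vecs I"
   by(rule op_compose[where T = "\<tau> j", OF tau_add tau_smult tau_poly[OF ij(2)]]) (use A[OF ij(2)] A[OF ij(1)] bc in auto)
  hence "lcomb (%c. \<Sum>k<?r. A i b k * A j k c) us : poly_vecs I"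
   using csub_cong[OF Oc] csub_van[OF Oc tau_e] by blast
  from frame_indep[OF fr this bc(2)] show ?thesis .
 qed
 define H where "H m b c = ?d b c - (\<Sum>i<m. A i b c)" for m b c
 have detH: "frame_det ?r (H m) - 1 : I" if "m \<le> l" for m
  using that
 proof(induction m)
  case 0
  thus ?case by(simp add: H_def frame_det_id ideal_zero[OF I])
 next
  case (Suc m)
  have "(\<Sum>k<?r. H m b k * (?d k c - A m k c)) - H (Suc m) b c : I" if bc: "b < ?r" "c < ?r" for b c
  proof -
   have "(\<Sum>k<?r. H m b k * (?d k c - A m k c)) = (\<Sum>k<?r. H m b k * ?d k c) - (\<Sum>k<?r. ?d b k * A m k c) + (\<Sum>k<?r. \<Sum>i<m. A i b k * A m k c)"
    by(simp add: H_def algebra_simps sum.distrib sum_subtractf sum_distrib_left)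
   also have "\<dots> = H (Suc m) b c + (\<Sum>i<m. \<Sum>k<?r. A i b k * A m k c)"
    using bc by(subst sum.swap) (simp add: mult_delta_left mult_delta_right H_def)
   finally show ?thesis using ideal_sum[OF I, of "{..<m}" "%i. \<Sum>k<?r. A i b k * A m k c"] AA[OF _ _ bc] Suc.prems by simp
  qed
  hence 1: "frame_det ?r (H m) * frame_det ?r (%b c. ?d b c - A m b c) - frame_det ?r (H (Suc m)) : I"
   unfolding frame_det_mult by(rule frame_det_cong_ideal[OF I])
  have "frame_det ?r (H m) * frame_det ?r (%b c. ?d b c - A m b c) - 1 * 1 : I"
   using Suc det[of m] by(intro cong_mult[OF I]) auto
  from cong_trans[OF I cong_sym[OF I 1] this] show ?case by simp
 qed
 have "us' ! b - lcomb (H l b) (map (nact e f') us) : poly_vecs I" if b: "b < ?r" for b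
 proof -
  let ?u = "us ! b" and ?S = "\<Sum>i<l. \<tau> i (us ! b)" and ?c = "%c. \<Sum>i<l. A i b c"
  note lin = linmap_nact[OF I e, of f']
  have nO: "nact e f' v : poly_vecs I" if "v : poly_vecs I" for v
   using mvset_in[OF lin Oc, of v] that mvset_nact_poly[OF I e, of f'] by simp
  have "lcomb (H l b) us = ?u - lcomb ?c us"
  proof -
   have "lcomb (H l b) us = lcomb (%c. (if c = b then 1 else 0) - ?c c) us" by(rule lcomb_cong) (auto simp: H_def)
   thus ?thesis by(simp add: lcomb_diff lcomb_delta[OF b])
  qed
  hence 1: "lcomb (H l b) (map (nact e f') us) = nact e f' ?u - nact e f' (lcomb ?c us)"
   by(simp add: linmap_lcomb[OF lin, symmetric] linmap_diff[OF lin])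
  have "?S - lcomb ?c us = (\<Sum>i<l. \<tau> i ?u - lcomb (A i b) us)" by(simp add: lcomb_sum sum_subtractf)
  also have "\<dots> : poly_vecs I" using A b by(intro csub_sum[OF Oc]) auto
  finally have 2: "nact e f' ?S - nact e f' (lcomb ?c us) : poly_vecs I"
   using nO by(simp flip: linmap_diff[OF lin])
  have "nact e f' ?S - ?S : poly_vecs I"
  proof -
   have "?S = e *c (\<Sum>i<l. \<epsilon> i *s P i ?u)" by(simp add: smult_sum_right)
   moreover have "nact e f' (e *c v) - e *c v : poly_vecs I" for v
    using csub_van[OF Oc van_sq[OF I e]] by(simp add: nact_def vfpart_smult smult_mv)
   ultimately show ?thesis by(simp only:)
  qed
  from csub_trans[OF Oc csub_sym[OF Oc this] 2] have "?S - nact e f' (lcomb ?c us) : poly_vecs I" .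
  from csub_diff[OF Oc mv[OF b] this] show ?thesis unfolding 1 by(simp add: algebra_simps)
 qed
 hence "changes_frame (poly_vecs I) (H l) (map (nact e f') us) us'"
  using len by(simp add: changes_frame_iff)
 thus ?thesis using detH[of l] by blast
qed

end

text \<open>Modulo polynomial vectors, \<epsilon> i fixes \<tau> i u and kills the other summands,
  so multiplying the sum by it isolates one summand.\<close>

lemma tau_mem:
 assumes B: "submod I B" "poly_vecs I \<subseteq> B" and u: "Yp ^ K *s u : poly_vecs I" and S: "(\<Sum>j<l. \<tau> j u) : B" and i: "i < l"
 shows "\<tau> i u : B"
proof -
 note Bc = submod_csub[OF I B(1)]
 have 1: "\<epsilon> i *s \<tau> j u : B" if "j : {..<l} - {i}" for j
 proof -
  have "\<epsilon> i *s \<tau> j u = e *c (\<epsilon> i *s (\<epsilon> j *s P j u))" by(simp add: smult_assoc mult_ac)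
  thus ?thesis using csub_smult[OF Oc eps_eps[OF i _ _ P_bound[OF _ u], of j j]] that B(2) by auto
 qed
 have "c *s (E *s w) - E *s (c *s (E *s w)) = c *s (E *s ((1 - E) *s w))" for c E and w :: "base fls ^ 'n"
  by(simp add: vec_eq_iff algebra_simps)
 hence 2: "\<tau> i u - \<epsilon> i *s \<tau> i u : B"
  using csub_smult[OF Oc eps_compl[OF i P_bound[OF i u]], of e] B(2) by auto
 have "(\<Sum>j<l. \<tau> j u) = \<tau> i u + (\<Sum>j\<in>{..<l} - {i}. \<tau> j u)" using i by(intro sum.remove) auto
 hence "\<epsilon> i *s (\<Sum>j<l. \<tau> j u) - (\<Sum>j\<in>{..<l} - {i}. \<epsilon> i *s \<tau> j u) = \<epsilon> i *s \<tau> i u"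
  by(simp only: smult_add smult_sum_right) simp
 moreover have "\<epsilon> i *s (\<Sum>j<l. \<tau> j u) - (\<Sum>j\<in>{..<l} - {i}. \<epsilon> i *s \<tau> j u) : B"
  by(rule csub_diff[OF Bc submod_smult[OF B(1) eps_poly[OF i] S] csub_sum[OF Bc 1]])
 ultimately have "\<epsilon> i *s \<tau> i u : B" by simp
 from csub_add[OF Bc 2 this] show ?thesis by simp
qed

text \<open>Write e w as 1 + e f applied to some u in \<open>A\<close>. Multiplying by
  \<open>e\<close> shows that e u is zero modulo \<open>I\<close>, so 1 + e f fixes u and e w equals
  u.\<close>

lemma small_mem:
 assumes A: "csub I A" and v: "e *c w : mvset I (gact e f') A"
 shows "e *c w : A"
proof -
 obtain u where u: "u : A" "e *c w - gact e f' u : van I" using v by(auto simp: mvset_def)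
 have "e *c (e *c w) - e *c gact e f' u : van I"
  using van_smult[OF I u(2)] by(simp add: smult_diff)
 hence "e *c gact e f' u : van I" using van_sq[OF I e] csub_cong[OF csub_self_van[OF I]] by blast
 hence "e *c u + e *c (e *c (f' *v u)) : van I" by(simp add: gact_def smult_add)
 from van_diff[OF I this van_sq[OF I e, of "f' *v u"]] have "e *c u : van I" by simp
 from van_add[OF I u(2) van_mv[OF I this, of f']] have "e *c w - u : van I" by(simp add: gact_def smult_mv)
 thus ?thesis using u(1) csub_cong[OF A csub_van[OF A]] by blast
qed

end

section \<open>Invariance of sections of lowest weight on a fibre\<close>

lemma covering_points:
 fixes l N :: nat
 assumes "inj_on y {..<l}" "(\<Sum>i<l. d i) = N" "ALL i<l. card {j. j < N \<and> b j = y i} = d i" "j < N"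
 shows "EX i<l. b j = y i"
proof -
 let ?A = "%i. {j. j < N \<and> b j = y i}"
 have "card (\<Union>i\<in>{..<l}. ?A i) = (\<Sum>i<l. card (?A i))"
  using assms(1) by(intro card_UN_disjoint) (auto simp: inj_on_def)
 hence "card (\<Union>i\<in>{..<l}. ?A i) = card {..<N}" using assms(2,3) by simp
 from card_subset_eq[OF _ _ this] have "(\<Union>i\<in>{..<l}. ?A i) = {..<N}" by auto
 thus ?thesis using assms(4) by blast
qed

text \<open>Clearing denominators by \<open>m\<close> copies of the divisor leaves a polynomial
  numerator. Vanishing at infinity bounds its degree strictly below \<open>m * N\<close>, which is
  exactly the range of \<open>a\<close> where the derivative lowers the weight.\<close>

lemma (in constant_points) g0_expand:
 fixes f :: "complex fls ^ 'n::finite ^ 'n"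
 assumes f: "f : g0 l y"
 shows "EX m Y. mmap cst f = (\<Sum>a<m * N. fam N m a (Y a) (cst o b)) \<and> (ALL i j. Yp ^ m * mmap cst f $ i $ j : polyfuns I)"
proof -
 interpret c: ring_map cst by(rule ring_map_cst)
 interpret fc: ring_map "fls_map cst" by(rule c.ring_map_fls)
 let ?f = "mmap cst f" and ?D = "divisor_eq N (cst o b) :: base fls"
 have I0: "is_ideal {0 :: complex}" "is_ideal {0 :: base}" by(simp_all add: is_ideal_zero)
 have "EX m. ALL ij. divisor_eq l y ^ m * f $ fst ij $ snd ij : polyfuns {0}"
 proof(rule uniform_exponent)
  fix ij show "EX m. divisor_eq l y ^ m * f $ fst ij $ snd ij : polyfuns {0}" using f by(simp add: g0_def ratfuns_def)
 next
  fix m m' :: nat and ij assume a: "divisor_eq l y ^ m * f $ fst ij $ snd ij : polyfuns {0}" "m \<le> m'"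
  have "divisor_eq l y ^ m' = divisor_eq l y ^ (m' - m) * divisor_eq l y ^ m" using a(2) by(simp flip: power_add)
  thus "divisor_eq l y ^ m' * f $ fst ij $ snd ij : polyfuns {0}"
   using polyfuns_mult[OF I0(1) polyfuns_power[OF I0(1) polyfuns_divisor[OF I0(1)]] a(1), of l y "m' - m"] by(simp only: mult.assoc)
 qed
 then obtain m where m: "!!i j. divisor_eq l y ^ m * f $ i $ j : polyfuns {0}" by(metis fst_conv snd_conv)
 have Y: "fls_map cst (divisor_eq l y) = Yp" by(simp add: c.map_divisor) (simp add: divisor_eq_def Yp_def pev_lin)
 have Ym: "Yp ^ m * ?f $ i $ j = fls_map cst (divisor_eq l y ^ m * f $ i $ j)" for i j
  by(simp add: mmap_def fc.mult fc.power Y)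
 have Yf: "Yp ^ m * ?f $ i $ j : polyfuns {0}" for i j
  unfolding Ym using m[of i j] by(simp add: polyfuns_def c.map_nth c.zero)
 obtain C where C: "(\<Prod>j<N. lin (b j)) = (\<Prod>i<l. lin (y i)) * C" using divisor_factor by blast
 have "?D = pev fls_X_inv (\<Prod>j<N. lin (b j))" by(simp add: divisor_eq_def pev.prod pev_lin)
 also have "\<dots> = pev fls_X_inv C * Yp" unfolding C by(simp add: Yp_def pev.mult pev.prod)
 finally have Df: "?D ^ m * ?f $ i $ j : polyfuns {0}" for i j
  using polyfuns_mult[OF I0(2) polyfuns_power[OF I0(2) pev_polyfuns[OF I0(2) polyfuns_X_inv[OF I0(2)]]] Yf]
  by(simp add: power_mult_distrib mult.assoc)
 define Y where "Y a = (\<chi> i j. fls_nth (divisor_eq N b ^ m * f $ i $ j) (- int a))" for a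
 have D: "?D ^ m * ?f $ i $ j = fls_map cst (divisor_eq N b ^ m * f $ i $ j)" for i j
  by(simp add: mmap_def fc.mult fc.power c.map_divisor)
 have "?D ^ m * ?f $ i $ j = (\<Sum>a<m * N. fls_const (cst (Y a $ i $ j)) * fls_X_inv ^ a)" for i j
 proof(rule fls_eqI)
  fix n
  let ?h = "divisor_eq N b ^ m * f $ i $ j"
  have R: "fls_nth (\<Sum>a<m * N. fls_const (cst (Y a $ i $ j)) * fls_X_inv ^ a) n = (\<Sum>a<m * N. if a = nat (- n) \<and> n \<le> 0 then cst (fls_nth ?h n) else 0)"
   unfolding Y_def by(auto simp: fls_nth_sum X_inv_power_nth intro!: sum.cong)
  \<comment> \<open>The divisor factor starts in degree - m N and the entries of \<open>f\<close> in
    degree 1, so the coefficient at - m N vanishes as well.\<close>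
  have "fls_nth ?h n = 0" if "n \<le> - int (m * N)"
  proof -
   have "fls_nth (divisor_eq N b ^ k) j = 0" if "j < - int (k * N)" for k j
    using that
   proof(induction k arbitrary: j)
    case (Suc k)
    show ?case unfolding power_Suc
     by(rule nth_prod_low[where a = "- int N" and b = "- int (k * N)"]) (use Suc divisor_nth_low in \<open>auto simp: algebra_simps\<close>)
   qed auto
   thus ?thesis using f that by(intro nth_prod_low[where a = "- int (m * N)" and b = 1]) (auto simp: g0_def)
  qed
  moreover have "cst (fls_nth ?h n) = 0" if "n > 0"
   using Df[of i j] that unfolding D by(simp add: polyfuns_def c.map_nth)
  moreover have "n \<le> - int (m * N)" if "n \<le> 0" "\<not> nat (- n) < m * N" using that by linarith
  moreover have "(\<Sum>a<m * N. if a = nat (- n) \<and> n \<le> 0 then cst (fls_nth ?h n) else 0) = (if n \<le> 0 \<and> nat (- n) < m * N then cst (fls_nth ?h n) else 0)"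
   by(cases "n \<le> 0") simp_all
  ultimately show "fls_nth (?D ^ m * ?f $ i $ j) n = fls_nth (\<Sum>a<m * N. fls_const (cst (Y a $ i $ j)) * fls_X_inv ^ a) n"
   unfolding R unfolding D c.map_nth using c.zero by(metis not_le)
 qed
 hence "?f $ i $ j = dinv N (cst o b) ^ m * (\<Sum>a<m * N. fls_const (cst (Y a $ i $ j)) * fls_X_inv ^ a)" for i j
  using dinv_pow2(2)[of N "cst o b" m "?f $ i $ j"] by simp
 hence "?f = (\<Sum>a<m * N. fam N m a (Y a) (cst o b))"
  by(simp add: vec_eq_iff fam_sum_nth) (simp add: fam_def sum_distrib_left mult_ac)
 moreover have "Yp ^ m * ?f $ i $ j : polyfuns I" for i j
  using Yf[of i j] ideal_zero[OF I] by(auto simp: polyfuns_def)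
 ultimately show ?thesis by blast
qed

text \<open>Three points are compared with \<open>p'\<close>: the motion by \<open>f\<close>,
  ordered at infinity, differs from \<open>p'\<close> by a change of frames of determinant 1; the
  motion by the homogeneous families agrees with it modulo \<open>alg p\<close>; and the latter
  motion does not change \<open>s\<close>.\<close>

lemma lowest_weight_invariant:
 fixes s :: "'n::finite framed_point => base" and p p' :: "'n framed_point"
 assumes N: "N > 0" and w: "is_smallest_weight TYPE('n) N k w" "s : weight_space N k w"
  and p: "p : Gr1 N" and p': "p' : Gr1 N" and c: "constant_points (alg p) N l (pts p) b y"
  and f: "f : g0 l y" and e: "e * e : alg p" and mv: "is_moved N l y e f p p'"
 shows "s p' - s p : alg p"
proof -
 let ?I = "alg p" and ?f = "mmap cst f"
 interpret constant_points ?I N l "pts p" b y by(rule c)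
 note d = Gr1D[OF p]
 have s: "s : sections N k (Gr1 N)" using w(2) by(simp add: weight_space_def)
 have l: "l > 0" using bl[of 0] N by auto
 obtain m Y where Y: "?f = (\<Sum>a<m * N. fam N m a (Y a) (cst o b))" and Yf: "!!i j. Yp ^ m * ?f $ i $ j : polyfuns ?I"
  using g0_expand[OF f] by blast
 \<comment> \<open>The families at the actual coordinates, which agree modulo \<open>alg p\<close>
   with the constants of the fibre. Only in this form are they part of a family over all
   configurations.\<close>
 let ?F = "\<Sum>a<m * N. fam N m a (Y a) (pts p)"
 have FF: "?F $ i $ j - ?f $ i $ j : cof ?I" for i j
  unfolding Y fam_sum_nth by(intro cong_sum[OF cI] fam_cong[OF I]) (simp add: xb)
 have rF: "ratmat ?I N (pts p) ?F" by(rule ratmat_fam_sum[OF I])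
 then obtain n where n: "divisor_eq N (pts p) ^ n * ?F $ i $ j : polyfuns ?I" for i j unfolding ratmat_def by blast
 have rf: "ratmat ?I N (pts p) ?f" unfolding ratmat_def
 proof(intro exI allI)
  fix i j
  have "divisor_eq N (pts p) ^ n * ?F $ i $ j - divisor_eq N (pts p) ^ n * ?f $ i $ j : cof ?I"
   using ideal_mult[OF cI FF] by(simp flip: right_diff_distrib)
  from polyfuns_cong[OF I this] n show "divisor_eq N (pts p) ^ n * ?f $ i $ j : polyfuns ?I" by blast
 qed
 have ia: "inf_act e f = gact e ?f" by(simp add: fun_eq_iff inf_act_def gact_def)
 have eq: "alg p' = ?I" "pts p' = pts p" "lat p' = mvset ?I (gact e ?f) (lat p)" "big p' = mvset ?I (gact e ?f) (big p)"
  and O: "list_all2 (moves_polar_part ?I N (pts p) l y e f) (frO p) (frO p')"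
  and E: "list_all2 (%v v'. v' - gact e ?f v : lat p') (frE p) (frE p')"
  using mv unfolding is_moved_def ia mvset_def by blast+
 note d' = Gr1D[OF p', unfolded eq(1,2)]
 have len: "length (frO p') = length (frO p)" "length (frE p') = length (frE p)" using O E by(auto dest: list_all2_lengthD)
 obtain M where M: "big p \<subseteq> Om ?I N (pts p) M" using frame_bounded[OF d(1,7,6)] by blast
 \<comment> \<open>A pole order along \<open>Yp\<close> that bounds all of \<open>big p\<close>, by
   \<open>Om_Yp\<close>; applying \<open>f\<close> raises it by at most \<open>m\<close>.\<close>
 define K where "K = N * M"
 obtain a where a: "!!i. i < l ==> a i : polyfuns ?I" "(\<Sum>i<l. a i * G i ^ (K + m)) = 1"
  using partition_of_unity[OF l, of "K + m"] by blast
 interpret moved_frame ?I N l "pts p" b y e f K "K + m" a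
 proof unfold_locales
  fix w :: "base fls ^ 'n" assume w: "Yp ^ K *s w : poly_vecs ?I"
  have "Yp ^ (K + m) * (?f *v w) $ i = (\<Sum>j\<in>UNIV. (Yp ^ m * ?f $ i $ j) * (Yp ^ K * w $ j))" for i
   by(simp add: matrix_vector_mult_def sum_distrib_left power_add mult_ac)
  thus "Yp ^ (K + m) *s (?f *v w) : poly_vecs ?I"
   using w Yf by(auto simp: poly_vecs_def intro!: polyfuns_sum[OF I] polyfuns_mult[OF I, of "Yp ^ m * _" "Yp ^ K * _"])
 qed (use e l a in auto)
 \<comment> \<open>Extracted from the existence of \<open>p'\<close>: its \<Omega> is the image of
   that of \<open>p\<close> and contains O^n.\<close>
 have mf: "movable e ?f p" unfolding movable_def
 proof
  fix w :: "base fls ^ 'n" assume wO: "w : poly_vecs ?I"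
  then obtain v where v: "v : big p" "w - gact e ?f v : van ?I" using d'(11) eq(4) by(auto simp: mvset_def)
  have "e *c (w - v) : van ?I"
   using van_add[OF I van_smult[OF I v(2), of "fls_const e"] van_sq[OF I e, of "?f *v v"]]
   by(simp add: gact_def smult_diff smult_add)
  from van_mv[OF I this, of ?f] have "e *c (?f *v w) - e *c (?f *v v) : van ?I"
   by(simp add: smult_mv mv_diff smult_diff)
  from van_add[OF I this van_uminus[OF I v(2)]] have "e *c (?f *v w) - (w - v) : van ?I"
   by(simp add: gact_def algebra_simps)
  moreover have "w - v : big p" using csub_diff[OF d(9)] d(11) wO v(1) by blast
  ultimately show "e *c (?f *v w) : big p" using csub_cong[OF d(9) csub_van[OF d(9)]] by blast
 qed
 have mF: "movable e ?F p" unfolding movable_def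
 proof
  fix w :: "base fls ^ 'n" assume w: "w : poly_vecs ?I"
  have "(?F - ?f) *v w : van ?I" by(rule van_mv_left[OF I]) (simp only: vector_minus_component FF)
  from csub_van[OF d(9) van_smult[OF I this, of "fls_const e"]]
  have "e *c (?F *v w) - e *c (?f *v w) : big p"
   by(simp add: diff_mv smult_diff)
  thus "e *c (?F *v w) : big p" using mf w csub_cong[OF d(9)] by(auto simp: movable_def)
 qed
 let ?p = "mv_point e ?f p"
 have p1: "?p : Gr1 N" by(rule mv_point_Gr1[OF p e rf mf])
 have 1: "s ?p - s p : ?I"
  using cong_trans[OF I mv_point_cong[OF s p e rF rf FF mF mf] fam_sum_invariance[OF N s order_refl w p e mF]] .
 have uB: "frO p ! j : big p" if "j < length (frO p)" for j using d(7) that by(auto simp: frame_iff)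
 have uY: "Yp ^ K *s (frO p ! j) : poly_vecs ?I" if "j < length (frO p)" for j
  unfolding K_def using uB[OF that] M by(intro Om_Yp) blast
 have mv': "frO p' ! j - nact e ?f (frO p ! j) + (\<Sum>i<l. \<tau> i (frO p ! j)) : poly_vecs ?I" if "j < length (frO p)" for j
  using moved_polar[OF uY[OF that]] O that by(simp add: list_all2_conv_all_nth)
 \<comment> \<open>The sum of the \<tau> i lies in the moved \<Omega> by comparing frames. As a
   multiple of \<open>e\<close> it lies in \<Omega> itself, and \<open>tau_mem\<close> separates its
   summands.\<close>
 have tB: "\<tau> i (frO p ! j) : big p" if i: "i < l" and j: "j < length (frO p)" for i j
 proof(rule tau_mem[OF d(4,11) uY[OF j] _ i])
  have "nact e ?f (frO p ! j) : mvset ?I (nact e ?f) (big p)"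
   using mvset_in[OF linmap_nact[OF I e] d(9)] uB[OF j] by blast
  also have "mvset ?I (nact e ?f) (big p) = big p'"
   using mvset_gact_nact(1)[OF I e d(9,11)] mf eq(4) by(simp add: movable_def)
  finally have "frO p' ! j - nact e ?f (frO p ! j) : big p'"
   using d'(7) j len(1) by(intro csub_diff[OF d'(9)]) (auto simp: frame_iff)
  from csub_diff[OF d'(9) subsetD[OF d'(11) mv'[OF j]] this]
  have "(\<Sum>i<l. \<tau> i (frO p ! j)) : big p'" by simp
  moreover have "(\<Sum>i<l. \<tau> i (frO p ! j)) = e *c (\<Sum>i<l. \<epsilon> i *s P i (frO p ! j))" by(simp only: smult_sum_right)
  ultimately show "(\<Sum>i<l. \<tau> i (frO p ! j)) : big p" using small_mem[OF d(9)] eq(4) by simp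
 qed
 obtain H where H: "changes_frame (poly_vecs ?I) H (frO ?p) (frO p')" "frame_det (length (frO ?p)) H - 1 : ?I"
  using moved_change[OF d(7,4) len(1) tB uY mv'] by auto
 have "changes_frame (lat ?p) (%i j. if i = j then 1 else 0) (frE ?p) (frE p')"
  using E len eq(3) by(intro changes_frame_id) (auto simp: list_all2_conv_all_nth)
 with sec_frame[OF s p1 p' _ _ _ _ _ this, of H] H(1) have "s p' - s ?p * frame_det (length (frO ?p)) H ^ k : ?I"
  by(simp add: eq frame_det_id)
 moreover have "s ?p * frame_det (length (frO ?p)) H ^ k - s ?p * 1 ^ k : ?I"
  using ideal_mult[OF I cong_power[OF I H(2), of k], of "s ?p"] by(simp add: right_diff_distrib)
 ultimately have "s p' - s ?p : ?I" using cong_trans[OF I] by fastforce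
 from cong_trans[OF I this 1] show ?thesis .
qed

theorem theorem6p6:
  fixes N k l :: nat
    and y b :: "nat \<Rightarrow> complex"
    and d :: "nat \<Rightarrow> nat"
    and \<phi> :: "'n::finite framed_point \<Rightarrow> base"
  assumes "N > 0" and "k > 0"
    and "inj_on y {..<l}"
    and "\<forall>i<l. d i > 0"
    and "(\<Sum>i<l. d i) = N"
    and "\<forall>i<l. card {j. j < N \<and> b j = y i} = d i"
    and "\<phi> \<in> lowest_weight_sections N k"
  shows "restrict \<phi> (fibre N b) \<in> modified_conformal_blocks N k l y b"
proof -
 obtain w where w: "is_smallest_weight TYPE('n) N k w" "\<phi> : weight_space N k w"
  using assms(7) by(auto simp: lowest_weight_sections_def)
 have F: "(fibre N b :: 'n framed_point set) \<subseteq> Gr1 N" by(auto simp: fibre_def)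
 have "restrict \<phi> (fibre N b) : sections N k (fibre N b)"
 proof(rule sections_restrict[OF _ F order_refl])
  show "\<phi> : sections N k (Gr1 N)" using w(2) by(simp add: weight_space_def)
  show "restrict \<phi> (fibre N b) p - \<phi> p : alg p" if "p : fibre N b" for p
   using ideal_zero[OF Gr1D(1)[OF subsetD[OF F that]]] that by simp
 qed
 moreover have "has_lie_derivative N l y (fibre N b) f (restrict \<phi> (fibre N b)) (%_. 0)" if f: "f : g0 l y" for f
  unfolding has_lie_derivative_def
 proof(intro allI ballI impI)
  fix e and p p' :: "'n framed_point"
  assume p: "p : fibre N b" "p' : fibre N b" and a: "e * e : alg p \<and> is_moved N l y e f p p'"
  have "constant_points (alg p) N l (pts p) b y"
  proof
   show "EX i<l. b j = y i" if "j < N" for j by(rule covering_points[OF assms(3,5,6) that])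
   show "EX j<N. b j = y i" if "i < l" for i
   proof -
    have "card {j. j < N \<and> b j = y i} \<noteq> 0" using assms(4,6) that by auto
    hence "{j. j < N \<and> b j = y i} \<noteq> {}" by(metis card.empty)
    thus ?thesis by blast
   qed
  qed (use p Gr1D(1) assms(3) in \<open>auto simp: fibre_def\<close>)
  from lowest_weight_invariant[OF assms(1) w subsetD[OF F p(1)] subsetD[OF F p(2)] this f conjunct1[OF a] conjunct2[OF a]]
  show "restrict \<phi> (fibre N b) p' - (restrict \<phi> (fibre N b) p + e * 0) : alg p"
   using p by simp
 qed
 ultimately show ?thesis by(simp add: modified_conformal_blocks_def)
qed

end
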